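(* Let $M$ be a Cohen-Macaulay module of dimension $r\ge1$, let $L$ be a submodule of $M$ with $\mathfrak qM\subseteq L$, and let $\mathbb M=\mathbb M_L$ be the good $\mathfrak q$-filtration on $M$ induced by $L$. If $\operatorname{depth} gr_{\mathbb M}(M)\ge r-2$, then $$r_J(\mathbb M)\le e_1(\mathbb M)-e_0(\mathbb M)+h_0(\mathbb M)+1$$ for every ideal $J$ generated by a maximal $\mathbb M$-superficial sequence for $\mathfrak q$.
   Context: $(A,\mathfrak m)$ is a commutative Noetherian local ring, $\mathfrak q$ is a (proper) $\mathfrak m$-primary ideal of $A$, $M$ is a nonzero finitely generated $A$-module, and $\lambda(\cdot)$ denotes length. A good $\mathfrak q$-filtration $\mathbb M=\{M_n\}_{n\ge 0}$ of $M$ is a chain of submodules $M=M_0\supseteq M_1\supseteq\cdots$ with $\mathfrak qM_n\subseteq M_{n+1}$ for all $n$ and $M_{n+1}=\mathfrak qM_n$ for all large $n$. For a submodule $L\supseteq\mathfrak qM$, the filtration $\mathbb M_L$ induced by $L$ is $M_0=M$, $M_{j+1}=\mathfrak q^jL$ for $j\ge0$. The associated graded module $gr_{\mathbb M}(M)=\bigoplus_{n\ge0}M_n/M_{n+1}$ is a graded module over $gr_{\mathfrak q}(A)=\bigoplus_{n\ge 0}\mathfrak q^n/\mathfrak q^{n+1}$; its depth is taken with respect to $Q=\bigoplus_{n\ge1}\mathfrak q^n/\mathfrak q^{n+1}$. The Hilbert series is $P_{\mathbb M}(z)=\sum_{n\ge0}\lambda(M_n/M_{n+1})z^n=h_{\mathbb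 M}(z)/(1-z)^r$ with $h_{\mathbb M}(z)=\sum_i h_i(\mathbb M)z^i\in\mathbb Z[z]$, $h_{\mathbb M}(1)\ne0$, $r=\dim M$; in particular $h_0(\mathbb M)=\lambda(M/M_1)$. The Hilbert coefficients are $e_i(\mathbb M)=h_{\mathbb M}^{(i)}(1)/i!$. For a submodule $N$ of $M$, $\mathbb M/N$ is the good $\mathfrak q$-filtration $\{(M_n+N)/N\}$ of $M/N$. An element $a\in\mathfrak q$ is $\mathbb M$-superficial for $\mathfrak q$ if there is $c\ge0$ such that $(M_{n+1}:_Ma)\cap M_c=M_n$ for all $n\ge c$. A sequence $a_1,\dots,a_t\in\mathfrak q$ is an $\mathbb M$-superficial sequence for $\mathfrak q$ if each $a_i$ is $\mathbb M/(a_1,\dots,a_{i-1})M$-superficial for $\mathfrak q$. It is maximal if $\mathbb M/(a_1,\dots,a_t)M$ is nilpotent (its $n$-th term is $0$ for $n\gg0$) but $\mathbb M/(a_1,\dots,a_{t-1})M$ is not; when $\dim M=r\ge1$ a maximal superficial sequence has length $t=r$. The reduction number is $r_J(\mathbb M)=\min\{n\in\mathbb N: M_{j+1}=JM_j\text{ for every }j\ge n\}$. *)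

theory Defs
  imports
    "HOL-Algebra.Module"
    "HOL-Algebra.Ideal_Product"
    "HOL-Algebra.Ring_Divisibility"
    "HOL-Computational_Algebra.Polynomial_FPS"
    "HOL-Library.Extended_Real"
begin

section \<open>Noetherian local rings and primary ideals\<close>

locale noetherian_local_ring = cring R + noetherian_ring R for R (structure) +
  fixes \<mm>
  assumes maximal: "maximalideal \<mm> R"
    and unique_maximal: "maximalideal I R \<Longrightarrow> I = \<mm>"

definition radical :: "('a, 'c) ring_scheme \<Rightarrow> 'a set \<Rightarrow> 'a set" where
  "radical R I = {x \<in> carrier R. \<exists>n::nat. x [^]\<^bsub>R\<^esub> n \<in> I}"

definition primary_ideal :: "('a, 'c) ring_scheme \<Rightarrow> 'a set \<Rightarrow> bool" where
  "primary_ideal R I \<longleftrightarrow> ideal I R \<and> I \<noteq> carrier R \<and>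
     (\<forall>x\<in>carrier R. \<forall>y\<in>carrier R. x \<otimes>\<^bsub>R\<^esub> y \<in> I \<longrightarrow> x \<in> I \<or> y \<in> radical R I)"

definition primary_to :: "('a, 'c) ring_scheme \<Rightarrow> 'a set \<Rightarrow> 'a set \<Rightarrow> bool" where
  "primary_to R P I \<longleftrightarrow> primary_ideal R I \<and> radical R I = P"


section \<open>Submodules and quotient modules\<close>

definition gen_submodule :: "('a, 'c) ring_scheme \<Rightarrow> ('a, 'b, 'd) module_scheme \<Rightarrow> 'b set \<Rightarrow> 'b set" where
  "gen_submodule R M S = \<Inter>{N. submodule N R M \<and> S \<subseteq> N}"

definition fin_gen :: "('a, 'c) ring_scheme \<Rightarrow> ('a, 'b, 'd) module_scheme \<Rightarrow> bool" where
  "fin_gen R M \<longleftrightarrow> (\<exists>S. finite S \<and> S \<subseteq> carrier M \<and> gen_submodule R M S = carrier M)"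

definition ideal_smult ::
    "('a, 'c) ring_scheme \<Rightarrow> ('a, 'b, 'd) module_scheme \<Rightarrow> 'a set \<Rightarrow> 'b set \<Rightarrow> 'b set" where
  "ideal_smult R M I N = gen_submodule R M {a \<odot>\<^bsub>M\<^esub> x | a x. a \<in> I \<and> x \<in> N}"

text \<open>The record of a module contains ring fields \<open>mult\<close> and \<open>one\<close>,
  which play no role in the theory of modules.\<close>

definition quot_module :: "('a, 'b, 'd) module_scheme \<Rightarrow> 'b set \<Rightarrow> ('a, 'b set) module" where
  "quot_module M N =
     \<lparr>carrier = a_rcosets\<^bsub>M\<^esub> N, monoid.mult = undefined, one = undefined,
      zero = N, add = set_add M,
      module.smult = (\<lambda>r C. \<Union>x\<in>C. (N +>\<^bsub>M\<^esub> (r \<odot>\<^bsub>M\<^esub> x)))\<rparr>"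

abbreviation quot_by_elems ::
    "('a, 'c) ring_scheme \<Rightarrow> ('a, 'b, 'd) module_scheme \<Rightarrow> 'a list \<Rightarrow> ('a, 'b set) module" where
  "quot_by_elems R M as \<equiv> quot_module M (ideal_smult R M (Idl\<^bsub>R\<^esub> (set as)) (carrier M))"

definition ring_as_module :: "('a, 'c) ring_scheme \<Rightarrow> ('a, 'a) module" where
  "ring_as_module R =
     \<lparr>carrier = carrier R, monoid.mult = monoid.mult R, one = one R, zero = zero R, add = add R,
      module.smult = monoid.mult R\<rparr>"


section \<open>Length, dimension, depth\<close>

definition module_length :: "('a, 'c) ring_scheme \<Rightarrow> ('a, 'b, 'd) module_scheme \<Rightarrow> enat" where
  "module_length R M =
     (SUP k\<in>{k. \<exists>N. (\<forall>i\<le>k. submodule (N i) R M) \<and> (\<forall>i<k. N i \<subset> N (Suc i))}. enat k)"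

definition annihilator :: "('a, 'c) ring_scheme \<Rightarrow> ('a, 'b, 'd) module_scheme \<Rightarrow> 'a set" where
  "annihilator R M = {a \<in> carrier R. \<forall>x\<in>carrier M. a \<odot>\<^bsub>M\<^esub> x = \<zero>\<^bsub>M\<^esub>}"

text \<open>The dimension of a finitely generated module is the Krull dimension of the ring
  modulo the annihilator; the zero module gets the value \<open>0\<close> here.\<close>

definition module_dim :: "('a, 'c) ring_scheme \<Rightarrow> ('a, 'b, 'd) module_scheme \<Rightarrow> enat" where
  "module_dim R M =
     (SUP k\<in>{k. \<exists>P. (\<forall>i\<le>k. primeideal (P i) R \<and> annihilator R M \<subseteq> P i) \<and>
                  (\<forall>i<k. P i \<subset> P (Suc i))}. enat k)"

definition regular_seq ::
    "('a, 'c) ring_scheme \<Rightarrow> ('a, 'b, 'd) module_scheme \<Rightarrow> 'a list \<Rightarrow> bool" where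
  "regular_seq R M xs \<longleftrightarrow> set xs \<subseteq> carrier R \<and>
     (\<forall>i<length xs. \<forall>y\<in>carrier (quot_by_elems R M (take i xs)).
        xs ! i \<odot>\<^bsub>quot_by_elems R M (take i xs)\<^esub> y = \<zero>\<^bsub>quot_by_elems R M (take i xs)\<^esub> \<longrightarrow>
        y = \<zero>\<^bsub>quot_by_elems R M (take i xs)\<^esub>) \<and>
     ideal_smult R M (Idl\<^bsub>R\<^esub> (set xs)) (carrier M) \<noteq> carrier M"

definition depth ::
    "('a, 'c) ring_scheme \<Rightarrow> 'a set \<Rightarrow> ('a, 'b, 'd) module_scheme \<Rightarrow> enat" where
  "depth R I M = (SUP xs\<in>{xs. set xs \<subseteq> I \<and> regular_seq R M xs}. enat (length xs))"

definition cohen_macaulay ::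
    "('a, 'c) ring_scheme \<Rightarrow> 'a set \<Rightarrow> ('a, 'b, 'd) module_scheme \<Rightarrow> bool" where
  "cohen_macaulay R \<mm> M \<longleftrightarrow> depth R \<mm> M = module_dim R M"


section \<open>Filtrations\<close>

definition adic_filt :: "('a, 'c) ring_scheme \<Rightarrow> 'a set \<Rightarrow> nat \<Rightarrow> 'a set" where
  "adic_filt R \<qq> n = \<qq> [^]\<^bsub>ideals_set R\<^esub> n"

definition good_filtration ::
    "('a, 'c) ring_scheme \<Rightarrow> 'a set \<Rightarrow> ('a, 'b, 'd) module_scheme \<Rightarrow> (nat \<Rightarrow> 'b set) \<Rightarrow> bool" where
  "good_filtration R \<qq> M F \<longleftrightarrow>
     F 0 = carrier M \<and> (\<forall>n. submodule (F n) R M \<and> F (Suc n) \<subseteq> F n) \<and>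
     (\<forall>n. ideal_smult R M \<qq> (F n) \<subseteq> F (Suc n)) \<and>
     (\<exists>k. \<forall>n\<ge>k. F (Suc n) = ideal_smult R M \<qq> (F n))"

fun induced_filt ::
    "('a, 'c) ring_scheme \<Rightarrow> 'a set \<Rightarrow> ('a, 'b, 'd) module_scheme \<Rightarrow> 'b set \<Rightarrow> nat \<Rightarrow> 'b set" where
  "induced_filt R \<qq> M L 0 = carrier M"
| "induced_filt R \<qq> M L (Suc j) = ideal_smult R M (adic_filt R \<qq> j) L"

definition quot_filt ::
    "('a, 'b, 'd) module_scheme \<Rightarrow> 'b set \<Rightarrow> (nat \<Rightarrow> 'b set) \<Rightarrow> nat \<Rightarrow> 'b set set" where
  "quot_filt M N F n = (\<lambda>x. N +>\<^bsub>M\<^esub> x) ` F n"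

abbreviation quot_filt_by_elems ::
    "('a, 'c) ring_scheme \<Rightarrow> ('a, 'b, 'd) module_scheme \<Rightarrow> 'a list \<Rightarrow> (nat \<Rightarrow> 'b set) \<Rightarrow>
     nat \<Rightarrow> 'b set set" where
  "quot_filt_by_elems R M as F \<equiv>
     quot_filt M (ideal_smult R M (Idl\<^bsub>R\<^esub> (set as)) (carrier M)) F"

definition nilpotent_filt :: "('a, 'b, 'd) module_scheme \<Rightarrow> (nat \<Rightarrow> 'b set) \<Rightarrow> bool" where
  "nilpotent_filt M F \<longleftrightarrow> (\<exists>k. \<forall>n\<ge>k. F n = {\<zero>\<^bsub>M\<^esub>})"


section \<open>Superficial sequences and reduction numbers\<close>

definition superficial ::
    "'a set \<Rightarrow> ('a, 'b, 'd) module_scheme \<Rightarrow> (nat \<Rightarrow> 'b set) \<Rightarrow> 'a \<Rightarrow> bool" where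
  "superficial \<qq> M F a \<longleftrightarrow> a \<in> \<qq> \<and>
     (\<exists>c. \<forall>n\<ge>c. {x \<in> carrier M. a \<odot>\<^bsub>M\<^esub> x \<in> F (Suc n)} \<inter> F c = F n)"

definition superficial_seq ::
    "('a, 'c) ring_scheme \<Rightarrow> 'a set \<Rightarrow> ('a, 'b, 'd) module_scheme \<Rightarrow> (nat \<Rightarrow> 'b set) \<Rightarrow>
     'a list \<Rightarrow> bool" where
  "superficial_seq R \<qq> M F as \<longleftrightarrow>
     (\<forall>i<length as. superficial \<qq> (quot_by_elems R M (take i as))
                       (quot_filt_by_elems R M (take i as) F) (as ! i))"

definition maximal_superficial_seq ::
    "('a, 'c) ring_scheme \<Rightarrow> 'a set \<Rightarrow> ('a, 'b, 'd) module_scheme \<Rightarrow> (nat \<Rightarrow> 'b set) \<Rightarrow>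
     'a list \<Rightarrow> bool" where
  "maximal_superficial_seq R \<qq> M F as \<longleftrightarrow> superficial_seq R \<qq> M F as \<and> as \<noteq> [] \<and>
     nilpotent_filt (quot_by_elems R M as) (quot_filt_by_elems R M as F) \<and>
     \<not> nilpotent_filt (quot_by_elems R M (butlast as)) (quot_filt_by_elems R M (butlast as) F)"

text \<open>As an infimum in \<^typ>\<open>enat\<close>, the reduction number is \<open>\<infinity>\<close> if no \<open>n\<close> qualifies.\<close>

definition reduction_number ::
    "('a, 'c) ring_scheme \<Rightarrow> ('a, 'b, 'd) module_scheme \<Rightarrow> 'a set \<Rightarrow> (nat \<Rightarrow> 'b set) \<Rightarrow> enat" where
  "reduction_number R M J F =
     (INF n\<in>{n. \<forall>j\<ge>n. F (Suc j) = ideal_smult R M J (F j)}. enat n)"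


section \<open>Associated graded ring and module\<close>

definition gr_comp :: "('a, 'b, 'd) module_scheme \<Rightarrow> (nat \<Rightarrow> 'b set) \<Rightarrow> nat \<Rightarrow> ('a, 'b set) module" where
  "gr_comp M F n = quot_module (M\<lparr>carrier := F n\<rparr>) (F (Suc n))"

text \<open>Elements of the direct sum are finitely supported sequences \<open>f\<close> whose \<open>n\<close>-th entry is a
  coset of \<open>F (Suc n)\<close> in \<open>F n\<close>.\<close>

definition gr_carrier :: "('a, 'b, 'd) module_scheme \<Rightarrow> (nat \<Rightarrow> 'b set) \<Rightarrow> (nat \<Rightarrow> 'b set) set" where
  "gr_carrier M F = {f. (\<forall>n. f n \<in> carrier (gr_comp M F n)) \<and>
                        finite {n. f n \<noteq> \<zero>\<^bsub>gr_comp M F n\<^esub>}}"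

definition gr_add ::
    "('a, 'b, 'd) module_scheme \<Rightarrow> (nat \<Rightarrow> 'b set) \<Rightarrow> (nat \<Rightarrow> 'b set) \<Rightarrow> (nat \<Rightarrow> 'b set) \<Rightarrow>
     nat \<Rightarrow> 'b set" where
  "gr_add M F f g = (\<lambda>n. f n \<oplus>\<^bsub>gr_comp M F n\<^esub> g n)"

text \<open>The action of \<open>\<Oplus>\<^sub>i \<qq>\<^sup>i/\<qq>\<^sup>i\<^sup>+\<^sup>1\<close> on \<open>\<Oplus>\<^sub>j F j/F (j + 1)\<close>: the product of the class of
  \<open>a \<in> \<qq>\<^sup>i\<close> and the class of \<open>x \<in> F j\<close> is the class of \<open>a x\<close> in \<open>F (i + j)/F (i + j + 1)\<close>.\<close>

definition gr_smult ::
    "('a, 'b, 'd) module_scheme \<Rightarrow> (nat \<Rightarrow> 'b set) \<Rightarrow> (nat \<Rightarrow> 'a set) \<Rightarrow> (nat \<Rightarrow> 'b set) \<Rightarrow>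
     nat \<Rightarrow> 'b set" where
  "gr_smult M F f g =
     (\<lambda>n. \<Oplus>\<^bsub>gr_comp M F n\<^esub>i\<in>{..n}. \<Union>a\<in>f i. \<Union>x\<in>g (n - i). (F (Suc n) +>\<^bsub>M\<^esub> (a \<odot>\<^bsub>M\<^esub> x)))"

definition gr_ring :: "('a, 'c) ring_scheme \<Rightarrow> 'a set \<Rightarrow> (nat \<Rightarrow> 'a set) ring" where
  "gr_ring R \<qq> = (let A = ring_as_module R; F = adic_filt R \<qq> in
     \<lparr>carrier = gr_carrier A F,
      monoid.mult = gr_smult A F,
      one = (\<lambda>n. if n = 0 then F (Suc 0) +>\<^bsub>R\<^esub> \<one>\<^bsub>R\<^esub> else \<zero>\<^bsub>gr_comp A F n\<^esub>),
      zero = (\<lambda>n. \<zero>\<^bsub>gr_comp A F n\<^esub>),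
      add = gr_add A F\<rparr>)"

definition gr_module ::
    "('a, 'b, 'd) module_scheme \<Rightarrow> (nat \<Rightarrow> 'b set) \<Rightarrow> (nat \<Rightarrow> 'a set, nat \<Rightarrow> 'b set) module" where
  "gr_module M F =
     \<lparr>carrier = gr_carrier M F, monoid.mult = undefined, one = undefined,
      zero = (\<lambda>n. \<zero>\<^bsub>gr_comp M F n\<^esub>), add = gr_add M F, module.smult = gr_smult M F\<rparr>"

definition gr_irrelevant :: "('a, 'c) ring_scheme \<Rightarrow> 'a set \<Rightarrow> (nat \<Rightarrow> 'a set) set" where
  "gr_irrelevant R \<qq> = {f \<in> carrier (gr_ring R \<qq>). f 0 = \<zero>\<^bsub>gr_ring R \<qq>\<^esub> 0}"

definition gr_depth ::
    "('a, 'c) ring_scheme \<Rightarrow> 'a set \<Rightarrow> ('a, 'b, 'd) module_scheme \<Rightarrow> (nat \<Rightarrow> 'b set) \<Rightarrow> enat" where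
  "gr_depth R \<qq> M F = depth (gr_ring R \<qq>) (gr_irrelevant R \<qq>) (gr_module M F)"


section \<open>Hilbert series and Hilbert coefficients\<close>

definition hilbert_series ::
    "('a, 'c) ring_scheme \<Rightarrow> ('a, 'b, 'd) module_scheme \<Rightarrow> (nat \<Rightarrow> 'b set) \<Rightarrow> int fps" where
  "hilbert_series R M F = Abs_fps (\<lambda>n. int (the_enat (module_length R (gr_comp M F n))))"

definition h_poly ::
    "('a, 'c) ring_scheme \<Rightarrow> ('a, 'b, 'd) module_scheme \<Rightarrow> (nat \<Rightarrow> 'b set) \<Rightarrow> int poly" where
  "h_poly R M F =
     (THE h. hilbert_series R M F * (1 - fps_X) ^ the_enat (module_dim R M) = fps_of_poly h \<and>
             poly h 1 \<noteq> 0)"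

definition h_coeff ::
    "('a, 'c) ring_scheme \<Rightarrow> ('a, 'b, 'd) module_scheme \<Rightarrow> (nat \<Rightarrow> 'b set) \<Rightarrow> nat \<Rightarrow> int" where
  "h_coeff R M F i = coeff (h_poly R M F) i"

definition hilbert_coeff ::
    "('a, 'c) ring_scheme \<Rightarrow> ('a, 'b, 'd) module_scheme \<Rightarrow> (nat \<Rightarrow> 'b set) \<Rightarrow> nat \<Rightarrow> real" where
  "hilbert_coeff R M F i = real_of_int (poly ((pderiv ^^ i) (h_poly R M F)) 1) / fact i"


section \<open>Well-definedness facts\<close>

lemma gen_sub_incl: "S \<subseteq> gen_submodule R M S" unfolding gen_submodule_def by auto
lemma gen_sub_least: "submodule N R M \<Longrightarrow> S \<subseteq> N \<Longrightarrow> gen_submodule R M S \<subseteq> N"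
  unfolding gen_submodule_def by auto

lemma gen_sub_submodule:
  assumes "module R M" "S \<subseteq> carrier M"
  shows "submodule (gen_submodule R M S) R M"
proof -
  interpret module R M by fact
  have c: "submodule (carrier M) R M" by (rule carrier_is_submodule)
  show ?thesis
  proof (rule submoduleI)
    show "gen_submodule R M S \<subseteq> carrier M" by (rule gen_sub_least[OF c assms(2)])
  qed (use submoduleE in \<open>auto simp: gen_submodule_def dest: submoduleE submodule.axioms(1)[THEN subgroup.one_closed]\<close>)
qed

lemma smult_in: "a \<in> I \<Longrightarrow> x \<in> N \<Longrightarrow> a \<odot>\<^bsub>M\<^esub> x \<in> ideal_smult R M I N"
  unfolding ideal_smult_def by (rule subsetD[OF gen_sub_incl]) auto

lemma ideal_smult_sub:
  assumes "module R M" "I \<subseteq> carrier R" "N \<subseteq> carrier M"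
  shows "submodule (ideal_smult R M I N) R M"
proof -
  interpret module R M by fact
  show ?thesis unfolding ideal_smult_def
    by (rule gen_sub_submodule) (use assms in auto)
qed

lemma ideal_smult_le:
  "submodule K R M \<Longrightarrow> (\<And>a x. a \<in> I \<Longrightarrow> x \<in> N \<Longrightarrow> a \<odot>\<^bsub>M\<^esub> x \<in> K) \<Longrightarrow> ideal_smult R M I N \<subseteq> K"
  unfolding ideal_smult_def by (rule gen_sub_least) auto

lemma ideal_smult_assoc:
  assumes M: "module R M" and I: "ideal I R" and J: "ideal J R" and N: "submodule N R M"
  shows "ideal_smult R M (ideal_prod R I J) N = ideal_smult R M I (ideal_smult R M J N)"
proof -
  interpret module R M by fact
  have sI: "I \<subseteq> carrier R" "J \<subseteq> carrier R" "N \<subseteq> carrier M"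
    using I J submoduleE[OF N] by (auto simp: ideal.Icarr)
  have IJ: "ideal (ideal_prod R I J) R" by (rule R.ideal_prod_is_ideal[OF I J])
  have sIJ: "ideal_prod R I J \<subseteq> carrier R" using IJ by (auto simp: ideal.Icarr)
  have subJN: "submodule (ideal_smult R M J N) R M" by (rule ideal_smult_sub[OF M sI(2,3)])
  have sJN: "ideal_smult R M J N \<subseteq> carrier M" using submoduleE[OF subJN] by auto
  have subL: "submodule (ideal_smult R M (ideal_prod R I J) N) R M" by (rule ideal_smult_sub[OF M sIJ sI(3)])
  have subR: "submodule (ideal_smult R M I (ideal_smult R M J N)) R M" by (rule ideal_smult_sub[OF M sI(1) sJN])
  show ?thesis
  proof
    show "ideal_smult R M (ideal_prod R I J) N \<subseteq> ideal_smult R M I (ideal_smult R M J N)"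
    proof (rule ideal_smult_le[OF subR])
      fix a x assume a: "a \<in> ideal_prod R I J" and x: "x \<in> N"
      from a show "a \<odot>\<^bsub>M\<^esub> x \<in> ideal_smult R M I (ideal_smult R M J N)"
      proof induction
        case (prod i j)
        then have "(i \<otimes>\<^bsub>R\<^esub> j) \<odot>\<^bsub>M\<^esub> x = i \<odot>\<^bsub>M\<^esub> (j \<odot>\<^bsub>M\<^esub> x)" using sI x by (auto intro!: smult_assoc1)
        then show ?case using prod x by (simp add: smult_in)
      next
        case (sum s t)
        then have "s \<in> carrier R" "t \<in> carrier R" using sIJ by auto
        then have "(s \<oplus>\<^bsub>R\<^esub> t) \<odot>\<^bsub>M\<^esub> x = s \<odot>\<^bsub>M\<^esub> x \<oplus>\<^bsub>M\<^esub> t \<odot>\<^bsub>M\<^esub> x" using sI x by (auto intro!: smult_l_distr)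
        then show ?case using sum submoduleE(5)[OF subR] by auto
      qed
    qed
  next
    let ?K = "ideal_smult R M (ideal_prod R I J) N"
    show "ideal_smult R M I (ideal_smult R M J N) \<subseteq> ?K"
    proof (rule ideal_smult_le[OF subL])
      fix i y assume i: "i \<in> I" and y: "y \<in> ideal_smult R M J N"
      have iR: "i \<in> carrier R" using i sI by auto
      have "submodule {y \<in> carrier M. i \<odot>\<^bsub>M\<^esub> y \<in> ?K} R M"
      proof (rule submoduleI)
        show "\<zero>\<^bsub>M\<^esub> \<in> {y \<in> carrier M. i \<odot>\<^bsub>M\<^esub> y \<in> ?K}"
          using iR submodule.axioms(1)[OF subL, THEN subgroup.one_closed] by simp
        fix a b assume ab: "a \<in> {y \<in> carrier M. i \<odot>\<^bsub>M\<^esub> y \<in> ?K}"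
        show "\<ominus>\<^bsub>M\<^esub> a \<in> {y \<in> carrier M. i \<odot>\<^bsub>M\<^esub> y \<in> ?K}"
          using ab iR submoduleE(3)[OF subL] by (simp add: smult_r_minus)
        { assume "b \<in> {y \<in> carrier M. i \<odot>\<^bsub>M\<^esub> y \<in> ?K}"
          then show "a \<oplus>\<^bsub>M\<^esub> b \<in> {y \<in> carrier M. i \<odot>\<^bsub>M\<^esub> y \<in> ?K}"
          using ab iR submoduleE(5)[OF subL] by (simp add: smult_r_distr) }
      next
        fix r a assume r: "r \<in> carrier R" and a: "a \<in> {y \<in> carrier M. i \<odot>\<^bsub>M\<^esub> y \<in> ?K}"
        then have "i \<odot>\<^bsub>M\<^esub> (r \<odot>\<^bsub>M\<^esub> a) = r \<odot>\<^bsub>M\<^esub> (i \<odot>\<^bsub>M\<^esub> a)"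
          using iR by (simp add: smult_assoc1[symmetric] R.m_comm)
        then show "r \<odot>\<^bsub>M\<^esub> a \<in> {y \<in> carrier M. i \<odot>\<^bsub>M\<^esub> y \<in> ?K}"
          using r a submoduleE(4)[OF subL] by auto
      qed auto
      moreover have "j \<odot>\<^bsub>M\<^esub> x \<in> {y \<in> carrier M. i \<odot>\<^bsub>M\<^esub> y \<in> ?K}" if "j \<in> J" "x \<in> N" for j x
      proof -
        have "(i \<otimes>\<^bsub>R\<^esub> j) \<odot>\<^bsub>M\<^esub> x \<in> ?K" using that i by (intro smult_in ideal_prod.prod)
        moreover have "j \<in> carrier R" "x \<in> carrier M" using that sI by auto
        ultimately show ?thesis using iR by (simp add: smult_assoc1)
      qed
      ultimately have "ideal_smult R M J N \<subseteq> {y \<in> carrier M. i \<odot>\<^bsub>M\<^esub> y \<in> ?K}"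
        by (rule ideal_smult_le)
      with y show "i \<odot>\<^bsub>M\<^esub> y \<in> ?K" by auto
    qed
  qed
qed

lemma adic_filt_ideal:
  assumes "cring R" "ideal I R" shows "ideal (adic_filt R I n) R"
proof -
  interpret cring R by fact
  show ?thesis
  by (induction n) (auto simp: adic_filt_def ideals_set_def nat_pow_def assms ideal_prod_is_ideal oneideal)
qed

lemma adic_filt_Suc: "adic_filt R I (Suc n) = ideal_prod R (adic_filt R I n) I"
  by (simp add: adic_filt_def ideals_set_def nat_pow_def)

lemma adic_filt_0: "adic_filt R I 0 = carrier R"
  by (simp add: adic_filt_def ideals_set_def nat_pow_def)

lemma ideal_smult_carrier:
  assumes M: "module R M" and N: "submodule N R M"
  shows "ideal_smult R M (carrier R) N = N"
proof -
  interpret module R M by fact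
  show ?thesis
  proof
    show "ideal_smult R M (carrier R) N \<subseteq> N" by (rule ideal_smult_le[OF N]) (use submoduleE(4)[OF N] in auto)
    show "N \<subseteq> ideal_smult R M (carrier R) N"
    proof
      fix x assume x: "x \<in> N"
      have "\<one>\<^bsub>R\<^esub> \<odot>\<^bsub>M\<^esub> x \<in> ideal_smult R M (carrier R) N" using x by (intro smult_in) auto
      then show "x \<in> ideal_smult R M (carrier R) N" using x submoduleE(1)[OF N] by auto
    qed
  qed
qed

lemma good_filtration_induced_filt:
  assumes M: "module R M" and q: "ideal \<qq> R" and L: "submodule L R M"
    and le: "ideal_smult R M \<qq> (carrier M) \<subseteq> L"
  shows "good_filtration R \<qq> M (induced_filt R \<qq> M L)"
proof -
  interpret module R M by fact
  let ?F = "induced_filt R \<qq> M L"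
  note qi = adic_filt_ideal[OF R.is_cring q]
  have sL: "L \<subseteq> carrier M" using submoduleE(1)[OF L] .
  have sub: "submodule (?F n) R M" for n
    by (cases n) (auto intro!: carrier_is_submodule ideal_smult_sub[OF M] sL dest: ideal.Icarr[OF qi])
  have step: "?F (Suc (Suc n)) = ideal_smult R M \<qq> (?F (Suc n))" for n
    by (simp add: adic_filt_Suc R.ideal_prod_commute[OF qi q] ideal_smult_assoc[OF M q qi L])
  have F1: "?F (Suc 0) = L" by (simp add: adic_filt_0 ideal_smult_carrier[OF M L])
  have dec: "?F (Suc n) \<subseteq> ?F n" for n
  proof (cases n)
    case 0 then show ?thesis using submoduleE(1)[OF sub[of "Suc 0"]] by simp
  next
    case (Suc k)
    have "?F (Suc n) \<subseteq> ?F (Suc k)" unfolding Suc step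
      by (rule ideal_smult_le[OF sub]) (use submoduleE(4)[OF sub[of "Suc k"]] ideal.Icarr[OF q] in auto)
    then show ?thesis by (simp add: Suc)
  qed
  have "ideal_smult R M \<qq> (?F n) \<subseteq> ?F (Suc n)" for n
    using le F1 step by (cases n) auto
  moreover have "\<forall>n\<ge>1. ?F (Suc n) = ideal_smult R M \<qq> (?F n)"
    using step by (metis One_nat_def Suc_le_D)
  ultimately show ?thesis using sub dec unfolding good_filtration_def by auto
qed

lemma quot_module_smult:
  assumes M: "module R M" and N: "submodule N R M" and "r \<in> carrier R" "x \<in> carrier M"
  shows "r \<odot>\<^bsub>quot_module M N\<^esub> (N +>\<^bsub>M\<^esub> x) = N +>\<^bsub>M\<^esub> (r \<odot>\<^bsub>M\<^esub> x)"
proof -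
  interpret module R M by fact
  have sg: "abelian_subgroup N M"
    using submodule.axioms(1)[OF N] by (intro abelian_subgroupI3 additive_subgroup.intro M.abelian_group_axioms)
  have *: "N +>\<^bsub>M\<^esub> (r \<odot>\<^bsub>M\<^esub> y) = N +>\<^bsub>M\<^esub> (r \<odot>\<^bsub>M\<^esub> x)" if "y \<in> N +>\<^bsub>M\<^esub> x" for y
  proof -
    obtain n where n: "n \<in> N" "y = n \<oplus>\<^bsub>M\<^esub> x" using \<open>y \<in> _\<close> by (auto simp: a_r_coset_def')
    have "n \<in> carrier M" using n submoduleE(1)[OF N] by auto
    then have "r \<odot>\<^bsub>M\<^esub> y = r \<odot>\<^bsub>M\<^esub> n \<oplus>\<^bsub>M\<^esub> r \<odot>\<^bsub>M\<^esub> x" using n assms by (simp add: smult_r_distr)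
    moreover have "r \<odot>\<^bsub>M\<^esub> n \<in> N" using submoduleE(4)[OF N] n assms by auto
    ultimately have "r \<odot>\<^bsub>M\<^esub> y \<in> N +>\<^bsub>M\<^esub> (r \<odot>\<^bsub>M\<^esub> x)" by (auto simp: a_r_coset_def')
    then show ?thesis using abelian_subgroup.a_repr_independence'[OF sg] assms by (metis smult_closed)
  qed
  have "x \<in> N +>\<^bsub>M\<^esub> x" using abelian_subgroup.a_rcos_self[OF sg] assms by auto
  then have "(\<Union>y\<in>(N +>\<^bsub>M\<^esub> x). N +>\<^bsub>M\<^esub> (r \<odot>\<^bsub>M\<^esub> x)) = N +>\<^bsub>M\<^esub> (r \<odot>\<^bsub>M\<^esub> x)"
    by blast
  moreover have "(\<Union>y\<in>(N +>\<^bsub>M\<^esub> x). N +>\<^bsub>M\<^esub> (r \<odot>\<^bsub>M\<^esub> y)) =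
      (\<Union>y\<in>(N +>\<^bsub>M\<^esub> x). N +>\<^bsub>M\<^esub> (r \<odot>\<^bsub>M\<^esub> x))"
    by (intro SUP_cong refl *)
  ultimately show ?thesis unfolding quot_module_def by simp
qed

lemma quot_module_module:
  assumes M: "module R M" and N: "submodule N R M"
  shows "module R (quot_module M N)"
proof -
  interpret module R M by fact
  have sg: "abelian_subgroup N M"
    using submodule.axioms(1)[OF N] by (intro abelian_subgroupI3 additive_subgroup.intro M.abelian_group_axioms)
  interpret abelian_subgroup N M by fact
  have c: "carrier (quot_module M N) = (\<lambda>x. N +>\<^bsub>M\<^esub> x) ` carrier M"
    by (auto simp: quot_module_def A_RCOSETS_def' )
  have p: "(N +>\<^bsub>M\<^esub> x) \<oplus>\<^bsub>quot_module M N\<^esub> (N +>\<^bsub>M\<^esub> y) = N +>\<^bsub>M\<^esub> (x \<oplus>\<^bsub>M\<^esub> y)"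
    if "x \<in> carrier M" "y \<in> carrier M" for x y
    using a_rcos_sum[OF that] by (simp add: quot_module_def)
  have z: "\<zero>\<^bsub>quot_module M N\<^esub> = N +>\<^bsub>M\<^esub> \<zero>\<^bsub>M\<^esub>" 
    using a_coset_add_zero[OF a_subset] by (simp add: quot_module_def )
  have cI: "N +>\<^bsub>M\<^esub> x \<in> carrier (quot_module M N)" if "x \<in> carrier M" for x
    using that by (simp add: c)
  have cE: thesis if "X \<in> carrier (quot_module M N)"
    "\<And>x. x \<in> carrier M \<Longrightarrow> X = N +>\<^bsub>M\<^esub> x \<Longrightarrow> thesis" for X thesis
    using that by (auto simp: c)
  note s = quot_module_smult[OF M N]
  have ag: "abelian_group (quot_module M N)"
  proof (rule abelian_groupI, goal_cases)
    case (1 x y) then show ?case by (elim cE) (simp add: p cI)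
  next
    case 2 show ?case unfolding z by (rule cI) simp
  next
    case (3 x y w) then show ?case by (elim cE) (simp add: p M.a_assoc)
  next
    case (4 x y) then show ?case by (elim cE) (simp add: p M.a_comm)
  next
    case (5 x) then show ?case by (elim cE) (simp add: p z)
  next
    case (6 x)
    then obtain y where y: "y \<in> carrier M" "x = N +>\<^bsub>M\<^esub> y" by (rule cE)
    then show ?case by (intro bexI[of _ "N +>\<^bsub>M\<^esub> (\<ominus>\<^bsub>M\<^esub> y)"]) (simp_all add: p z M.l_neg cI)
  qed
  show ?thesis
  proof (rule moduleI[OF R.is_cring ag], goal_cases)
    case (1 a x) then show ?case by (elim cE) (simp add: s cI)
  next
    case (2 a b x) then show ?case by (elim cE) (simp add: s p smult_l_distr)
  next
    case (3 a x y) then show ?case by (elim cE) (simp add: s p smult_r_distr)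
  next
    case (4 a b x) then show ?case by (elim cE) (simp add: s smult_assoc1)
  next
    case (5 x) then show ?case by (elim cE) (simp add: s)
  qed
qed

text \<open>The sets in \<^const>\<open>gr_smult\<close> are single cosets, independent of representatives.\<close>

lemma gr_smult_class:
  assumes M: "module R M" and q: "ideal \<qq> R" and sub: "\<And>n. submodule (F n) R M"
    and F: "\<And>i j. ideal_smult R M (adic_filt R \<qq> i) (F j) \<subseteq> F (i + j)"
    and a: "a \<in> adic_filt R \<qq> i" and x: "x \<in> F j"
  shows "(\<Union>a\<in>(adic_filt R \<qq> (Suc i) +>\<^bsub>R\<^esub> a). \<Union>x\<in>(F (Suc j) +>\<^bsub>M\<^esub> x). (F (Suc (i+j)) +>\<^bsub>M\<^esub> (a \<odot>\<^bsub>M\<^esub> x)))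
    = F (Suc (i+j)) +>\<^bsub>M\<^esub> (a \<odot>\<^bsub>M\<^esub> x)"
proof -
  interpret module R M by fact
  let ?N = "F (Suc (i+j))"
  have sg: "abelian_subgroup (F n) M" for n
    using submodule.axioms(1)[OF sub] by (intro abelian_subgroupI3 additive_subgroup.intro M.abelian_group_axioms)
  note qi = adic_filt_ideal[OF R.is_cring q]
  have sg': "abelian_subgroup (adic_filt R \<qq> n) R" for n
    using qi[of n] by (simp add: abelian_subgroupI3 ideal_def R.is_abelian_group)
  have cM: "F n \<subseteq> carrier M" for n using submoduleE(1)[OF sub] .
  have cR: "adic_filt R \<qq> n \<subseteq> carrier R" for n using ideal.Icarr[OF qi] by auto
  have pr: "b \<odot>\<^bsub>M\<^esub> y \<in> F (k+l)" if "b \<in> adic_filt R \<qq> k" "y \<in> F l" for b y k l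
    using F smult_in[OF that] by blast
  have aR: "a \<in> carrier R" and xM: "x \<in> carrier M" using a x cM cR by auto
  have *: "?N +>\<^bsub>M\<^esub> (b \<odot>\<^bsub>M\<^esub> y) = ?N +>\<^bsub>M\<^esub> (a \<odot>\<^bsub>M\<^esub> x)"
    if b: "b \<in> adic_filt R \<qq> (Suc i) +>\<^bsub>R\<^esub> a" and y: "y \<in> F (Suc j) +>\<^bsub>M\<^esub> x" for b y
  proof -
    obtain u where u: "u \<in> adic_filt R \<qq> (Suc i)" "b = u \<oplus>\<^bsub>R\<^esub> a" using b by (auto simp: a_r_coset_def')
    obtain v where v: "v \<in> F (Suc j)" "y = v \<oplus>\<^bsub>M\<^esub> x" using y by (auto simp: a_r_coset_def')
    have uR: "u \<in> carrier R" and vM: "v \<in> carrier M" using u v cM cR by auto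
    have eq: "b \<odot>\<^bsub>M\<^esub> y = ((u \<odot>\<^bsub>M\<^esub> v \<oplus>\<^bsub>M\<^esub> u \<odot>\<^bsub>M\<^esub> x) \<oplus>\<^bsub>M\<^esub> a \<odot>\<^bsub>M\<^esub> v) \<oplus>\<^bsub>M\<^esub> a \<odot>\<^bsub>M\<^esub> x"
      using u v uR vM aR xM by (simp add: smult_r_distr smult_l_distr M.a_ac)
    have ux: "u \<odot>\<^bsub>M\<^esub> x \<in> ?N" using pr[OF u(1) x] by simp
    have av: "a \<odot>\<^bsub>M\<^esub> v \<in> ?N" using pr[OF a v(1)] by simp
    have uv: "u \<odot>\<^bsub>M\<^esub> v \<in> ?N"
      using submoduleE(4)[OF sub[of "Suc j"]] pr[OF _ v(1), of u i] u(1) 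
        R.ideal_prod_inter[OF qi[of i] q] by (auto simp: adic_filt_Suc)
    have "(u \<odot>\<^bsub>M\<^esub> v \<oplus>\<^bsub>M\<^esub> u \<odot>\<^bsub>M\<^esub> x) \<oplus>\<^bsub>M\<^esub> a \<odot>\<^bsub>M\<^esub> v \<in> ?N"
      using submoduleE(5)[OF sub[of "Suc (i+j)"]] ux av uv by blast
    then have "b \<odot>\<^bsub>M\<^esub> y \<in> ?N +>\<^bsub>M\<^esub> (a \<odot>\<^bsub>M\<^esub> x)" unfolding eq by (auto simp: a_r_coset_def')
    then show ?thesis using abelian_subgroup.a_repr_independence'[OF sg] aR xM by (metis smult_closed)
  qed
  have "a \<in> adic_filt R \<qq> (Suc i) +>\<^bsub>R\<^esub> a" "x \<in> F (Suc j) +>\<^bsub>M\<^esub> x"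
    using abelian_subgroup.a_rcos_self[OF sg'] abelian_subgroup.a_rcos_self[OF sg] aR xM by auto
  then have "(\<Union>b\<in>(adic_filt R \<qq> (Suc i) +>\<^bsub>R\<^esub> a). \<Union>y\<in>(F (Suc j) +>\<^bsub>M\<^esub> x). ?N +>\<^bsub>M\<^esub> (a \<odot>\<^bsub>M\<^esub> x))
      = ?N +>\<^bsub>M\<^esub> (a \<odot>\<^bsub>M\<^esub> x)"
    by blast
  moreover have "(\<Union>b\<in>(adic_filt R \<qq> (Suc i) +>\<^bsub>R\<^esub> a). \<Union>y\<in>(F (Suc j) +>\<^bsub>M\<^esub> x). ?N +>\<^bsub>M\<^esub> (b \<odot>\<^bsub>M\<^esub> y))
      = (\<Union>b\<in>(adic_filt R \<qq> (Suc i) +>\<^bsub>R\<^esub> a). \<Union>y\<in>(F (Suc j) +>\<^bsub>M\<^esub> x). ?N +>\<^bsub>M\<^esub> (a \<odot>\<^bsub>M\<^esub> x))"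
    by (intro SUP_cong refl *)
  ultimately show ?thesis by (rule trans[rotated])
qed

end

theory Submission
  imports Defs "HOL-Combinatorics.Permutations"
begin

text \<open>
  Write \<open>B\<^sub>i = (a\<^sub>1, \<dots>, a\<^sub>i) M\<close>. Since \<open>M\<close> is Cohen-Macaulay, a maximal superficial sequence has length \<open>r\<close>
  and is regular, so the Hilbert numerator can be computed along it: with \<open>B = B\<^sub>r\<^sub>-\<^sub>1\<close>,
  \<open>K = e\<^sub>1 - e\<^sub>0 + h\<^sub>0\<close> is the sum over \<open>n \<ge> 1\<close> of \<open>e\<^sub>0 - H(n)\<close>, where \<open>H\<close> is the Hilbert function
  of the one-dimensional module \<open>M / B\<close>. For \<open>r \<ge> 2\<close> put \<open>C = B\<^sub>r\<^sub>-\<^sub>2\<close> and let \<open>G\<^sub>n\<close> consist of the \<open>u\<close> with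
  \<open>a\<^sub>r\<^sub>-\<^sub>1\<^sup>k u \<in> F\<^sub>n\<^sub>+\<^sub>k + C\<close> for some \<open>k\<close>. This enlarged filtration has
  \<open>\<lambda>(G\<^sub>1 / F\<^sub>1) + \<Sum>\<^sub>n \<lambda>(G\<^sub>n\<^sub>+\<^sub>1 / (J G\<^sub>n + C)) \<le> K\<close>, so at most \<open>K\<close> elements generate it over \<open>F\<^sub>1\<close> and \<open>J\<close>.
  A determinant argument with these generators gives \<open>F\<^sub>n\<^sub>+\<^sub>1 \<subseteq> J F\<^sub>n + C\<close> for \<open>n > K\<close>. Finally, the depth of
  the associated graded module forces \<open>F\<^sub>n\<^sub>+\<^sub>1 \<inter> C \<subseteq> J F\<^sub>n\<close> (Valabrega and Valla), which removes \<open>C\<close>.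
  For \<open>r = 1\<close> take \<open>C = 0\<close> and \<open>G = F\<close>.
\<close>

section \<open>Submodules, chains and lengths\<close>

text \<open>Write \<open>a\<close>, \<open>b\<close> for the last two members of the sequence and
  \<open>D\<close> for C + aM. Saturation forces aM to meet G_{n+1} exactly in aG_n; this identifies
  the length of G_{n+1}/(J G_n + C) with that of (D + G_{n+1})/(D + b(D + G_n)), computed in the
  one-dimensional module M/D. There the lengths telescope, and D + G_n = D + F_n for large n makes
  the total depend on F only. Counting the degree-one generators modulo F_1 discards the term n = 0
  of e_1, which is e_0 - h_0; hence K = e_1 - e_0 + h_0. The final summand 1 of the bound appears
  because the determinant multiplies F_2 into J F + C, but not F_1. Only the r - 2 members that span
  \<open>C\<close> have to be removed at the end, which explains the hypothesis on the depth.

  All arguments about associated primes, socles and regular sequences start from a chain condition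
  on submodules of the module and not on ideals of the ring. Thus the same theorem on socles serves
  \<open>M\<close> over the local ring and the associated graded module over the associated graded
  ring, for which only the module is shown to be Noetherian.\<close>

text \<open>Quotients of \<open>M\<close> are avoided: a statement on \<open>M / N\<close> is phrased with submodules containing \<open>N\<close>.
  The scalars \<open>P\<close> need not form a ring; the proof of Hilbert's basis theorem uses small \<open>P\<close>.\<close>
definition stab :: "('a, 'b, 'd) module_scheme \<Rightarrow> 'a set \<Rightarrow> 'b set \<Rightarrow> bool" where
  "stab M P A \<longleftrightarrow> A \<subseteq> carrier M \<and> \<zero>\<^bsub>M\<^esub> \<in> A \<and> (\<forall>x\<in>A. \<forall>y\<in>A. x \<oplus>\<^bsub>M\<^esub> y \<in> A) \<and>
     (\<forall>x\<in>A. \<ominus>\<^bsub>M\<^esub> x \<in> A) \<and> (\<forall>a\<in>P. \<forall>x\<in>A. a \<odot>\<^bsub>M\<^esub> x \<in> A)"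

definition msum :: "('a, 'b, 'd) module_scheme \<Rightarrow> 'b set \<Rightarrow> 'b set \<Rightarrow> 'b set" where
  "msum M A B = {x \<oplus>\<^bsub>M\<^esub> y | x y. x \<in> A \<and> y \<in> B}"

definition smul :: "('a, 'b, 'd) module_scheme \<Rightarrow> 'a \<Rightarrow> 'b set \<Rightarrow> 'b set" where
  "smul M a A = {a \<odot>\<^bsub>M\<^esub> x | x. x \<in> A}"

definition colon :: "('a, 'b, 'd) module_scheme \<Rightarrow> 'a \<Rightarrow> 'b set \<Rightarrow> 'b set" where
  "colon M a A = {x \<in> carrier M. a \<odot>\<^bsub>M\<^esub> x \<in> A}"

definition cyc :: "('a, 'b, 'd) module_scheme \<Rightarrow> 'a set \<Rightarrow> 'b \<Rightarrow> 'b set" where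
  "cyc M P u = {a \<odot>\<^bsub>M\<^esub> u | a. a \<in> P}"

definition acc :: "('a, 'b, 'd) module_scheme \<Rightarrow> 'a set \<Rightarrow> 'b set \<Rightarrow> 'b set \<Rightarrow> bool" where
  "acc M P B A \<longleftrightarrow> (\<forall>f::nat \<Rightarrow> 'b set.
     (\<forall>n. stab M P (f n) \<and> B \<subseteq> f n \<and> f n \<subseteq> A \<and> f n \<subseteq> f (Suc n)) \<longrightarrow> (\<exists>k. \<forall>n\<ge>k. f n = f k))"

text \<open>The base case asks for inclusion and not for equality, so the chain may begin strictly
  above \<open>B\<close>. Hence \<open>k\<close> is a lower bound for the number of proper steps,
  and the predicate is monotone in \<open>A\<close>.\<close>

primrec chn :: "('a, 'b, 'd) module_scheme \<Rightarrow> 'a set \<Rightarrow> nat \<Rightarrow> 'b set \<Rightarrow> 'b set \<Rightarrow> bool" where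
  "chn M P 0 B A \<longleftrightarrow> stab M P A \<and> stab M P B \<and> B \<subseteq> A"
| "chn M P (Suc k) B A \<longleftrightarrow> stab M P A \<and> (\<exists>C. chn M P k B C \<and> C \<subset> A)"

definition flen :: "('a, 'b, 'd) module_scheme \<Rightarrow> 'a set \<Rightarrow> 'b set \<Rightarrow> 'b set \<Rightarrow> bool" where
  "flen M P B A \<longleftrightarrow> (\<exists>k. \<forall>j. chn M P j B A \<longrightarrow> j \<le> k)"

text \<open>Meaningful only together with \<open>flen\<close>, which bounds the set whose greatest
  member is taken.\<close>

definition len :: "('a, 'b, 'd) module_scheme \<Rightarrow> 'a set \<Rightarrow> 'b set \<Rightarrow> 'b set \<Rightarrow> nat" where
  "len M P B A = (GREATEST j. chn M P j B A)"

lemma stableD: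
  assumes "stab M P A"
  shows "A \<subseteq> carrier M" "\<zero>\<^bsub>M\<^esub> \<in> A" "x \<in> A \<Longrightarrow> y \<in> A \<Longrightarrow> x \<oplus>\<^bsub>M\<^esub> y \<in> A" "x \<in> A \<Longrightarrow> \<ominus>\<^bsub>M\<^esub> x \<in> A"
    "a \<in> P \<Longrightarrow> x \<in> A \<Longrightarrow> a \<odot>\<^bsub>M\<^esub> x \<in> A" "x \<in> A \<Longrightarrow> x \<in> carrier M"
    "x \<in> A \<Longrightarrow> y \<in> A \<Longrightarrow> x \<ominus>\<^bsub>M\<^esub> y \<in> A"
  using assms by (auto simp: stab_def a_minus_def)

lemma msumI: "x \<in> A \<Longrightarrow> y \<in> B \<Longrightarrow> x \<oplus>\<^bsub>M\<^esub> y \<in> msum M A B" by (auto simp: msum_def)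
lemma msumE: "z \<in> msum M A B \<Longrightarrow> (\<And>x y. x \<in> A \<Longrightarrow> y \<in> B \<Longrightarrow> z = x \<oplus>\<^bsub>M\<^esub> y \<Longrightarrow> thesis) \<Longrightarrow> thesis"
  by (auto simp: msum_def)
lemma smulI: "x \<in> A \<Longrightarrow> a \<odot>\<^bsub>M\<^esub> x \<in> smul M a A" by (auto simp: smul_def)
lemma smulE: "z \<in> smul M a A \<Longrightarrow> (\<And>x. x \<in> A \<Longrightarrow> z = a \<odot>\<^bsub>M\<^esub> x \<Longrightarrow> thesis) \<Longrightarrow> thesis"
  by (auto simp: smul_def)
lemma msum_mono: "A \<subseteq> A' \<Longrightarrow> B \<subseteq> B' \<Longrightarrow> msum M A B \<subseteq> msum M A' B'" by (fastforce simp: msum_def)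
lemma smul_mono: "A \<subseteq> A' \<Longrightarrow> smul M a A \<subseteq> smul M a A'" by (fastforce simp: smul_def)
lemma colon_mono: "A \<subseteq> A' \<Longrightarrow> colon M a A \<subseteq> colon M a A'" by (fastforce simp: colon_def)
lemma msum_least: "stab M P C \<Longrightarrow> A \<subseteq> C \<Longrightarrow> B \<subseteq> C \<Longrightarrow> msum M A B \<subseteq> C"
  unfolding msum_def stab_def by blast

context module begin

lemma submodule_iff_stable: "submodule A R M \<longleftrightarrow> stab M (carrier R) A"
proof
  assume "submodule A R M" then show "stab M (carrier R) A"
    using submoduleE[of A] submodule.axioms(1)[THEN subgroup.one_closed, of A R M] unfolding stab_def by auto
next
  assume "stab M (carrier R) A" then show "submodule A R M"
    by (intro submoduleI) (auto simp: stab_def)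
qed

lemma add_minus_cancel: "x \<in> carrier M \<Longrightarrow> y \<in> carrier M \<Longrightarrow> (x \<oplus>\<^bsub>M\<^esub> y) \<ominus>\<^bsub>M\<^esub> y = x"
    "x \<in> carrier M \<Longrightarrow> y \<in> carrier M \<Longrightarrow> (x \<ominus>\<^bsub>M\<^esub> y) \<oplus>\<^bsub>M\<^esub> y = x"
    "x \<in> carrier M \<Longrightarrow> y \<in> carrier M \<Longrightarrow> (y \<oplus>\<^bsub>M\<^esub> x) \<ominus>\<^bsub>M\<^esub> y = x"
    "x \<in> carrier M \<Longrightarrow> y \<in> carrier M \<Longrightarrow> y \<oplus>\<^bsub>M\<^esub> (x \<ominus>\<^bsub>M\<^esub> y) = x"
  by (simp_all add: a_minus_def M.a_assoc M.r_neg M.l_neg)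
     (simp_all add: M.a_comm[of y] M.a_assoc M.r_neg M.l_neg)

lemma smult_r_diff: "a \<in> carrier R \<Longrightarrow> x \<in> carrier M \<Longrightarrow> y \<in> carrier M \<Longrightarrow>
   a \<odot>\<^bsub>M\<^esub> (x \<ominus>\<^bsub>M\<^esub> y) = a \<odot>\<^bsub>M\<^esub> x \<ominus>\<^bsub>M\<^esub> a \<odot>\<^bsub>M\<^esub> y"
  by (simp add: a_minus_def smult_r_distr smult_r_minus)

lemma smult_l_diff: "a \<in> carrier R \<Longrightarrow> b \<in> carrier R \<Longrightarrow> y \<in> carrier M \<Longrightarrow>
   (a \<ominus> b) \<odot>\<^bsub>M\<^esub> y = a \<odot>\<^bsub>M\<^esub> y \<ominus>\<^bsub>M\<^esub> b \<odot>\<^bsub>M\<^esub> y"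
  by (simp add: a_minus_def smult_l_distr smult_l_minus)

lemma smult_lcomm: "a \<in> carrier R \<Longrightarrow> b \<in> carrier R \<Longrightarrow> x \<in> carrier M \<Longrightarrow>
   a \<odot>\<^bsub>M\<^esub> (b \<odot>\<^bsub>M\<^esub> x) = b \<odot>\<^bsub>M\<^esub> (a \<odot>\<^bsub>M\<^esub> x)"
  by (simp add: smult_assoc1[symmetric] R.m_comm)

lemma stable_add_iff: "stab M P A \<Longrightarrow> x \<in> carrier M \<Longrightarrow> y \<in> A \<Longrightarrow> x \<oplus>\<^bsub>M\<^esub> y \<in> A \<longleftrightarrow> x \<in> A"
  using add_minus_cancel(1)[of x y] stableD[of M P A] by metis

lemma stable_add_iff': "stab M P A \<Longrightarrow> x \<in> carrier M \<Longrightarrow> y \<in> A \<Longrightarrow> y \<oplus>\<^bsub>M\<^esub> x \<in> A \<longleftrightarrow> x \<in> A"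
  using add_minus_cancel(3)[of x y] stableD[of M P A] by metis

lemma stable_diff_iff: "stab M P A \<Longrightarrow> x \<in> carrier M \<Longrightarrow> y \<in> A \<Longrightarrow> x \<ominus>\<^bsub>M\<^esub> y \<in> A \<longleftrightarrow> x \<in> A"
  using add_minus_cancel(2)[of x y] stableD[of M P A] by metis

lemma stable_diff_sym: "stab M P A \<Longrightarrow> x \<in> carrier M \<Longrightarrow> y \<in> carrier M \<Longrightarrow> x \<ominus>\<^bsub>M\<^esub> y \<in> A \<Longrightarrow> y \<ominus>\<^bsub>M\<^esub> x \<in> A"
  using stableD(4)[of M P A "x \<ominus>\<^bsub>M\<^esub> y"] by (simp add: a_minus_def M.minus_add M.a_comm)

lemma stable_carrier: "P \<subseteq> carrier R \<Longrightarrow> stab M P (carrier M)" by (auto simp: stab_def)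
lemma stable_zero: "P \<subseteq> carrier R \<Longrightarrow> stab M P {\<zero>\<^bsub>M\<^esub>}" by (auto simp: stab_def)
lemma stable_Int: "stab M P A \<Longrightarrow> stab M P B \<Longrightarrow> stab M P (A \<inter> B)" by (auto simp: stab_def)
lemma stable_mono: "stab M P A \<Longrightarrow> P' \<subseteq> P \<Longrightarrow> stab M P' A" by (auto simp: stab_def)

lemma stable_msum:
  assumes P: "P \<subseteq> carrier R" and A: "stab M P A" and B: "stab M P B"
  shows "stab M P (msum M A B)"
proof -
  note [simp] = stableD(6)[OF A] stableD(6)[OF B]
  show ?thesis unfolding stab_def
  proof (intro conjI ballI)
    show "msum M A B \<subseteq> carrier M" by (auto simp: msum_def)
    show "\<zero>\<^bsub>M\<^esub> \<in> msum M A B" using msumI[OF stableD(2)[OF A] stableD(2)[OF B], of M] by simp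
  next
    fix x y assume "x \<in> msum M A B" "y \<in> msum M A B"
    then show "x \<oplus>\<^bsub>M\<^esub> y \<in> msum M A B"
    proof (elim msumE)
      fix a b c d assume *: "a \<in> A" "b \<in> B" "c \<in> A" "d \<in> B" "x = a \<oplus>\<^bsub>M\<^esub> b" "y = c \<oplus>\<^bsub>M\<^esub> d"
      then have "x \<oplus>\<^bsub>M\<^esub> y = (a \<oplus>\<^bsub>M\<^esub> c) \<oplus>\<^bsub>M\<^esub> (b \<oplus>\<^bsub>M\<^esub> d)" by (simp add: M.a_ac)
      then show ?thesis using * stableD[OF A] stableD[OF B] by (simp add: msumI)
    qed
  next
    fix x assume "x \<in> msum M A B" then show "\<ominus>\<^bsub>M\<^esub> x \<in> msum M A B"
      by (elim msumE) (simp add: M.minus_add msumI stableD(4)[OF A] stableD(4)[OF B])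
  next
    fix a x assume "a \<in> P" "x \<in> msum M A B" then show "a \<odot>\<^bsub>M\<^esub> x \<in> msum M A B"
      using P by (elim msumE) (auto simp: subset_iff smult_r_distr msumI stableD(5)[OF A] stableD(5)[OF B])
  qed
qed

lemma msum_upper1: "stab M P A \<Longrightarrow> stab M P B \<Longrightarrow> A \<subseteq> msum M A B"
  using msumI[of _ A "\<zero>\<^bsub>M\<^esub>" B M] by (auto simp: stab_def subset_iff)
lemma msum_upper2: "stab M P A \<Longrightarrow> stab M P B \<Longrightarrow> B \<subseteq> msum M A B"
  using msumI[of "\<zero>\<^bsub>M\<^esub>" A _ B M] by (auto simp: stab_def subset_iff)
lemma msum_comm: "A \<subseteq> carrier M \<Longrightarrow> B \<subseteq> carrier M \<Longrightarrow> msum M A B = msum M B A"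
  unfolding msum_def by (auto simp: subset_iff) (metis M.a_comm)+
lemma msum_assoc: "A \<subseteq> carrier M \<Longrightarrow> B \<subseteq> carrier M \<Longrightarrow> C \<subseteq> carrier M \<Longrightarrow>
   msum M (msum M A B) C = msum M A (msum M B C)"
  unfolding msum_def by (auto simp: subset_iff) (metis M.a_assoc)+
lemma msum_absorb: "stab M P A \<Longrightarrow> stab M P B \<Longrightarrow> B \<subseteq> A \<Longrightarrow> msum M A B = A"
  using msum_upper1 msum_least by (metis subset_antisym order_refl)
lemma msum_absorb2: "stab M P A \<Longrightarrow> stab M P B \<Longrightarrow> A \<subseteq> B \<Longrightarrow> msum M A B = B"
  using msum_upper2 msum_least by (metis subset_antisym order_refl)
lemma msum_modular:
  assumes A: "stab M P A" and B: "stab M P B" and C: "stab M P C" and "A \<subseteq> C"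
  shows "msum M A B \<inter> C = msum M A (B \<inter> C)"
proof
  show "msum M A B \<inter> C \<subseteq> msum M A (B \<inter> C)"
  proof
    fix x assume x: "x \<in> msum M A B \<inter> C"
    then obtain a b where ab: "a \<in> A" "b \<in> B" "x = a \<oplus>\<^bsub>M\<^esub> b" by (auto elim: msumE)
    then have "b \<in> C" using x assms(4) stable_add_iff'[OF C, of b a] stableD(6)[OF B] by auto
    then show "x \<in> msum M A (B \<inter> C)" using ab by (auto intro: msumI)
  qed
  show "msum M A (B \<inter> C) \<subseteq> msum M A B \<inter> C"
    using msum_least[OF C assms(4), of "B \<inter> C"] msum_mono[of A A "B \<inter> C" B] by auto
qed

lemma stable_smul:
  assumes P: "P \<subseteq> carrier R" and a: "a \<in> carrier R" and A: "stab M P A"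
  shows "stab M P (smul M a A)"
proof -
  note [simp] = stableD(6)[OF A] a
  show ?thesis unfolding stab_def
  proof (intro conjI ballI)
    show "smul M a A \<subseteq> carrier M" by (auto simp: smul_def)
    show "\<zero>\<^bsub>M\<^esub> \<in> smul M a A" using smulI[OF stableD(2)[OF A], of M a] by simp
  next
    fix x y assume "x \<in> smul M a A" "y \<in> smul M a A" then show "x \<oplus>\<^bsub>M\<^esub> y \<in> smul M a A"
      by (elim smulE) (simp add: smult_r_distr[symmetric] smulI stableD(3)[OF A])
  next
    fix x assume "x \<in> smul M a A" then show "\<ominus>\<^bsub>M\<^esub> x \<in> smul M a A"
      by (elim smulE) (simp add: smult_r_minus[symmetric] smulI stableD(4)[OF A])
  next
    fix b x assume b: "b \<in> P" and "x \<in> smul M a A" then show "b \<odot>\<^bsub>M\<^esub> x \<in> smul M a A"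
      using P by (elim smulE) (auto simp: subset_iff smult_lcomm[of _ a] intro!: smulI stableD(5)[OF A])
  qed
qed

lemma stable_colon:
  assumes P: "P \<subseteq> carrier R" and a: "a \<in> carrier R" and A: "stab M P A"
  shows "stab M P (colon M a A)"
  using a stableD[OF A] P unfolding stab_def colon_def
  by (auto simp: smult_r_distr smult_r_minus subset_iff smult_lcomm[of a])

lemma stable_cyc: "u \<in> carrier M \<Longrightarrow> stab M (carrier R) (cyc M (carrier R) u)"
  unfolding stab_def cyc_def
  apply (auto simp: smult_assoc1[symmetric])
    apply (metis R.zero_closed smult_l_null)
   apply (metis R.a_closed smult_l_distr)
  by (metis R.a_inv_closed smult_l_minus)

lemma cyc_self: "u \<in> carrier M \<Longrightarrow> u \<in> cyc M (carrier R) u"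
  unfolding cyc_def by (auto intro!: exI[of _ "\<one>"])

lemma cyc_least: "stab M (carrier R) A \<Longrightarrow> u \<in> A \<Longrightarrow> cyc M (carrier R) u \<subseteq> A"
  unfolding cyc_def by (auto simp: stab_def)

lemma colon_smul: "stab M P A \<Longrightarrow> A \<subseteq> colon M a (smul M a A)"
  by (auto simp: colon_def intro: smulI stableD(6))

lemma stable_finsum:
  assumes "stab M P A" "finite S" "f \<in> S \<rightarrow> A" shows "(\<Oplus>\<^bsub>M\<^esub>i\<in>S. f i) \<in> A"
  using assms(2,3)
proof (induction S)
  case empty then show ?case using stableD(2)[OF assms(1)] by simp
next
  case (insert x S)
  then have "f \<in> S \<rightarrow> carrier M" "f x \<in> carrier M" "f x \<in> A" "f \<in> S \<rightarrow> A" using stableD(6)[OF assms(1)] by auto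
  then show ?case using insert stableD(3)[OF assms(1)] by simp
qed

text \<open>A member X of an ascending chain is determined, relative to a smaller member, by its
  trace X \<inter> B and its image X + B: by the modular law no proper inclusion leaves both
  unchanged. Both associated chains become stationary.\<close>

lemma acc_trans:
  assumes P: "P \<subseteq> carrier R" and CB: "acc M P C B" and BA: "acc M P B A"
    and sB: "stab M P B" and "C \<subseteq> B" "B \<subseteq> A" and sA: "stab M P A"
  shows "acc M P C A"
  unfolding acc_def
proof (intro allI impI)
  fix f :: "nat \<Rightarrow> 'c set" assume f: "\<forall>n. stab M P (f n) \<and> C \<subseteq> f n \<and> f n \<subseteq> A \<and> f n \<subseteq> f (Suc n)"
  have m: "f n \<subseteq> f m" if "n \<le> m" for n m using that f by (simp add: lift_Suc_mono_le)
  have "\<exists>k. \<forall>n\<ge>k. f n \<inter> B = f k \<inter> B"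
    using CB[unfolded acc_def, rule_format, of "\<lambda>n. f n \<inter> B"] f stable_Int sB assms(5) by auto
  then obtain k where k: "\<And>n. n \<ge> k \<Longrightarrow> f n \<inter> B = f k \<inter> B" by auto
  have "\<forall>n. stab M P (msum M (f n) B) \<and> B \<subseteq> msum M (f n) B \<and> msum M (f n) B \<subseteq> A \<and> msum M (f n) B \<subseteq> msum M (f (Suc n)) B"
    using f sB assms stable_msum[OF P] msum_upper2 msum_least[OF sA] msum_mono by (metis order_refl)
  then obtain l where l: "\<And>n. n \<ge> l \<Longrightarrow> msum M (f n) B = msum M (f l) B"
    using BA[unfolded acc_def, rule_format, of "\<lambda>n. msum M (f n) B"] by blast
  show "\<exists>k. \<forall>n\<ge>k. f n = f k"
  proof (intro exI[of _ "max k l"] allI impI)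
    fix n assume n: "max k l \<le> n"
    let ?X = "f (max k l)" let ?Y = "f n"
    have XY: "?X \<subseteq> ?Y" using m n by auto
    have "?Y = msum M ?X B \<inter> ?Y" using l[of n] l[of "max k l"] n f msum_upper1[of P ?Y B] sB by auto
    also have "\<dots> = msum M ?X (B \<inter> ?Y)" using msum_modular[OF _ sB _ XY] f by auto
    also have "B \<inter> ?Y = B \<inter> ?X" using k[of n] k[of "max k l"] n by auto
    also have "msum M ?X (B \<inter> ?X) = ?X" using msum_absorb[of P ?X] stable_Int sB f by auto
    finally show "?Y = ?X" .
  qed
qed

lemma acc_sub: "acc M P C A \<Longrightarrow> C \<subseteq> C' \<Longrightarrow> A' \<subseteq> A \<Longrightarrow> acc M P C' A'"
  unfolding acc_def by (meson order_trans)

end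

text \<open>Without a maximal member above \<open>X0\<close>, iterating a choice of a strictly
  larger member gives a chain that never stops. This is the form in which Noetherian induction is
  used below, for submodules and, through \<open>ring_as_module\<close>, for ideals.\<close>

lemma acc_max:
  assumes "acc M P B A" and "\<And>X. X \<in> S \<Longrightarrow> stab M P X \<and> B \<subseteq> X \<and> X \<subseteq> A" and "X0 \<in> S"
  shows "\<exists>X\<in>S. X0 \<subseteq> X \<and> (\<forall>Y\<in>S. X \<subseteq> Y \<longrightarrow> Y = X)"
proof (rule ccontr)
  assume a: "\<not> ?thesis"
  define g where "g X = (SOME Y. Y \<in> S \<and> X \<subset> Y)" for X
  have g: "g X \<in> S \<and> X \<subset> g X" if "X \<in> S" "X0 \<subseteq> X" for X
    unfolding g_def by (rule someI_ex) (use a that in blast)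
  define f where "f n = (g ^^ n) X0" for n
  have f: "f n \<in> S \<and> X0 \<subseteq> f n" for n
  proof (induction n)
    case (Suc n) then show ?case using g[of "f n"] by (auto simp: f_def)
  qed (use assms in \<open>auto simp: f_def\<close>)
  have st: "f n \<subset> f (Suc n)" for n using g[of "f n"] f[of n] by (auto simp: f_def)
  have "\<forall>n. stab M P (f n) \<and> B \<subseteq> f n \<and> f n \<subseteq> A \<and> f n \<subseteq> f (Suc n)"
    using assms(2)[OF conjunct1[OF f]] psubset_imp_subset[OF st] by simp
  then have "\<exists>k. \<forall>n\<ge>k. f n = f k" using assms(1) unfolding acc_def by simp
  then obtain k where k: "\<forall>n\<ge>k. f n = f k" by (elim exE)
  have "f (Suc k) = f k" using k[rule_format, of "Suc k"] by simp
  then show False using st[of k] by auto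
qed

lemma chn_stable: "chn M P k B A \<Longrightarrow> stab M P A \<and> stab M P B \<and> B \<subseteq> A"
  by (induction k arbitrary: A) auto

lemma chn_mono: "chn M P k B C \<Longrightarrow> C \<subseteq> A \<Longrightarrow> stab M P A \<Longrightarrow> chn M P k B A"
proof (cases k)
  case 0 assume "chn M P k B C" "C \<subseteq> A" "stab M P A" then show ?thesis using 0 by auto
next
  case (Suc n)
  assume "chn M P k B C" "C \<subseteq> A" "stab M P A"
  then obtain D where "chn M P n B D" "D \<subset> A" "stab M P A" using Suc by (auto dest: psubset_subset_trans)
  then show ?thesis using Suc by auto
qed

lemma chn_concat: "chn M P j B A \<Longrightarrow> chn M P i C B \<Longrightarrow> chn M P (i + j) C A"
  by (induction j arbitrary: A) (auto intro: chn_mono)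

lemma chn_len:
  assumes "flen M P B A" "stab M P A" "stab M P B" "B \<subseteq> A"
  shows "chn M P (len M P B A) B A" "chn M P j B A \<Longrightarrow> j \<le> len M P B A"
  using assms GreatestI_nat[of "\<lambda>j. chn M P j B A" 0] Greatest_le_nat[of "\<lambda>j. chn M P j B A"]
  unfolding flen_def len_def by auto

lemma chn_map:
  assumes map: "\<And>X. stab M P X \<Longrightarrow> B \<subseteq> X \<Longrightarrow> X \<subseteq> A \<Longrightarrow> stab M' P' (\<phi> X) \<and> B' \<subseteq> \<phi> X \<and> \<phi> X \<subseteq> A'"
    and strict: "\<And>X Y. stab M P X \<Longrightarrow> stab M P Y \<Longrightarrow> B \<subseteq> X \<Longrightarrow> Y \<subseteq> A \<Longrightarrow> X \<subset> Y \<Longrightarrow> \<phi> X \<subset> \<phi> Y"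
    and st: "stab M' P' A'" "stab M' P' B'" and c: "chn M P k B A"
  shows "chn M' P' k B' A'"
proof -
  have "chn M P k B X \<Longrightarrow> X \<subseteq> A \<Longrightarrow> chn M' P' k B' (\<phi> X)" for X
  proof (induction k arbitrary: X)
    case 0 then show ?case using map st by auto
  next
    case (Suc k)
    then obtain C where C: "chn M P k B C" "C \<subset> X" by auto
    then have "chn M' P' k B' (\<phi> C)" "\<phi> C \<subset> \<phi> X" using Suc strict[of C X] chn_stable[OF C(1)] by auto
    moreover have "stab M' P' (\<phi> X)" using map[of X] Suc.prems chn_stable[OF C(1)] C by auto
    ultimately show ?case unfolding chn.simps by blast
  qed
  then show ?thesis using c map[of A] chn_stable[OF c] chn_mono st by blast
qed

text \<open>Only the two lattices of submodules are compared, not elements, so the two sides may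
  belong to different modules of different types. Beside the isomorphism theorems, this serves the
  graded pieces in \<open>gr_comp_length\<close>.\<close>

lemma len_iso:
  assumes map: "\<And>X. stab M P X \<Longrightarrow> B \<subseteq> X \<Longrightarrow> X \<subseteq> A \<Longrightarrow> stab M' P' (\<phi> X) \<and> B' \<subseteq> \<phi> X \<and> \<phi> X \<subseteq> A' \<and> \<psi> (\<phi> X) = X"
    and map': "\<And>X. stab M' P' X \<Longrightarrow> B' \<subseteq> X \<Longrightarrow> X \<subseteq> A' \<Longrightarrow> stab M P (\<psi> X) \<and> B \<subseteq> \<psi> X \<and> \<psi> X \<subseteq> A \<and> \<phi> (\<psi> X) = X"
    and mono: "\<And>X Y. X \<subseteq> Y \<Longrightarrow> \<phi> X \<subseteq> \<phi> Y" and mono': "\<And>X Y. X \<subseteq> Y \<Longrightarrow> \<psi> X \<subseteq> \<psi> Y"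
    and st: "stab M' P' A'" "stab M' P' B'" "stab M P A" "stab M P B"
  shows "flen M P B A \<longleftrightarrow> flen M' P' B' A'" "len M P B A = len M' P' B' A'"
proof -
  have "chn M P k B A \<longleftrightarrow> chn M' P' k B' A'" for k
  proof
    assume c: "chn M P k B A"
    show "chn M' P' k B' A'"
    proof (rule chn_map[where \<phi> = \<phi>, OF _ _ st(1,2) c])
      fix X Y assume a: "stab M P X" "stab M P Y" "B \<subseteq> X" "Y \<subseteq> A" "X \<subset> Y"
      then have "\<psi> (\<phi> X) = X" "\<psi> (\<phi> Y) = Y" using map by auto
      then have "\<phi> X \<noteq> \<phi> Y" using a(5) by (metis less_irrefl)
      then show "\<phi> X \<subset> \<phi> Y" using mono[OF psubset_imp_subset[OF a(5)]] by (rule psubsetI[rotated])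
    qed (use map in auto)
  next
    assume c: "chn M' P' k B' A'"
    show "chn M P k B A"
    proof (rule chn_map[where \<phi> = \<psi>, OF _ _ st(3,4) c])
      fix X Y assume a: "stab M' P' X" "stab M' P' Y" "B' \<subseteq> X" "Y \<subseteq> A'" "X \<subset> Y"
      then have "\<phi> (\<psi> X) = X" "\<phi> (\<psi> Y) = Y" using map' by auto
      then have "\<psi> X \<noteq> \<psi> Y" using a(5) by (metis less_irrefl)
      then show "\<psi> X \<subset> \<psi> Y" using mono'[OF psubset_imp_subset[OF a(5)]] by (rule psubsetI[rotated])
    qed (use map' in auto)
  qed
  then show "flen M P B A \<longleftrightarrow> flen M' P' B' A'" "len M P B A = len M' P' B' A'"
    by (auto simp: flen_def len_def)
qed

section \<open>Additivity of length and the isomorphism theorems\<close>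

context module begin

abbreviation "sub \<equiv> stab M (carrier R)"
abbreviation "fl \<equiv> flen M (carrier R)"
abbreviation "ll \<equiv> len M (carrier R)"

lemmas sub_msum = stable_msum[OF order_refl] and sub_smul = stable_smul[OF order_refl]
  and sub_colon = stable_colon[OF order_refl] and sub_carrier = stable_carrier[OF order_refl]
  and sub_zero = stable_zero[OF order_refl]

text \<open>Each proper step of a chain is visible in its intersection with \<open>B\<close> or in
  its sum with \<open>B\<close>, by the modular law. Counting both kinds of steps yields additivity
  of length directly, without composition series.\<close>

lemma chn_split:
  assumes B: "sub B" and C: "sub C" "C \<subseteq> B"
  shows "chn M (carrier R) k C A \<Longrightarrow>
    \<exists>i j. k \<le> i + j \<and> chn M (carrier R) i C (A \<inter> B) \<and> chn M (carrier R) j B (msum M A B)"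
proof (induction k arbitrary: A)
  case 0 
  then have A: "sub A" "C \<subseteq> A" by auto
  then have "chn M (carrier R) 0 C (A \<inter> B)" "chn M (carrier R) 0 B (msum M A B)"
    using B C stable_Int[OF A(1) B] sub_msum[OF A(1) B] msum_upper2[OF A(1) B] by auto
  then show ?case by (metis add_0 le_refl)
next
  case (Suc k)
  then obtain D where D: "chn M (carrier R) k C D" "D \<subset> A" and A: "sub A" by auto
  have sD: "sub D" using chn_stable[OF D(1)] by auto
  obtain i j where ij: "k \<le> i + j" "chn M (carrier R) i C (D \<inter> B)" "chn M (carrier R) j B (msum M D B)"
    using Suc.IH[OF D(1)] by auto
  have s1: "D \<inter> B \<subseteq> A \<inter> B" "msum M D B \<subseteq> msum M A B" using D msum_mono[of D A B B] by auto
  have s2: "sub (A \<inter> B)" "sub (msum M A B)" using A B stable_Int sub_msum by auto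
  show ?case
  proof (cases "D \<inter> B = A \<inter> B")
    case False
    then have "chn M (carrier R) (Suc i) C (A \<inter> B)" using s1 s2 ij by auto
    moreover have "chn M (carrier R) j B (msum M A B)" using chn_mono[OF ij(3) s1(2) s2(2)] .
    ultimately show ?thesis using ij(1) by (metis Suc_le_mono add_Suc)
  next
    case True
    have "msum M D B \<noteq> msum M A B"
    proof
      assume e: "msum M D B = msum M A B"
      have "A = msum M D B \<inter> A" using e msum_upper1[OF A B] by auto
      also have "\<dots> = msum M D (B \<inter> A)" using msum_modular[OF sD B A] D by auto
      also have "B \<inter> A = D \<inter> B" using True by auto
      also have "msum M D (D \<inter> B) = D" using msum_absorb[OF sD stable_Int[OF sD B]] by simp
      finally show False using D by auto
    qed
    then have "chn M (carrier R) (Suc j) B (msum M A B)" using s1 s2 ij by auto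
    moreover have "chn M (carrier R) i C (A \<inter> B)" using chn_mono[OF ij(2) s1(1) s2(1)] .
    ultimately show ?thesis using ij(1) by (metis Suc_le_mono add_Suc_right)
  qed
qed

lemma len_add:
  assumes A: "sub A" and B: "sub B" and C: "sub C" and CB: "C \<subseteq> B" and BA: "B \<subseteq> A"
  shows "fl C A \<longleftrightarrow> fl C B \<and> fl B A" "fl C A \<Longrightarrow> ll C A = ll C B + ll B A"
proof -
  have c0: "chn M (carrier R) 0 B A" "chn M (carrier R) 0 C B" using assms by auto
  have 1: "fl C B" "fl B A" if "fl C A"
  proof -
    from that obtain k where k: "\<And>j. chn M (carrier R) j C A \<Longrightarrow> j \<le> k" by (auto simp: flen_def)
    show "fl C B" unfolding flen_def
      using k chn_concat[OF c0(1)] by (intro exI[of _ k]) fastforce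
    show "fl B A" unfolding flen_def
      using k chn_concat[OF _ c0(2)] by (intro exI[of _ k]) fastforce
  qed
  have sp: "\<exists>i j. k \<le> i + j \<and> chn M (carrier R) i C B \<and> chn M (carrier R) j B A" if "chn M (carrier R) k C A" for k
    using chn_split[OF B C CB that] BA msum_absorb[OF A B BA] by (simp add: Int_absorb1)
  have 2: "fl C A" if "fl C B" "fl B A"
    unfolding flen_def using sp chn_len(2)[OF that(1) B C CB] chn_len(2)[OF that(2) A B BA]
    by (intro exI[of _ "ll C B + ll B A"]) (meson add_mono order_trans)
  show "fl C A \<longleftrightarrow> fl C B \<and> fl B A" using 1 2 by blast
  assume f: "fl C A"
  have CA: "C \<subseteq> A" using CB BA by auto
  show "ll C A = ll C B + ll B A"
  proof (rule antisym)
    show "ll C A \<le> ll C B + ll B A"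
      using sp[OF chn_len(1)[OF f A C CA]] chn_len(2)[OF 1(1)[OF f] B C CB] chn_len(2)[OF 1(2)[OF f] A B BA]
      by (meson add_mono order_trans)
    show "ll C B + ll B A \<le> ll C A"
      by (rule chn_len(2)[OF f A C CA chn_concat[OF chn_len(1)[OF 1(2)[OF f] A B BA] chn_len(1)[OF 1(1)[OF f] B C CB]]])
  qed
qed

lemma len_self: "sub A \<Longrightarrow> fl A A \<and> ll A A = 0"
proof -
  assume "sub A"
  have "\<not> chn M (carrier R) (Suc n) A A" for n
  proof
    assume "chn M (carrier R) (Suc n) A A"
    then obtain C where C: "chn M (carrier R) n A C" "C \<subset> A" by auto
    then show False using chn_stable[OF C(1)] by blast
  qed
  then have e: "chn M (carrier R) j A A \<longleftrightarrow> j = 0" for j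
    using \<open>sub A\<close> by (cases j) (simp_all del: chn.simps(2))
  show ?thesis unfolding flen_def len_def e by (auto intro: Greatest_equality)
qed

lemma len_0_iff:
  assumes "fl B A" "sub A" "sub B" "B \<subseteq> A" shows "ll B A = 0 \<longleftrightarrow> A = B"
proof
  assume "ll B A = 0"
  show "A = B"
  proof (rule ccontr)
    assume "A \<noteq> B" then have "chn M (carrier R) (Suc 0) B A" using assms by auto
    then show False using chn_len(2)[OF assms] \<open>ll B A = 0\<close> by fastforce
  qed
qed (use len_self assms in auto)

lemma len_second_iso:
  assumes A: "sub A" and B: "sub B"
  shows "fl (A \<inter> B) A \<longleftrightarrow> fl B (msum M A B)" "ll (A \<inter> B) A = ll B (msum M A B)"
proof -
  have 1: "sub (msum M X B) \<and> B \<subseteq> msum M X B \<and> msum M X B \<subseteq> msum M A B \<and> msum M X B \<inter> A = X"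
    if "sub X" "A \<inter> B \<subseteq> X" "X \<subseteq> A" for X
    using that msum_modular[OF that(1) B A] A B sub_msum msum_upper2 msum_absorb[of "carrier R" X "B \<inter> A"] stable_Int
    by (auto simp: msum_mono Int_commute intro: subsetD[OF msum_mono[of X A B B]])
  have 2: "sub (X \<inter> A) \<and> A \<inter> B \<subseteq> X \<inter> A \<and> X \<inter> A \<subseteq> A \<and> msum M (X \<inter> A) B = X"
    if "sub X" "B \<subseteq> X" "X \<subseteq> msum M A B" for X
  proof -
    have "msum M (X \<inter> A) B = msum M B (A \<inter> X)" using that B A msum_comm[of "X \<inter> A" B] by (auto simp: Int_commute stab_def)
    also have "\<dots> = msum M B A \<inter> X" using msum_modular[OF B A that(1,2)] by simp
    also have "\<dots> = X" using that(3) msum_comm[of A B] A B by (auto simp: stab_def)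
    finally show ?thesis using that stable_Int A by auto
  qed
  have m: "msum M X B \<subseteq> msum M Y B" "X \<inter> A \<subseteq> Y \<inter> A" if "X \<subseteq> Y" for X Y
    using that msum_mono[OF that order_refl] by auto
  note st = sub_msum[OF A B] B A stable_Int[OF A B]
  show "fl (A \<inter> B) A \<longleftrightarrow> fl B (msum M A B)"
    by (rule len_iso(1)[where \<phi> = "\<lambda>X. msum M X B" and \<psi> = "\<lambda>X. X \<inter> A"]) ((rule 1 2 m; assumption) | rule st)+
  show "ll (A \<inter> B) A = ll B (msum M A B)"
    by (rule len_iso(2)[where \<phi> = "\<lambda>X. msum M X B" and \<psi> = "\<lambda>X. X \<inter> A"]) ((rule 1 2 m; assumption) | rule st)+
qed

text \<open>Multiplication by \<open>a\<close> induces an isomorphism from M/(Z : a) onto (Z +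
  aM)/Z; on submodules its two directions are Z + aX and the colon by \<open>a\<close>.\<close>

lemma len_colon:
  assumes Z: "sub Z" and a: "a \<in> carrier R"
  shows "fl Z (msum M Z (smul M a (carrier M))) \<longleftrightarrow> fl (colon M a Z) (carrier M)"
    "ll Z (msum M Z (smul M a (carrier M))) = ll (colon M a Z) (carrier M)"
proof -
  let ?T = "msum M Z (smul M a (carrier M))"
  have T: "sub ?T" using sub_msum[OF Z sub_smul[OF a sub_carrier]] .
  have 1: "sub (colon M a X) \<and> colon M a Z \<subseteq> colon M a X \<and> colon M a X \<subseteq> carrier M \<and> msum M Z (smul M a (colon M a X)) = X"
    if X: "sub X" "Z \<subseteq> X" "X \<subseteq> ?T" for X
  proof -
    have "msum M Z (smul M a (colon M a X)) = X"
    proof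
      show "msum M Z (smul M a (colon M a X)) \<subseteq> X"
        by (rule msum_least[OF X(1,2)]) (auto simp: smul_def colon_def)
      show "X \<subseteq> msum M Z (smul M a (colon M a X))"
      proof
        fix x assume x: "x \<in> X"
        then obtain z u where zu: "z \<in> Z" "u \<in> carrier M" "x = z \<oplus>\<^bsub>M\<^esub> a \<odot>\<^bsub>M\<^esub> u" using X(3) by (auto elim!: msumE smulE)
        then have "a \<odot>\<^bsub>M\<^esub> u \<in> X" using stable_add_iff'[OF X(1), of "a \<odot>\<^bsub>M\<^esub> u" z] X(2) x a by auto
        then have "u \<in> colon M a X" using zu by (auto simp: colon_def)
        then show "x \<in> msum M Z (smul M a (colon M a X))" using zu by (auto intro: msumI smulI)
      qed
    qed
    then show ?thesis using sub_colon[OF a X(1)] X(2) by (auto simp: colon_def)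
  qed
  have 2: "sub (msum M Z (smul M a X)) \<and> Z \<subseteq> msum M Z (smul M a X) \<and> msum M Z (smul M a X) \<subseteq> ?T \<and>
      colon M a (msum M Z (smul M a X)) = X" if X: "sub X" "colon M a Z \<subseteq> X" "X \<subseteq> carrier M" for X
  proof -
    note s = sub_smul[OF a X(1)]
    have "colon M a (msum M Z (smul M a X)) \<subseteq> X"
    proof
      fix u assume "u \<in> colon M a (msum M Z (smul M a X))"
      then obtain z x where *: "u \<in> carrier M" "z \<in> Z" "x \<in> X" "a \<odot>\<^bsub>M\<^esub> u = z \<oplus>\<^bsub>M\<^esub> a \<odot>\<^bsub>M\<^esub> x"
        by (auto simp: colon_def elim!: msumE smulE)
      have c: "x \<in> carrier M" "z \<in> carrier M" using * X stableD(6)[OF Z] by auto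
      have "a \<odot>\<^bsub>M\<^esub> (u \<ominus>\<^bsub>M\<^esub> x) = z" using * c a by (simp add: smult_r_diff add_minus_cancel)
      then have "u \<ominus>\<^bsub>M\<^esub> x \<in> X" using * c X(2) by (auto simp: colon_def)
      then show "u \<in> X" using stable_diff_iff[OF X(1)] * by auto
    qed
    moreover have "X \<subseteq> colon M a (msum M Z (smul M a X))"
      using colon_smul[OF X(1), of a] colon_mono[OF msum_upper2[OF Z s], of M a] by (rule order_trans)
    moreover have "msum M Z (smul M a X) \<subseteq> ?T" by (rule msum_mono[OF order_refl smul_mono[OF X(3)]])
    ultimately show ?thesis using sub_msum[OF Z s] msum_upper1[OF Z s] by (simp add: subset_antisym)
  qed
  have m: "msum M Z (smul M a X) \<subseteq> msum M Z (smul M a Y)" if "X \<subseteq> Y" for X Y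
    using that by (intro msum_mono smul_mono) auto
  note st = T Z sub_carrier sub_colon[OF a Z]
  show "fl Z ?T \<longleftrightarrow> fl (colon M a Z) (carrier M)"
    by (rule len_iso(1)[where \<phi> = "\<lambda>X. colon M a X" and \<psi> = "\<lambda>X. msum M Z (smul M a X)"])
       ((rule 1 2 m colon_mono; assumption) | rule st)+
  show "ll Z ?T = ll (colon M a Z) (carrier M)"
    by (rule len_iso(2)[where \<phi> = "\<lambda>X. colon M a X" and \<psi> = "\<lambda>X. msum M Z (smul M a X)"])
       ((rule 1 2 m colon_mono; assumption) | rule st)+
qed

end

section \<open>Regular sequences and socles\<close>

definition nzd :: "('a, 'b, 'd) module_scheme \<Rightarrow> 'a \<Rightarrow> 'b set \<Rightarrow> bool" where
  "nzd M z N \<longleftrightarrow> (\<forall>v\<in>carrier M. z \<odot>\<^bsub>M\<^esub> v \<in> N \<longrightarrow> v \<in> N)"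

text \<open>\<open>M / N\<close> has no nonzero element killed by \<open>Q\<close>.\<close>
definition sfree :: "('a, 'b, 'd) module_scheme \<Rightarrow> 'a set \<Rightarrow> 'b set \<Rightarrow> bool" where
  "sfree M Q N \<longleftrightarrow> (\<forall>v\<in>carrier M. (\<forall>b\<in>Q. b \<odot>\<^bsub>M\<^esub> v \<in> N) \<longrightarrow> v \<in> N)"

definition annmod :: "('a, 'c) ring_scheme \<Rightarrow> ('a, 'b, 'd) module_scheme \<Rightarrow> 'b set \<Rightarrow> 'b \<Rightarrow> 'a set" where
  "annmod R M N v = {s \<in> carrier R. s \<odot>\<^bsub>M\<^esub> v \<in> N}"

abbreviation adj :: "('a, 'b, 'd) module_scheme \<Rightarrow> 'b set \<Rightarrow> 'a \<Rightarrow> 'b set" where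
  "adj M N x \<equiv> msum M N (smul M x (carrier M))"

fun addl :: "('a, 'b, 'd) module_scheme \<Rightarrow> 'b set \<Rightarrow> 'a list \<Rightarrow> 'b set" where
  "addl M N [] = N" | "addl M N (x # xs) = addl M (adj M N x) xs"

text \<open>This is weak regularity on M / N. Properness of the quotients is supplied by Nakayama in
  \<open>bas_proper\<close> at the place where it matters.\<close>

fun rseq :: "('a, 'b, 'd) module_scheme \<Rightarrow> 'b set \<Rightarrow> 'a list \<Rightarrow> bool" where
  "rseq M N [] = True" | "rseq M N (x # xs) \<longleftrightarrow> nzd M x N \<and> rseq M (adj M N x) xs"

lemma addl_append: "addl M N (xs @ ys) = addl M (addl M N xs) ys"
  by (induction xs arbitrary: N) auto

lemma rseq_append: "rseq M N (xs @ ys) \<longleftrightarrow> rseq M N xs \<and> rseq M (addl M N xs) ys"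
  by (induction xs arbitrary: N) auto

lemma rseq_iff_nth: "rseq M N xs \<longleftrightarrow> (\<forall>i<length xs. nzd M (xs ! i) (addl M N (take i xs)))"
proof (induction xs arbitrary: N)
  case (Cons x xs)
  show ?case by (simp add: Cons.IH All_less_Suc2)
qed simp

section \<open>Associated primes and prime avoidance from the chain condition on the module\<close>

context module begin

lemma annmod_ideal:
  assumes N: "sub N" and v: "v \<in> carrier M" shows "ideal (annmod R M N v) R"
proof (rule idealI[OF R.ring_axioms])
  note s = stableD[OF N]
  show "subgroup (annmod R M N v) (add_monoid R)"
  proof (rule R.add.subgroupI)
    show "annmod R M N v \<noteq> {}" using s(2) v by (auto simp: annmod_def intro!: exI[of _ \<zero>])
  qed (use s v in \<open>auto simp: annmod_def smult_l_distr smult_l_minus a_inv_def[symmetric]\<close>)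
  fix a x assume "a \<in> annmod R M N v" "x \<in> carrier R"
  then show "x \<otimes> a \<in> annmod R M N v" "a \<otimes> x \<in> annmod R M N v"
    using s v by (auto simp: annmod_def smult_assoc1 R.m_comm[of a x])
qed

text \<open>Annihilators that are maximal in this sense are associated primes of A / N
  (\<open>maxann_prime\<close>).\<close>

definition maxann where
  "maxann A N v \<longleftrightarrow> v \<in> A \<and> v \<notin> N \<and> (\<forall>w\<in>A. w \<notin> N \<longrightarrow> annmod R M N v \<subseteq> annmod R M N w \<longrightarrow> annmod R M N w = annmod R M N v)"

text \<open>The ring need not satisfy a chain condition here, so an annihilator ideal I is stored as
  the submodule N + Iv. For I containing the annihilator of \<open>v\<close> modulo \<open>N\<close>
  this loses nothing (\<open>inj\<close>), and maximality can be sought among submodules.\<close>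

lemma maxann_exists:
  assumes ac: "acc M (carrier R) N A" and N: "sub N" and A: "sub A" "N \<subseteq> A" and v: "v \<in> A" "v \<notin> N"
  shows "\<exists>w. maxann A N w \<and> annmod R M N v \<subseteq> annmod R M N w"
proof -
  let ?I = "annmod R M N"
  define T where "T I = msum M N {s \<odot>\<^bsub>M\<^esub> v | s. s \<in> I}" for I
  have cM: "A \<subseteq> carrier M" "v \<in> carrier M" using A v by (auto simp: stab_def)
  have T: "sub (T I) \<and> N \<subseteq> T I \<and> T I \<subseteq> A" if "ideal I R" for I
  proof -
    interpret ideal I R by fact
    have "sub {s \<odot>\<^bsub>M\<^esub> v | s. s \<in> I}" (is "sub ?J")
    proof -
      have J: "s \<odot>\<^bsub>M\<^esub> v \<in> ?J" if "s \<in> I" for s using that by auto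
      show ?thesis unfolding stab_def
      proof (intro conjI ballI)
        show "?J \<subseteq> carrier M" using cM Icarr by auto
        show "\<zero>\<^bsub>M\<^esub> \<in> ?J" using J[of \<zero>] cM by simp
      next
        fix x y assume "x \<in> ?J" "y \<in> ?J"
        then obtain s t where st: "s \<in> I" "t \<in> I" "x = s \<odot>\<^bsub>M\<^esub> v" "y = t \<odot>\<^bsub>M\<^esub> v" by auto
        then show "x \<oplus>\<^bsub>M\<^esub> y \<in> ?J" using J[of "s \<oplus> t"] cM Icarr by (simp add: smult_l_distr)
      next
        fix x assume "x \<in> ?J"
        then obtain s where st: "s \<in> I" "x = s \<odot>\<^bsub>M\<^esub> v" by auto
        then show "\<ominus>\<^bsub>M\<^esub> x \<in> ?J" using J[of "\<ominus> s"] cM Icarr by (simp add: smult_l_minus)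
      next
        fix a x assume a: "a \<in> carrier R" and "x \<in> ?J"
        then obtain s where st: "s \<in> I" "x = s \<odot>\<^bsub>M\<^esub> v" by auto
        then show "a \<odot>\<^bsub>M\<^esub> x \<in> ?J" using J[of "a \<otimes> s"] cM Icarr a I_l_closed by (simp add: smult_assoc1)
      qed
    qed
    moreover have "{s \<odot>\<^bsub>M\<^esub> v | s. s \<in> I} \<subseteq> A" using Icarr stableD(5)[OF A(1) _ v(1)] by auto
    ultimately show ?thesis unfolding T_def using sub_msum[OF N] msum_upper1[OF N] msum_least[OF A(1,2)] by simp
  qed
  have inj: "I = {s \<in> carrier R. s \<odot>\<^bsub>M\<^esub> v \<in> T I}" if I: "ideal I R" "?I v \<subseteq> I" for I
  proof -
    interpret ideal I R by fact
    have "s \<in> I" if s: "s \<in> carrier R" "s \<odot>\<^bsub>M\<^esub> v \<in> T I" for s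
    proof -
      obtain n t where *: "n \<in> N" "t \<in> I" "s \<odot>\<^bsub>M\<^esub> v = n \<oplus>\<^bsub>M\<^esub> t \<odot>\<^bsub>M\<^esub> v" using s by (auto simp: T_def elim!: msumE)
      then have "(s \<ominus> t) \<odot>\<^bsub>M\<^esub> v = n" using s cM Icarr stableD(6)[OF N]
        by (simp add: smult_l_diff add_minus_cancel)
      then have "s \<ominus> t \<in> I" using * I(2) s Icarr by (auto simp: annmod_def)
      then have "(s \<ominus> t) \<oplus> t \<in> I" using * by auto
      then show "s \<in> I" using s * Icarr by (simp add: a_minus_def R.a_assoc R.l_neg)
    qed
    moreover have "s \<odot>\<^bsub>M\<^esub> v \<in> T I" if "s \<in> I" for s
      using msumI[OF stableD(2)[OF N], of "s \<odot>\<^bsub>M\<^esub> v" "{s \<odot>\<^bsub>M\<^esub> v | s. s \<in> I}" M] that cM Icarr by (auto simp: T_def)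
    ultimately show ?thesis using Icarr by blast
  qed
  let ?S = "{T (?I w) | w. w \<in> A \<and> w \<notin> N \<and> ?I v \<subseteq> ?I w}"
  have id: "ideal (?I w) R" if "w \<in> A" for w using annmod_ideal[OF N] that cM by auto
  have "\<exists>X\<in>?S. T (?I v) \<subseteq> X \<and> (\<forall>Y\<in>?S. X \<subseteq> Y \<longrightarrow> Y = X)"
    by (rule acc_max[OF ac]) (use T id v in auto)
  then obtain w where w: "w \<in> A" "w \<notin> N" "?I v \<subseteq> ?I w"
    and mx: "\<And>Y. Y \<in> ?S \<Longrightarrow> T (?I w) \<subseteq> Y \<Longrightarrow> Y = T (?I w)" by auto
  have "?I u = ?I w" if u: "u \<in> A" "u \<notin> N" "?I w \<subseteq> ?I u" for u
  proof -
    have "T (?I w) \<subseteq> T (?I u)" unfolding T_def using u(3) by (intro msum_mono) auto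
    then have "T (?I u) = T (?I w)" using mx u w by blast
    then show ?thesis using inj[OF id[OF w(1)] w(3)] inj[OF id[OF u(1)]] u(3) w(3) by auto
  qed
  then show ?thesis using w by (auto simp: maxann_def)
qed

lemma maxann_prime:
  assumes N: "sub N" and A: "sub A" and v: "maxann A N v"
  shows "primeideal (annmod R M N v) R"
proof (rule primeidealI[OF annmod_ideal[OF N] R.is_cring])
  have c: "v \<in> A" "v \<in> carrier M" "v \<notin> N" using v A by (auto simp: maxann_def stab_def)
  show "v \<in> carrier M" by fact
  have "\<one> \<notin> annmod R M N v" using c by (auto simp: annmod_def)
  then show "carrier R \<noteq> annmod R M N v" by auto
  fix a b assume ab: "a \<in> carrier R" "b \<in> carrier R" "a \<otimes> b \<in> annmod R M N v"
  show "a \<in> annmod R M N v \<or> b \<in> annmod R M N v"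
  proof (rule disjCI)
    assume b: "b \<notin> annmod R M N v"
    let ?w = "b \<odot>\<^bsub>M\<^esub> v"
    have "?w \<in> A" "?w \<notin> N" using ab b c stableD(5)[OF A] by (auto simp: annmod_def)
    moreover have "annmod R M N v \<subseteq> annmod R M N ?w"
      using c ab stableD(5)[OF N] by (auto simp: annmod_def smult_lcomm[of _ b])
    ultimately have "annmod R M N ?w = annmod R M N v" using v by (auto simp: maxann_def)
    moreover have "a \<in> annmod R M N ?w" using ab c by (auto simp: annmod_def smult_assoc1)
    ultimately show "a \<in> annmod R M N v" by simp
  qed
qed

text \<open>Suppose infinitely many distinct maximal annihilators P_k belong to elements y_k. The
  submodules spanned by N and y_0, ..., y_{k-1} become stationary, so some y_k is a combination of
  its predecessors modulo \<open>N\<close>. Distinct maximal annihilators are incomparable and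
  prime, so a product of suitable elements lies in all P_j with j < k but not in P_k. That product
  kills the predecessors and therefore y_k, a contradiction.\<close>

lemma maxann_finite:
  assumes ac: "acc M (carrier R) N (carrier M)" and N: "sub N"
  shows "finite {annmod R M N v | v. maxann (carrier M) N v}" (is "finite ?S")
proof (rule ccontr)
  let ?I = "annmod R M N"
  assume "infinite ?S"
  then obtain P :: "nat \<Rightarrow> 'a set" where P: "inj P" "range P \<subseteq> ?S"
    using infinite_countable_subset by blast
  have "\<forall>k. \<exists>v. maxann (carrier M) N v \<and> P k = ?I v" using P(2) by blast
  then obtain y where y: "\<And>k. maxann (carrier M) N (y k)" "\<And>k. P k = ?I (y k)" by metis
  have yc: "y k \<in> carrier M" "y k \<notin> N" for k using y(1)[of k] by (auto simp: maxann_def)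
  define f where "f = rec_nat N (\<lambda>k X. msum M X (cyc M (carrier R) (y k)))"
  have f0: "f 0 = N" and fS: "f (Suc k) = msum M (f k) (cyc M (carrier R) (y k))" for k by (simp_all add: f_def)
  have fs: "sub (f k)" for k by (induction k) (simp_all add: f0 fS N sub_msum stable_cyc yc)
  have fm: "f k \<subseteq> f (Suc k)" for k using msum_upper1[OF fs[of k] stable_cyc[OF yc(1)[of k]]] fS by simp
  have fN: "N \<subseteq> f k" for k
  proof (induction k)
    case (Suc k) then show ?case using fm by blast
  qed (simp add: f0)
  have "\<exists>k. \<forall>n\<ge>k. f n = f k"
    using ac[unfolded acc_def, rule_format, of f] fs fN fm by (auto simp: stab_def)
  then obtain k where k: "f (Suc k) = f k" by (metis le_Suc_eq order_refl)
  have yk: "y k \<in> f k" using k fS[of k] msum_upper2[OF fs[of k] stable_cyc[OF yc(1)[of k]]] cyc_self[OF yc(1)[of k]] by auto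
  have kill: "\<lbrakk>s \<in> carrier R; \<forall>j<i. s \<in> P j; u \<in> f i\<rbrakk> \<Longrightarrow> s \<odot>\<^bsub>M\<^esub> u \<in> N" for s i u
  proof (induction i arbitrary: u)
    case 0 then show ?case using stableD(5)[OF N] by (auto simp: f0)
  next
    case (Suc i)
    then obtain w t where wt: "w \<in> f i" "t \<in> carrier R" "u = w \<oplus>\<^bsub>M\<^esub> t \<odot>\<^bsub>M\<^esub> y i" by (auto simp: fS cyc_def elim!: msumE)
    have "s \<odot>\<^bsub>M\<^esub> w \<in> N" using Suc wt by auto
    moreover have "s \<odot>\<^bsub>M\<^esub> y i \<in> N" using Suc.prems y(2)[of i] by (auto simp: annmod_def)
    moreover have "w \<in> carrier M" using stableD(6)[OF fs wt(1)] .
    ultimately show ?case using wt Suc.prems(1) yc stableD(3)[OF N] stableD(5)[OF N]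
      by (simp add: smult_r_distr smult_lcomm[of s t])
  qed
  have pr: "primeideal (P i) R" for i using maxann_prime[OF N sub_carrier y(1)] y(2) by simp
  have notsub: "\<exists>s\<in>P j. s \<notin> P k" if "j < k" for j
  proof (rule ccontr)
    assume "\<not> ?thesis" then have "P j \<subseteq> P k" by auto
    then have "P k = P j" using y(1)[of j] y(2) yc[of k] by (auto simp: maxann_def)
    then show False using P(1) that by (auto simp: inj_def)
  qed
  have "\<exists>s\<in>carrier R. (\<forall>j<i. s \<in> P j) \<and> s \<notin> P k" if "i \<le> k" for i using that
  proof (induction i)
    case 0 then show ?case using ideal.one_imp_carrier[OF primeideal.axioms(1)[OF pr[of k]]] primeideal.I_notcarr[OF pr[of k]]
      by (intro bexI[of _ \<one>]) auto
  next
    case (Suc i)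
    then obtain s where s: "s \<in> carrier R" "\<forall>j<i. s \<in> P j" "s \<notin> P k" by auto
    obtain t where t: "t \<in> P i" "t \<notin> P k" using notsub[of i] Suc by auto
    have tc: "t \<in> carrier R" using t ideal.Icarr[OF primeideal.axioms(1)[OF pr]] by auto
    have "s \<otimes> t \<in> P j" if "j < Suc i" for j
      using that s t tc ideal.I_l_closed[OF primeideal.axioms(1)[OF pr[of j]]] ideal.I_r_closed[OF primeideal.axioms(1)[OF pr[of j]]]
      by (auto simp: less_Suc_eq)
    moreover have "s \<otimes> t \<notin> P k" using primeideal.I_prime[OF pr s(1) tc] s t by auto
    ultimately show ?case using s tc by auto
  qed
  then obtain s where s: "s \<in> carrier R" "\<forall>j<k. s \<in> P j" "s \<notin> P k" by auto
  then have "s \<odot>\<^bsub>M\<^esub> y k \<in> N" using kill yk by auto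
  then show False using s y(2)[of k] by (auto simp: annmod_def)
qed

definition scal_closed where
  "scal_closed Q \<longleftrightarrow> Q \<subseteq> carrier R \<and> (\<forall>x\<in>Q. \<forall>y\<in>Q. x \<oplus> y \<in> Q) \<and> (\<forall>x\<in>Q. \<forall>s\<in>carrier R. s \<otimes> x \<in> Q)"

text \<open>By induction on the number of primes. If one prime lies properly in another, avoiding
  the larger one suffices. Otherwise take \<open>z\<close> outside all primes but \<open>P\<close>
  and, by a product, \<open>w\<close> in all primes but \<open>P\<close>; then \<open>z\<close> or
  \<open>z\<close> + \<open>w\<close> avoids everything.\<close>

lemma prime_avoidance:
  assumes Q: "scal_closed Q"
  shows "finite S \<Longrightarrow> \<forall>P\<in>S. primeideal P R \<and> \<not> Q \<subseteq> P \<Longrightarrow> Q \<noteq> {} \<Longrightarrow> \<exists>z\<in>Q. \<forall>P\<in>S. z \<notin> P"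
proof (induction "card S" arbitrary: S)
  case 0 then show ?case by auto
next
  case (Suc n)
  show ?case
  proof (cases "\<exists>P\<in>S. \<exists>P'\<in>S. P' \<subset> P")
    case True
    then obtain P P' where P: "P \<in> S" "P' \<in> S" "P' \<subset> P" by auto
    have "\<exists>z\<in>Q. \<forall>P\<in>S - {P'}. z \<notin> P" using Suc P by (intro Suc.hyps(1)) auto
    then show ?thesis using P by blast
  next
    case False
    obtain P where P: "P \<in> S" using Suc by fastforce
    have pP: "primeideal P R" "\<not> Q \<subseteq> P" using P Suc by auto
    have "\<exists>z\<in>Q. \<forall>P\<in>S - {P}. z \<notin> P" using Suc P by (intro Suc.hyps(1)) auto
    then obtain z where z: "z \<in> Q" "\<And>P'. P' \<in> S \<Longrightarrow> P' \<noteq> P \<Longrightarrow> z \<notin> P'" by auto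
    have "finite T \<Longrightarrow> T \<subseteq> S - {P} \<Longrightarrow> \<exists>w\<in>Q. w \<notin> P \<and> (\<forall>P'\<in>T. w \<in> P')" for T
    proof (induction T rule: finite_induct)
      case empty then show ?case using pP by auto
    next
      case (insert P' T)
      then obtain w where w: "w \<in> Q" "w \<notin> P" "\<forall>P'\<in>T. w \<in> P'" by auto
      have P': "P' \<in> S" "P' \<noteq> P" using insert by auto
      then obtain t where t: "t \<in> P'" "t \<notin> P" using False P by blast
      have i: "ideal X R" if "X \<in> S" for X using Suc.prems that primeideal.axioms(1) by auto
      have c: "t \<in> carrier R" "w \<in> carrier R" using t ideal.Icarr[OF i[OF P'(1)]] w Q by (auto simp: scal_closed_def)
      have "t \<otimes> w \<in> Q" using Q w c by (auto simp: scal_closed_def)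
      moreover have "t \<otimes> w \<notin> P" using primeideal.I_prime[OF pP(1) c] t w by auto
      moreover have "\<forall>X\<in>insert P' T. t \<otimes> w \<in> X"
        using ideal.I_r_closed[OF i[OF P'(1)] t(1) c(2)] w(3) insert.prems ideal.I_l_closed[OF i _ c(1)] by blast
      ultimately show ?case by blast
    qed
    from this[of "S - {P}"] have "\<exists>w\<in>Q. w \<notin> P \<and> (\<forall>P'\<in>S - {P}. w \<in> P')" using Suc.prems(1) by simp
    then obtain w where w: "w \<in> Q" "w \<notin> P" "\<And>P'. P' \<in> S \<Longrightarrow> P' \<noteq> P \<Longrightarrow> w \<in> P'" by blast
    show ?thesis
    proof (cases "z \<in> P")
      case False then show ?thesis using z by blast
    next
      case True
      have c: "z \<in> carrier R" "w \<in> carrier R" using z w Q by (auto simp: scal_closed_def)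
      have "z \<oplus> w \<notin> P'" if P': "P' \<in> S" for P'
      proof
        assume a: "z \<oplus> w \<in> P'"
        interpret P': ideal P' R using Suc.prems P' primeideal.axioms(1) by auto
        have e1: "(z \<oplus> w) \<oplus> \<ominus> w = z" using c by (simp add: R.a_assoc R.r_neg)
        have e2: "(z \<oplus> w) \<oplus> \<ominus> z = w" using c by (simp add: R.a_comm[of z w] R.a_assoc R.r_neg)
        show False
        proof (cases "P' = P")
          case True
          then have "(z \<oplus> w) \<oplus> \<ominus> z \<in> P'" using P'.a_closed[OF a P'.a_inv_closed] \<open>z \<in> P\<close> by simp
          then show False using e2 w True by simp
        next
          case False
          then have "(z \<oplus> w) \<oplus> \<ominus> w \<in> P'" using P'.a_closed[OF a P'.a_inv_closed[OF w(3)[OF P']]] by simp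
          then show False using e1 z P' False by simp
        qed
      qed
      moreover have "z \<oplus> w \<in> Q" using Q z w by (auto simp: scal_closed_def)
      ultimately show ?thesis by blast
    qed
  qed
qed

text \<open>The zero divisors modulo \<open>N\<close> lie in the union of the finitely many maximal
  annihilators. None of these contains \<open>Q\<close>, since its element would represent a nonzero
  socle element; prime avoidance then works for all members of \<open>S\<close> at once.\<close>

lemma nzd_exists:
  assumes Q: "scal_closed Q" "Q \<noteq> {}" and S: "finite S" "\<And>N. N \<in> S \<Longrightarrow> sub N \<and> sfree M Q N \<and> acc M (carrier R) N (carrier M)"
  shows "\<exists>z\<in>Q. \<forall>N\<in>S. nzd M z N"
proof -
  let ?A = "\<Union>N\<in>S. {annmod R M N v | v. maxann (carrier M) N v}"
  have "finite ?A" using S maxann_finite by auto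
  moreover have "\<forall>P\<in>?A. primeideal P R \<and> \<not> Q \<subseteq> P"
  proof safe
    fix N v assume N: "N \<in> S" and v: "maxann (carrier M) N v"
    show "primeideal (annmod R M N v) R" using maxann_prime[OF _ sub_carrier v] S N by auto
    assume "Q \<subseteq> annmod R M N v"
    then have "\<forall>b\<in>Q. b \<odot>\<^bsub>M\<^esub> v \<in> N" by (auto simp: annmod_def)
    then show False using S(2)[OF N] v by (auto simp: sfree_def maxann_def)
  qed
  ultimately obtain z where z: "z \<in> Q" "\<forall>P\<in>?A. z \<notin> P" using prime_avoidance[OF Q(1) _ _ Q(2)] by blast
  have zc: "z \<in> carrier R" using z Q by (auto simp: scal_closed_def)
  have "nzd M z N" if N: "N \<in> S" for N
    unfolding nzd_def
  proof (intro ballI impI, rule ccontr)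
    fix v assume v: "v \<in> carrier M" "z \<odot>\<^bsub>M\<^esub> v \<in> N" "v \<notin> N"
    obtain w where w: "maxann (carrier M) N w" "annmod R M N v \<subseteq> annmod R M N w"
      using maxann_exists[of N "carrier M" v] S(2)[OF N] v sub_carrier by (auto simp: stab_def)
    have "z \<in> annmod R M N v" using v zc by (auto simp: annmod_def)
    then show False using z(2) w N by blast
  qed
  then show ?thesis using z by auto
qed

section \<open>Exchanging the members of a regular sequence\<close>

lemma sub_adj: "sub N \<Longrightarrow> x \<in> carrier R \<Longrightarrow> sub (adj M N x)"
  by (intro sub_msum sub_smul sub_carrier)

lemma sub_addl: "sub N \<Longrightarrow> set xs \<subseteq> carrier R \<Longrightarrow> sub (addl M N xs)"
  by (induction xs arbitrary: N) (auto intro: sub_adj)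

lemma adj_upper: "sub N \<Longrightarrow> x \<in> carrier R \<Longrightarrow> N \<subseteq> adj M N x"
  by (intro msum_upper1[OF _ sub_smul] sub_carrier)

lemma addl_upper: "sub N \<Longrightarrow> set xs \<subseteq> carrier R \<Longrightarrow> N \<subseteq> addl M N xs"
proof (induction xs arbitrary: N)
  case (Cons x xs)
  then have x: "x \<in> carrier R" "set xs \<subseteq> carrier R" by auto
  show ?case using adj_upper[OF Cons.prems(1) x(1)] Cons.IH[OF sub_adj[OF Cons.prems(1) x(1)] x(2)] by simp
qed simp

lemma adjI: "n \<in> N \<Longrightarrow> u \<in> carrier M \<Longrightarrow> n \<oplus>\<^bsub>M\<^esub> x \<odot>\<^bsub>M\<^esub> u \<in> adj M N x"
  by (auto intro: msumI smulI)

lemma adjE: "w \<in> adj M N x \<Longrightarrow> (\<And>n u. n \<in> N \<Longrightarrow> u \<in> carrier M \<Longrightarrow> w = n \<oplus>\<^bsub>M\<^esub> x \<odot>\<^bsub>M\<^esub> u \<Longrightarrow> thesis) \<Longrightarrow> thesis"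
  by (auto elim!: msumE smulE)

lemma adj_comm: "sub N \<Longrightarrow> x \<in> carrier R \<Longrightarrow> y \<in> carrier R \<Longrightarrow> adj M (adj M N x) y = adj M (adj M N y) x"
  using sub_smul[OF _ sub_carrier] msum_comm[of "smul M x (carrier M)" "smul M y (carrier M)"]
  by (simp add: msum_assoc stab_def)

text \<open>An elementwise form of Hom(A/Q, M/xM) = Ext^1(A/Q, M) = Hom(A/Q, M/yM), with
  \<open>M\<close> read modulo \<open>N\<close>. A socle element \<open>u\<close> modulo
  \<open>x\<close> is sent to the \<open>v\<close> with yu congruent to xv; this \<open>v\<close> is
  a socle element modulo \<open>y\<close>, hence trivial, and cancelling \<open>y\<close> shows that
  \<open>u\<close> is trivial.\<close>

lemma soc_exchange1:
  assumes N: "sub N" and Q: "Q \<subseteq> carrier R" and x: "x \<in> Q" "nzd M x N" and y: "y \<in> Q" "nzd M y N"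
    and sf: "sfree M Q (adj M N y)"
  shows "sfree M Q (adj M N x)"
  unfolding sfree_def
proof (intro ballI impI)
  have xy: "x \<in> carrier R" "y \<in> carrier R" using x y Q by auto
  fix u assume u: "u \<in> carrier M" "\<forall>b\<in>Q. b \<odot>\<^bsub>M\<^esub> u \<in> adj M N x"
  then obtain n v where v: "n \<in> N" "v \<in> carrier M" "y \<odot>\<^bsub>M\<^esub> u = n \<oplus>\<^bsub>M\<^esub> x \<odot>\<^bsub>M\<^esub> v" using y by (blast elim: adjE)
  have n: "n \<in> carrier M" using v N by (auto simp: stab_def)
  have "v \<in> adj M N y"
  proof (rule sf[unfolded sfree_def, rule_format, OF v(2)])
    fix b assume b: "b \<in> Q"
    have bc: "b \<in> carrier R" using b Q by auto
    obtain n' w where w: "n' \<in> N" "w \<in> carrier M" "b \<odot>\<^bsub>M\<^esub> u = n' \<oplus>\<^bsub>M\<^esub> x \<odot>\<^bsub>M\<^esub> w" using u(2) b by (blast elim: adjE)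
    have n': "n' \<in> carrier M" using w N by (auto simp: stab_def)
    have "b \<odot>\<^bsub>M\<^esub> (y \<odot>\<^bsub>M\<^esub> u) = y \<odot>\<^bsub>M\<^esub> (b \<odot>\<^bsub>M\<^esub> u)" using smult_lcomm bc xy u by auto
    then have "b \<odot>\<^bsub>M\<^esub> n \<oplus>\<^bsub>M\<^esub> x \<odot>\<^bsub>M\<^esub> (b \<odot>\<^bsub>M\<^esub> v) = y \<odot>\<^bsub>M\<^esub> n' \<oplus>\<^bsub>M\<^esub> x \<odot>\<^bsub>M\<^esub> (y \<odot>\<^bsub>M\<^esub> w)"
      using v w bc xy n n' by (simp add: smult_r_distr smult_lcomm[of x])
    then have "x \<odot>\<^bsub>M\<^esub> (b \<odot>\<^bsub>M\<^esub> v) = (y \<odot>\<^bsub>M\<^esub> n' \<oplus>\<^bsub>M\<^esub> x \<odot>\<^bsub>M\<^esub> (y \<odot>\<^bsub>M\<^esub> w)) \<ominus>\<^bsub>M\<^esub> b \<odot>\<^bsub>M\<^esub> n"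
      using add_minus_cancel(3)[of "x \<odot>\<^bsub>M\<^esub> (b \<odot>\<^bsub>M\<^esub> v)" "b \<odot>\<^bsub>M\<^esub> n"] v bc xy n by auto
    then have "x \<odot>\<^bsub>M\<^esub> (b \<odot>\<^bsub>M\<^esub> v) \<ominus>\<^bsub>M\<^esub> x \<odot>\<^bsub>M\<^esub> (y \<odot>\<^bsub>M\<^esub> w) = y \<odot>\<^bsub>M\<^esub> n' \<ominus>\<^bsub>M\<^esub> b \<odot>\<^bsub>M\<^esub> n"
      using v w bc xy n n' by (simp add: a_minus_def M.a_ac M.r_neg)
    then have "x \<odot>\<^bsub>M\<^esub> (b \<odot>\<^bsub>M\<^esub> v \<ominus>\<^bsub>M\<^esub> y \<odot>\<^bsub>M\<^esub> w) = y \<odot>\<^bsub>M\<^esub> n' \<ominus>\<^bsub>M\<^esub> b \<odot>\<^bsub>M\<^esub> n"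
      using v w bc xy by (simp add: smult_r_diff)
    also have "\<dots> \<in> N" using stableD[OF N] v w bc xy by auto
    finally have "b \<odot>\<^bsub>M\<^esub> v \<ominus>\<^bsub>M\<^esub> y \<odot>\<^bsub>M\<^esub> w \<in> N" using x(2) v w bc xy by (auto simp: nzd_def)
    then have "(b \<odot>\<^bsub>M\<^esub> v \<ominus>\<^bsub>M\<^esub> y \<odot>\<^bsub>M\<^esub> w) \<oplus>\<^bsub>M\<^esub> y \<odot>\<^bsub>M\<^esub> w \<in> adj M N y" using w by (intro adjI)
    then show "b \<odot>\<^bsub>M\<^esub> v \<in> adj M N y" using v w bc xy by (simp add: add_minus_cancel)
  qed
  then obtain n' w where w: "n' \<in> N" "w \<in> carrier M" "v = n' \<oplus>\<^bsub>M\<^esub> y \<odot>\<^bsub>M\<^esub> w" by (blast elim: adjE)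
  have n': "n' \<in> carrier M" using w N by (auto simp: stab_def)
  have "y \<odot>\<^bsub>M\<^esub> (u \<ominus>\<^bsub>M\<^esub> x \<odot>\<^bsub>M\<^esub> w) = n \<oplus>\<^bsub>M\<^esub> x \<odot>\<^bsub>M\<^esub> n'"
    using v w n n' xy u by (simp add: smult_r_diff smult_r_distr smult_lcomm[of y x] M.a_assoc[symmetric] add_minus_cancel)
  also have "\<dots> \<in> N" using stableD[OF N] v w xy by auto
  finally have "u \<ominus>\<^bsub>M\<^esub> x \<odot>\<^bsub>M\<^esub> w \<in> N" using y(2) u w xy by (auto simp: nzd_def)
  then have "(u \<ominus>\<^bsub>M\<^esub> x \<odot>\<^bsub>M\<^esub> w) \<oplus>\<^bsub>M\<^esub> x \<odot>\<^bsub>M\<^esub> w \<in> adj M N x" using w by (intro adjI)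
  then show "u \<in> adj M N x" using u w xy by (simp add: add_minus_cancel)
qed

lemma nzd_swap:
  assumes N: "sub N" and c: "x \<in> carrier R" "z \<in> carrier R" and x: "nzd M x N" and z: "nzd M z (adj M N x)"
  shows "nzd M x (adj M N z)"
  unfolding nzd_def
proof (intro ballI impI)
  fix u assume u: "u \<in> carrier M" "x \<odot>\<^bsub>M\<^esub> u \<in> adj M N z"
  then obtain n v where v: "n \<in> N" "v \<in> carrier M" "x \<odot>\<^bsub>M\<^esub> u = n \<oplus>\<^bsub>M\<^esub> z \<odot>\<^bsub>M\<^esub> v" by (blast elim: adjE)
  have n: "n \<in> carrier M" using v N by (auto simp: stab_def)
  have "z \<odot>\<^bsub>M\<^esub> v = \<ominus>\<^bsub>M\<^esub> n \<oplus>\<^bsub>M\<^esub> x \<odot>\<^bsub>M\<^esub> u" using v n c by (simp add: M.r_neg1)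
  also have "\<dots> \<in> adj M N x" using stableD(4)[OF N v(1)] u by (intro adjI)
  finally have "v \<in> adj M N x" using z v by (auto simp: nzd_def)
  then obtain n' w where w: "n' \<in> N" "w \<in> carrier M" "v = n' \<oplus>\<^bsub>M\<^esub> x \<odot>\<^bsub>M\<^esub> w" by (blast elim: adjE)
  have n': "n' \<in> carrier M" using w N by (auto simp: stab_def)
  have "x \<odot>\<^bsub>M\<^esub> (u \<ominus>\<^bsub>M\<^esub> z \<odot>\<^bsub>M\<^esub> w) = n \<oplus>\<^bsub>M\<^esub> z \<odot>\<^bsub>M\<^esub> n'"
    using v w n n' c u by (simp add: smult_r_diff smult_r_distr smult_lcomm[of x z] M.a_assoc[symmetric] add_minus_cancel)
  also have "\<dots> \<in> N" using stableD[OF N] v w c by auto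
  finally have "u \<ominus>\<^bsub>M\<^esub> z \<odot>\<^bsub>M\<^esub> w \<in> N" using x u w c by (auto simp: nzd_def)
  then have "(u \<ominus>\<^bsub>M\<^esub> z \<odot>\<^bsub>M\<^esub> w) \<oplus>\<^bsub>M\<^esub> z \<odot>\<^bsub>M\<^esub> w \<in> adj M N z" using w by (intro adjI)
  then show "u \<in> adj M N z" using u w c by (simp add: add_minus_cancel)
qed

text \<open>Moves a new element in front of a regular sequence. Each step is the harmless half of
  permuting regular sequences, \<open>nzd_swap\<close>, which holds without a local hypothesis; the
  price is that \<open>z\<close> has to be regular modulo all the partial sums.\<close>

lemma rseq_adj:
  "sub N \<Longrightarrow> set xs \<subseteq> carrier R \<Longrightarrow> z \<in> carrier R \<Longrightarrow> rseq M N xs \<Longrightarrow>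
   \<forall>i\<le>length xs. nzd M z (addl M N (take i xs)) \<Longrightarrow> rseq M (adj M N z) xs"
proof (induction xs arbitrary: N)
  case (Cons x xs)
  have z: "nzd M z (adj M N x)" using Cons.prems(5)[rule_format, of 1] by simp
  have "nzd M x (adj M N z)" using nzd_swap Cons.prems z by auto
  moreover have "rseq M (adj M (adj M N x) z) xs"
  proof (rule Cons.IH)
    show "\<forall>i\<le>length xs. nzd M z (addl M (adj M N x) (take i xs))"
      using Cons.prems(5)[rule_format, of "Suc _"] by auto
  qed (use Cons.prems sub_adj in auto)
  ultimately show ?case using Cons.prems adj_comm[of N x z] by auto
qed simp

lemma addl_adj: "sub N \<Longrightarrow> set xs \<subseteq> carrier R \<Longrightarrow> z \<in> carrier R \<Longrightarrow> addl M (adj M N z) xs = adj M (addl M N xs) z"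
proof (induction xs arbitrary: N)
  case (Cons x xs) then show ?case using adj_comm[of N z x] sub_adj by auto
qed simp

text \<open>The next member of the sequence lies in \<open>Q\<close> and is a nonzerodivisor, so it
  cannot kill a nonzero socle element. Nothing is claimed modulo the full sequence.\<close>

lemma sfree_rseq:
  assumes "rseq M N xs" "set xs \<subseteq> Q" "i < length xs" shows "sfree M Q (addl M N (take i xs))"
  using assms unfolding rseq_iff_nth nzd_def sfree_def by (meson nth_mem subsetD)

text \<open>Whether the socle is trivial modulo a regular sequence in \<open>Q\<close> depends only on its length: an element
  regular modulo all partial ideals of both sequences (prime avoidance) can replace the last member of either.\<close>
theorem soc_exchange:
  assumes Q: "scal_closed Q" and "Q \<noteq> {}"
  shows "sub N \<Longrightarrow> acc M (carrier R) N (carrier M) \<Longrightarrow> length xs = length ys \<Longrightarrow> set xs \<subseteq> Q \<Longrightarrow> set ys \<subseteq> Q \<Longrightarrow>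
    rseq M N xs \<Longrightarrow> rseq M N ys \<Longrightarrow> sfree M Q (addl M N ys) \<Longrightarrow> sfree M Q (addl M N xs)"
proof (induction "length xs" arbitrary: xs ys N)
  case 0 then show ?case by auto
next
  case (Suc n)
  have QR: "Q \<subseteq> carrier R" using Q by (auto simp: scal_closed_def)
  obtain xs' x where xs: "xs = xs' @ [x]" using Suc.hyps(2) by (cases xs rule: rev_cases) auto
  obtain ys' y where ys: "ys = ys' @ [y]" using Suc.hyps(2) Suc.prems(3) by (cases ys rule: rev_cases) auto
  note p = Suc.prems
  have l: "length xs' = n" "length ys' = n" using Suc xs ys by auto
  have c: "set xs' \<subseteq> carrier R" "set ys' \<subseteq> carrier R" using p xs ys QR by auto
  \<comment> \<open>All partial sums of both sequences except the two full ones. Each is followed by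
    a regular element of \<open>Q\<close>, hence is socle free, so a single \<open>z\<close> can be
    regular modulo all of them.\<close>
  let ?S = "(\<lambda>i. addl M N (take i xs)) ` {..n} \<union> (\<lambda>i. addl M N (take i ys)) ` {..n}"
  have sb: "sub (addl M N (take i zs))" if "set zs \<subseteq> Q" for i zs
    using sub_addl[OF p(1), of "take i zs"] that QR set_take_subset by (metis order_trans)
  have ac: "acc M (carrier R) (addl M N (take i zs)) (carrier M)" if "set zs \<subseteq> Q" for i zs
    using acc_sub[OF p(2) addl_upper[OF p(1), of "take i zs"] order_refl] that QR set_take_subset by (metis order_trans)
  have "\<exists>z\<in>Q. \<forall>N\<in>?S. nzd M z N"
    by (rule nzd_exists[OF Q assms(2)]) (use p sb ac sfree_rseq Suc.hyps(2) in auto)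
  then obtain z where z: "z \<in> Q" "\<And>i. i \<le> n \<Longrightarrow> nzd M z (addl M N (take i xs))" "\<And>i. i \<le> n \<Longrightarrow> nzd M z (addl M N (take i ys))" by auto
  have zc: "z \<in> carrier R" using z QR by auto
  have sx: "sub (addl M N xs')" and sy: "sub (addl M N ys')" using sub_addl p c by auto
  have 1: "sfree M Q (adj M (addl M N ys') z)"
    by (rule soc_exchange1[OF sy QR, where y = y]) (use z(1) z(3)[of n] p l ys in \<open>auto simp: rseq_append addl_append\<close>)
  \<comment> \<open>The last member of \<open>ys\<close> has been replaced by \<open>z\<close>.
    Moving \<open>z\<close> to the front leaves the shorter sequences \<open>xs'\<close> and
    \<open>ys'\<close> over N + zM, where the induction hypothesis transfers the socle; afterwards
    \<open>z\<close> is replaced by the last member of \<open>xs\<close>.\<close>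
  have "sfree M Q (addl M (adj M N z) xs')"
  proof (rule Suc.hyps(1)[where ys = ys'])
    show "sub (adj M N z)" using p zc sub_adj by auto
    show "acc M (carrier R) (adj M N z) (carrier M)" using acc_sub[OF p(2) adj_upper[OF p(1) zc] order_refl] .
    show "rseq M (adj M N z) xs'" by (rule rseq_adj) (use p c zc l z xs in \<open>auto simp: rseq_append\<close>)
    show "rseq M (adj M N z) ys'" by (rule rseq_adj) (use p c zc l z ys in \<open>auto simp: rseq_append\<close>)
    show "sfree M Q (addl M (adj M N z) ys')" using 1 addl_adj[OF p(1) c(2) zc] by simp
  qed (use l p xs ys in auto)
  then have "sfree M Q (adj M (addl M N xs') z)" using addl_adj[OF p(1) c(1) zc] by simp
  then have "sfree M Q (adj M (addl M N xs') x)"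
    by (rule soc_exchange1[OF sx QR, rotated 4]) (use z(1) z(2)[of n] p l xs in \<open>auto simp: rseq_append\<close>)
  then show ?case using xs by (simp add: addl_append)
qed

end

section \<open>Modules over Noetherian local rings\<close>

lemma (in cring) module_ring_as_module: "module R (ring_as_module R)"
proof (rule moduleI[OF is_cring])
  show "abelian_group (ring_as_module R)"
    by (rule abelian_groupI) (auto simp: ring_as_module_def a_ac intro!: bexI[of _ "\<ominus> _"] l_neg)
qed (auto simp: ring_as_module_def l_distr r_distr m_assoc)

text \<open>Lets the predicates \<open>stab\<close> and \<open>acc\<close>, and with them
  \<open>acc_max\<close>, speak about ideals.\<close>

lemma (in cring) stab_ring_iff: "stab (ring_as_module R) (carrier R) I \<longleftrightarrow> ideal I R"
proof -
  interpret N: module R "ring_as_module R" by (rule module_ring_as_module)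
  have inv: "\<ominus>\<^bsub>ring_as_module R\<^esub> x = \<ominus> x" for x by (simp add: a_inv_def ring_as_module_def m_inv_def)
  show ?thesis
  proof
    assume s: "stab (ring_as_module R) (carrier R) I"
    show "ideal I R"
    proof (rule idealI[OF ring_axioms])
      show "subgroup I (add_monoid R)"
        by (rule add.subgroupI) (use s inv in \<open>auto simp: stab_def ring_as_module_def a_inv_def[symmetric]\<close>)
      show "x \<otimes> a \<in> I" "a \<otimes> x \<in> I" if "a \<in> I" "x \<in> carrier R" for a x
        using s that m_comm[of a x] by (auto simp: stab_def ring_as_module_def)
    qed
  next
    assume "ideal I R" then interpret ideal I R .
    show "stab (ring_as_module R) (carrier R) I"
      unfolding stab_def inv using Icarr I_l_closed by (auto simp: ring_as_module_def)
  qed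
qed

lemma (in noetherian_ring) acc_ring:
  assumes "cring R" shows "acc (ring_as_module R) (carrier R) {} (carrier R)"
  unfolding acc_def
proof (intro allI impI)
  interpret cring R by fact
  fix f :: "nat \<Rightarrow> 'a set"
  assume "\<forall>n. stab (ring_as_module R) (carrier R) (f n) \<and> {} \<subseteq> f n \<and> f n \<subseteq> carrier R \<and> f n \<subseteq> f (Suc n)"
  then have f: "\<And>n. ideal (f n) R" "\<And>n. f n \<subseteq> f (Suc n)" by (auto simp: stab_ring_iff)
  have m: "f n \<subseteq> f k" if "n \<le> k" for n k using lift_Suc_mono_le[of f, OF f(2) that] .
  have "\<Union>(range f) \<in> range f"
  proof (rule ideal_chain_is_trivial)
    show "subset.chain {I. ideal I R} (range f)"
    proof -
      have "f a \<subseteq> f b \<or> f b \<subseteq> f a" for a b using m[of a b] m[of b a] by (cases "a \<le> b") auto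
      then show ?thesis unfolding pred_on.chain_def using f(1) by blast
    qed
  qed auto
  then obtain k where k: "\<Union>(range f) = f k" by auto
  then show "\<exists>k. \<forall>n\<ge>k. f n = f k" using m by (intro exI[of _ k]) blast
qed

text \<open>An ideal that is maximal among those containing \<open>I\<close> and missing the
  multiplicative set \<open>S\<close> is prime: if neither factor of a product in it lies in it,
  adding either one makes it meet \<open>S\<close>, and the product of two such elements of
  \<open>S\<close> falls back into the ideal.\<close>

lemma (in noetherian_ring) prime_disjoint:
  assumes R: "cring R" and I: "ideal I R" and S: "S \<subseteq> carrier R" "\<one> \<in> S" "\<And>s t. s \<in> S \<Longrightarrow> t \<in> S \<Longrightarrow> s \<otimes> t \<in> S" "S \<inter> I = {}"
  shows "\<exists>P. primeideal P R \<and> I \<subseteq> P \<and> P \<inter> S = {}"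
proof -
  interpret cring R by fact
  let ?F = "{X. ideal X R \<and> I \<subseteq> X \<and> S \<inter> X = {}}"
  have "\<exists>X\<in>?F. I \<subseteq> X \<and> (\<forall>Y\<in>?F. X \<subseteq> Y \<longrightarrow> Y = X)"
    by (rule acc_max[OF acc_ring[OF R]]) (use I S ideal.Icarr in \<open>auto simp: stab_ring_iff\<close>)
  then obtain P where P: "ideal P R" "I \<subseteq> P" "S \<inter> P = {}" and mx: "\<And>Y. ideal Y R \<Longrightarrow> S \<inter> Y = {} \<Longrightarrow> P \<subseteq> Y \<Longrightarrow> Y = P"
    by auto
  interpret P: ideal P R by fact
  have meet: "\<exists>i\<in>P. \<exists>r\<in>carrier R. i \<oplus> r \<otimes> a \<in> S" if a: "a \<in> carrier R" "a \<notin> P" for a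
  proof -
    have "ideal (P <+> PIdl a) R" using add_ideals[OF P(1) cgenideal_ideal[OF a(1)]] .
    moreover have sub: "P \<subseteq> P <+> PIdl a"
    proof
      fix x assume x: "x \<in> P"
      have "x \<oplus> \<zero> \<in> P <+> PIdl a"
        using x additive_subgroup.zero_closed[OF ideal.axioms(1)[OF cgenideal_ideal[OF a(1)]]] unfolding set_add_def' by blast
      then show "x \<in> P <+> PIdl a" using P.Icarr[OF x] by simp
    qed
    moreover have "a \<in> P <+> PIdl a"
    proof -
      have "\<zero> \<oplus> a \<in> P <+> PIdl a" using cgenideal_self[OF a(1)] P.zero_closed unfolding set_add_def' by blast
      then show ?thesis using a(1) by simp
    qed
    ultimately have "S \<inter> (P <+> PIdl a) \<noteq> {}" using mx[of "P <+>\<^bsub>R\<^esub> PIdl a"] a(2) by metis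
    then show ?thesis by (auto simp: set_add_def' cgenideal_def)
  qed
  have "primeideal P R"
  proof (rule primeidealI[OF P(1) R])
    show "carrier R \<noteq> P" using S P by auto
    fix a b assume ab: "a \<in> carrier R" "b \<in> carrier R" "a \<otimes> b \<in> P"
    show "a \<in> P \<or> b \<in> P"
    proof (rule ccontr)
      assume "\<not> ?thesis"
      then obtain i r j t where 1: "i \<in> P" "r \<in> carrier R" "i \<oplus> r \<otimes> a \<in> S" and 2: "j \<in> P" "t \<in> carrier R" "j \<oplus> t \<otimes> b \<in> S"
        using meet[of a] meet[of b] ab by auto
      have c: "i \<in> carrier R" "j \<in> carrier R" using 1 2 P.Icarr by auto
      have "(i \<oplus> r \<otimes> a) \<otimes> (j \<oplus> t \<otimes> b) = (i \<otimes> (j \<oplus> t \<otimes> b) \<oplus> (r \<otimes> a) \<otimes> j) \<oplus> (r \<otimes> t) \<otimes> (a \<otimes> b)"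
        using c 1 2 ab by algebra
      also have "\<dots> \<in> P" 
        using P.a_closed[OF P.a_closed[OF P.I_r_closed[OF 1(1), of "j \<oplus> t \<otimes> b"] P.I_l_closed[OF 2(1), of "r \<otimes> a"]] P.I_l_closed[OF ab(3), of "r \<otimes> t"]]
          1 2 ab c by simp
      finally show False using S(3)[OF 1(3) 2(3)] P(3) by auto
    qed
  qed
  then show ?thesis using P by auto
qed

context module begin

text \<open>A submodule between B and B + Ru is recovered from the ideal of scalars that carry
  \<open>u\<close> into it, so the chain condition comes from ideals of \<open>R\<close>.\<close>

lemma acc_cyc:
  assumes N: "noetherian_ring R" and B: "sub B" and u: "u \<in> carrier M"
  shows "acc M (carrier R) B (msum M B (cyc M (carrier R) u))"
  unfolding acc_def
proof (intro allI impI)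
  fix f assume f: "\<forall>n. sub (f n) \<and> B \<subseteq> f n \<and> f n \<subseteq> msum M B (cyc M (carrier R) u) \<and> f n \<subseteq> f (Suc n)"
  let ?I = "\<lambda>n. annmod R M (f n) u"
  have "\<exists>k. \<forall>n\<ge>k. ?I n = ?I k"
    using noetherian_ring.acc_ring[OF N R.is_cring, unfolded acc_def, rule_format, of ?I] annmod_ideal[OF _ u] f
    by (auto simp: R.stab_ring_iff annmod_def)
  then obtain k where k: "\<And>n. n \<ge> k \<Longrightarrow> ?I n = ?I k" by auto
  have "f n \<subseteq> f k" if "n \<ge> k" for n
  proof
    fix x assume x: "x \<in> f n"
    then obtain b s where *: "b \<in> B" "s \<in> carrier R" "x = b \<oplus>\<^bsub>M\<^esub> s \<odot>\<^bsub>M\<^esub> u" using f by (fastforce simp: msum_def cyc_def)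
    have sn: "sub (f n)" "b \<in> f n" "sub (f k)" "b \<in> f k" using f * by auto
    then have "s \<odot>\<^bsub>M\<^esub> u \<in> f n" using stable_add_iff'[OF sn(1), of "s \<odot>\<^bsub>M\<^esub> u" b] * x u by auto
    then have "s \<in> ?I n" using * by (auto simp: annmod_def)
    then have "s \<odot>\<^bsub>M\<^esub> u \<in> f k" using k[OF that] by (auto simp: annmod_def)
    then show "x \<in> f k" using * sn stableD(3) by metis
  qed
  moreover have "f k \<subseteq> f n" if "n \<ge> k" for n using lift_Suc_mono_le[of f, OF _ that] f by auto
  ultimately have "\<forall>n\<ge>k. f n = f k" by (simp add: subset_antisym)
  then show "\<exists>k. \<forall>n\<ge>k. f n = f k" by (rule exI)
qed

lemma acc_fin_gen:
  assumes N: "noetherian_ring R" and fg: "fin_gen R M" shows "acc M (carrier R) {\<zero>\<^bsub>M\<^esub>} (carrier M)"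
proof -
  obtain S where S: "finite S" "S \<subseteq> carrier M" "gen_submodule R M S = carrier M" using fg by (auto simp: fin_gen_def)
  have "\<exists>A. sub A \<and> S \<subseteq> A \<and> acc M (carrier R) {\<zero>\<^bsub>M\<^esub>} A" using S(1,2)
  proof (induction S rule: finite_induct)
    case empty
    have "f n = f 0" if "\<forall>n. sub (f n) \<and> {\<zero>\<^bsub>M\<^esub>} \<subseteq> f n \<and> f n \<subseteq> {\<zero>\<^bsub>M\<^esub>} \<and> f n \<subseteq> f (Suc n)" for f :: "nat \<Rightarrow> 'c set" and n
    proof -
      have "f n = {\<zero>\<^bsub>M\<^esub>}" for n using that[rule_format, of n] by (simp add: subset_antisym)
      then show ?thesis by simp
    qed
    then have "acc M (carrier R) {\<zero>\<^bsub>M\<^esub>} {\<zero>\<^bsub>M\<^esub>}" unfolding acc_def by metis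
    then show ?case using sub_zero by auto
  next
    case (insert u S)
    then obtain A where A: "sub A" "S \<subseteq> A" "acc M (carrier R) {\<zero>\<^bsub>M\<^esub>} A" by auto
    have u: "u \<in> carrier M" using insert by auto
    let ?B = "msum M A (cyc M (carrier R) u)"
    have B: "sub ?B" "A \<subseteq> ?B" "cyc M (carrier R) u \<subseteq> ?B"
      using sub_msum[OF A(1) stable_cyc[OF u]] msum_upper1[OF A(1) stable_cyc[OF u]] msum_upper2[OF A(1) stable_cyc[OF u]] by auto
    have "acc M (carrier R) {\<zero>\<^bsub>M\<^esub>} ?B"
      by (rule acc_trans[OF order_refl A(3) acc_cyc[OF N A(1) u] A(1) _ B(2) B(1)]) (use stableD(2)[OF A(1)] in auto)
    then show ?case using B A cyc_self[OF u] by blast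
  qed
  then obtain A where A: "sub A" "S \<subseteq> A" "acc M (carrier R) {\<zero>\<^bsub>M\<^esub>} A" by auto
  have "carrier M \<subseteq> A" using gen_sub_least[OF A(1)[folded submodule_iff_stable] A(2)] S(3) by simp
  then show ?thesis by (rule acc_sub[OF A(3) order_refl])
qed

lemma prime_pow: "primeideal P R \<Longrightarrow> z \<in> carrier R \<Longrightarrow> z [^] (k::nat) \<in> P \<Longrightarrow> z \<in> P"
proof (induction k)
  case 0 then show ?case using ideal.one_imp_carrier[OF primeideal.axioms(1)[OF 0(1)]] by auto
next
  case (Suc k) then show ?case using primeideal.I_prime[OF Suc(2), of "z [^] k" z] by auto
qed

text \<open>A maximal annihilator of an element of A modulo B is prime; by nilpotency it contains a
  power of each member of \<open>Q\<close>, hence all of \<open>Q\<close>.\<close>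

lemma soc_exists:
  assumes ac: "acc M (carrier R) B A" and s: "sub A" "sub B" "B \<subset> A" and Q: "Q \<subseteq> carrier R"
    and nil: "\<And>z v. z \<in> Q \<Longrightarrow> v \<in> A \<Longrightarrow> \<exists>k::nat. z [^] k \<odot>\<^bsub>M\<^esub> v \<in> B"
  shows "\<exists>u\<in>A. u \<notin> B \<and> (\<forall>z\<in>Q. z \<odot>\<^bsub>M\<^esub> u \<in> B)"
proof -
  obtain v where "v \<in> A" "v \<notin> B" using s by auto
  then obtain w where w: "maxann A B w" using maxann_exists[OF ac s(2,1)] s by blast
  have wA: "w \<in> A" "w \<notin> B" using w by (auto simp: maxann_def)
  have "z \<odot>\<^bsub>M\<^esub> w \<in> B" if z: "z \<in> Q" for z
  proof -
    obtain k where "z [^] (k::nat) \<odot>\<^bsub>M\<^esub> w \<in> B" using nil[OF z wA(1)] by auto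
    then have "z [^] k \<in> annmod R M B w" using z Q by (auto simp: annmod_def)
    then have "z \<in> annmod R M B w" using prime_pow[OF maxann_prime[OF s(2,1) w]] z Q by auto
    then show ?thesis by (auto simp: annmod_def)
  qed
  then show ?thesis using wA by auto
qed

lemma flen_dcc:
  assumes f: "fl X A" and s: "sub X" and g: "\<And>n. sub (g n) \<and> X \<subseteq> g n \<and> g n \<subseteq> A \<and> g (Suc n) \<subseteq> g n" and A: "sub A"
  shows "\<exists>k. \<forall>n\<ge>k. g n = g k"
proof -
  have "\<exists>k. \<forall>n. ll X (g k) \<le> ll X (g n)" using ex_has_least_nat[of "\<lambda>_. True" _ "\<lambda>n. ll X (g n)"] by auto
  then obtain k where k: "\<And>n. ll X (g k) \<le> ll X (g n)" by auto
  have "g n = g k" if "n \<ge> k" for n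
  proof -
    have le: "g n \<subseteq> g k" using lift_Suc_antimono_le[of g, OF _ that] g by auto
    have fk: "fl X (g k)" using len_add(1)[OF A _ s, of "g k"] g f by auto
    have *: "sub (g k)" "sub (g n)" "X \<subseteq> g n" using g by auto
    have "ll X (g k) = ll X (g n) + ll (g n) (g k)" using len_add(2)[OF *(1,2) s *(3) le fk] .
    then have "ll (g n) (g k) = 0" using k[of n] by auto
    moreover have "fl (g n) (g k)" using len_add(1)[OF *(1,2) s *(3) le] fk by auto
    ultimately show ?thesis using len_0_iff[OF _ *(1,2) le] by auto
  qed
  then show ?thesis by blast
qed

lemma sub_ideal_smult: "I \<subseteq> carrier R \<Longrightarrow> A \<subseteq> carrier M \<Longrightarrow> sub (ideal_smult R M I A)"
  using ideal_smult_sub[OF module_axioms] submodule_iff_stable by auto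

lemma ideal_smult_least: "sub T \<Longrightarrow> (\<And>z u. z \<in> I \<Longrightarrow> u \<in> A \<Longrightarrow> z \<odot>\<^bsub>M\<^esub> u \<in> T) \<Longrightarrow> ideal_smult R M I A \<subseteq> T"
  unfolding ideal_smult_def submodule_iff_stable[symmetric] by (rule gen_sub_least) auto

end

section \<open>Noetherian modules over a local ring: Nakayama, finite length, Krull intersection,
  chains of primes\<close>

locale local_module = module R M for R (structure) and M (structure) +
  fixes \<mm>
  assumes loc: "noetherian_local_ring R \<mm>"
    and ac: "acc M (carrier R) {\<zero>\<^bsub>M\<^esub>} (carrier M)"
begin

lemma noeth: "noetherian_ring R" using loc by (auto simp: noetherian_local_ring_def)
lemma mm_max: "maximalideal \<mm> R" using noetherian_local_ring.maximal[OF loc] .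
lemma mm_ideal: "ideal \<mm> R" using mm_max by (rule maximalideal.axioms(1))
lemma mm_carrier: "\<mm> \<subseteq> carrier R" using ideal.Icarr[OF mm_ideal] by auto
lemma mm_prime: "primeideal \<mm> R" using R.maximalideal_prime[OF mm_max] .

lemma acc_between: "sub B \<Longrightarrow> sub A \<Longrightarrow> acc M (carrier R) B A"
  by (rule acc_sub[OF ac]) (auto simp: stab_def)

lemma unit_or_mm:
  assumes x: "x \<in> carrier R" "x \<notin> \<mm>" shows "\<exists>y\<in>carrier R. y \<otimes> x = \<one>"
proof (rule ccontr)
  assume a: "\<not> ?thesis"
  let ?F = "{X. ideal X R \<and> \<one> \<notin> X}"
  have F0: "PIdl x \<in> ?F" using R.cgenideal_ideal[OF x(1)] a by (auto simp: cgenideal_def)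
  have "\<exists>X\<in>?F. PIdl x \<subseteq> X \<and> (\<forall>Y\<in>?F. X \<subseteq> Y \<longrightarrow> Y = X)"
    by (rule acc_max[OF noetherian_ring.acc_ring[OF noeth R.is_cring]]) (use F0 ideal.Icarr in \<open>auto simp: R.stab_ring_iff\<close>)
  then obtain X where X: "ideal X R" "\<one> \<notin> X" "PIdl x \<subseteq> X" "\<And>Y. ideal Y R \<Longrightarrow> \<one> \<notin> Y \<Longrightarrow> X \<subseteq> Y \<Longrightarrow> Y = X" by auto
  have "maximalideal X R"
  proof (rule maximalidealI[OF X(1)])
    show "carrier R \<noteq> X" using X(2) by auto
    fix J assume "ideal J R" "X \<subseteq> J" "J \<subseteq> carrier R" then show "J = X \<or> J = carrier R"
      using X(4) ideal.one_imp_carrier by metis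
  qed
  then have "X = \<mm>" using noetherian_local_ring.unique_maximal[OF loc] by auto
  then show False using X(3) R.cgenideal_self[OF x(1)] x by auto
qed

text \<open>Writing u = c + szu gives (1 - sz)u = c, and 1 - sz is a unit because \<open>z\<close>
  lies in the maximal ideal. It is Nakayama's lemma for a single element.\<close>

lemma mm_shrink:
  assumes C: "sub C" and u: "u \<in> carrier M" and z: "z \<in> \<mm>" and uC: "u \<in> msum M C (cyc M (carrier R) (z \<odot>\<^bsub>M\<^esub> u))"
  shows "u \<in> C"
proof -
  have zc: "z \<in> carrier R" using z mm_carrier by auto
  obtain c s where cs: "c \<in> C" "s \<in> carrier R" "u = c \<oplus>\<^bsub>M\<^esub> s \<odot>\<^bsub>M\<^esub> (z \<odot>\<^bsub>M\<^esub> u)" using uC by (auto simp: msum_def cyc_def)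
  have cc: "c \<in> carrier M" using cs C by (auto simp: stab_def)
  have sz: "s \<otimes> z \<in> \<mm>" using ideal.I_l_closed[OF mm_ideal z cs(2)] .
  have "\<one> \<ominus> s \<otimes> z \<notin> \<mm>"
  proof
    assume "\<one> \<ominus> s \<otimes> z \<in> \<mm>"
    then have "(\<one> \<ominus> s \<otimes> z) \<oplus> s \<otimes> z \<in> \<mm>" using sz additive_subgroup.a_closed[OF ideal.axioms(1)[OF mm_ideal]] by auto
    then have "\<one> \<in> \<mm>" using cs zc by (simp add: a_minus_def R.a_assoc R.l_neg)
    then show False using ideal.one_imp_carrier[OF mm_ideal] maximalideal.I_notcarr[OF mm_max] by auto
  qed
  then obtain y where y: "y \<in> carrier R" "y \<otimes> (\<one> \<ominus> s \<otimes> z) = \<one>" using unit_or_mm[of "\<one> \<ominus> s \<otimes> z"] cs zc by auto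
  have "(\<one> \<ominus> s \<otimes> z) \<odot>\<^bsub>M\<^esub> u = u \<ominus>\<^bsub>M\<^esub> s \<odot>\<^bsub>M\<^esub> (z \<odot>\<^bsub>M\<^esub> u)" using cs zc u by (simp add: smult_l_diff smult_assoc1)
  also have "\<dots> = c" using cs cc zc u add_minus_cancel(1)[of c "s \<odot>\<^bsub>M\<^esub> (z \<odot>\<^bsub>M\<^esub> u)"] by simp
  finally have e: "(\<one> \<ominus> s \<otimes> z) \<odot>\<^bsub>M\<^esub> u = c" .
  have "(y \<otimes> (\<one> \<ominus> s \<otimes> z)) \<odot>\<^bsub>M\<^esub> u = y \<odot>\<^bsub>M\<^esub> c" unfolding e[symmetric] by (rule smult_assoc1) (use y(1) cs(2) zc u in auto)
  then have "y \<odot>\<^bsub>M\<^esub> c = u" using y(2) u by simp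
  then show ?thesis using stableD(5)[OF C y(1) cs(1)] by simp
qed

text \<open>The hypothesis \<open>h\<close> says that A is contained in B + \<open>\<mm>\<close>A,
  phrased through all submodules \<open>T\<close> so that no ideal product is needed. If A were not
  in B, a maximal proper submodule C between B and A + B would contain \<open>\<mm>\<close>A by
  \<open>mm_shrink\<close>, and then all of A.\<close>

lemma nakayama:
  assumes A: "sub A" and B: "sub B"
    and h: "\<And>T. sub T \<Longrightarrow> B \<subseteq> T \<Longrightarrow> (\<And>z u. z \<in> \<mm> \<Longrightarrow> u \<in> A \<Longrightarrow> z \<odot>\<^bsub>M\<^esub> u \<in> T) \<Longrightarrow> A \<subseteq> T"
  shows "A \<subseteq> B"
proof (rule ccontr)
  assume n: "\<not> A \<subseteq> B"
  let ?D = "msum M A B"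
  have D: "sub ?D" "A \<subseteq> ?D" "B \<subseteq> ?D" using sub_msum[OF A B] msum_upper1[OF A B] msum_upper2[OF A B] by auto
  let ?F = "{X. sub X \<and> B \<subseteq> X \<and> X \<subset> ?D}"
  have "B \<in> ?F" using B D n by auto
  have "\<exists>X\<in>?F. B \<subseteq> X \<and> (\<forall>Y\<in>?F. X \<subseteq> Y \<longrightarrow> Y = X)"
    by (rule acc_max[OF acc_between[OF B D(1)]]) (use \<open>B \<in> ?F\<close> in auto)
  then obtain C where C0: "C \<in> ?F" "\<forall>Y\<in>?F. C \<subseteq> Y \<longrightarrow> Y = C" by blast
  then have C: "sub C" "B \<subseteq> C" "C \<subset> ?D" by simp_all
  have mx: "Y = C" if "sub Y" "Y \<subset> ?D" "C \<subseteq> Y" for Y using C0(2) C(2) that by blast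
  have "z \<odot>\<^bsub>M\<^esub> u \<in> C" if z: "z \<in> \<mm>" and u: "u \<in> A" for z u
  proof (rule ccontr)
    assume nC: "z \<odot>\<^bsub>M\<^esub> u \<notin> C"
    have zu: "u \<in> carrier M" "z \<odot>\<^bsub>M\<^esub> u \<in> A" "z \<odot>\<^bsub>M\<^esub> u \<in> carrier M" using stableD(5,6)[OF A] z u mm_carrier by auto
    let ?Y = "msum M C (cyc M (carrier R) (z \<odot>\<^bsub>M\<^esub> u))"
    have Y: "sub ?Y" "C \<subseteq> ?Y" "z \<odot>\<^bsub>M\<^esub> u \<in> ?Y" using sub_msum[OF C(1) stable_cyc[OF zu(3)]] msum_upper1[OF C(1) stable_cyc[OF zu(3)]]
        msum_upper2[OF C(1) stable_cyc[OF zu(3)]] cyc_self[OF zu(3)] by auto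
    have "?Y \<subseteq> ?D" using msum_least[OF D(1), of C] C cyc_least[OF D(1)] zu D by auto
    then have "?Y = ?D" using mx[OF Y(1)] Y nC by blast
    then have "u \<in> C" using mm_shrink[OF C(1) zu(1) z] u D by auto
    then show False using nC stableD(5)[OF C(1)] z mm_carrier by auto
  qed
  then have "A \<subseteq> C" using h C by blast
  then show False using msum_least[OF C(1) _ C(2)] C(3) by blast
qed

text \<open>An elementwise substitute for finite length: \<open>mnil_flen\<close> turns it into a
  bound on chains.\<close>

definition mnil where "mnil B A \<longleftrightarrow> (\<forall>z\<in>\<mm>. \<forall>v\<in>A. \<exists>k::nat. z [^] k \<odot>\<^bsub>M\<^esub> v \<in> B)"

lemma mnil_soc: "mnil B A \<Longrightarrow> sub A \<Longrightarrow> sub B \<Longrightarrow> B \<subset> A \<Longrightarrow> \<exists>u\<in>A. u \<notin> B \<and> (\<forall>z\<in>\<mm>. z \<odot>\<^bsub>M\<^esub> u \<in> B)"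
  by (rule soc_exists[OF acc_between _ _ _ mm_carrier]) (auto simp: mnil_def)

lemma flen_soc_step:
  assumes X: "sub X" and u: "u \<in> carrier M" "\<forall>z\<in>\<mm>. z \<odot>\<^bsub>M\<^esub> u \<in> X"
  shows "fl X (msum M X (cyc M (carrier R) u))"
proof -
  let ?Y = "msum M X (cyc M (carrier R) u)"
  have Y: "sub ?Y" "X \<subseteq> ?Y" using sub_msum[OF X stable_cyc[OF u(1)]] msum_upper1[OF X stable_cyc[OF u(1)]] by auto
  have dich: "C = X \<or> C = ?Y" if C: "sub C" "X \<subseteq> C" "C \<subseteq> ?Y" for C
  proof (cases "C = X")
    case False
    then obtain c where c: "c \<in> C" "c \<notin> X" using C by auto
    then obtain x s where xs: "x \<in> X" "s \<in> carrier R" "c = x \<oplus>\<^bsub>M\<^esub> s \<odot>\<^bsub>M\<^esub> u" using C(3) by (auto simp: msum_def cyc_def)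
    have "s \<notin> \<mm>" using xs c u(2) stableD(3)[OF X] by auto
    then obtain y where y: "y \<in> carrier R" "y \<otimes> s = \<one>" using unit_or_mm xs by auto
    have "s \<odot>\<^bsub>M\<^esub> u \<in> C" using stable_add_iff'[OF C(1), of "s \<odot>\<^bsub>M\<^esub> u" x] xs c C(2) u by auto
    then have "y \<odot>\<^bsub>M\<^esub> (s \<odot>\<^bsub>M\<^esub> u) \<in> C" using stableD(5)[OF C(1) y(1)] by auto
    then have "u \<in> C" using y xs u by (simp add: smult_assoc1[symmetric])
    then have "?Y \<subseteq> C" using msum_least[OF C(1,2) cyc_least[OF C(1)]] by auto
    then show ?thesis using C by auto
  qed auto
  have "j \<le> 1" if j: "chn M (carrier R) j X ?Y" for j
  proof (rule ccontr)
    assume "\<not> j \<le> 1" then obtain i where i: "j = Suc (Suc i)" by (metis One_nat_def not_less_eq_eq le_Suc_ex add_Suc plus_nat.add_0 not_less_eq_eq Suc_le_D)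
    from j[unfolded i] obtain C D where CD: "chn M (carrier R) i X D" "D \<subset> C" "C \<subset> ?Y" "sub C" by auto
    then show False using dich[of C] chn_stable[OF CD(1)] by blast
  qed
  then show ?thesis by (auto simp: flen_def)
qed

text \<open>Choose a submodule X maximal with A/X of infinite length. A socle element
  \<open>u\<close> modulo X adds only a simple factor, so A/(X + Ru) would still have infinite
  length, against maximality.\<close>

lemma mnil_flen:
  assumes nil: "mnil B A" and A: "sub A" and B: "sub B" "B \<subseteq> A" shows "fl B A"
proof (rule ccontr)
  assume n: "\<not> fl B A"
  let ?F = "{X. sub X \<and> B \<subseteq> X \<and> X \<subseteq> A \<and> \<not> fl X A}"
  have "\<exists>X\<in>?F. B \<subseteq> X \<and> (\<forall>Y\<in>?F. X \<subseteq> Y \<longrightarrow> Y = X)"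
    by (rule acc_max[OF acc_between[OF B(1) A]]) (use n B in auto)
  then obtain X where X: "sub X" "B \<subseteq> X" "X \<subseteq> A" "\<not> fl X A" and mx: "\<And>Y. sub Y \<Longrightarrow> X \<subseteq> Y \<Longrightarrow> Y \<subseteq> A \<Longrightarrow> \<not> fl Y A \<Longrightarrow> Y = X" by auto
  have "X \<noteq> A" using X len_self[OF A] by auto
  moreover have "mnil X A" using nil X(2) unfolding mnil_def by blast
  ultimately obtain u where u: "u \<in> A" "u \<notin> X" "\<forall>z\<in>\<mm>. z \<odot>\<^bsub>M\<^esub> u \<in> X" using mnil_soc[OF _ A X(1)] X(3) by blast
  have uc: "u \<in> carrier M" using stableD(6)[OF A] u by auto
  let ?Y = "msum M X (cyc M (carrier R) u)"
  have Y: "sub ?Y" "X \<subseteq> ?Y" "u \<in> ?Y" using sub_msum[OF X(1) stable_cyc[OF uc]] msum_upper1[OF X(1) stable_cyc[OF uc]]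
      msum_upper2[OF X(1) stable_cyc[OF uc]] cyc_self[OF uc] by auto
  have YA: "?Y \<subseteq> A" using msum_least[OF A X(3) cyc_least[OF A u(1)]] .
  then have "fl ?Y A" using mx[OF Y(1,2)] Y u by blast
  then have "fl X A" using len_add(1)[OF A Y(1) X(1) Y(2) YA] flen_soc_step[OF X(1) uc u(3)] by auto
  then show False using X by auto
qed

text \<open>The submodules X + F_n become stationary by finite length; beyond that point F_n is
  contained in X + \<open>\<mm>\<close>F_n, and Nakayama applies.\<close>

lemma finite_len_vanish:
  assumes X: "sub X" "fl X (carrier M)" and F: "\<And>n. sub (F n) \<and> F (Suc n) \<subseteq> F n"
    and gen: "\<And>n T. n \<ge> n0 \<Longrightarrow> sub T \<Longrightarrow> (\<And>z u. z \<in> \<mm> \<Longrightarrow> u \<in> F n \<Longrightarrow> z \<odot>\<^bsub>M\<^esub> u \<in> T) \<Longrightarrow> F (Suc n) \<subseteq> T"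
  shows "\<exists>n. F n \<subseteq> X"
proof -
  have g: "sub (msum M X (F n)) \<and> X \<subseteq> msum M X (F n) \<and> msum M X (F n) \<subseteq> carrier M \<and> msum M X (F (Suc n)) \<subseteq> msum M X (F n)" for n
    using sub_msum[OF X(1), of "F n"] msum_upper1[OF X(1), of "F n"] F[of n] msum_mono[OF order_refl, of "F (Suc n)" "F n" M X]
      stableD(1)[OF sub_msum[OF X(1), of "F n"]] by simp
  obtain k where k: "\<And>n. n \<ge> k \<Longrightarrow> msum M X (F n) = msum M X (F k)" using flen_dcc[where g = "\<lambda>n. msum M X (F n)", OF X(2,1) g sub_carrier] by auto
  let ?n = "max k n0"
  have e: "msum M X (F (Suc ?n)) = msum M X (F ?n)" using k[of ?n] k[of "Suc ?n"] by auto
  have "F ?n \<subseteq> X"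
  proof (rule nakayama[OF _ X(1)])
    show "sub (F ?n)" using F by auto
    fix T assume T: "sub T" "X \<subseteq> T" "\<And>z u. z \<in> \<mm> \<Longrightarrow> u \<in> F ?n \<Longrightarrow> z \<odot>\<^bsub>M\<^esub> u \<in> T"
    have "F (Suc ?n) \<subseteq> T" using gen[OF _ T(1,3)] by auto
    then have "msum M X (F ?n) \<subseteq> T" using msum_least[OF T(1,2)] e by auto
    then show "F ?n \<subseteq> T" using msum_upper2[OF X(1), of "F ?n"] F by auto
  qed
  then show ?thesis by auto
qed

text \<open>Avoids Artin-Rees. Let D be the intersection and E = W + \<open>\<mm>\<close>D, and let
  X be maximal with X \<inter> D = E. Then M/X is shown to have finite length, so F_n lies in X for
  some n; hence D lies in X, D = E, and Nakayama gives D = W.\<close>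

lemma krull_intersection:
  assumes W: "sub W" and F: "\<And>n. sub (F n) \<and> F (Suc n) \<subseteq> F n"
    and gen: "\<And>n T. n \<ge> n0 \<Longrightarrow> sub T \<Longrightarrow> (\<And>z u. z \<in> \<mm> \<Longrightarrow> u \<in> F n \<Longrightarrow> z \<odot>\<^bsub>M\<^esub> u \<in> T) \<Longrightarrow> F (Suc n) \<subseteq> T"
  shows "(\<Inter>n. msum M W (F n)) = W"
proof -
  let ?D = "\<Inter>n. msum M W (F n)"
  have sF: "sub (F n)" for n using F by auto
  have sW: "sub (msum M W (F n))" for n using sub_msum[OF W sF] .
  have WD: "W \<subseteq> ?D" using msum_upper1[OF W sF] by auto
  have D: "sub ?D" using sW unfolding stab_def by (auto; blast)
  have Dc: "?D \<subseteq> carrier M" using D by (auto simp: stab_def)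
  let ?mD = "ideal_smult R M \<mm> ?D"
  have smD: "sub ?mD" using sub_ideal_smult[OF mm_carrier Dc] .
  have mDD: "?mD \<subseteq> ?D" by (rule ideal_smult_least[OF D]) (use mm_carrier in \<open>auto intro!: stableD(5)[OF sW]\<close>)
  let ?E = "msum M W ?mD"
  have E: "sub ?E" "W \<subseteq> ?E" "?mD \<subseteq> ?E" "?E \<subseteq> ?D"
    using sub_msum[OF W smD] msum_upper1[OF W smD] msum_upper2[OF W smD] msum_least[OF D WD mDD] by auto
  let ?F = "{X. sub X \<and> ?E \<subseteq> X \<and> X \<inter> ?D = ?E}"
  have EF: "?E \<in> ?F" using E by auto
  have "\<exists>X\<in>?F. ?E \<subseteq> X \<and> (\<forall>Y\<in>?F. X \<subseteq> Y \<longrightarrow> Y = X)"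
    by (rule acc_max[OF acc_between[OF E(1) sub_carrier] _ EF]) (auto simp: stab_def)
  then obtain X where X: "sub X" "?E \<subseteq> X" "X \<inter> ?D = ?E" and mx: "\<And>Y. sub Y \<Longrightarrow> X \<subseteq> Y \<Longrightarrow> Y \<inter> ?D = ?E \<Longrightarrow> Y = X" by auto
  \<comment> \<open>Choose \<open>k\<close> where the colons of X by powers of \<open>z\<close> stop
    growing. If d = x + z^k v lies in D, then zd lies in E, so z^{k+1} v and hence z^k v lie in X.
    Thus X + z^k M still meets D in E, and maximality of X puts z^k M into X.\<close>
  have "mnil X (carrier M)" unfolding mnil_def
  proof
    fix z assume z: "z \<in> \<mm>"
    have zc: "z \<in> carrier R" using z mm_carrier by auto
    let ?f = "\<lambda>k::nat. colon M (z [^] k) X"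
    have step: "?f k \<subseteq> ?f (Suc k)" for k
    proof
      fix x assume "x \<in> ?f k"
      then have "x \<in> carrier M" "z \<odot>\<^bsub>M\<^esub> (z [^] k \<odot>\<^bsub>M\<^esub> x) \<in> X" using stableD(5)[OF X(1) zc] by (auto simp: colon_def)
      then show "x \<in> ?f (Suc k)" using zc by (simp add: colon_def smult_lcomm[of z] smult_assoc1)
    qed
    have "\<exists>k. \<forall>n\<ge>k. ?f n = ?f k"
      using ac[unfolded acc_def, rule_format, of ?f] step sub_colon[OF _ X(1)] zc by (auto simp: stab_def)
    then obtain k where k: "\<forall>n\<ge>k. ?f n = ?f k" by (elim exE)
    have eq: "?f (Suc k) = ?f k" using k by (metis le_SucI order_refl)
    let ?Y = "msum M X (smul M (z [^] k) (carrier M))"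
    have sm: "sub (smul M (z [^] k) (carrier M))" using sub_smul[OF _ sub_carrier] zc by auto
    have Y: "sub ?Y" "X \<subseteq> ?Y" "smul M (z [^] k) (carrier M) \<subseteq> ?Y" using sub_msum[OF X(1) sm] msum_upper1[OF X(1) sm] msum_upper2[OF X(1) sm] by auto
    have "?Y \<inter> ?D \<subseteq> X"
    proof
      fix d assume d: "d \<in> ?Y \<inter> ?D"
      then have "d \<in> ?Y" by simp
      then obtain x v where xv: "x \<in> X" "v \<in> carrier M" "d = x \<oplus>\<^bsub>M\<^esub> z [^] k \<odot>\<^bsub>M\<^esub> v" by (auto simp: msum_def smul_def)
      have xc: "x \<in> carrier M" using xv stableD(6)[OF X(1)] by auto
      have "z \<odot>\<^bsub>M\<^esub> d \<in> ?mD" using d z by (intro smult_in) auto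
      then have "z \<odot>\<^bsub>M\<^esub> d \<in> X" using E(3) X(2) by blast
      then have "z \<odot>\<^bsub>M\<^esub> x \<oplus>\<^bsub>M\<^esub> z \<odot>\<^bsub>M\<^esub> (z [^] k \<odot>\<^bsub>M\<^esub> v) \<in> X" using xv xc zc by (simp add: smult_r_distr)
      then have "z \<odot>\<^bsub>M\<^esub> (z [^] k \<odot>\<^bsub>M\<^esub> v) \<in> X" using stable_add_iff'[OF X(1)] stableD(5)[OF X(1) zc xv(1)] xv zc by auto
      then have "v \<in> ?f (Suc k)" using xv zc by (simp add: colon_def smult_lcomm[of z] smult_assoc1)
      then have "z [^] k \<odot>\<^bsub>M\<^esub> v \<in> X" using eq by (auto simp: colon_def)
      then show "d \<in> X" using xv stableD(3)[OF X(1)] by auto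
    qed
    then have "?Y \<inter> ?D = ?E" using X(3) Y(2) by blast
    then have "?Y = X" using mx[OF Y(1,2)] by simp
    then show "\<forall>v\<in>carrier M. \<exists>k::nat. z [^] k \<odot>\<^bsub>M\<^esub> v \<in> X" using Y(3) smulI[of _ "carrier M" M "z [^] k"] by blast
  qed
  then have "fl X (carrier M)" using mnil_flen sub_carrier X(1) stableD(1)[OF X(1)] by auto
  then have "\<exists>n. F n \<subseteq> X" by (rule finite_len_vanish[OF X(1), where ?n0.0 = n0]) (fact F, fact gen)
  then obtain n where n: "F n \<subseteq> X" by auto
  have "?D \<subseteq> X" using msum_least[OF X(1) _ n, of W] E(2) X(2) by blast
  then have DE: "?D = ?E" using X(3) by blast
  have "?D \<subseteq> W"
  proof (rule nakayama[OF D W])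
    fix T assume T: "sub T" "W \<subseteq> T" "\<And>z u. z \<in> \<mm> \<Longrightarrow> u \<in> ?D \<Longrightarrow> z \<odot>\<^bsub>M\<^esub> u \<in> T"
    have "?mD \<subseteq> T" by (rule ideal_smult_least[OF T(1)]) (use T(3) in blast)
    then have "?E \<subseteq> T" using msum_least[OF T(1,2)] by blast
    then show "?D \<subseteq> T" using DE by simp
  qed
  then show ?thesis using WD by blast
qed

text \<open>The dimension drops modulo a nonzerodivisor \<open>x\<close>: products of a power of
  \<open>x\<close> with an element outside \<open>P\<close> never annihilate M/B, because the power
  can be cancelled and the annihilator lies in \<open>P\<close>. A prime over the annihilator that
  avoids all these products lies in \<open>P\<close> and misses \<open>x\<close>.\<close>

lemma prime_descent:
  assumes B: "sub B" and x: "x \<in> carrier R" "nzd M x B" and P: "primeideal P R" "x \<in> P" and ann: "{s \<in> carrier R. \<forall>v\<in>carrier M. s \<odot>\<^bsub>M\<^esub> v \<in> B} \<subseteq> P"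
  shows "\<exists>P'. primeideal P' R \<and> {s \<in> carrier R. \<forall>v\<in>carrier M. s \<odot>\<^bsub>M\<^esub> v \<in> B} \<subseteq> P' \<and> P' \<subset> P"
proof -
  let ?I = "{s \<in> carrier R. \<forall>v\<in>carrier M. s \<odot>\<^bsub>M\<^esub> v \<in> B}"
  have I: "ideal ?I R"
  proof -
    have "?I = carrier R \<inter> (\<Inter>v\<in>carrier M. annmod R M B v)" by (auto simp: annmod_def)
    also have "\<dots> = \<Inter> (insert (carrier R) (annmod R M B ` carrier M))" by auto
    finally show ?thesis using R.i_Intersect[of "insert (carrier R) (annmod R M B ` carrier M)"] annmod_ideal[OF B] R.oneideal by auto
  qed
  let ?S = "{s \<otimes> x [^] (k::nat) | s k. s \<in> carrier R \<and> s \<notin> P}"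
  have Pn: "\<one> \<notin> P" using ideal.one_imp_carrier[OF primeideal.axioms(1)[OF P(1)]] primeideal.I_notcarr[OF P(1)] by auto
  have nz: "x [^] (k::nat) \<odot>\<^bsub>M\<^esub> v \<in> B \<Longrightarrow> v \<in> carrier M \<Longrightarrow> v \<in> B" for k v
  proof (induction k)
    case (Suc k)
    then have "x \<odot>\<^bsub>M\<^esub> (x [^] k \<odot>\<^bsub>M\<^esub> v) \<in> B" using x by (simp add: smult_assoc1 smult_lcomm[of x])
    then have "x [^] k \<odot>\<^bsub>M\<^esub> v \<in> B" using x Suc.prems by (auto simp: nzd_def)
    then show ?case using Suc by auto
  qed simp
  have "\<exists>P'. primeideal P' R \<and> ?I \<subseteq> P' \<and> P' \<inter> ?S = {}"
  proof (rule noetherian_ring.prime_disjoint[OF noeth R.is_cring I])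
    show "?S \<subseteq> carrier R" using x by auto
    show "\<one> \<in> ?S" using Pn by (intro CollectI exI[of _ \<one>] exI[of _ 0]) auto
    fix a b assume "a \<in> ?S" "b \<in> ?S"
    then obtain s k t l where *: "a = s \<otimes> x [^] (k::nat)" "s \<in> carrier R" "s \<notin> P" "b = t \<otimes> x [^] (l::nat)" "t \<in> carrier R" "t \<notin> P" by auto
    have "a \<otimes> b = (s \<otimes> t) \<otimes> x [^] (k + l)" using * x by (simp add: R.nat_pow_mult[symmetric] R.m_ac)
    moreover have "s \<otimes> t \<notin> P" using primeideal.I_prime[OF P(1)] * by blast
    ultimately show "a \<otimes> b \<in> ?S" using * by blast
  next
    show "?S \<inter> ?I = {}"
    proof (rule equals0I)
      fix a assume "a \<in> ?S \<inter> ?I"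
      then obtain s k where *: "s \<in> carrier R" "s \<notin> P" and i: "s \<otimes> x [^] (k::nat) \<in> ?I" by auto
      have "s \<odot>\<^bsub>M\<^esub> v \<in> B" if v: "v \<in> carrier M" for v
      proof -
        have "x [^] k \<odot>\<^bsub>M\<^esub> (s \<odot>\<^bsub>M\<^esub> v) \<in> B" using i v x * by (simp add: smult_assoc1 smult_lcomm[of s])
        then show ?thesis using nz v * by auto
      qed
      then show False using * ann by auto
    qed
  qed
  then obtain P' where P': "primeideal P' R" "?I \<subseteq> P'" "P' \<inter> ?S = {}" by auto
  have "P' \<subseteq> P"
  proof
    fix s assume s: "s \<in> P'"
    then have "s \<in> carrier R" using ideal.Icarr[OF primeideal.axioms(1)[OF P'(1)]] by auto
    then have "s \<in> P \<or> s \<in> ?S" by (auto intro!: exI[of _ s] exI[of _ "0::nat"])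
    then show "s \<in> P" using P'(3) s by blast
  qed
  moreover have "x \<in> ?S" using x Pn by (intro CollectI exI[of _ \<one>] exI[of _ 1]) auto
  ultimately show ?thesis using P' P(2) by blast
qed

text \<open>If no power of \<open>z\<close> kills \<open>v\<close> modulo \<open>B\<close>, a prime
  over the annihilator of \<open>v\<close> can be chosen to avoid the powers of \<open>z\<close>.
  This is the top step of the chains in \<open>prime_chain\<close>.\<close>

lemma prime_not_mm:
  assumes B: "sub B" and n: "\<not> mnil B (carrier M)"
  shows "\<exists>P. primeideal P R \<and> {s \<in> carrier R. \<forall>v\<in>carrier M. s \<odot>\<^bsub>M\<^esub> v \<in> B} \<subseteq> P \<and> P \<subset> \<mm>"
proof -
  obtain z v where zv: "z \<in> \<mm>" "v \<in> carrier M" "\<And>k::nat. z [^] k \<odot>\<^bsub>M\<^esub> v \<notin> B" using n by (auto simp: mnil_def)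
  have zc: "z \<in> carrier R" using zv mm_carrier by auto
  have "\<exists>P. primeideal P R \<and> annmod R M B v \<subseteq> P \<and> P \<inter> {z [^] (k::nat) | k. True} = {}"
  proof (rule noetherian_ring.prime_disjoint[OF noeth R.is_cring annmod_ideal[OF B zv(2)]])
    show "\<one> \<in> {z [^] (k::nat) | k. True}" by (auto intro: exI[of _ "0::nat"])
    show "a \<otimes> b \<in> {z [^] (k::nat) | k. True}" if "a \<in> {z [^] (k::nat) | k. True}" "b \<in> {z [^] (k::nat) | k. True}" for a b
      using that zc R.nat_pow_mult by fastforce
  qed (use zv zc in \<open>auto simp: annmod_def\<close>)
  then obtain P where P: "primeideal P R" "annmod R M B v \<subseteq> P" "P \<inter> {z [^] (k::nat) | k. True} = {}" by auto
  have iP: "ideal P R" using primeideal.axioms(1)[OF P(1)] .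
  have "z [^] (1::nat) \<notin> P" using P(3) by blast
  then have "z \<notin> P" using zc by simp
  moreover have "P \<subseteq> \<mm>"
  proof
    fix x assume x: "x \<in> P" show "x \<in> \<mm>"
    proof (rule ccontr)
      assume "x \<notin> \<mm>"
      then obtain y where "y \<in> carrier R" "y \<otimes> x = \<one>" using unit_or_mm ideal.Icarr[OF iP x] by auto
      then have "\<one> \<in> P" using ideal.I_l_closed[OF iP x] by metis
      then show False using ideal.one_imp_carrier[OF iP] primeideal.I_notcarr[OF P(1)] by auto
    qed
  qed
  moreover have "{s \<in> carrier R. \<forall>v\<in>carrier M. s \<odot>\<^bsub>M\<^esub> v \<in> B} \<subseteq> P" using P(2) zv(2) by (auto simp: annmod_def)
  ultimately show ?thesis using P(1) zv(1) by blast
qed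

end

section \<open>Superficial sequences\<close>

fun lsum :: "('a, 'b, 'd) module_scheme \<Rightarrow> 'a list \<Rightarrow> 'b set \<Rightarrow> 'b set" where
  "lsum M [] A = {\<zero>\<^bsub>M\<^esub>}" | "lsum M (a # as) A = msum M (smul M a A) (lsum M as A)"

context module begin

lemma sub_lsum: "sub A \<Longrightarrow> set as \<subseteq> carrier R \<Longrightarrow> sub (lsum M as A)"
  by (induction as) (auto intro: sub_zero sub_msum sub_smul)

lemma lsum_least: "sub T \<Longrightarrow> (\<And>a u. a \<in> set as \<Longrightarrow> u \<in> A \<Longrightarrow> a \<odot>\<^bsub>M\<^esub> u \<in> T) \<Longrightarrow> lsum M as A \<subseteq> T"
proof (induction as)
  case Nil then show ?case by (auto simp: stab_def)
next
  case (Cons a as)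
  have "smul M a A \<subseteq> T" using Cons.prems by (auto simp: smul_def)
  then show ?case using Cons msum_least[OF Cons.prems(1)] by simp
qed

lemma lsum_in: "sub A \<Longrightarrow> set as \<subseteq> carrier R \<Longrightarrow> a \<in> set as \<Longrightarrow> u \<in> A \<Longrightarrow> a \<odot>\<^bsub>M\<^esub> u \<in> lsum M as A"
proof (induction as)
  case (Cons b as)
  have s: "sub (smul M b A)" "sub (lsum M as A)" using Cons.prems sub_smul sub_lsum by auto
  show ?case
  proof (cases "a = b")
    case True then show ?thesis using subsetD[OF msum_upper1[OF s]] smulI[OF Cons.prems(4), of M b] by simp
  next
    case False then show ?thesis using subsetD[OF msum_upper2[OF s]] Cons by simp
  qed
qed simp

lemma lsum_mono: "A \<subseteq> B \<Longrightarrow> lsum M as A \<subseteq> lsum M as B"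
  by (induction as) (auto intro!: msum_mono smul_mono dest: subsetD[OF msum_mono[OF smul_mono]])

lemma lsum_append:
  assumes A: "sub A" and "set as \<subseteq> carrier R" "set bs \<subseteq> carrier R"
  shows "lsum M (as @ bs) A = msum M (lsum M as A) (lsum M bs A)"
  using assms(2)
proof (induction as)
  case Nil
  have "{\<zero>\<^bsub>M\<^esub>} \<subseteq> lsum M bs A" using sub_lsum[OF A assms(3)] by (auto simp: stab_def)
  then show ?case using msum_absorb2[OF sub_zero sub_lsum[OF A assms(3)]] by simp
next
  case (Cons a as)
  then show ?case using msum_assoc[of "smul M a A" "lsum M as A" "lsum M bs A"]
      stableD(1)[OF sub_smul[OF _ A]] stableD(1)[OF sub_lsum[OF A]] assms(3) by simp
qed

lemma lsum_snoc:
  assumes A: "sub A" and "set as \<subseteq> carrier R" "a \<in> carrier R"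
  shows "lsum M (as @ [a]) A = msum M (lsum M as A) (smul M a A)"
proof -
  have "sub (smul M a A)" using sub_smul[OF assms(3) A] .
  then have "msum M (smul M a A) {\<zero>\<^bsub>M\<^esub>} = smul M a A"
    using msum_absorb[OF _ sub_zero] stableD(2) by fastforce
  then show ?thesis using lsum_append[OF A assms(2), of "[a]"] assms(3) by simp
qed

lemma addl_lsum: "sub N \<Longrightarrow> set as \<subseteq> carrier R \<Longrightarrow> addl M N as = msum M N (lsum M as (carrier M))"
proof (induction as arbitrary: N)
  case Nil then show ?case using msum_absorb[OF Nil(1) sub_zero] by (auto simp: stab_def)
next
  case (Cons a as)
  then have a: "a \<in> carrier R" "set as \<subseteq> carrier R" by auto
  show ?case using Cons.IH[OF sub_adj[OF Cons.prems(1) a(1)] a(2)]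
      msum_assoc[of N "smul M a (carrier M)" "lsum M as (carrier M)"] stableD(1)[OF Cons.prems(1)]
      stableD(1)[OF sub_smul[OF a(1) sub_carrier]] stableD(1)[OF sub_lsum[OF sub_carrier a(2)]] by simp
qed

lemma addl_zero: "set as \<subseteq> carrier R \<Longrightarrow> addl M {\<zero>\<^bsub>M\<^esub>} as = lsum M as (carrier M)"
proof -
  assume a: "set as \<subseteq> carrier R"
  have s: "sub (lsum M as (carrier M))" using sub_lsum[OF sub_carrier a] .
  then have "{\<zero>\<^bsub>M\<^esub>} \<subseteq> lsum M as (carrier M)" by (auto simp: stab_def)
  then show ?thesis using addl_lsum[OF sub_zero a] msum_absorb2[OF sub_zero s] by simp
qed

lemma ideal_smult_Idl:
  assumes A: "sub A" and as: "set as \<subseteq> carrier R"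
  shows "ideal_smult R M (Idl (set as)) A = lsum M as A"
proof
  have sL: "sub (lsum M as A)" using sub_lsum[OF A as] .
  let ?I = "\<Inter>u\<in>A. annmod R M (lsum M as A) u"
  have ne: "annmod R M (lsum M as A) ` A \<noteq> {}" using stableD(2)[OF A] by auto
  have I: "ideal ?I R" using R.i_Intersect[OF _ ne] annmod_ideal[OF sL] stableD(6)[OF A] by auto
  have "set as \<subseteq> ?I" using lsum_in[OF A as] as by (auto simp: annmod_def)
  then have "Idl (set as) \<subseteq> ?I" using R.genideal_minimal[OF I] by auto
  then have "\<And>z u. z \<in> Idl (set as) \<Longrightarrow> u \<in> A \<Longrightarrow> z \<odot>\<^bsub>M\<^esub> u \<in> lsum M as A" by (auto simp: annmod_def)
  then show "ideal_smult R M (Idl (set as)) A \<subseteq> lsum M as A" by (rule ideal_smult_least[OF sL])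
  have iI: "ideal (Idl (set as)) R" using R.genideal_ideal[OF as] .
  have "sub (ideal_smult R M (Idl (set as)) A)"
    by (rule sub_ideal_smult) (use ideal.Icarr[OF iI] A in \<open>auto simp: stab_def\<close>)
  then show "lsum M as A \<subseteq> ideal_smult R M (Idl (set as)) A"
    by (rule lsum_least) (use R.genideal_self[OF as] in \<open>auto intro: smult_in\<close>)
qed

section \<open>Translation of statements on quotient modules into statements on submodules\<close>

lemma abelian_subgroup_sub: "sub B \<Longrightarrow> abelian_subgroup B M"
  by (metis submodule_iff_stable submodule.axioms(1) abelian_subgroupI3 additive_subgroup.intro M.abelian_group_axioms)

lemma coset_eq_iff:
  assumes B: "sub B" and x: "x \<in> carrier M" and y: "y \<in> carrier M"
  shows "B +>\<^bsub>M\<^esub> x = B +>\<^bsub>M\<^esub> y \<longleftrightarrow> x \<ominus>\<^bsub>M\<^esub> y \<in> B"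
proof
  interpret S: abelian_subgroup B M using abelian_subgroup_sub[OF B] .
  assume "B +>\<^bsub>M\<^esub> x = B +>\<^bsub>M\<^esub> y"
  then have "x \<in> B +>\<^bsub>M\<^esub> y" using S.a_rcos_self[OF x] by simp
  then obtain b where "b \<in> B" "x = b \<oplus>\<^bsub>M\<^esub> y" by (auto simp: a_r_coset_def')
  then show "x \<ominus>\<^bsub>M\<^esub> y \<in> B" using y stableD(6)[OF B] by (simp add: add_minus_cancel)
next
  interpret S: abelian_subgroup B M using abelian_subgroup_sub[OF B] .
  assume b: "x \<ominus>\<^bsub>M\<^esub> y \<in> B"
  have "x = (x \<ominus>\<^bsub>M\<^esub> y) \<oplus>\<^bsub>M\<^esub> y" using x y by (simp add: add_minus_cancel)
  then have "x \<in> B +>\<^bsub>M\<^esub> y" using b by (auto simp: a_r_coset_def')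
  then show "B +>\<^bsub>M\<^esub> x = B +>\<^bsub>M\<^esub> y" using S.a_repr_independence'[OF _ y] by metis
qed

lemma coset_zero_iff:
  assumes B: "sub B" and x: "x \<in> carrier M" shows "B +>\<^bsub>M\<^esub> x = B \<longleftrightarrow> x \<in> B"
proof -
  have "B +>\<^bsub>M\<^esub> \<zero>\<^bsub>M\<^esub> = B" using M.a_coset_add_zero[OF stableD(1)[OF B]] .
  then show ?thesis using coset_eq_iff[OF B x M.zero_closed] stable_diff_iff[OF B x stableD(2)[OF B]] by simp
qed

lemma coset_mem_iff:
  assumes B: "sub B" and A: "sub A" and x: "x \<in> carrier M"
  shows "B +>\<^bsub>M\<^esub> x \<in> (\<lambda>x. B +>\<^bsub>M\<^esub> x) ` A \<longleftrightarrow> x \<in> msum M B A"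
proof
  assume "B +>\<^bsub>M\<^esub> x \<in> (\<lambda>x. B +>\<^bsub>M\<^esub> x) ` A"
  then obtain y where y: "y \<in> A" "B +>\<^bsub>M\<^esub> x = B +>\<^bsub>M\<^esub> y" by auto
  have yc: "y \<in> carrier M" using stableD(6)[OF A y(1)] .
  have "x \<ominus>\<^bsub>M\<^esub> y \<in> B" using coset_eq_iff[OF B x yc] y by simp
  then have "(x \<ominus>\<^bsub>M\<^esub> y) \<oplus>\<^bsub>M\<^esub> y \<in> msum M B A" using y by (intro msumI)
  then show "x \<in> msum M B A" using x yc by (simp add: add_minus_cancel)
next
  assume "x \<in> msum M B A"
  then obtain b y where y: "b \<in> B" "y \<in> A" "x = b \<oplus>\<^bsub>M\<^esub> y" by (auto elim: msumE)
  then have c: "b \<in> carrier M" "y \<in> carrier M" using stableD(6)[OF A] stableD(6)[OF B] by auto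
  have "B +>\<^bsub>M\<^esub> x = B +>\<^bsub>M\<^esub> y" using coset_eq_iff[OF B x c(2)] y c by (simp add: add_minus_cancel)
  then show "B +>\<^bsub>M\<^esub> x \<in> (\<lambda>x. B +>\<^bsub>M\<^esub> x) ` A" using y by auto
qed

lemma carrier_quot: "carrier (quot_module M B) = (\<lambda>x. B +>\<^bsub>M\<^esub> x) ` carrier M"
  by (auto simp: quot_module_def A_RCOSETS_def')

lemma zero_quot: "\<zero>\<^bsub>quot_module M B\<^esub> = B" by (simp add: quot_module_def)

lemma smult_quot: "sub B \<Longrightarrow> r \<in> carrier R \<Longrightarrow> x \<in> carrier M \<Longrightarrow>
    r \<odot>\<^bsub>quot_module M B\<^esub> (B +>\<^bsub>M\<^esub> x) = B +>\<^bsub>M\<^esub> (r \<odot>\<^bsub>M\<^esub> x)"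
  using quot_module_smult[OF module_axioms, of B r x] submodule_iff_stable by auto

lemma nzd_quot:
  assumes B: "sub B" and a: "a \<in> carrier R"
  shows "(\<forall>y\<in>carrier (quot_module M B). a \<odot>\<^bsub>quot_module M B\<^esub> y = \<zero>\<^bsub>quot_module M B\<^esub> \<longrightarrow> y = \<zero>\<^bsub>quot_module M B\<^esub>) \<longleftrightarrow> nzd M a B"
  using a by (auto simp: carrier_quot zero_quot smult_quot[OF B a] coset_zero_iff[OF B] nzd_def)

lemma regular_seq_rseq:
  assumes "regular_seq R M xs" shows "rseq M {\<zero>\<^bsub>M\<^esub>} xs"
  unfolding rseq_iff_nth
proof (intro allI impI)
  fix i assume i: "i < length xs"
  have xs: "set xs \<subseteq> carrier R" using assms by (auto simp: regular_seq_def)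
  then have t: "set (take i xs) \<subseteq> carrier R" using set_take_subset by fastforce
  have e: "ideal_smult R M (Idl (set (take i xs))) (carrier M) = addl M {\<zero>\<^bsub>M\<^esub>} (take i xs)"
    using ideal_smult_Idl[OF sub_carrier t] addl_zero[OF t] by simp
  show "nzd M (xs ! i) (addl M {\<zero>\<^bsub>M\<^esub>} (take i xs))"
  proof -
    have a: "xs ! i \<in> carrier R" using xs i by auto
    note h = assms[unfolded regular_seq_def, THEN conjunct2, THEN conjunct1, rule_format, OF i]
    show ?thesis using h[unfolded e] nzd_quot[OF sub_addl[OF sub_zero t] a] by blast
  qed
qed

text \<open>Superficiality of \<open>a\<close> for the filtration induced on \<open>M / B\<close>.\<close>
definition supf where
  "supf q F B a \<longleftrightarrow> a \<in> q \<and> (\<exists>c. \<forall>n\<ge>c. colon M a (msum M B (F (Suc n))) \<inter> msum M B (F c) = msum M B (F n))"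

lemma superficial_quot:
  assumes B: "sub B" and F: "\<And>n. sub (F n)" and q: "q \<subseteq> carrier R"
  shows "superficial q (quot_module M B) (quot_filt M B F) a \<longleftrightarrow> supf q F B a"
proof (cases "a \<in> q")
  case True
  then have a: "a \<in> carrier R" using q by auto
  have m: "B +>\<^bsub>M\<^esub> x \<in> quot_filt M B F n \<longleftrightarrow> x \<in> msum M B (F n)" if "x \<in> carrier M" for x n
    unfolding quot_filt_def using coset_mem_iff[OF B F that] .
  have sC: "quot_filt M B F n \<subseteq> (\<lambda>x. B +>\<^bsub>M\<^esub> x) ` carrier M" for n
    unfolding quot_filt_def using stableD(1)[OF F] by auto
  have mc: "msum M B (F n) \<subseteq> carrier M" for n using stableD(1)[OF sub_msum[OF B F]] .
  have "{x \<in> carrier (quot_module M B). a \<odot>\<^bsub>quot_module M B\<^esub> x \<in> quot_filt M B F (Suc n)} \<inter> quot_filt M B F c = quot_filt M B F n \<longleftrightarrow>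
     colon M a (msum M B (F (Suc n))) \<inter> msum M B (F c) = msum M B (F n)" (is "?L = ?Q \<longleftrightarrow> ?R = ?S") for n c
  proof -
    have L: "B +>\<^bsub>M\<^esub> x \<in> ?L \<longleftrightarrow> x \<in> ?R" if "x \<in> carrier M" for x
      using that a m by (auto simp: carrier_quot smult_quot[OF B a] colon_def)
    have "?L = ?Q \<longleftrightarrow> (\<forall>x\<in>carrier M. B +>\<^bsub>M\<^esub> x \<in> ?L \<longleftrightarrow> B +>\<^bsub>M\<^esub> x \<in> ?Q)"
      using sC[of n] by (auto simp: carrier_quot)
    also have "\<dots> \<longleftrightarrow> (\<forall>x\<in>carrier M. x \<in> ?R \<longleftrightarrow> x \<in> ?S)" using L m by simp
    also have "\<dots> \<longleftrightarrow> ?R = ?S" using mc by (auto simp: colon_def)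
    finally show ?thesis .
  qed
  then show ?thesis by (simp add: superficial_def supf_def)
qed (simp add: superficial_def supf_def)

lemma nilpotent_quot:
  assumes B: "sub B" and F: "\<And>n. sub (F n)" "\<And>n. F (Suc n) \<subseteq> F n"
  shows "nilpotent_filt (quot_module M B) (quot_filt M B F) \<longleftrightarrow> (\<exists>k. F k \<subseteq> B)"
proof -
  have e: "quot_filt M B F n = {B} \<longleftrightarrow> F n \<subseteq> B" for n
  proof -
    have "quot_filt M B F n = {B} \<longleftrightarrow> (\<forall>x\<in>F n. B +>\<^bsub>M\<^esub> x = B)"
      using stableD(2)[OF F(1), of n] unfolding quot_filt_def by blast
    also have "\<dots> \<longleftrightarrow> (\<forall>x\<in>F n. x \<in> B)" by (intro ball_cong refl coset_zero_iff[OF B stableD(6)[OF F(1)]])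
    finally show ?thesis by (simp add: subset_iff Ball_def)
  qed
  have h: "F n \<subseteq> B" if "F k \<subseteq> B" "k \<le> n" for k n
    using lift_Suc_antimono_le[of F k n, OF F(2) that(2)] that(1) by (rule subset_trans)
  show ?thesis unfolding nilpotent_filt_def zero_quot e
  proof
    assume "\<exists>k. \<forall>n\<ge>k. F n \<subseteq> B" then show "\<exists>k. F k \<subseteq> B" by blast
  next
    assume "\<exists>k. F k \<subseteq> B"
    then obtain k where "F k \<subseteq> B" by blast
    then show "\<exists>k. \<forall>n\<ge>k. F n \<subseteq> B" using h by (intro exI[of _ k] allI impI)
  qed
qed

end

text \<open>The special shape of an induced filtration is \<open>F_gen\<close>: from degree 1 on
  each step is multiplication by \<open>q\<close>, and only the first step is free. The other facts
  hold for good filtrations in general.\<close>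

locale good_filt = local_module R M \<mm> for R (structure) and M (structure) and \<mm> +
  fixes q F
  assumes q_ideal: "ideal q R" and q_mm: "q \<subseteq> \<mm>" and mm_pow: "\<And>z. z \<in> \<mm> \<Longrightarrow> \<exists>k::nat. z [^] k \<in> q"
    and F0: "F 0 = carrier M" and F_sub: "\<And>n. sub (F n)" and F_dec: "\<And>n. F (Suc n) \<subseteq> F n"
    and F_mul: "\<And>n x u. x \<in> q \<Longrightarrow> u \<in> F n \<Longrightarrow> x \<odot>\<^bsub>M\<^esub> u \<in> F (Suc n)"
    and F_gen: "\<And>n. n \<ge> 1 \<Longrightarrow> F (Suc n) = ideal_smult R M q (F n)"
begin

lemma q_carrier: "q \<subseteq> carrier R" using ideal.Icarr[OF q_ideal] by auto

lemma F_anti: "m \<le> n \<Longrightarrow> F n \<subseteq> F m" using lift_Suc_antimono_le[of F, OF F_dec] .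

lemma F_gen_least: "n \<ge> 1 \<Longrightarrow> sub T \<Longrightarrow> (\<And>z u. z \<in> q \<Longrightarrow> u \<in> F n \<Longrightarrow> z \<odot>\<^bsub>M\<^esub> u \<in> T) \<Longrightarrow> F (Suc n) \<subseteq> T"
  unfolding F_gen by (rule ideal_smult_least)

abbreviation "N B n \<equiv> msum M B (F n)"

lemma sub_N: "sub B \<Longrightarrow> sub (N B n)" using sub_msum F_sub by blast
lemma N_dec: "N B (Suc n) \<subseteq> N B n" using msum_mono[OF order_refl F_dec] .
lemma N_anti: "m \<le> n \<Longrightarrow> N B n \<subseteq> N B m" using msum_mono[OF order_refl F_anti] .
lemma N_upper: "sub B \<Longrightarrow> B \<subseteq> N B n" using msum_upper1[OF _ F_sub] .
lemma N_0: "sub B \<Longrightarrow> N B 0 = carrier M" using F0 msum_absorb2[OF _ sub_carrier stableD(1)[of M "carrier R" B]] by simp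

lemma q_pow_F: "x \<in> q \<Longrightarrow> v \<in> carrier M \<Longrightarrow> x [^] (k::nat) \<odot>\<^bsub>M\<^esub> v \<in> F k"
proof (induction k)
  case 0 then show ?case using F0 by simp
next
  case (Suc k)
  have x: "x \<in> carrier R" using Suc q_carrier by auto
  have "x \<odot>\<^bsub>M\<^esub> (x [^] k \<odot>\<^bsub>M\<^esub> v) \<in> F (Suc k)" using F_mul Suc by auto
  then show ?case using x Suc.prems by (simp add: smult_assoc1 smult_lcomm[of x])
qed

lemma mm_pow_F: "z \<in> \<mm> \<Longrightarrow> \<exists>j::nat. \<forall>v\<in>carrier M. z [^] j \<odot>\<^bsub>M\<^esub> v \<in> F k"
proof -
  assume z: "z \<in> \<mm>"
  then obtain i where i: "z [^] (i::nat) \<in> q" using mm_pow by auto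
  have zc: "z \<in> carrier R" using z mm_carrier by auto
  have "z [^] (i * k) = (z [^] i) [^] k" using zc by (simp add: R.nat_pow_pow)
  then show ?thesis using q_pow_F[OF i] by (intro exI[of _ "i * k"]) simp
qed

lemma mnil_F: "F k \<subseteq> B \<Longrightarrow> mnil B (carrier M)"
  unfolding mnil_def using mm_pow_F[of _ k] by blast

lemma fl_N: "sub B \<Longrightarrow> fl (N B k) (carrier M)"
  using mnil_flen[OF mnil_F[of k "N B k"] sub_carrier sub_N] msum_upper2[OF _ F_sub] stableD(1)[OF sub_N] by blast

lemma krull_F: "sub W \<Longrightarrow> (\<Inter>n. N W n) = W"
proof (rule krull_intersection[where ?n0.0 = 1])
  show "sub (F n) \<and> F (Suc n) \<subseteq> F n" for n using F_sub F_dec by auto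
  show "F (Suc n) \<subseteq> T" if "1 \<le> n" "sub T" "\<And>z u. z \<in> \<mm> \<Longrightarrow> u \<in> F n \<Longrightarrow> z \<odot>\<^bsub>M\<^esub> u \<in> T" for n T
    by (rule F_gen_least[OF that(1,2)]) (use that(3) q_mm in auto)
qed

lemma fl_vanish: "sub B \<Longrightarrow> mnil B (carrier M) \<Longrightarrow> \<exists>n. F n \<subseteq> B"
proof -
  assume B: "sub B" "mnil B (carrier M)"
  have f: "fl B (carrier M)" using mnil_flen[OF B(2) sub_carrier B(1)] stableD(1)[OF B(1)] by auto
  show ?thesis
  proof (rule finite_len_vanish[OF B(1) f, where ?n0.0 = 1])
    show "sub (F n) \<and> F (Suc n) \<subseteq> F n" for n using F_sub F_dec by auto
    show "F (Suc n) \<subseteq> T" if "1 \<le> n" "sub T" "\<And>z u. z \<in> \<mm> \<Longrightarrow> u \<in> F n \<Longrightarrow> z \<odot>\<^bsub>M\<^esub> u \<in> T" for n T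
      by (rule F_gen_least[OF that(1,2)]) (use that(3) q_mm in auto)
  qed
qed

text \<open>Superficiality and Krull's intersection theorem show that (B : a) meets B + F_c only in
  \<open>B\<close>. Powers of elements of \<open>\<mm>\<close> carry everything into F_c, so (B :
  a)/B is \<open>\<mm>\<close>-torsion; if it were nonzero it would contain a socle element of
  M/B.\<close>

lemma supf_nzd:
  assumes B: "sub B" and sf: "sfree M \<mm> B" and a: "supf q F B a"
  shows "nzd M a B"
proof -
  have ac: "a \<in> carrier R" using a q_carrier by (auto simp: supf_def)
  obtain c where c: "\<And>n. n \<ge> c \<Longrightarrow> colon M a (N B (Suc n)) \<inter> N B c = N B n" using a by (auto simp: supf_def)
  let ?K = "colon M a B"
  have K: "sub ?K" using sub_colon[OF ac B] .
  have BK: "B \<subseteq> ?K" using stableD(5)[OF B ac] stableD(6)[OF B] by (auto simp: colon_def)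
  have KN: "?K \<inter> N B c \<subseteq> B"
  proof -
    have "?K \<inter> N B c \<subseteq> N B n" for n
    proof -
      have "?K \<subseteq> colon M a (N B (Suc (max n c)))" using colon_mono[OF N_upper[OF B]] .
      then have "?K \<inter> N B c \<subseteq> N B (max n c)" using c[of "max n c"] by auto
      then show ?thesis using N_anti[of n "max n c" B] by auto
    qed
    then show ?thesis using krull_F[OF B] by blast
  qed
  have "?K = B"
  proof (rule ccontr)
    assume "?K \<noteq> B"
    then have "B \<subset> ?K" using BK by auto
    moreover have "mnil B ?K" unfolding mnil_def
    proof (intro ballI)
      fix z v assume z: "z \<in> \<mm>" and v: "v \<in> ?K"
      obtain j where j: "z [^] (j::nat) \<odot>\<^bsub>M\<^esub> v \<in> F c" using mm_pow_F[OF z, of c] v by (auto simp: colon_def)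
      have "z [^] j \<in> carrier R" using z mm_carrier by auto
      then have "z [^] j \<odot>\<^bsub>M\<^esub> v \<in> ?K \<inter> N B c" using j msum_upper2[OF B F_sub, of c] stableD(5)[OF K _ v] by auto
      then show "\<exists>k::nat. z [^] k \<odot>\<^bsub>M\<^esub> v \<in> B" using KN by blast
    qed
    ultimately obtain u where "u \<in> ?K" "u \<notin> B" "\<forall>z\<in>\<mm>. z \<odot>\<^bsub>M\<^esub> u \<in> B" using mnil_soc[OF _ K B] by blast
    then show False using sf by (auto simp: sfree_def colon_def)
  qed
  then show ?thesis by (auto simp: nzd_def colon_def)
qed

text \<open>The task is to remove the intersection with F_c from superficiality. Adding B + F_c to
  the colons gives a chain that becomes stationary by finite length. Multiplying a member of the
  limit by \<open>a\<close> lands in the intersection of all W + F_n, where W = B + a(B + F_c); this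
  is W by Krull, and cancelling \<open>a\<close> shows that the colons eventually lie in B +
  F_c.\<close>

lemma supf_colon:
  assumes B: "sub B" and nz: "nzd M a B" and a: "supf q F B a"
  shows "\<exists>n0. \<forall>n\<ge>n0. colon M a (N B (Suc n)) = N B n"
proof -
  have ac: "a \<in> carrier R" using a q_carrier by (auto simp: supf_def)
  obtain c where c: "\<And>n. n \<ge> c \<Longrightarrow> colon M a (N B (Suc n)) \<inter> N B c = N B n" using a by (auto simp: supf_def)
  define g where "g n = msum M (colon M a (N B (Suc n))) (N B c)" for n
  have sc: "sub (colon M a (N B n))" for n using sub_colon[OF ac sub_N[OF B]] .
  have g: "sub (g n) \<and> N B c \<subseteq> g n \<and> g n \<subseteq> carrier M \<and> g (Suc n) \<subseteq> g n" for n
    unfolding g_def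
    by (intro conjI sub_msum[OF sc sub_N[OF B]] msum_upper2[OF sc sub_N[OF B]]
      stableD(1)[OF sub_msum[OF sc sub_N[OF B]]] msum_mono[OF colon_mono[OF N_dec] order_refl])
  obtain k where k: "\<And>n. n \<ge> k \<Longrightarrow> g n = g k" using flen_dcc[where g = g, OF fl_N[OF B] sub_N[OF B] g sub_carrier] by auto
  let ?W = "msum M B (smul M a (N B c))"
  have sm: "sub (smul M a (N B c))" using sub_smul[OF ac sub_N[OF B]] .
  have W: "sub ?W" "B \<subseteq> ?W" "smul M a (N B c) \<subseteq> ?W" using sub_msum[OF B sm] msum_upper1[OF B sm] msum_upper2[OF B sm] by auto
  have "g k \<subseteq> N B c"
  proof
    fix u assume u: "u \<in> g k"
    have uc: "u \<in> carrier M" using u g by auto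
    have "a \<odot>\<^bsub>M\<^esub> u \<in> N ?W n" for n
    proof -
      have "u \<in> g (max n k)" using u k[OF max.cobounded2] by simp
      then obtain v w where vw: "v \<in> colon M a (N B (Suc (max n k)))" "w \<in> N B c" "u = v \<oplus>\<^bsub>M\<^esub> w" by (auto simp: g_def elim: msumE)
      have wc: "w \<in> carrier M" using stableD(6)[OF sub_N[OF B] vw(2)] .
      have "a \<odot>\<^bsub>M\<^esub> v \<in> N B (Suc (max n k))" using vw by (auto simp: colon_def)
      then have "a \<odot>\<^bsub>M\<^esub> v \<in> N B n" by (rule subsetD[OF N_anti[OF le_SucI[OF max.cobounded1]]])
      then have 1: "a \<odot>\<^bsub>M\<^esub> v \<in> N ?W n" by (rule subsetD[OF msum_mono[OF W(2) order_refl]])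
      have "a \<odot>\<^bsub>M\<^esub> w \<in> ?W" by (rule subsetD[OF W(3) smulI[OF vw(2)]])
      then have 2: "a \<odot>\<^bsub>M\<^esub> w \<in> N ?W n" by (rule subsetD[OF N_upper[OF W(1)]])
      have "v \<in> carrier M" using vw by (auto simp: colon_def)
      then show ?thesis using stableD(3)[OF sub_N[OF W(1)] 1 2] vw wc ac by (simp add: smult_r_distr)
    qed
    then have "a \<odot>\<^bsub>M\<^esub> u \<in> (\<Inter>n. N ?W n)" by (intro INT_I)
    then have "a \<odot>\<^bsub>M\<^esub> u \<in> ?W" by (simp only: krull_F[OF W(1)])
    then obtain b s where bs: "b \<in> B" "s \<in> smul M a (N B c)" "a \<odot>\<^bsub>M\<^esub> u = b \<oplus>\<^bsub>M\<^esub> s" by (rule msumE)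
    from bs(2) obtain w where "w \<in> N B c" "s = a \<odot>\<^bsub>M\<^esub> w" by (rule smulE)
    then have bw: "b \<in> B" "w \<in> N B c" "a \<odot>\<^bsub>M\<^esub> u = b \<oplus>\<^bsub>M\<^esub> a \<odot>\<^bsub>M\<^esub> w" using bs by simp_all
    have c': "b \<in> carrier M" "w \<in> carrier M" using bw stableD(6)[OF B] stableD(6)[OF sub_N[OF B]] by auto
    have "a \<odot>\<^bsub>M\<^esub> (u \<ominus>\<^bsub>M\<^esub> w) = b" using bw c' uc ac by (simp add: smult_r_diff add_minus_cancel)
    then have "u \<ominus>\<^bsub>M\<^esub> w \<in> B" using nz bw uc c' by (auto simp: nzd_def)
    then have "u \<ominus>\<^bsub>M\<^esub> w \<in> N B c" using N_upper[OF B] by blast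
    then show "u \<in> N B c" using stable_diff_iff[OF sub_N[OF B] uc bw(2)] by simp
  qed
  moreover have "colon M a (N B (Suc n)) \<subseteq> g n" for n unfolding g_def using msum_upper1[OF sc sub_N[OF B]] .
  ultimately have "colon M a (N B (Suc n)) \<subseteq> N B c" if "n \<ge> k" for n using k[OF that] by blast
  then have "colon M a (N B (Suc n)) = N B n" if "n \<ge> max k c" for n using c[of n] that by auto
  then show ?thesis by blast
qed

definition "bas as i = lsum M (take i as) (carrier M)"

lemma take_carrier: "set as \<subseteq> q \<Longrightarrow> set (take i as) \<subseteq> carrier R"
  using set_take_subset[of i as] q_carrier by auto

lemma sub_bas: "set as \<subseteq> q \<Longrightarrow> sub (bas as i)"
  unfolding bas_def using sub_lsum[OF sub_carrier take_carrier] .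

lemma bas_addl: "set as \<subseteq> q \<Longrightarrow> addl M {\<zero>\<^bsub>M\<^esub>} (take i as) = bas as i"
  unfolding bas_def using addl_zero[OF take_carrier] .

lemma bas_Suc: "set as \<subseteq> q \<Longrightarrow> i < length as \<Longrightarrow> bas as (Suc i) = adj M (bas as i) (as ! i)"
proof -
  assume as: "set as \<subseteq> q" "i < length as"
  then have a: "as ! i \<in> carrier R" using q_carrier nth_mem[of i as] by blast
  show "bas as (Suc i) = adj M (bas as i) (as ! i)"
    unfolding bas_def take_Suc_conv_app_nth[OF as(2)] by (rule lsum_snoc[OF sub_carrier take_carrier[OF as(1)] a])
qed

lemma bas_mono: "set as \<subseteq> q \<Longrightarrow> i \<le> j \<Longrightarrow> bas as i \<subseteq> bas as j"
proof -
  assume as: "set as \<subseteq> q" and ij: "i \<le> j"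
  have "set (take i as) \<subseteq> set (take j as)" using set_take_subset_set_take[OF ij] .
  then show ?thesis unfolding bas_def
    by (intro lsum_least[OF sub_lsum[OF sub_carrier take_carrier[OF as]]] lsum_in[OF sub_carrier take_carrier[OF as]]) auto
qed

lemma bas_F1: "set as \<subseteq> q \<Longrightarrow> bas as i \<subseteq> F 1"
  unfolding bas_def using set_take_subset[of i as] F_mul[of _ _ 0] F0 by (intro lsum_least[OF F_sub]) auto

lemma bas_proper:
  assumes as: "set as \<subseteq> q" and nz: "carrier M \<noteq> {\<zero>\<^bsub>M\<^esub>}" shows "bas as i \<noteq> carrier M"
proof
  assume e: "bas as i = carrier M"
  have "carrier M \<subseteq> {\<zero>\<^bsub>M\<^esub>}"
  proof (rule nakayama[OF sub_carrier sub_zero])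
    fix T assume T: "sub T" "{\<zero>\<^bsub>M\<^esub>} \<subseteq> T" "\<And>z u. z \<in> \<mm> \<Longrightarrow> u \<in> carrier M \<Longrightarrow> z \<odot>\<^bsub>M\<^esub> u \<in> T"
    have "set (take i as) \<subseteq> \<mm>" using as q_mm set_take_subset[of i as] by blast
    then have "bas as i \<subseteq> T" unfolding bas_def by (intro lsum_least[OF T(1)] T(3)) auto
    then show "carrier M \<subseteq> T" using e by simp
  qed
  then show False using nz by auto
qed

text \<open>A regular sequence \<open>xs\<close> in \<open>\<mm>\<close> makes M socle free modulo
  its proper initial segments. \<open>soc_exchange\<close> transfers this to the superficial
  elements found so far, and then \<open>supf_nzd\<close> makes the next one regular.\<close>

lemma rseq_upto:
  assumes as: "set as \<subseteq> q" and sup: "\<And>i. i < length as \<Longrightarrow> supf q F (bas as i) (as ! i)"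
    and xs: "set xs \<subseteq> \<mm>" "rseq M {\<zero>\<^bsub>M\<^esub>} xs"
  shows "i \<le> length as \<Longrightarrow> i \<le> length xs \<Longrightarrow> rseq M {\<zero>\<^bsub>M\<^esub>} (take i as) \<and> (i < length xs \<longrightarrow> sfree M \<mm> (bas as i))"
proof (induction i)
  case 0
  have "bas as 0 = {\<zero>\<^bsub>M\<^esub>}" by (simp add: bas_def)
  then show ?case using sfree_rseq[OF xs(2,1), of 0] by auto
next
  case (Suc i)
  have "nzd M (as ! i) (bas as i)" using supf_nzd[OF sub_bas[OF as] _ sup] Suc by auto
  then have r: "rseq M {\<zero>\<^bsub>M\<^esub>} (take (Suc i) as)"
    using Suc by (simp add: take_Suc_conv_app_nth rseq_append bas_addl[OF as])
  have sc: "scal_closed \<mm>" unfolding scal_closed_def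
    using mm_carrier additive_subgroup.a_closed[OF ideal.axioms(1)[OF mm_ideal]] ideal.I_l_closed[OF mm_ideal] by auto
  have "sfree M \<mm> (bas as (Suc i))" if l: "Suc i < length xs"
  proof -
    have "sfree M \<mm> (addl M {\<zero>\<^bsub>M\<^esub>} (take (Suc i) as))"
    proof (rule soc_exchange[OF sc])
      show "\<mm> \<noteq> {}" using additive_subgroup.zero_closed[OF ideal.axioms(1)[OF mm_ideal]] by auto
      show "length (take (Suc i) as) = length (take (Suc i) xs)" using Suc.prems by simp
      show "set (take (Suc i) as) \<subseteq> \<mm>" using as q_mm set_take_subset[of "Suc i" as] by auto
      show "set (take (Suc i) xs) \<subseteq> \<mm>" using xs set_take_subset[of "Suc i" xs] by auto
      show "rseq M {\<zero>\<^bsub>M\<^esub>} (take (Suc i) xs)" using xs(2) by (metis append_take_drop_id rseq_append)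
      show "sfree M \<mm> (addl M {\<zero>\<^bsub>M\<^esub>} (take (Suc i) xs))" using sfree_rseq[OF xs(2,1) l] .
    qed (use r sub_zero ac in auto)
    then show ?thesis by (simp add: bas_addl[OF as])
  qed
  then show ?case using r by auto
qed

definition "annM B = {s \<in> carrier R. \<forall>v\<in>carrier M. s \<odot>\<^bsub>M\<^esub> v \<in> B}"

text \<open>Starts with a proper inclusion of a prime in \<open>\<mm>\<close> over the annihilator
  of M/B_k, and peels off the elements of the sequence from the last to the first; each yields one
  smaller prime by \<open>prime_descent\<close>. Altogether there are \<open>k\<close> + 1 proper
  inclusions.\<close>

lemma prime_chain:
  assumes as: "set as \<subseteq> q" and r: "rseq M {\<zero>\<^bsub>M\<^esub>} (take k as)" "k \<le> length as"
    and n: "\<not> mnil (bas as k) (carrier M)"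
  shows "\<exists>P. (\<forall>j\<le>Suc k. primeideal (P j) R \<and> annM {\<zero>\<^bsub>M\<^esub>} \<subseteq> P j) \<and> (\<forall>j<Suc k. P j \<subset> P (Suc j))"
proof -
  have "i \<le> k \<Longrightarrow> \<exists>P. (\<forall>j\<le>Suc i. primeideal (P j) R \<and> annM (bas as (k - i)) \<subseteq> P j) \<and> (\<forall>j<Suc i. P j \<subset> P (Suc j))" for i
  proof (induction i)
    case 0
    obtain P where P: "primeideal P R" "annM (bas as k) \<subseteq> P" "P \<subset> \<mm>"
      using prime_not_mm[OF sub_bas[OF as] n] by (auto simp: annM_def)
    then show ?case using mm_prime by (intro exI[of _ "\<lambda>j. if j = 0 then P else \<mm>"]) (auto simp: le_Suc_eq)
  next
    case (Suc i)
    let ?l = "k - Suc i"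
    have l: "k - i = Suc ?l" "?l < length as" using Suc.prems r(2) by auto
    obtain P where P: "\<forall>j\<le>Suc i. primeideal (P j) R \<and> annM (bas as (k - i)) \<subseteq> P j" "\<forall>j<Suc i. P j \<subset> P (Suc j)" using Suc by auto
    have aq: "as ! ?l \<in> carrier R" using nth_mem[OF l(2)] as q_carrier by auto
    have "as ! ?l \<in> annM (bas as (k - i))"
      unfolding annM_def l(1) bas_Suc[OF as l(2)] 
      using aq subsetD[OF msum_upper2[OF sub_bas[OF as] sub_smul[OF aq sub_carrier]]] by (auto intro: smulI)
    then have aP: "as ! ?l \<in> P 0" using P(1) by auto
    have nz: "nzd M (as ! ?l) (bas as ?l)"
    proof -
      have lk: "?l < k" using Suc.prems by auto
      then have "nzd M (take k as ! ?l) (addl M {\<zero>\<^bsub>M\<^esub>} (take ?l (take k as)))"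
        using r(1) l(2) unfolding rseq_iff_nth by simp
      then show ?thesis using lk by (simp add: bas_addl[OF as] min_def)
    qed
    have am: "annM (bas as ?l) \<subseteq> annM (bas as (k - i))" using bas_mono[OF as, of ?l "k - i"] l unfolding annM_def by auto
    then have "annM (bas as ?l) \<subseteq> P 0" using P(1) by auto
    then obtain P' where P': "primeideal P' R" "annM (bas as ?l) \<subseteq> P'" "P' \<subset> P 0"
      using prime_descent[OF sub_bas[OF as] aq nz _ aP] P(1) unfolding annM_def by auto
    show ?case
    proof (intro exI[of _ "case_nat P' P"] conjI allI impI)
      fix j assume "j \<le> Suc (Suc i)" then show "primeideal (case_nat P' P j) R" "annM (bas as ?l) \<subseteq> case_nat P' P j"
        using P' P(1) am by (auto split: nat.split)
    next
      fix j assume "j < Suc (Suc i)" then show "case_nat P' P j \<subset> case_nat P' P (Suc j)"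
        using P'(3) P(2) by (cases j) auto
    qed
  qed
  from this[of k] show ?thesis by (simp add: bas_def)
qed

text \<open>A sequence shorter than \<open>xs\<close> would leave a quotient that is nonzero, socle
  free and \<open>\<mm>\<close>-torsion at once. A longer one would leave the quotient by its first
  \<open>length xs\<close> members non-torsion, because nilpotency is reached only by the last
  member; \<open>prime_chain\<close> would then exceed the dimension bound
  \<open>dim\<close>.\<close>

theorem maximal_superficial_regular:
  assumes as: "set as \<subseteq> q" and sup: "\<And>i. i < length as \<Longrightarrow> supf q F (bas as i) (as ! i)"
    and xs: "set xs \<subseteq> \<mm>" "rseq M {\<zero>\<^bsub>M\<^esub>} xs" and nz: "carrier M \<noteq> {\<zero>\<^bsub>M\<^esub>}"
    and nil: "F k \<subseteq> bas as (length as)" and nnil: "\<And>k. \<not> F k \<subseteq> bas as (length as - 1)"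
    and dim: "\<And>P. (\<forall>j\<le>Suc (length xs). primeideal (P j) R \<and> annM {\<zero>\<^bsub>M\<^esub>} \<subseteq> P j) \<Longrightarrow> \<exists>j<Suc (length xs). \<not> P j \<subset> P (Suc j)"
  shows "length as = length xs" "rseq M {\<zero>\<^bsub>M\<^esub>} as"
proof -
  note up = rseq_upto[OF as sup xs]
  have "\<not> length as < length xs"
  proof
    assume l: "length as < length xs"
    then have sf: "sfree M \<mm> (bas as (length as))" using up[of "length as"] by auto
    have "bas as (length as) \<subset> carrier M" using bas_proper[OF as nz] stableD(1)[OF sub_bas[OF as]] by auto
    then obtain u where "u \<in> carrier M" "u \<notin> bas as (length as)" "\<forall>z\<in>\<mm>. z \<odot>\<^bsub>M\<^esub> u \<in> bas as (length as)"
      using mnil_soc[OF mnil_F[OF nil] sub_carrier sub_bas[OF as]] by auto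
    then show False using sf by (auto simp: sfree_def)
  qed
  moreover have "\<not> length xs < length as"
  proof
    assume l: "length xs < length as"
    have r: "rseq M {\<zero>\<^bsub>M\<^esub>} (take (length xs) as)" using up l by auto
    have "\<not> mnil (bas as (length xs)) (carrier M)"
    proof
      have le: "length xs \<le> length as - 1" using l by linarith
      assume "mnil (bas as (length xs)) (carrier M)"
      then obtain n where "F n \<subseteq> bas as (length xs)" using fl_vanish[OF sub_bas[OF as]] by auto
      then show False using nnil[of n] bas_mono[OF as le] by (meson subset_trans)
    qed
    then show False using prime_chain[OF as r] l dim by (metis less_imp_le)
  qed
  ultimately show l: "length as = length xs" by auto
  show "rseq M {\<zero>\<^bsub>M\<^esub>} as" using up[of "length as"] l by auto
qed

end

section \<open>Hilbert series along a superficial sequence\<close>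

definition spoly :: "(nat \<Rightarrow> int) \<Rightarrow> nat \<Rightarrow> int poly" where
  "spoly b k = (\<Sum>n<k. monom (b n) n)"

lemma coeff_spoly: "coeff (spoly b k) n = (if n < k then b n else 0)"
  unfolding spoly_def coeff_sum by (simp add: coeff_monom sum.delta)

lemma poly_spoly_1: "poly (spoly b k) 1 = (\<Sum>n<k. b n)"
  unfolding spoly_def poly_sum by (simp add: poly_monom)

lemma poly_pderiv_spoly_1: "poly (pderiv (spoly b k)) 1 = (\<Sum>n<k. int n * b n)"
  unfolding spoly_def by (induction k) (simp_all add: pderiv_add pderiv_monom poly_monom)

lemma Abs_fps_spoly: "(\<And>n. n \<ge> k \<Longrightarrow> b n = 0) \<Longrightarrow> Abs_fps b = fps_of_poly (spoly b k)"
  by (rule fps_ext) (simp add: coeff_spoly)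

lemma fps_mult_one_minus_X_nth: "fps_nth (f * (1 - fps_X)) n = fps_nth f n - (if n = 0 then 0 else fps_nth f (n - 1) :: int)"
  by (simp add: right_diff_distrib fps_X_mult_right_nth)

lemma one_minus_X: "(1 - fps_X :: int fps) = fps_of_poly [:1, -1:]"
  by (rule fps_ext) (auto simp: fps_X_def coeff_pCons split: nat.split)

lemma factor_square_step: "(h + x ^ 2 * c) - s * x ^ 2 * x ^ j = h + x ^ 2 * (c - s * x ^ j)" for h x c s :: "'z :: comm_ring_1"
  by (simp add: algebra_simps)

text \<open>Turns a sum of tails of the Hilbert function into the derivative of its generating
  polynomial at 1.\<close>

lemma sum_tail: "(\<Sum>n<k. \<Sum>m\<in>{Suc n..<k}. f m) = (\<Sum>n<k. int n * f n)"
proof (induction k)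
  case (Suc k)
  have "(\<Sum>n<Suc k. \<Sum>m\<in>{Suc n..<Suc k}. f m) = (\<Sum>n<k. (\<Sum>m\<in>{Suc n..<k}. f m) + f k)"
    by (simp add: sum.atLeastLessThan_Suc)
  then show ?case using Suc by (simp add: sum.distrib)
qed simp

context good_filt begin

abbreviation "H B n \<equiv> ll (N B (Suc n)) (N B n)"

lemma N_carrier: "sub B \<Longrightarrow> N B n \<subseteq> carrier M" using stableD(1)[OF sub_N] .

lemma N_colon: "sub B \<Longrightarrow> a \<in> q \<Longrightarrow> N B n \<subseteq> colon M a (N B (Suc n))"
proof
  fix x assume B: "sub B" and a: "a \<in> q" and x: "x \<in> N B n"
  have ac: "a \<in> carrier R" using a q_carrier by auto
  obtain b u where bu: "b \<in> B" "u \<in> F n" "x = b \<oplus>\<^bsub>M\<^esub> u" using x by (auto elim: msumE)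
  have c: "b \<in> carrier M" "u \<in> carrier M" using bu stableD(6)[OF B] stableD(6)[OF F_sub] by auto
  have "a \<odot>\<^bsub>M\<^esub> b \<oplus>\<^bsub>M\<^esub> a \<odot>\<^bsub>M\<^esub> u \<in> N B (Suc n)" using stableD(5)[OF B ac] F_mul[OF a] bu by (intro msumI) auto
  then show "x \<in> colon M a (N B (Suc n))" using c bu ac by (simp add: colon_def smult_r_distr)
qed

lemma N_adj: "sub B \<Longrightarrow> a \<in> q \<Longrightarrow> N (adj M B a) n = msum M (N B n) (smul M a (carrier M))"
proof -
  assume B: "sub B" and "a \<in> q"
  then have a: "a \<in> carrier R" using q_carrier by auto
  have c: "B \<subseteq> carrier M" "smul M a (carrier M) \<subseteq> carrier M" "F n \<subseteq> carrier M"
    using stableD(1)[OF B] stableD(1)[OF sub_smul[OF a sub_carrier]] stableD(1)[OF F_sub] by auto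
  show ?thesis using msum_assoc[OF c] msum_assoc[OF c(1,3,2)] msum_comm[OF c(2,3)] by simp
qed

text \<open>Singh's equality: the cumulative Hilbert function modulo \<open>a\<close> differs from
  the Hilbert function before only by the failure of \<open>a\<close> to be regular on the graded
  module in degree \<open>n\<close>.\<close>

lemma one_step:
  assumes B: "sub B" and a: "a \<in> q"
  shows "ll (N (adj M B a) (Suc n)) (carrier M) = H B n + ll (N B n) (colon M a (N B (Suc n)))"
proof -
  let ?Z = "N B (Suc n)" and ?T = "msum M (N B (Suc n)) (smul M a (carrier M))" and ?K = "colon M a (N B (Suc n))"
  have ac: "a \<in> carrier R" using a q_carrier by auto
  have sm: "sub (smul M a (carrier M))" using sub_smul[OF ac sub_carrier] .
  have s: "sub ?Z" "sub ?T" "sub ?K" "sub (N B n)" using sub_N[OF B] sub_msum[OF sub_N[OF B] sm] sub_colon[OF ac sub_N[OF B]] by auto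
  have i: "?Z \<subseteq> ?T" "?T \<subseteq> carrier M" "N B n \<subseteq> ?K" "?K \<subseteq> carrier M" "?Z \<subseteq> N B n" "N B n \<subseteq> carrier M"
    using msum_upper1[OF s(1) sm] stableD(1)[OF s(2)] N_colon[OF B a] stableD(1)[OF s(3)] N_dec N_carrier[OF B] by auto
  have "ll ?Z (carrier M) = ll ?Z ?T + ll ?T (carrier M)" using len_add(2)[OF sub_carrier s(2,1) i(1,2)] fl_N[OF B] by auto
  moreover have "ll ?Z ?T = ll ?K (carrier M)" by (rule len_colon(2)[OF s(1) ac])
  moreover have "ll (N B n) (carrier M) = ll (N B n) ?K + ll ?K (carrier M)" using len_add(2)[OF sub_carrier s(3,4) i(3,4)] fl_N[OF B] by auto
  moreover have "ll ?Z (carrier M) = ll ?Z (N B n) + ll (N B n) (carrier M)" using len_add(2)[OF sub_carrier s(4,1) i(5,6)] fl_N[OF B] by auto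
  ultimately show ?thesis using N_adj[OF B a] by simp
qed

lemma H_sum: "sub B \<Longrightarrow> m \<le> n \<Longrightarrow> ll (N B n) (N B m) = (\<Sum>i\<in>{m..<n}. H B i)"
proof (induction n)
  case 0 then show ?case using len_self[OF sub_N] by simp
next
  case (Suc n)
  show ?case
  proof (cases "m = Suc n")
    case True then show ?thesis using len_self[OF sub_N[OF Suc.prems(1)]] by simp
  next
    case False
    then have mn: "m \<le> n" using Suc by auto
    have "fl (N B (Suc n)) (N B m)"
      using fl_N[OF Suc.prems(1)]
        len_add(1)[OF sub_carrier sub_N[OF Suc.prems(1)] sub_N[OF Suc.prems(1)] N_anti[OF Suc.prems(2)] N_carrier[OF Suc.prems(1)]] by blast
    then have "ll (N B (Suc n)) (N B m) = H B n + ll (N B n) (N B m)"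
      using len_add(2)[OF sub_N[OF Suc.prems(1)] sub_N[OF Suc.prems(1)] sub_N[OF Suc.prems(1)] N_dec N_anti[OF mn]] by simp
    then show ?thesis using Suc.IH[OF Suc.prems(1) mn] mn by simp
  qed
qed

definition "HS B = Abs_fps (\<lambda>n. int (H B n))"

lemma HS_step:
  assumes B: "sub B" and nz: "nzd M a B" and a: "supf q F B a"
  shows "\<exists>k b. (\<forall>n. b n = int (ll (N B n) (colon M a (N B (Suc n))))) \<and> (\<forall>n\<ge>k. b n = 0) \<and>
    HS B * (1 - fps_X) = HS (adj M B a) - fps_of_poly (spoly b k) * (1 - fps_X)"
proof -
  have aq: "a \<in> q" "a \<in> carrier R" using a q_carrier by (auto simp: supf_def)
  let ?B = "adj M B a"
  have B': "sub ?B" using sub_adj[OF B aq(2)] .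
  define b where "b n = int (ll (N B n) (colon M a (N B (Suc n))))" for n
  obtain k where k: "\<And>n. n \<ge> k \<Longrightarrow> colon M a (N B (Suc n)) = N B n" using supf_colon[OF B nz a] by auto
  have b0: "b n = 0" if "n \<ge> k" for n using len_self[OF sub_N[OF B]] k[OF that] by (simp add: b_def)
  define c where "c n = int (ll (N ?B (Suc n)) (carrier M))" for n
  have c: "c n = int (H B n) + b n" for n using one_step[OF B aq(1)] by (simp add: c_def b_def)
  have "(HS B + fps_of_poly (spoly b k)) * (1 - fps_X) = HS ?B"
  proof (rule fps_ext)
    fix n
    have e: "fps_nth (HS B + fps_of_poly (spoly b k)) n = c n" for n
      using b0[of n] by (simp add: HS_def c coeff_spoly)
    have "c n - (if n = 0 then 0 else c (n - 1)) = int (H ?B n)"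
    proof (cases n)
      case 0 then show ?thesis using N_0[OF B'] by (simp add: c_def)
    next
      case (Suc m)
      have "ll (N ?B (Suc n)) (carrier M) = H ?B n + ll (N ?B n) (carrier M)"
        using len_add(2)[OF sub_carrier sub_N[OF B'] sub_N[OF B'] N_dec N_carrier[OF B']] fl_N[OF B'] by blast
      then show ?thesis using Suc by (simp add: c_def)
    qed
    then show "fps_nth ((HS B + fps_of_poly (spoly b k)) * (1 - fps_X)) n = fps_nth (HS ?B) n"
      unfolding fps_mult_one_minus_X_nth e by (simp add: HS_def)
  qed
  then have "HS B * (1 - fps_X) = HS ?B - fps_of_poly (spoly b k) * (1 - fps_X)" by (simp add: algebra_simps)
  then show ?thesis using b0 by (intro exI[of _ k] exI[of _ b]) (auto simp: b_def)
qed

text \<open>The last step, into a quotient of finite length, where the series is a polynomial.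
  Writing B' for the enlarged submodule, e_0 - H_n splits into the tail of the Hilbert function of
  M/B' beyond \<open>n\<close> and the correction of Singh's equality in degree \<open>n\<close>.
  The derivative of the numerator at 1 consists of the same two contributions.\<close>

lemma HS_base:
  assumes B: "sub B" and nz: "nzd M a B" and a: "supf q F B a" and k: "F k \<subseteq> adj M B a"
  shows "\<exists>h p0. HS B * (1 - fps_X) = fps_of_poly h \<and> poly h 1 = int (ll (adj M B a) (carrier M)) \<and>
    (\<forall>p\<ge>p0. poly (pderiv h) 1 = (\<Sum>n<p. int (ll (adj M B a) (carrier M)) - int (H B n))) \<and>
    (\<forall>n\<ge>p0. H B n = ll (adj M B a) (carrier M))"
proof -
  have aq: "a \<in> q" "a \<in> carrier R" using a q_carrier by (auto simp: supf_def)
  let ?B = "adj M B a"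
  let ?e = "ll ?B (carrier M)"
  have B': "sub ?B" using sub_adj[OF B aq(2)] .
  have NB: "N ?B n = ?B" if "n \<ge> k" for n using msum_absorb[OF B' F_sub] F_anti[OF that] k by blast
  obtain l b where b: "\<And>n. b n = int (ll (N B n) (colon M a (N B (Suc n))))" "\<And>n. n \<ge> l \<Longrightarrow> b n = 0"
    and eq: "HS B * (1 - fps_X) = HS ?B - fps_of_poly (spoly b l) * (1 - fps_X)" using HS_step[OF B nz a] by blast
  have H0: "int (H ?B n) = 0" if "n \<ge> k" for n using len_self[OF B'] NB[of n] NB[of "Suc n"] that by simp
  let ?p = "spoly (\<lambda>n. int (H ?B n)) k"
  define h where "h = ?p - spoly b l * [:1, -1:]"
  have P: "HS ?B = fps_of_poly ?p" unfolding HS_def by (rule Abs_fps_spoly) (use H0 in auto)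
  have 1: "HS B * (1 - fps_X) = fps_of_poly h"
    unfolding eq P unfolding h_def one_minus_X fps_of_poly_diff fps_of_poly_mult by (rule refl)
  have 2: "poly h 1 = int ?e"
    using H_sum[OF B', of 0 k] N_0[OF B'] NB[of k] by (simp add: h_def poly_spoly_1 atLeast0LessThan)
  have d: "poly (pderiv h) 1 = (\<Sum>n<k. int n * int (H ?B n)) + (\<Sum>n<l. b n)"
  proof -
    have "pderiv h = pderiv ?p - (spoly b l * pderiv [:1, -1:] + [:1, -1:] * pderiv (spoly b l))"
      unfolding h_def pderiv_diff pderiv_mult by (rule refl)
    moreover have "poly (pderiv [:1, -1 :: int:]) 1 = -1" "poly [:1, -1 :: int:] 1 = 0" by (simp_all add: pderiv_pCons)
    ultimately show ?thesis by (simp add: poly_diff poly_add poly_mult poly_spoly_1 poly_pderiv_spoly_1 del: mult_pCons_left mult_pCons_right)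
  qed
  have HB: "int ?e - int (H B n) = int (ll ?B (N ?B (Suc n))) + b n" for n
  proof -
    have f: "fl ?B (carrier M)" using fl_N[OF B', of k] NB[of k] by simp
    have "?e = ll ?B (N ?B (Suc n)) + ll (N ?B (Suc n)) (carrier M)"
      by (rule len_add(2)[OF sub_carrier sub_N[OF B'] B' N_upper[OF B'] N_carrier[OF B'] f])
    then show ?thesis using one_step[OF B aq(1), of n] b(1)[of n] by simp
  qed
  have Bn: "int (ll ?B (N ?B (Suc n))) = (\<Sum>m\<in>{Suc n..<k}. int (H ?B m))" for n
  proof (cases "Suc n \<le> k")
    case True then show ?thesis using H_sum[OF B' True] NB[of k] by simp
  next
    case False then show ?thesis using NB[of "Suc n"] len_self[OF B'] by simp
  qed
  have 3: "poly (pderiv h) 1 = (\<Sum>n<p. int ?e - int (H B n))" if p: "p \<ge> max k l" for p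
  proof -
    have "(\<Sum>n<p. int ?e - int (H B n)) = (\<Sum>n<p. \<Sum>m\<in>{Suc n..<k}. int (H ?B m)) + (\<Sum>n<p. b n)"
      unfolding HB Bn by (simp add: sum.distrib)
    also have "(\<Sum>n<p. \<Sum>m\<in>{Suc n..<k}. int (H ?B m)) = (\<Sum>n<k. \<Sum>m\<in>{Suc n..<k}. int (H ?B m))"
      by (rule sum.mono_neutral_right) (use p in auto)
    also have "(\<Sum>n<p. b n) = (\<Sum>n<l. b n)"
      by (rule sum.mono_neutral_right) (use p b(2) in auto)
    finally show ?thesis using d sum_tail[where k = k and f = "\<lambda>m. int (H ?B m)"] by simp
  qed
  have 4: "H B n = ?e" if "n \<ge> max k l" for n using HB[of n] Bn[of n] b(2)[of n] that by simp
  show ?thesis using 1 2 3 4 by blast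
qed

text \<open>In each step before the last, the correction polynomial reaches the numerator with a
  factor (1 - z)^2. So the value and the derivative of the numerator at 1, that is e_0 and e_1, can
  be read off in the one-dimensional quotient.\<close>

lemma hilbert_reduction:
  assumes as: "set as \<subseteq> q" "rseq M {\<zero>\<^bsub>M\<^esub>} as" and sup: "\<And>i. i < length as \<Longrightarrow> supf q F (bas as i) (as ! i)"
    and nil: "F k \<subseteq> bas as (length as)" and ne: "as \<noteq> []"
  defines "e \<equiv> ll (bas as (length as)) (carrier M)" and "B \<equiv> bas as (length as - 1)"
  shows "\<exists>h p0. HS {\<zero>\<^bsub>M\<^esub>} * (1 - fps_X) ^ length as = fps_of_poly h \<and> poly h 1 = int e \<and>
    (\<forall>p\<ge>p0. poly (pderiv h) 1 = (\<Sum>n<p. int e - int (H B n))) \<and> (\<forall>n\<ge>p0. H B n = e) \<and> coeff h 0 = int (H {\<zero>\<^bsub>M\<^esub>} 0)"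
proof -
  let ?r = "length as"
  have nzd: "nzd M (as ! i) (bas as i)" if "i < ?r" for i using as(2) that by (auto simp: rseq_iff_nth bas_addl[OF as(1)])
  have r: "?r - 1 < ?r" "?r = Suc (?r - 1)" using ne by (cases as; simp)+
  have Br: "bas as ?r = adj M B (as ! (?r - 1))" using bas_Suc[OF as(1) r(1)] r(2) by (simp add: B_def)
  obtain h p0 where h: "HS B * (1 - fps_X) = fps_of_poly h" "poly h 1 = int e"
    "\<And>p. p \<ge> p0 \<Longrightarrow> poly (pderiv h) 1 = (\<Sum>n<p. int e - int (H B n))" "\<And>n. n \<ge> p0 \<Longrightarrow> H B n = e"
  proof -
    have k': "F k \<subseteq> adj M (bas as (?r - 1)) (as ! (?r - 1))" using nil Br by (simp add: B_def)
    note base = HS_base[OF sub_bas[OF as(1)] nzd[OF r(1)] sup[OF r(1)] k', folded B_def, folded Br, folded e_def]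
    from base obtain h p0 where "HS B * (1 - fps_X) = fps_of_poly h \<and> poly h 1 = int e \<and>
      (\<forall>p\<ge>p0. poly (pderiv h) 1 = (\<Sum>n<p. int e - int (H B n))) \<and> (\<forall>n\<ge>p0. H B n = e)" by (elim exE)
    then show thesis by (intro that[of h p0]) simp_all
  qed
  have "j \<le> ?r - 1 \<Longrightarrow> \<exists>c. HS (bas as (?r - 1 - j)) * (1 - fps_X) ^ Suc j = fps_of_poly (h + [:1, -1:] ^ 2 * c)" for j
  proof (induction j)
    case 0 then show ?case using h(1) by (intro exI[of _ 0]) (simp add: B_def)
  next
    case (Suc j)
    let ?i = "?r - 1 - Suc j"
    have i: "?i < ?r" "Suc ?i = ?r - 1 - j" using Suc by auto
    obtain c where c: "HS (bas as (?r - 1 - j)) * (1 - fps_X) ^ Suc j = fps_of_poly (h + [:1, -1:] ^ 2 * c)" using Suc by auto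
    obtain l b where b: "HS (bas as ?i) * (1 - fps_X) = HS (bas as (Suc ?i)) - fps_of_poly (spoly b l) * (1 - fps_X)"
      using HS_step[OF sub_bas[OF as(1)] nzd[OF i(1)] sup[OF i(1)]] bas_Suc[OF as(1) i(1)] by auto
    have "HS (bas as ?i) * (1 - fps_X) ^ Suc (Suc j) = (HS (bas as ?i) * (1 - fps_X)) * (1 - fps_X) ^ Suc j" by (simp add: algebra_simps)
    also have "\<dots> = HS (bas as (?r - 1 - j)) * (1 - fps_X) ^ Suc j - fps_of_poly (spoly b l) * (1 - fps_X) ^ 2 * (1 - fps_X) ^ j"
      unfolding b i(2) by (simp only: left_diff_distrib power_Suc power2_eq_square mult.assoc)
    also have "\<dots> = fps_of_poly (h + [:1, -1:] ^ 2 * (c - spoly b l * [:1, -1:] ^ j))"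
      unfolding c unfolding one_minus_X fps_of_poly_power[symmetric] fps_of_poly_mult[symmetric] fps_of_poly_diff[symmetric]
      by (rule arg_cong[where f = fps_of_poly]) (rule factor_square_step)
    finally show ?case by blast
  qed
  from this[of "?r - 1", OF order_refl] have "\<exists>c. HS (bas as 0) * (1 - fps_X) ^ ?r = fps_of_poly (h + [:1, -1:] ^ 2 * c)"
    by (simp only: diff_self_eq_0 r(2)[symmetric])
  then obtain c where c: "HS (bas as 0) * (1 - fps_X) ^ ?r = fps_of_poly (h + [:1, -1:] ^ 2 * c)" by (elim exE)
  let ?h = "h + [:1, -1:] ^ 2 * c"
  have b0: "bas as 0 = {\<zero>\<^bsub>M\<^esub>}" by (simp add: bas_def)
  have "poly ?h 1 = int e" using h(2) by simp
  moreover have "poly (pderiv ?h) 1 = poly (pderiv h) 1"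
  proof -
    have "pderiv ?h = pderiv h + ([:1, -1:] ^ 2 * pderiv c + c * ([:1, -1:] * pderiv [:1, -1:] + [:1, -1:] * pderiv [:1, -1:]))"
      unfolding pderiv_add pderiv_mult power2_eq_square by (rule refl)
    moreover have "poly [:1, -1 :: int:] 1 = 0" by simp
    ultimately show ?thesis by (simp add: poly_power del: mult_pCons_left mult_pCons_right)
  qed
  moreover have "coeff ?h 0 = int (H {\<zero>\<^bsub>M\<^esub>} 0)"
  proof -
    have "coeff ?h 0 = fps_nth (HS {\<zero>\<^bsub>M\<^esub>} * (1 - fps_X) ^ ?r) 0" using c b0 by simp
    also have "\<dots> = fps_nth (HS {\<zero>\<^bsub>M\<^esub>}) 0" by (simp add: fps_mult_nth_0 fps_nth_power_0)
    finally show ?thesis by (simp add: HS_def)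
  qed
  ultimately show ?thesis using c b0 h by (intro exI[of _ ?h] exI[of _ p0]) auto
qed

end

section \<open>Determinants acting on a module\<close>

context module begin

lemma finsum_M_swap:
  assumes "finite A" "finite B" "\<And>i j. i \<in> A \<Longrightarrow> j \<in> B \<Longrightarrow> f i j \<in> carrier M"
  shows "(\<Oplus>\<^bsub>M\<^esub>i\<in>A. \<Oplus>\<^bsub>M\<^esub>j\<in>B. f i j) = (\<Oplus>\<^bsub>M\<^esub>j\<in>B. \<Oplus>\<^bsub>M\<^esub>i\<in>A. f i j)"
  using assms(1,3)
proof (induction A rule: finite_induct)
  case (insert a A)
  have c: "(\<Oplus>\<^bsub>M\<^esub>j\<in>B. f i j) \<in> carrier M" if "i \<in> insert a A" for i using insert.prems that by (intro M.finsum_closed) auto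
  have c': "(\<Oplus>\<^bsub>M\<^esub>i\<in>A. f i j) \<in> carrier M" if "j \<in> B" for j using insert.prems that by (intro M.finsum_closed) auto
  have "(\<Oplus>\<^bsub>M\<^esub>i\<in>insert a A. \<Oplus>\<^bsub>M\<^esub>j\<in>B. f i j) = (\<Oplus>\<^bsub>M\<^esub>j\<in>B. f a j) \<oplus>\<^bsub>M\<^esub> (\<Oplus>\<^bsub>M\<^esub>j\<in>B. \<Oplus>\<^bsub>M\<^esub>i\<in>A. f i j)"
    using insert c by (subst M.finsum_insert) auto
  also have "\<dots> = (\<Oplus>\<^bsub>M\<^esub>j\<in>B. f a j \<oplus>\<^bsub>M\<^esub> (\<Oplus>\<^bsub>M\<^esub>i\<in>A. f i j))"
    by (rule M.finsum_addf[symmetric]) (use insert.prems c' in auto)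
  also have "\<dots> = (\<Oplus>\<^bsub>M\<^esub>j\<in>B. \<Oplus>\<^bsub>M\<^esub>i\<in>insert a A. f i j)"
    using insert by (intro M.finsum_cong' refl) (auto intro!: M.finsum_closed M.finsum_insert[symmetric])
  finally show ?case .
qed (simp add: M.finsum_zero)

lemma finsum_smult_rdistr:
  assumes "finite A" "f \<in> A \<rightarrow> carrier R" "u \<in> carrier M"
  shows "(\<Oplus>i\<in>A. f i) \<odot>\<^bsub>M\<^esub> u = (\<Oplus>\<^bsub>M\<^esub>i\<in>A. f i \<odot>\<^bsub>M\<^esub> u)"
  using assms(1,2)
proof (induction A rule: finite_induct)
  case (insert a A)
  then have "f \<in> A \<rightarrow> carrier R" "f a \<in> carrier R" by auto
  then show ?case using insert assms(3) by (simp add: smult_l_distr R.finsum_closed Pi_def)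
qed (simp add: assms)

lemma finsum_single:
  assumes "finite A" "l \<in> A" "f l \<in> carrier M" "\<And>m. m \<in> A \<Longrightarrow> m \<noteq> l \<Longrightarrow> f m = \<zero>\<^bsub>M\<^esub>"
  shows "(\<Oplus>\<^bsub>M\<^esub>m\<in>A. f m) = f l"
proof -
  have "(\<Oplus>\<^bsub>M\<^esub>m\<in>A. f m) = (\<Oplus>\<^bsub>M\<^esub>m\<in>insert l (A - {l}). f m)" using assms(2) by (simp add: insert_absorb)
  also have "\<dots> = f l \<oplus>\<^bsub>M\<^esub> (\<Oplus>\<^bsub>M\<^esub>m\<in>A - {l}. f m)" using assms by (subst M.finsum_insert) auto
  also have "(\<Oplus>\<^bsub>M\<^esub>m\<in>A - {l}. f m) = (\<Oplus>\<^bsub>M\<^esub>m\<in>A - {l}. \<zero>\<^bsub>M\<^esub>)" using assms(4) by (intro M.finsum_cong') auto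
  finally show ?thesis using assms(3) by (simp add: M.finsum_zero)
qed

definition "eperm k = {p. p permutes {..<k} \<and> evenperm p}"
definition "operm k = {p. p permutes {..<k::nat} \<and> \<not> evenperm p}"
definition "pprod A S p = (\<Otimes>i\<in>S. A i (p i))"
text \<open>Even minus odd permutations, to avoid signs in the ring.\<close>
definition "mdet k A = (\<Oplus>p\<in>eperm k. pprod A {..<k} p) \<ominus> (\<Oplus>p\<in>operm k. pprod A {..<k} p)"

lemma finite_perms: "finite (eperm k)" "finite (operm k)"
  unfolding eperm_def operm_def using finite_permutations[of "{..<k}"] by (auto intro: rev_finite_subset)

lemma operm_eq_image:
  assumes l: "l < k" "m < k" "l \<noteq> m"
  shows "operm k = (\<lambda>p. transpose l m \<circ> p) ` eperm k" "inj_on (\<lambda>p. transpose l m \<circ> p) (eperm k)"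
proof -
  let ?t = "transpose l m"
  have tp: "?t permutes {..<k}" using l by (intro permutes_swap_id) auto
  have pm: "permutation p" if "p permutes {..<k}" for p using that permutation_permutes by blast
  have ev: "evenperm (?t \<circ> p) \<longleftrightarrow> \<not> evenperm p" if "p permutes {..<k}" for p
    using evenperm_comp[OF permutation_swap_id pm[OF that], of l m] l evenperm_swap[of l m] by auto
  have cl: "?t \<circ> p permutes {..<k}" if "p permutes {..<k}" for p using permutes_compose[OF that tp] .
  have inv: "?t \<circ> (?t \<circ> p) = p" for p by (simp add: fun_eq_iff)
  show "operm k = (\<lambda>p. ?t \<circ> p) ` eperm k"
  proof (intro equalityI subsetI)
    fix p assume "p \<in> operm k"
    then have p: "p permutes {..<k}" "\<not> evenperm p" by (auto simp: operm_def)
    then have "?t \<circ> p \<in> eperm k" using ev cl by (auto simp: eperm_def)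
    then show "p \<in> (\<lambda>p. ?t \<circ> p) ` eperm k" using inv[of p] by (metis imageI)
  next
    fix p assume "p \<in> (\<lambda>p. ?t \<circ> p) ` eperm k"
    then show "p \<in> operm k" using ev cl by (auto simp: eperm_def operm_def)
  qed
  show "inj_on (\<lambda>p. ?t \<circ> p) (eperm k)" by (rule inj_on_inverseI[where g = "\<lambda>p. ?t \<circ> p"]) (rule inv)
qed

text \<open>This is the identity adj(A) A g = det(A) g read in column \<open>l\<close>. The
  hypothesis \<open>cof\<close> concerns the single products of the cofactor expansion and not the
  cofactors, because in the application membership in \<open>T\<close> is a degree count made
  separately for each permutation.\<close>

lemma det_cramer:
  assumes A: "\<And>i j. i < k \<Longrightarrow> j < k \<Longrightarrow> A i j \<in> carrier R" and g: "\<And>i. i < k \<Longrightarrow> g i \<in> carrier M"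
    and T: "sub T" and l: "l < k"
    and cof: "\<And>p i. p permutes {..<k} \<Longrightarrow> i < k \<Longrightarrow> p i = l \<Longrightarrow>
       pprod A ({..<k} - {i}) p \<odot>\<^bsub>M\<^esub> (\<Oplus>\<^bsub>M\<^esub>m\<in>{..<k}. A i m \<odot>\<^bsub>M\<^esub> g m) \<in> T"
  shows "mdet k A \<odot>\<^bsub>M\<^esub> g l \<in> T"
proof -
  let ?i = "\<lambda>p. inv_into UNIV p l"
  have ip: "?i p < k" "p (?i p) = l" if "p permutes {..<k}" for p
  proof -
    show "p (?i p) = l" using permutes_inverses(1)[OF that] .
    show "?i p < k" using permutes_in_image[OF permutes_inv[OF that], of l] l by auto
  qed
  have lt: "p i < k" if "p permutes {..<k}" "i < k" for p i using permutes_in_image[OF that(1), of i] that(2) by auto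
  have pc: "pprod A S p \<in> carrier R" if "p permutes {..<k}" "S \<subseteq> {..<k}" for p S
    unfolding pprod_def using that A lt by (intro R.finprod_closed) auto
  define t where "t p m = pprod A ({..<k} - {?i p}) p \<odot>\<^bsub>M\<^esub> (A (?i p) m \<odot>\<^bsub>M\<^esub> g m)" for p m
  have tc: "t p m \<in> carrier M" if "p permutes {..<k}" "m < k" for p m
    unfolding t_def using that pc[OF that(1)] A[OF ip(1)[OF that(1)] that(2)] g by auto
  have ec: "p permutes {..<k}" if "p \<in> eperm k" for p using that by (auto simp: eperm_def)
  have oc: "p permutes {..<k}" if "p \<in> operm k" for p using that by (auto simp: operm_def)
  note fin = finite_perms[of k]
  have sumT: "(\<Oplus>\<^bsub>M\<^esub>m\<in>{..<k}. t p m) \<in> T" if p: "p permutes {..<k}" for p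
  proof -
    have "(\<Oplus>\<^bsub>M\<^esub>m\<in>{..<k}. t p m) = pprod A ({..<k} - {?i p}) p \<odot>\<^bsub>M\<^esub> (\<Oplus>\<^bsub>M\<^esub>m\<in>{..<k}. A (?i p) m \<odot>\<^bsub>M\<^esub> g m)"
      unfolding t_def by (rule finsum_smult_ldistr[symmetric]) (use pc[OF p] A[OF ip(1)[OF p]] g in auto)
    then show ?thesis using cof[OF p ip[OF p]] by simp
  qed
  have tl: "t p l = pprod A {..<k} p \<odot>\<^bsub>M\<^esub> g l" if p: "p permutes {..<k}" for p
  proof -
    have "pprod A {..<k} p = pprod A (insert (?i p) ({..<k} - {?i p})) p" using ip(1)[OF p] by (simp add: insert_absorb)
    also have "\<dots> = A (?i p) l \<otimes> pprod A ({..<k} - {?i p}) p"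
      unfolding pprod_def using A lt[OF p] ip[OF p] l by (subst R.finprod_insert) auto
    finally show ?thesis unfolding t_def using A[OF ip(1)[OF p] l] pc[OF p] g[OF l] by (simp add: smult_assoc1 smult_lcomm[of "A (?i p) l"])
  qed
  define D where "D m = (\<Oplus>\<^bsub>M\<^esub>p\<in>eperm k. t p m) \<ominus>\<^bsub>M\<^esub> (\<Oplus>\<^bsub>M\<^esub>p\<in>operm k. t p m)" for m
  \<comment> \<open>These are the off-diagonal entries of adj(A) A, a determinant with two equal
    rows: composing with the transposition of \<open>l\<close> and \<open>m\<close> pairs even and
    odd permutations with equal terms.\<close>
  have Dz: "D m = \<zero>\<^bsub>M\<^esub>" if m: "m < k" "m \<noteq> l" for m
  proof -
    let ?t = "transpose l m"
    note im = operm_eq_image[OF l m(1) m(2)[symmetric]]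
    have sym: "t (?t \<circ> p) m = t p m" if p: "p permutes {..<k}" for p
    proof -
      have tp: "?t permutes {..<k}" using l m by (intro permutes_swap_id) auto
      have tpp: "?t \<circ> p permutes {..<k}" using permutes_compose[OF p tp] .
      let ?j = "inv_into UNIV p m"
      have j: "?j < k" "p ?j = m" using permutes_inverses(1)[OF p] permutes_in_image[OF permutes_inv[OF p], of m] m by auto
      have ij: "?i p \<noteq> ?j" using ip(2)[OF p] j(2) m by metis
      have ij2: "?i (?t \<circ> p) = ?j"
        using permutes_inv_eq[OF tpp, of l ?j] j(2) by simp
      have oth: "A i ((?t \<circ> p) i) = A i (p i)" if "i < k" "i \<noteq> ?i p" "i \<noteq> ?j" for i
      proof -
        have "p i \<noteq> l" "p i \<noteq> m" using that permutes_inverses(2)[OF p, of i] by metis+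
        then show ?thesis by simp
      qed
      let ?S = "{..<k} - {?i p} - {?j}"
      have "pprod A ({..<k} - {?j}) (?t \<circ> p) = pprod A (insert (?i p) ?S) (?t \<circ> p)"
        using ij ip(1)[OF p] by (intro arg_cong[where f = "\<lambda>S. pprod A S _"]) auto
      also have "\<dots> = A (?i p) m \<otimes> pprod A ?S (?t \<circ> p)"
        unfolding pprod_def using A lt[OF tpp] ip[OF p] m by (subst R.finprod_insert) auto
      also have "pprod A ?S (?t \<circ> p) = pprod A ?S p"
        unfolding pprod_def using oth A lt[OF p] by (intro R.finprod_cong') auto
      finally have 1: "pprod A ({..<k} - {?j}) (?t \<circ> p) = A (?i p) m \<otimes> pprod A ?S p" .
      have "pprod A ({..<k} - {?i p}) p = pprod A (insert ?j ?S) p"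
        using ij j(1) by (intro arg_cong[where f = "\<lambda>S. pprod A S _"]) auto
      also have "\<dots> = A ?j m \<otimes> pprod A ?S p"
        unfolding pprod_def using A lt[OF p] j m by (subst R.finprod_insert) auto
      finally have 2: "pprod A ({..<k} - {?i p}) p = A ?j m \<otimes> pprod A ?S p" .
      have c: "A (?i p) m \<in> carrier R" "A ?j m \<in> carrier R" "pprod A ?S p \<in> carrier R" "g m \<in> carrier M"
        using A[OF ip(1)[OF p] m(1)] A[OF j(1) m(1)] g[OF m(1)] pc[OF p, of ?S] by auto
      show ?thesis unfolding t_def ij2 1 2 using c
        by (simp add: smult_assoc1[symmetric] R.m_ac)
    qed
    have "(\<Oplus>\<^bsub>M\<^esub>p\<in>operm k. t p m) = (\<Oplus>\<^bsub>M\<^esub>p\<in>eperm k. t (?t \<circ> p) m)"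
      unfolding im(1) by (rule M.finsum_reindex[OF _ im(2)]) (use tc oc m im(1) in auto)
    also have "\<dots> = (\<Oplus>\<^bsub>M\<^esub>p\<in>eperm k. t p m)"
      by (rule M.finsum_cong') (use sym ec tc m in auto)
    finally have "(\<Oplus>\<^bsub>M\<^esub>p\<in>operm k. t p m) = (\<Oplus>\<^bsub>M\<^esub>p\<in>eperm k. t p m)" .
    moreover have "(\<Oplus>\<^bsub>M\<^esub>p\<in>eperm k. t p m) \<in> carrier M" using tc ec m by (intro M.finsum_closed) auto
    ultimately show ?thesis by (simp add: D_def a_minus_def M.r_neg)
  qed
  have sE: "(\<Oplus>\<^bsub>M\<^esub>p\<in>eperm k. t p m) \<in> carrier M" if "m < k" for m using that tc ec by (intro M.finsum_closed) auto
  have sO: "(\<Oplus>\<^bsub>M\<^esub>p\<in>operm k. t p m) \<in> carrier M" if "m < k" for m using that tc oc by (intro M.finsum_closed) auto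
  have split: "D l \<oplus>\<^bsub>M\<^esub> (\<Oplus>\<^bsub>M\<^esub>m\<in>{..<k}. \<Oplus>\<^bsub>M\<^esub>p\<in>operm k. t p m) = (\<Oplus>\<^bsub>M\<^esub>m\<in>{..<k}. \<Oplus>\<^bsub>M\<^esub>p\<in>eperm k. t p m)"
  proof -
    have Dc: "D m \<in> carrier M" if "m < k" for m unfolding D_def using sE[OF that] sO[OF that] by auto
    have "D l = (\<Oplus>\<^bsub>M\<^esub>m\<in>{..<k}. D m)" by (rule finsum_single[symmetric]) (use l Dz Dc in auto)
    then have "D l \<oplus>\<^bsub>M\<^esub> (\<Oplus>\<^bsub>M\<^esub>m\<in>{..<k}. \<Oplus>\<^bsub>M\<^esub>p\<in>operm k. t p m) = (\<Oplus>\<^bsub>M\<^esub>m\<in>{..<k}. D m \<oplus>\<^bsub>M\<^esub> (\<Oplus>\<^bsub>M\<^esub>p\<in>operm k. t p m))"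
      using Dc sO by (subst M.finsum_addf) auto
    also have "\<dots> = (\<Oplus>\<^bsub>M\<^esub>m\<in>{..<k}. \<Oplus>\<^bsub>M\<^esub>p\<in>eperm k. t p m)"
      by (rule M.finsum_cong') (use sE sO add_minus_cancel(2) in \<open>auto simp: D_def\<close>)
    finally show ?thesis .
  qed
  have "(\<Oplus>\<^bsub>M\<^esub>m\<in>{..<k}. \<Oplus>\<^bsub>M\<^esub>p\<in>eperm k. t p m) = (\<Oplus>\<^bsub>M\<^esub>p\<in>eperm k. \<Oplus>\<^bsub>M\<^esub>m\<in>{..<k}. t p m)"
    by (rule finsum_M_swap) (use fin tc ec in auto)
  also have "\<dots> \<in> T" by (rule stable_finsum[OF T fin(1)]) (use sumT ec in auto)
  finally have eT: "(\<Oplus>\<^bsub>M\<^esub>m\<in>{..<k}. \<Oplus>\<^bsub>M\<^esub>p\<in>eperm k. t p m) \<in> T" .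
  have "(\<Oplus>\<^bsub>M\<^esub>m\<in>{..<k}. \<Oplus>\<^bsub>M\<^esub>p\<in>operm k. t p m) = (\<Oplus>\<^bsub>M\<^esub>p\<in>operm k. \<Oplus>\<^bsub>M\<^esub>m\<in>{..<k}. t p m)"
    by (rule finsum_M_swap) (use fin tc oc in auto)
  also have "\<dots> \<in> T" by (rule stable_finsum[OF T fin(2)]) (use sumT oc in auto)
  finally have oT: "(\<Oplus>\<^bsub>M\<^esub>m\<in>{..<k}. \<Oplus>\<^bsub>M\<^esub>p\<in>operm k. t p m) \<in> T" .
  have Dlc: "D l \<in> carrier M" unfolding D_def using sE[OF l] sO[OF l] by auto
  have "D l \<in> T" using stable_add_iff[OF T Dlc oT] eT split by simp
  moreover have "mdet k A \<odot>\<^bsub>M\<^esub> g l = D l"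
  proof -
    have "(\<Oplus>p\<in>eperm k. pprod A {..<k} p) \<odot>\<^bsub>M\<^esub> g l = (\<Oplus>\<^bsub>M\<^esub>p\<in>eperm k. t p l)"
      using fin pc ec g[OF l] by (subst finsum_smult_rdistr) (auto intro!: M.finsum_cong' simp: tl)
    moreover have "(\<Oplus>p\<in>operm k. pprod A {..<k} p) \<odot>\<^bsub>M\<^esub> g l = (\<Oplus>\<^bsub>M\<^esub>p\<in>operm k. t p l)"
      using fin pc oc g[OF l] by (subst finsum_smult_rdistr) (auto intro!: M.finsum_cong' simp: tl)
    moreover have "(\<Oplus>p\<in>eperm k. pprod A {..<k} p) \<in> carrier R" "(\<Oplus>p\<in>operm k. pprod A {..<k} p) \<in> carrier R"
      using pc ec oc by (auto intro!: R.finsum_closed)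
    ultimately show ?thesis unfolding mdet_def D_def using g[OF l] by (simp add: smult_l_diff)
  qed
  ultimately show ?thesis by simp
qed

lemma mdet_diff:
  assumes A: "\<And>i j. i < k \<Longrightarrow> j < k \<Longrightarrow> A i j \<in> carrier R" and I: "ideal I R"
    and off: "\<And>p. p permutes {..<k} \<Longrightarrow> p \<noteq> id \<Longrightarrow> pprod A {..<k} p \<in> I"
  shows "mdet k A \<ominus> pprod A {..<k} id \<in> I"
proof -
  interpret I: ideal I R by fact
  have lt: "p i < k" if "p permutes {..<k}" "i < k" for p i using permutes_in_image[OF that(1), of i] that(2) by auto
  have pc: "pprod A {..<k} p \<in> carrier R" if "p permutes {..<k}" for p
    unfolding pprod_def using that A lt by (intro R.finprod_closed) auto
  have ic: "pprod A {..<k} id \<in> carrier R" by (rule pc[OF permutes_id])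
  have ie: "id \<in> eperm k" by (simp add: eperm_def permutes_id evenperm_id)
  have fs: "(\<Oplus>p\<in>S. pprod A {..<k} p) \<in> I" if "finite S" "\<And>p. p \<in> S \<Longrightarrow> p permutes {..<k} \<and> p \<noteq> id" for S
    using that
  proof (induction S rule: finite_induct)
    case (insert p S)
    have e: "(\<Oplus>p\<in>insert p S. pprod A {..<k} p) = pprod A {..<k} p \<oplus> (\<Oplus>p\<in>S. pprod A {..<k} p)"
      using pc insert by (intro R.finsum_insert) auto
    have "pprod A {..<k} p \<in> I" "(\<Oplus>p\<in>S. pprod A {..<k} p) \<in> I" using insert off[of p] insert.prems[of p] by (simp_all add: insert.IH)
    then show ?case unfolding e by (rule I.a_closed)
  qed simp
  have "(\<Oplus>p\<in>eperm k. pprod A {..<k} p) = (\<Oplus>p\<in>insert id (eperm k - {id}). pprod A {..<k} p)" using ie by (simp add: insert_absorb)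
  also have "\<dots> = pprod A {..<k} id \<oplus> (\<Oplus>p\<in>eperm k - {id}. pprod A {..<k} p)"
    using finite_perms pc ic by (intro R.finsum_insert) (auto simp: eperm_def)
  finally have e: "(\<Oplus>p\<in>eperm k. pprod A {..<k} p) = pprod A {..<k} id \<oplus> (\<Oplus>p\<in>eperm k - {id}. pprod A {..<k} p)" .
  have 1: "(\<Oplus>p\<in>eperm k - {id}. pprod A {..<k} p) \<in> I" by (rule fs) (use finite_perms in \<open>auto simp: eperm_def\<close>)
  have 2: "(\<Oplus>p\<in>operm k. pprod A {..<k} p) \<in> I" by (rule fs) (use finite_perms evenperm_id in \<open>auto simp: operm_def id_def\<close>)
  have "mdet k A \<ominus> pprod A {..<k} id = (\<Oplus>p\<in>eperm k - {id}. pprod A {..<k} p) \<ominus> (\<Oplus>p\<in>operm k. pprod A {..<k} p)"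
    unfolding mdet_def e using ic I.Icarr[OF 1] I.Icarr[OF 2] by algebra
  then show ?thesis using 1 2 by (simp add: a_minus_def)
qed

end

section \<open>Degree bookkeeping and the Cayley-Hamilton argument\<close>

context good_filt begin

text \<open>\<open>Qa e\<close> and \<open>Ja as C e\<close> play the roles of \<open>\<qq>\<^sup>e\<close> and, modulo \<open>C\<close>, of \<open>J \<qq>\<^sup>e\<^sup>-\<^sup>1\<close>; only their effect on the
  filtration matters.\<close>
definition "Qa e = {s \<in> carrier R. \<forall>n. \<forall>v\<in>F n. s \<odot>\<^bsub>M\<^esub> v \<in> F (n + e)}"
definition "W as C n = msum M C (lsum M as (F n))"
definition "Ja as C e = {s \<in> Qa e. e \<noteq> 0 \<longrightarrow> (\<forall>n. \<forall>v\<in>F n. s \<odot>\<^bsub>M\<^esub> v \<in> W as C (n + e - 1))}"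
text \<open>Coefficients by which a generator of degree \<open>d\<close> may enter degree
  \<open>e\<close>: any scalar when the degrees agree, a coefficient carrying a factor from
  \<open>J\<close> when \<open>e\<close> is larger, and nothing when \<open>e\<close> is
  smaller.\<close>

definition "pw as C e d = (if d \<le> e then Ja as C (e - d) else {\<zero>})"
text \<open>Degree 0 is exceptional because the generators of degree one are chosen modulo F_1; this
  exception is what later removes the term n = 0 from e_1.\<close>

definition "Wd as C n = (if n = 0 then F 1 else W as C n)"
text \<open>The normal form expected of elements of G_{n+1}; note the shift, which gives
  \<open>comb\<close> at \<open>n\<close> the coefficients of degree n + 1.\<close>

definition "comb as C gs n = {u \<in> carrier M. \<exists>c w. w \<in> Wd as C n \<and> (\<forall>i<length gs. c i \<in> pw as C (Suc n) (snd (gs ! i))) \<and>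
    u = w \<oplus>\<^bsub>M\<^esub> (\<Oplus>\<^bsub>M\<^esub>i\<in>{..<length gs}. c i \<odot>\<^bsub>M\<^esub> fst (gs ! i))}"

lemma Qa_mult: "s \<in> Qa a \<Longrightarrow> t \<in> Qa b \<Longrightarrow> s \<otimes> t \<in> Qa (a + b)"
proof -
  assume s: "s \<in> Qa a" and t: "t \<in> Qa b"
  show ?thesis unfolding Qa_def
  proof (intro CollectI conjI allI ballI)
    show "s \<otimes> t \<in> carrier R" using s t by (auto simp: Qa_def)
    fix n v assume v: "v \<in> F n"
    have "s \<odot>\<^bsub>M\<^esub> (t \<odot>\<^bsub>M\<^esub> v) \<in> F (n + b + a)" using s t v by (auto simp: Qa_def)
    then show "(s \<otimes> t) \<odot>\<^bsub>M\<^esub> v \<in> F (n + (a + b))"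
      using s t stableD(6)[OF F_sub v] by (simp add: Qa_def smult_assoc1 ac_simps)
  qed
qed

lemma Qa_carrier: "s \<in> Qa e \<Longrightarrow> s \<in> carrier R" by (simp add: Qa_def)
lemma q_Qa: "x \<in> q \<Longrightarrow> x \<in> Qa 1" using q_carrier F_mul by (auto simp: Qa_def)
lemma Qa_0: "carrier R \<subseteq> Qa 0" using stableD(5)[OF F_sub] by (auto simp: Qa_def)
lemma Ja_0: "Ja as C 0 = Qa 0" by (simp add: Ja_def)
lemma Ja_Qa: "s \<in> Ja as C e \<Longrightarrow> s \<in> Qa e" by (simp add: Ja_def)

context
  fixes as C and gs :: "('c \<times> nat) list"
  assumes as: "set as \<subseteq> q" and C: "sub C" "C \<subseteq> F 1" and gs: "\<And>g d. (g, d) \<in> set gs \<Longrightarrow> g \<in> carrier M \<and> d \<ge> 1"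
begin

lemma as_c: "set as \<subseteq> carrier R" using as q_carrier by auto
lemma sub_W: "sub (W as C n)" unfolding W_def by (intro sub_msum C(1) sub_lsum F_sub as_c)
lemma C_W: "C \<subseteq> W as C n" unfolding W_def by (intro msum_upper1[OF C(1)] sub_lsum F_sub as_c)
lemma lsum_W: "lsum M as (F n) \<subseteq> W as C n" unfolding W_def by (intro msum_upper2[OF C(1)] sub_lsum F_sub as_c)
lemma a_W: "a \<in> set as \<Longrightarrow> v \<in> F n \<Longrightarrow> a \<odot>\<^bsub>M\<^esub> v \<in> W as C n" using lsum_W lsum_in[OF F_sub as_c] by blast
lemma W_carrier: "W as C n \<subseteq> carrier M" using stableD(1)[OF sub_W] .
lemma gi: "i < length gs \<Longrightarrow> fst (gs ! i) \<in> carrier M \<and> snd (gs ! i) \<ge> 1" using gs[of "fst (gs ! i)" "snd (gs ! i)"] nth_mem[of i gs] by simp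

lemma Qa_W: assumes s: "s \<in> Qa e" and w: "w \<in> W as C n" shows "s \<odot>\<^bsub>M\<^esub> w \<in> W as C (n + e)"
proof -
  have sc: "s \<in> carrier R" using s by (rule Qa_carrier)
  have "W as C n \<subseteq> colon M s (W as C (n + e))" unfolding W_def[of _ _ n]
  proof (rule msum_least[OF sub_colon[OF sc sub_W]])
    show "C \<subseteq> colon M s (W as C (n + e))"
      using stableD(5)[OF C(1) sc] C_W stableD(6)[OF C(1)] by (auto simp: colon_def)
    show "lsum M as (F n) \<subseteq> colon M s (W as C (n + e))"
    proof (rule lsum_least[OF sub_colon[OF sc sub_W]])
      fix a u assume a: "a \<in> set as" and u: "u \<in> F n"
      have ac: "a \<in> carrier R" using a as_c by auto
      have "a \<odot>\<^bsub>M\<^esub> (s \<odot>\<^bsub>M\<^esub> u) \<in> W as C (n + e)" using a_W[OF a] s u by (auto simp: Qa_def)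
      then show "a \<odot>\<^bsub>M\<^esub> u \<in> colon M s (W as C (n + e))" using ac sc stableD(6)[OF F_sub u] by (simp add: colon_def smult_lcomm[of s])
    qed
  qed
  then show ?thesis using w by (auto simp: colon_def)
qed

lemma Ja_ideal: "ideal (Ja as C e) R"
proof (rule idealI[OF R.ring_axioms])
  note m = Ja_def Qa_def
  show "subgroup (Ja as C e) (add_monoid R)"
  proof (rule R.add.subgroupI)
    show "Ja as C e \<subseteq> carrier R" by (auto simp: m)
    have "\<zero> \<in> Ja as C e" using stableD(2)[OF F_sub] stableD(2)[OF sub_W] stableD(6)[OF F_sub] by (auto simp: m)
    then show "Ja as C e \<noteq> {}" by auto
  next
    fix s assume "s \<in> Ja as C e"
    then show "\<ominus> s \<in> Ja as C e" using stableD(4)[OF F_sub] stableD(4)[OF sub_W] stableD(6)[OF F_sub]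
      by (auto simp: m smult_l_minus)
  next
    fix s t assume "s \<in> Ja as C e" "t \<in> Ja as C e"
    then show "s \<oplus> t \<in> Ja as C e" using stableD(3)[OF F_sub] stableD(3)[OF sub_W] stableD(6)[OF F_sub]
      by (auto simp: m smult_l_distr)
  qed
  fix s x assume s: "s \<in> Ja as C e" and x: "x \<in> carrier R"
  then have "x \<otimes> s \<in> Ja as C e" using stableD(5)[OF F_sub x] stableD(5)[OF sub_W x] stableD(6)[OF F_sub]
    by (auto simp: m smult_assoc1)
  then show "x \<otimes> s \<in> Ja as C e" "s \<otimes> x \<in> Ja as C e" using s x by (simp_all add: R.m_comm[of s] m)
qed

text \<open>The exponent \<open>b\<close> must be positive: with exponent 0 the set
  \<open>Ja\<close> is \<open>Qa 0\<close>, that is the whole ring, and contributes no factor from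
  \<open>J\<close>.\<close>

lemma Ja_mult: assumes s: "s \<in> Ja as C b" and t: "t \<in> Qa a" and b: "b \<noteq> 0" shows "s \<otimes> t \<in> Ja as C (b + a)"
proof -
  have st: "s \<otimes> t \<in> Qa (b + a)" using Qa_mult[OF Ja_Qa[OF s] t] .
  have "(s \<otimes> t) \<odot>\<^bsub>M\<^esub> v \<in> W as C (n + (b + a) - 1)" if v: "v \<in> F n" for n v
  proof -
    have "t \<odot>\<^bsub>M\<^esub> v \<in> F (n + a)" using t v by (auto simp: Qa_def)
    then have "s \<odot>\<^bsub>M\<^esub> (t \<odot>\<^bsub>M\<^esub> v) \<in> W as C (n + a + b - 1)" using s b by (auto simp: Ja_def)
    then show ?thesis using Qa_carrier[OF t] Qa_carrier[OF Ja_Qa[OF s]] stableD(6)[OF F_sub v] by (simp add: smult_assoc1 ac_simps)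
  qed
  then show ?thesis using st by (auto simp: Ja_def)
qed

lemma a_Ja: assumes a: "a \<in> set as" and s: "s \<in> Ja as C e" shows "a \<otimes> s \<in> Ja as C (Suc e)"
proof -
  have ac: "a \<in> carrier R" "a \<in> q" using a as_c as by auto
  have "a \<in> Ja as C 1" using q_Qa[OF ac(2)] a_W[OF a] by (auto simp: Ja_def)
  then show ?thesis using Ja_mult[OF _ Ja_Qa[OF s], of a 1] by simp
qed

lemma pw_ideal: "ideal (pw as C e d) R" unfolding pw_def using Ja_ideal R.zeroideal by auto
lemma pw_carrier: "s \<in> pw as C e d \<Longrightarrow> s \<in> carrier R" using ideal.Icarr[OF pw_ideal] .
lemma a_pw: "a \<in> set as \<Longrightarrow> s \<in> pw as C e d \<Longrightarrow> a \<otimes> s \<in> pw as C (Suc e) d"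
proof (cases "d \<le> e")
  case True
  assume "a \<in> set as" "s \<in> pw as C e d"
  then show ?thesis using True a_Ja[of a s "e - d"] by (simp add: pw_def Suc_diff_le)
next
  case False
  assume "a \<in> set as" "s \<in> pw as C e d"
  then show ?thesis using False as_c additive_subgroup.zero_closed[OF ideal.axioms(1)[OF pw_ideal]] by (auto simp: pw_def[of _ _ e])
qed

lemma sub_Wd: "sub (Wd as C n)" unfolding Wd_def using sub_W F_sub by auto
lemma C_Wd: "C \<subseteq> Wd as C n" unfolding Wd_def using C_W C(2) by auto

lemma sub_comb: "sub (comb as C gs n)"
proof -
  let ?k = "length gs" and ?g = "\<lambda>i. fst (gs ! i)" and ?d = "\<lambda>i. snd (gs ! i)"
  let ?ok = "\<lambda>c w. w \<in> Wd as C n \<and> (\<forall>i<?k. c i \<in> pw as C (Suc n) (?d i))"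
  let ?S = "\<lambda>c. \<Oplus>\<^bsub>M\<^esub>i\<in>{..<?k}. c i \<odot>\<^bsub>M\<^esub> ?g i"
  have I: "w \<oplus>\<^bsub>M\<^esub> ?S c \<in> comb as C gs n" if "?ok c w" for c w
  proof -
    have "w \<in> carrier M" using that stableD(6)[OF sub_Wd] by auto
    moreover have "?S c \<in> carrier M" by (rule M.finsum_closed) (use that gi pw_carrier in \<open>auto intro!: smult_closed\<close>)
    ultimately show ?thesis unfolding comb_def using that by blast
  qed
  have wc: "w \<in> carrier M" if "?ok c w" for c w using that stableD(6)[OF sub_Wd] by auto
  have cg: "c i \<odot>\<^bsub>M\<^esub> ?g i \<in> carrier M" "c i \<in> carrier R" "?g i \<in> carrier M" if "?ok c w" "i < ?k" for c w i
    using that gi pw_carrier by auto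
  have Sc: "?S c \<in> carrier M" if "?ok c w" for c w using cg[OF that] by (auto intro!: M.finsum_closed)
  show ?thesis unfolding stab_def
  proof (intro conjI ballI)
    show "comb as C gs n \<subseteq> carrier M" by (auto simp: comb_def)
    have z: "?ok (\<lambda>_. \<zero>) (\<zero>\<^bsub>M\<^esub>)" using stableD(2)[OF sub_Wd] additive_subgroup.zero_closed[OF ideal.axioms(1)[OF pw_ideal]] by auto
    have "?S (\<lambda>_. \<zero>) = (\<Oplus>\<^bsub>M\<^esub>i\<in>{..<?k}. \<zero>\<^bsub>M\<^esub>)" using gi by (intro M.finsum_cong') auto
    then show "\<zero>\<^bsub>M\<^esub> \<in> comb as C gs n" using I[OF z] by (simp add: M.finsum_zero)
  next
    fix x y assume "x \<in> comb as C gs n" "y \<in> comb as C gs n"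
    then obtain c w c' w' where x: "?ok c w" "x = w \<oplus>\<^bsub>M\<^esub> ?S c" and y: "?ok c' w'" "y = w' \<oplus>\<^bsub>M\<^esub> ?S c'" by (auto simp: comb_def)
    have ok: "?ok (\<lambda>i. c i \<oplus> c' i) (w \<oplus>\<^bsub>M\<^esub> w')" using x y stableD(3)[OF sub_Wd] additive_subgroup.a_closed[OF ideal.axioms(1)[OF pw_ideal]] by auto
    have "?S (\<lambda>i. c i \<oplus> c' i) = (\<Oplus>\<^bsub>M\<^esub>i\<in>{..<?k}. c i \<odot>\<^bsub>M\<^esub> ?g i \<oplus>\<^bsub>M\<^esub> c' i \<odot>\<^bsub>M\<^esub> ?g i)"
      using cg[OF x(1)] cg[OF y(1)] by (intro M.finsum_cong') (auto simp: smult_l_distr)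
    also have "\<dots> = ?S c \<oplus>\<^bsub>M\<^esub> ?S c'" using cg[OF x(1)] cg[OF y(1)] by (intro M.finsum_addf) auto
    finally show "x \<oplus>\<^bsub>M\<^esub> y \<in> comb as C gs n" using I[OF ok] x y wc[OF x(1)] wc[OF y(1)] Sc[OF x(1)] Sc[OF y(1)] by (simp add: M.a_ac)
  next
    fix x assume "x \<in> comb as C gs n"
    then obtain c w where x: "?ok c w" "x = w \<oplus>\<^bsub>M\<^esub> ?S c" by (auto simp: comb_def)
    have ok: "?ok (\<lambda>i. \<ominus> \<one> \<otimes> c i) (\<ominus> \<one> \<odot>\<^bsub>M\<^esub> w)" using x stableD(5)[OF sub_Wd] ideal.I_l_closed[OF pw_ideal] by auto
    have "?S (\<lambda>i. \<ominus> \<one> \<otimes> c i) = (\<Oplus>\<^bsub>M\<^esub>i\<in>{..<?k}. \<ominus> \<one> \<odot>\<^bsub>M\<^esub> (c i \<odot>\<^bsub>M\<^esub> ?g i))"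
      using cg[OF x(1)] by (intro M.finsum_cong') (auto simp: smult_assoc1)
    also have "\<dots> = \<ominus> \<one> \<odot>\<^bsub>M\<^esub> ?S c" using cg[OF x(1)] by (intro finsum_smult_ldistr[symmetric]) auto
    finally have "\<ominus> \<one> \<odot>\<^bsub>M\<^esub> x \<in> comb as C gs n" using I[OF ok] x wc[OF x(1)] Sc[OF x(1)] by (simp add: smult_r_distr)
    then show "\<ominus>\<^bsub>M\<^esub> x \<in> comb as C gs n" using x wc[OF x(1)] Sc[OF x(1)] by (simp add: smult_l_minus)
  next
    fix a x assume a: "a \<in> carrier R" and "x \<in> comb as C gs n"
    then obtain c w where x: "?ok c w" "x = w \<oplus>\<^bsub>M\<^esub> ?S c" by (auto simp: comb_def)
    have ok: "?ok (\<lambda>i. a \<otimes> c i) (a \<odot>\<^bsub>M\<^esub> w)" using x a stableD(5)[OF sub_Wd] ideal.I_l_closed[OF pw_ideal] by auto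
    have "?S (\<lambda>i. a \<otimes> c i) = (\<Oplus>\<^bsub>M\<^esub>i\<in>{..<?k}. a \<odot>\<^bsub>M\<^esub> (c i \<odot>\<^bsub>M\<^esub> ?g i))"
      using cg[OF x(1)] a by (intro M.finsum_cong') (auto simp: smult_assoc1)
    also have "\<dots> = a \<odot>\<^bsub>M\<^esub> ?S c" using cg[OF x(1)] a by (intro finsum_smult_ldistr[symmetric]) auto
    finally show "a \<odot>\<^bsub>M\<^esub> x \<in> comb as C gs n" using I[OF ok] x wc[OF x(1)] Sc[OF x(1)] a by (simp add: smult_r_distr)
  qed
qed

lemma Wd_comb: "Wd as C n \<subseteq> comb as C gs n"
proof
  fix w assume w: "w \<in> Wd as C n"
  let ?k = "length gs"
  have wc: "w \<in> carrier M" using w stableD(6)[OF sub_Wd] by auto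
  have "(\<Oplus>\<^bsub>M\<^esub>i\<in>{..<?k}. \<zero> \<odot>\<^bsub>M\<^esub> fst (gs ! i)) = (\<Oplus>\<^bsub>M\<^esub>i\<in>{..<?k}. \<zero>\<^bsub>M\<^esub>)" using gi by (intro M.finsum_cong') auto
  then have "w = w \<oplus>\<^bsub>M\<^esub> (\<Oplus>\<^bsub>M\<^esub>i\<in>{..<?k}. \<zero> \<odot>\<^bsub>M\<^esub> fst (gs ! i))" using wc by (simp add: M.finsum_zero)
  then show "w \<in> comb as C gs n" unfolding comb_def using w wc additive_subgroup.zero_closed[OF ideal.axioms(1)[OF pw_ideal]]
    by (intro CollectI conjI exI[of _ "\<lambda>_. \<zero>"] exI[of _ w]) auto
qed

lemma gen_comb: assumes l: "l < length gs" and d: "snd (gs ! l) = Suc n" shows "fst (gs ! l) \<in> comb as C gs n"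
proof -
  let ?k = "length gs"
  let ?c = "\<lambda>i. if i = l then \<one> else \<zero>"
  have "(\<Oplus>\<^bsub>M\<^esub>i\<in>{..<?k}. ?c i \<odot>\<^bsub>M\<^esub> fst (gs ! i)) = ?c l \<odot>\<^bsub>M\<^esub> fst (gs ! l)"
    by (rule finsum_single) (use l gi in auto)
  then have e1: "fst (gs ! l) = \<zero>\<^bsub>M\<^esub> \<oplus>\<^bsub>M\<^esub> (\<Oplus>\<^bsub>M\<^esub>i\<in>{..<?k}. ?c i \<odot>\<^bsub>M\<^esub> fst (gs ! i))" using gi[OF l] by simp
  have e2: "?c i \<in> pw as C (Suc n) (snd (gs ! i))" for i
  proof (cases "i = l")
    case True then show ?thesis using d Qa_0 by (auto simp: pw_def Ja_0)
  next
    case False then show ?thesis using additive_subgroup.zero_closed[OF ideal.axioms(1)[OF pw_ideal]] by simp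
  qed
  show ?thesis unfolding comb_def
  proof (intro CollectI conjI exI)
    show "fst (gs ! l) \<in> carrier M" using gi[OF l] by simp
    show "\<zero>\<^bsub>M\<^esub> \<in> Wd as C n" by (rule stableD(2)[OF sub_Wd])
    show "\<forall>i<?k. ?c i \<in> pw as C (Suc n) (snd (gs ! i))" using e2 by blast
  qed (rule e1)
qed

lemma a_comb: assumes a: "a \<in> set as" and u: "u \<in> comb as C gs n" shows "a \<odot>\<^bsub>M\<^esub> u \<in> comb as C gs (Suc n)"
proof -
  let ?k = "length gs" and ?g = "\<lambda>i. fst (gs ! i)" and ?d = "\<lambda>i. snd (gs ! i)"
  have ac: "a \<in> carrier R" "a \<in> q" using a as_c as by auto
  obtain c w where cw: "w \<in> Wd as C n" "\<And>i. i < ?k \<Longrightarrow> c i \<in> pw as C (Suc n) (?d i)" "u = w \<oplus>\<^bsub>M\<^esub> (\<Oplus>\<^bsub>M\<^esub>i\<in>{..<?k}. c i \<odot>\<^bsub>M\<^esub> ?g i)"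
    using u by (auto simp: comb_def)
  have cc: "c i \<in> carrier R" if "i < ?k" for i using cw(2)[OF that] pw_carrier by auto
  have wc: "w \<in> carrier M" using stableD(6)[OF sub_Wd cw(1)] .
  have aw: "a \<odot>\<^bsub>M\<^esub> w \<in> Wd as C (Suc n)"
  proof (cases n)
    case 0 then show ?thesis using cw(1) a_W[OF a, of w 1] by (simp add: Wd_def)
  next
    case (Suc m) then show ?thesis using cw(1) Qa_W[OF q_Qa[OF ac(2)], of w n] by (simp add: Wd_def)
  qed
  have S: "a \<odot>\<^bsub>M\<^esub> (\<Oplus>\<^bsub>M\<^esub>i\<in>{..<?k}. c i \<odot>\<^bsub>M\<^esub> ?g i) = (\<Oplus>\<^bsub>M\<^esub>i\<in>{..<?k}. (a \<otimes> c i) \<odot>\<^bsub>M\<^esub> ?g i)"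
  proof -
    have "a \<odot>\<^bsub>M\<^esub> (\<Oplus>\<^bsub>M\<^esub>i\<in>{..<?k}. c i \<odot>\<^bsub>M\<^esub> ?g i) = (\<Oplus>\<^bsub>M\<^esub>i\<in>{..<?k}. a \<odot>\<^bsub>M\<^esub> (c i \<odot>\<^bsub>M\<^esub> ?g i))"
      using cc gi ac by (intro finsum_smult_ldistr) auto
    also have "\<dots> = (\<Oplus>\<^bsub>M\<^esub>i\<in>{..<?k}. (a \<otimes> c i) \<odot>\<^bsub>M\<^esub> ?g i)"
      using cc gi ac by (intro M.finsum_cong') (auto simp: smult_assoc1)
    finally show ?thesis .
  qed
  have Sc: "(\<Oplus>\<^bsub>M\<^esub>i\<in>{..<?k}. c i \<odot>\<^bsub>M\<^esub> ?g i) \<in> carrier M" using cc gi by (intro M.finsum_closed) auto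
  have "a \<odot>\<^bsub>M\<^esub> u = a \<odot>\<^bsub>M\<^esub> w \<oplus>\<^bsub>M\<^esub> (\<Oplus>\<^bsub>M\<^esub>i\<in>{..<?k}. (a \<otimes> c i) \<odot>\<^bsub>M\<^esub> ?g i)"
    using cw(3) wc Sc ac by (simp add: smult_r_distr S)
  moreover have "a \<odot>\<^bsub>M\<^esub> u \<in> carrier M" using cw(3) wc Sc ac by simp
  ultimately show ?thesis unfolding comb_def using aw a_pw[OF a cw(2)] by (intro CollectI conjI exI[of _ "\<lambda>i. a \<otimes> c i"] exI[of _ "a \<odot>\<^bsub>M\<^esub> w"]) auto
qed

text \<open>The hypotheses say that G_1 is generated over F_1, and G_{n+1} over J G_n + C, by the
  listed elements of the matching degree. Since multiplication by a member of \<open>as\<close> maps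
  normal forms to normal forms of the next degree, induction gives a normal form for all of
  G.\<close>

lemma G_comb:
  fixes G :: "nat \<Rightarrow> 'c set"
  assumes h0: "\<And>T. sub T \<Longrightarrow> F 1 \<subseteq> T \<Longrightarrow> (\<And>g. (g, 1) \<in> set gs \<Longrightarrow> g \<in> T) \<Longrightarrow> G 1 \<subseteq> T"
    and h1: "\<And>n T. n \<ge> 1 \<Longrightarrow> sub T \<Longrightarrow> C \<subseteq> T \<Longrightarrow> (\<And>a u. a \<in> set as \<Longrightarrow> u \<in> G n \<Longrightarrow> a \<odot>\<^bsub>M\<^esub> u \<in> T) \<Longrightarrow> (\<And>g. (g, Suc n) \<in> set gs \<Longrightarrow> g \<in> T) \<Longrightarrow> G (Suc n) \<subseteq> T"
  shows "G (Suc n) \<subseteq> comb as C gs n"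
proof (induction n)
  have gc: "g \<in> comb as C gs n" if "(g, Suc n) \<in> set gs" for g n
    using that gen_comb by (metis in_set_conv_nth fst_conv snd_conv)
  {
    case 0 
    have "F 1 \<subseteq> comb as C gs 0" using Wd_comb[of 0] by (simp add: Wd_def)
    then show ?case using h0[OF sub_comb, of 0] gc[of _ 0] by simp
  next
    case (Suc n)
    have "C \<subseteq> comb as C gs (Suc n)" using C_Wd Wd_comb by (rule subset_trans)
    then show ?case using a_comb[OF _ subsetD[OF Suc]] gc[of _ "Suc n"] by (intro h1[OF _ sub_comb]) simp_all
  }
qed

text \<open>Homogeneity of determinants: entry (i, l) has degree d_i + 1 - d_l. A product that would
  need an entry of negative degree vanishes, which keeps the truncated subtractions honest.\<close>

lemma pprod_Qa:
  assumes A: "\<And>i l. i < length gs \<Longrightarrow> l < length gs \<Longrightarrow> (if d l \<le> Suc (d i) then A i l \<in> Qa (Suc (d i) - d l) else A i l = \<zero>)"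
    and p: "p permutes {..<length gs}"
  shows "finite S \<Longrightarrow> S \<subseteq> {..<length gs} \<Longrightarrow>
    pprod A S p = \<zero> \<or> ((\<Sum>i\<in>S. d (p i)) \<le> (\<Sum>i\<in>S. Suc (d i)) \<and> pprod A S p \<in> Qa ((\<Sum>i\<in>S. Suc (d i)) - (\<Sum>i\<in>S. d (p i))))"
proof (induction S rule: finite_induct)
  case empty then show ?case using Qa_0 by (auto simp: pprod_def)
next
  case (insert i S)
  have pl: "p i < length gs" if "i < length gs" for i using permutes_in_image[OF p, of i] that by auto
  have Ac: "A i (p i) \<in> carrier R" if "i < length gs" for i
    using A[OF that pl[OF that]] Qa_carrier by (auto split: if_splits)
  have i: "i < length gs" and S: "\<And>j. j \<in> S \<Longrightarrow> j < length gs" using insert by auto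
  have e: "pprod A (insert i S) p = A i (p i) \<otimes> pprod A S p"
    unfolding pprod_def using insert Ac[OF i] Ac S by (intro R.finprod_insert) auto
  have Sc: "pprod A S p \<in> carrier R" unfolding pprod_def using Ac S by (intro R.finprod_closed) auto
  show ?case
  proof (cases "pprod A S p = \<zero> \<or> A i (p i) = \<zero>")
    case True then show ?thesis using e Sc Ac[OF i] by auto
  next
    case False
    then have 1: "(\<Sum>i\<in>S. d (p i)) \<le> (\<Sum>i\<in>S. Suc (d i))" "pprod A S p \<in> Qa ((\<Sum>i\<in>S. Suc (d i)) - (\<Sum>i\<in>S. d (p i)))" using insert by auto
    have 2: "d (p i) \<le> Suc (d i)" "A i (p i) \<in> Qa (Suc (d i) - d (p i))" using A[OF i pl[OF i]] False by (auto split: if_splits)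
    have eq: "(Suc (d i) - d (p i)) + ((\<Sum>i\<in>S. Suc (d i)) - (\<Sum>i\<in>S. d (p i))) = (\<Sum>i\<in>insert i S. Suc (d i)) - (\<Sum>i\<in>insert i S. d (p i))"
      using 1(1) 2(1) insert(1,2) by simp
    show ?thesis using Qa_mult[OF 2(2) 1(2)] 1(1) 2(1) insert(1,2) unfolding e eq by simp
  qed
qed

text \<open>With k generators g_i of degrees d_i and arbitrary x_i in \<open>q\<close>, the normal
  forms of x_i g_i give a linear system for the g_i with right-hand sides in J F + C. Its
  determinant carries the g_i, and hence F_2, into J F + C, and it agrees with the product of the
  x_i up to coefficients from \<open>J\<close>. Hence q^k F_2 lies in J F_{k+1} + C.\<close>

theorem cayley_hamilton_reduction:
  fixes G :: "nat \<Rightarrow> 'c set"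
  assumes Gs: "\<And>n. sub (G n)" and Gq: "\<And>n x u. n \<ge> 1 \<Longrightarrow> x \<in> q \<Longrightarrow> u \<in> G n \<Longrightarrow> x \<odot>\<^bsub>M\<^esub> u \<in> G (Suc n)"
    and FG: "F 2 \<subseteq> G 2" and gG: "\<And>g d. (g, d) \<in> set gs \<Longrightarrow> g \<in> G d"
    and h0: "\<And>T. sub T \<Longrightarrow> F 1 \<subseteq> T \<Longrightarrow> (\<And>g. (g, 1) \<in> set gs \<Longrightarrow> g \<in> T) \<Longrightarrow> G 1 \<subseteq> T"
    and h1: "\<And>n T. n \<ge> 1 \<Longrightarrow> sub T \<Longrightarrow> C \<subseteq> T \<Longrightarrow> (\<And>a u. a \<in> set as \<Longrightarrow> u \<in> G n \<Longrightarrow> a \<odot>\<^bsub>M\<^esub> u \<in> T) \<Longrightarrow> (\<And>g. (g, Suc n) \<in> set gs \<Longrightarrow> g \<in> T) \<Longrightarrow> G (Suc n) \<subseteq> T"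
    and n: "n \<ge> Suc (length gs)"
  shows "F (Suc n) \<subseteq> W as C n"
proof -
  let ?k = "length gs"
  define g where "g i = fst (gs ! i)" for i
  define d where "d i = snd (gs ! i)" for i
  have Gc: "G (Suc n) \<subseteq> comb as C gs n" for n by (rule G_comb[where G = G]) (fact h0, fact h1)
  have gc: "g i \<in> carrier M" "d i \<ge> 1" if "i < ?k" for i using gi[OF that] by (auto simp: g_def d_def)
  \<comment> \<open>Degree 2 is the first degree in which this can work: the normal form of an
    element of F_2 has its free term in J F_1 + C, while that of an element of F_1 only has it in
    F_1.\<close>
  have Tk: "(\<Otimes>i\<in>{..<?k}. x i) \<odot>\<^bsub>M\<^esub> v \<in> W as C (Suc ?k)" if x: "\<And>i. x i \<in> q" and v: "v \<in> F 2" for x v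
  proof -
    have xc: "x i \<in> carrier R" for i using x q_carrier by auto
    have "\<exists>c w. w \<in> W as C (d i) \<and> (\<forall>l<?k. c l \<in> pw as C (Suc (d i)) (d l)) \<and>
        x i \<odot>\<^bsub>M\<^esub> g i = w \<oplus>\<^bsub>M\<^esub> (\<Oplus>\<^bsub>M\<^esub>l\<in>{..<?k}. c l \<odot>\<^bsub>M\<^esub> g l)" if i: "i < ?k" for i
    proof -
      have "g i \<in> G (d i)" using gG[of "g i" "d i"] nth_mem[OF i] by (simp add: g_def d_def)
      then have "x i \<odot>\<^bsub>M\<^esub> g i \<in> G (Suc (d i))" using Gq x gc(2)[OF i] by auto
      then have "x i \<odot>\<^bsub>M\<^esub> g i \<in> comb as C gs (d i)" using Gc by blast
      then show ?thesis unfolding comb_def g_def[symmetric] d_def[symmetric] using gc(2)[OF i] by (auto simp: Wd_def)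
    qed
    then have ex: "\<And>i. i < ?k \<Longrightarrow> \<exists>c w. w \<in> W as C (d i) \<and> (\<forall>l<?k. c l \<in> pw as C (Suc (d i)) (d l)) \<and>
        x i \<odot>\<^bsub>M\<^esub> g i = w \<oplus>\<^bsub>M\<^esub> (\<Oplus>\<^bsub>M\<^esub>l\<in>{..<?k}. c l \<odot>\<^bsub>M\<^esub> g l)" .
    define Pr where "Pr i cw \<longleftrightarrow> snd cw \<in> W as C (d i) \<and> (\<forall>l<?k. fst cw l \<in> pw as C (Suc (d i)) (d l)) \<and>
        x i \<odot>\<^bsub>M\<^esub> g i = snd cw \<oplus>\<^bsub>M\<^esub> (\<Oplus>\<^bsub>M\<^esub>l\<in>{..<?k}. fst cw l \<odot>\<^bsub>M\<^esub> g l)" for i cw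
    have "\<exists>cw. Pr i cw" if i: "i \<in> {..<?k}" for i
    proof -
      obtain c w where "w \<in> W as C (d i) \<and> (\<forall>l<?k. c l \<in> pw as C (Suc (d i)) (d l)) \<and>
        x i \<odot>\<^bsub>M\<^esub> g i = w \<oplus>\<^bsub>M\<^esub> (\<Oplus>\<^bsub>M\<^esub>l\<in>{..<?k}. c l \<odot>\<^bsub>M\<^esub> g l)" using ex[OF i[unfolded lessThan_iff]] by (elim exE)
      then show ?thesis by (intro exI[of _ "(c, w)"]) (simp add: Pr_def)
    qed
    then have "\<forall>i\<in>{..<?k}. \<exists>cw. Pr i cw" by (rule ballI)
    then obtain f where f: "\<forall>i\<in>{..<?k}. Pr i (f i)" by (rule bchoice[THEN exE])
    define c where "c i = fst (f i)" for i
    define w where "w i = snd (f i)" for i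
    have Pf: "Pr i (f i)" if "i < ?k" for i using f that by simp
    have w: "w i \<in> W as C (d i)" if "i < ?k" for i using Pf[OF that] by (simp add: Pr_def w_def)
    have cp: "c i l \<in> pw as C (Suc (d i)) (d l)" if "i < ?k" "l < ?k" for i l using Pf[OF that(1)] that(2) by (simp add: Pr_def c_def)
    have xg: "x i \<odot>\<^bsub>M\<^esub> g i = w i \<oplus>\<^bsub>M\<^esub> (\<Oplus>\<^bsub>M\<^esub>l\<in>{..<?k}. c i l \<odot>\<^bsub>M\<^esub> g l)" if "i < ?k" for i
      using Pf[OF that] by (simp add: Pr_def c_def w_def)
    have cc: "c i l \<in> carrier R" if "i < ?k" "l < ?k" for i l using pw_carrier[OF cp[OF that]] .
    have wc: "w i \<in> carrier M" if "i < ?k" for i using w[OF that] W_carrier by auto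
    \<comment> \<open>The matrix diag(x) - c, for which \<open>rows\<close> gives A g = w with w_i
      in J F_{d_i} + C.\<close>
    define A where "A i l = (if i = l then x i \<ominus> c i l else \<ominus> c i l)" for i l
    have Ac: "A i l \<in> carrier R" if "i < ?k" "l < ?k" for i l using cc[OF that] xc by (auto simp: A_def)
    have JQ: "s \<in> Ja as C e \<Longrightarrow> \<ominus> s \<in> Ja as C e" for s e
      using additive_subgroup.a_inv_closed[OF ideal.axioms(1)[OF Ja_ideal]] .
    have off: "if d l \<le> Suc (d i) then A i l \<in> Ja as C (Suc (d i) - d l) else A i l = \<zero>" if "i < ?k" "l < ?k" "i \<noteq> l" for i l
      using cp[OF that(1,2)] JQ that by (auto simp: pw_def A_def)
    have cJ1: "c i i \<in> Ja as C 1" if "i < ?k" for i using cp[OF that that] by (simp add: pw_def)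
    have AQ: "if d l \<le> Suc (d i) then A i l \<in> Qa (Suc (d i) - d l) else A i l = \<zero>" if il: "i < ?k" "l < ?k" for i l
    proof (cases "i = l")
      case True
      have "x i \<ominus> c i i \<in> Qa 1"
        unfolding Qa_def
      proof (intro CollectI conjI allI ballI)
        show "x i \<ominus> c i i \<in> carrier R" using xc cc il by auto
        fix n v assume v: "v \<in> F n"
        have "x i \<odot>\<^bsub>M\<^esub> v \<in> F (n + 1)" "c i i \<odot>\<^bsub>M\<^esub> v \<in> F (n + 1)"
          using q_Qa[OF x] Ja_Qa[OF cJ1[OF il(1)]] v by (auto simp: Qa_def)
        then show "(x i \<ominus> c i i) \<odot>\<^bsub>M\<^esub> v \<in> F (n + 1)"
          using xc cc[OF il(1) il(1)] stableD(6)[OF F_sub v] stableD(7)[OF F_sub] by (simp add: smult_l_diff)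
      qed
      then show ?thesis using True by (simp add: A_def)
    next
      case False then show ?thesis using off[OF il False] Ja_Qa by auto
    qed
    have rows: "(\<Oplus>\<^bsub>M\<^esub>m\<in>{..<?k}. A i m \<odot>\<^bsub>M\<^esub> g m) = w i" if i: "i < ?k" for i
    proof -
      let ?S = "\<Oplus>\<^bsub>M\<^esub>m\<in>{..<?k}. c i m \<odot>\<^bsub>M\<^esub> g m"
      have Sc: "?S \<in> carrier M" using cc i gc by (intro M.finsum_closed) auto
      have Am: "A i m \<odot>\<^bsub>M\<^esub> g m \<oplus>\<^bsub>M\<^esub> c i m \<odot>\<^bsub>M\<^esub> g m = (if m = i then x i \<odot>\<^bsub>M\<^esub> g i else \<zero>\<^bsub>M\<^esub>)" if "m < ?k" for m
        using that cc[OF i that] xc gc by (auto simp: A_def smult_l_diff smult_l_minus add_minus_cancel M.l_neg)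
      have "(\<Oplus>\<^bsub>M\<^esub>m\<in>{..<?k}. A i m \<odot>\<^bsub>M\<^esub> g m) \<oplus>\<^bsub>M\<^esub> ?S = (\<Oplus>\<^bsub>M\<^esub>m\<in>{..<?k}. A i m \<odot>\<^bsub>M\<^esub> g m \<oplus>\<^bsub>M\<^esub> c i m \<odot>\<^bsub>M\<^esub> g m)"
        using Ac i cc gc by (intro M.finsum_addf[symmetric]) auto
      also have "\<dots> = (\<Oplus>\<^bsub>M\<^esub>m\<in>{..<?k}. (if m = i then x i \<odot>\<^bsub>M\<^esub> g i else \<zero>\<^bsub>M\<^esub>))"
        using Am xc gc i by (intro M.finsum_cong') auto
      also have "\<dots> = x i \<odot>\<^bsub>M\<^esub> g i" using i xc gc by (subst finsum_single[of _ i]) auto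
      finally have "(\<Oplus>\<^bsub>M\<^esub>m\<in>{..<?k}. A i m \<odot>\<^bsub>M\<^esub> g m) \<oplus>\<^bsub>M\<^esub> ?S = w i \<oplus>\<^bsub>M\<^esub> ?S" using xg[OF i] by simp
      then show ?thesis using Sc wc[OF i] Ac i gc by (subst (asm) M.add.right_cancel) (auto intro!: M.finsum_closed)
    qed
    let ?\<Delta> = "mdet ?k A"
    \<comment> \<open>Omitting row i with p i = l leaves a product of degree (k - 1) + d_l - d_i,
      and w_i supplies the missing d_i.\<close>
    have \<Delta>g: "?\<Delta> \<odot>\<^bsub>M\<^esub> g l \<in> W as C (?k + d l - 1)" if l: "l < ?k" for l
    proof (rule det_cramer[OF Ac gc(1) sub_W l])
      fix p i assume p: "p permutes {..<?k}" and i: "i < ?k" "p i = l"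
      let ?S = "{..<?k} - {i}"
      have sm: "(\<Sum>j\<in>{..<?k}. f j) = f i + (\<Sum>j\<in>?S. f j)" for f :: "nat \<Rightarrow> nat" using i by (subst sum.remove[of _ i]) auto
      have pe: "(\<Sum>j\<in>{..<?k}. d (p j)) = (\<Sum>j\<in>{..<?k}. d j)" using sum.permute[OF p, of d] by (simp add: comp_def)
      have cnt: "(\<Sum>j\<in>?S. Suc (d j)) = (\<Sum>j\<in>?S. d j) + (?k - 1)" using i by (simp add: sum_Suc)
      have e: "(\<Sum>j\<in>?S. Suc (d j)) + d i = (?k - 1) + d l + (\<Sum>j\<in>?S. d (p j))"
        using sm[of d] sm[of "\<lambda>j. d (p j)"] pe cnt i by simp
      have "pprod A ?S p \<odot>\<^bsub>M\<^esub> w i \<in> W as C (?k + d l - 1)"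
      proof (cases "pprod A ?S p = \<zero>")
        case True then show ?thesis using wc[OF i(1)] stableD(2)[OF sub_W] by simp
      next
        case False
        then have *: "(\<Sum>j\<in>?S. d (p j)) \<le> (\<Sum>j\<in>?S. Suc (d j))" "pprod A ?S p \<in> Qa ((\<Sum>j\<in>?S. Suc (d j)) - (\<Sum>j\<in>?S. d (p j)))"
          using pprod_Qa[where d = d and A = A and S = ?S, OF AQ p finite_Diff[OF finite_lessThan] Diff_subset] by blast+
        have "d i + ((\<Sum>j\<in>?S. Suc (d j)) - (\<Sum>j\<in>?S. d (p j))) = ?k + d l - 1" using e *(1) i by simp
        then show ?thesis using Qa_W[OF *(2) w[OF i(1)]] by simp
      qed
      then show "pprod A ?S p \<odot>\<^bsub>M\<^esub> (\<Oplus>\<^bsub>M\<^esub>m\<in>{..<?k}. A i m \<odot>\<^bsub>M\<^esub> g m) \<in> W as C (?k + d l - 1)" using rows[OF i(1)] by simp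
    qed
    have d1: "?\<Delta> \<ominus> pprod A {..<?k} id \<in> Ja as C ?k"
    proof (rule mdet_diff[OF Ac Ja_ideal])
      fix p assume p: "p permutes {..<?k}" "p \<noteq> id"
      have pl: "p i < ?k" if "i < ?k" for i using permutes_in_image[OF p(1), of i] that by auto
      have pe: "(\<Sum>j\<in>{..<?k}. d (p j)) = (\<Sum>j\<in>{..<?k}. d j)" using sum.permute[OF p(1), of d] by (simp add: comp_def)
      \<comment> \<open>A nontrivial permutation cannot raise all moved degrees, since their sum is
        preserved. A moved index whose degree is not raised gives an off-diagonal entry of positive
        exponent, which lies in \<open>Ja\<close> and puts the entire product there.\<close>
      have "\<exists>i<?k. p i \<noteq> i \<and> d (p i) \<le> d i"
      proof (rule ccontr)
        assume n: "\<not> ?thesis"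
        obtain i where i: "p i \<noteq> i" using p(2) by (auto simp: fun_eq_iff)
        then have ik: "i < ?k" using p(1) by (auto simp: permutes_def)
        have "(\<Sum>j\<in>{..<?k}. d j) < (\<Sum>j\<in>{..<?k}. d (p j))"
        proof (rule sum_strict_mono_ex1)
          show "\<forall>j\<in>{..<?k}. d j \<le> d (p j)"
          proof
            fix j assume "j \<in> {..<?k}" then show "d j \<le> d (p j)" using n by (cases "p j = j") auto
          qed
          show "\<exists>j\<in>{..<?k}. d j < d (p j)" using n ik i by (intro bexI[of _ i]) auto
        qed simp
        then show False using pe by simp
      qed
      then obtain i where i: "i < ?k" "p i \<noteq> i" "d (p i) \<le> d i" by auto
      let ?S = "{..<?k} - {i}"
      have Ai: "A i (p i) \<in> Ja as C (Suc (d i) - d (p i))" using off[OF i(1) pl[OF i(1)] i(2)[symmetric]] i(3) by simp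
      have "pprod A {..<?k} p = pprod A (insert i ?S) p" using i by (simp add: insert_absorb)
      also have "\<dots> = A i (p i) \<otimes> pprod A ?S p" unfolding pprod_def using Ac pl i by (intro R.finprod_insert) auto
      finally have e: "pprod A {..<?k} p = A i (p i) \<otimes> pprod A ?S p" .
      show "pprod A {..<?k} p \<in> Ja as C ?k"
      proof (cases "pprod A ?S p = \<zero>")
        case True
        then show ?thesis using e Ac[OF i(1) pl[OF i(1)]] additive_subgroup.zero_closed[OF ideal.axioms(1)[OF Ja_ideal]] by simp
      next
        case False
        then have *: "(\<Sum>j\<in>?S. d (p j)) \<le> (\<Sum>j\<in>?S. Suc (d j))" "pprod A ?S p \<in> Qa ((\<Sum>j\<in>?S. Suc (d j)) - (\<Sum>j\<in>?S. d (p j)))"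
          using pprod_Qa[where d = d and A = A and S = ?S, OF AQ p(1) finite_Diff[OF finite_lessThan] Diff_subset] by blast+
        have sm: "(\<Sum>j\<in>{..<?k}. f j) = f i + (\<Sum>j\<in>?S. f j)" for f :: "nat \<Rightarrow> nat" using i by (subst sum.remove[of _ i]) auto
        have cnt: "(\<Sum>j\<in>?S. Suc (d j)) = (\<Sum>j\<in>?S. d j) + (?k - 1)" using i by (simp add: sum_Suc)
        have "(Suc (d i) - d (p i)) + ((\<Sum>j\<in>?S. Suc (d j)) - (\<Sum>j\<in>?S. d (p j))) = ?k"
          using *(1) cnt sm[of d] sm[of "\<lambda>j. d (p j)"] pe i by simp
        then show ?thesis unfolding e using Ja_mult[OF Ai *(2)] i(3) by simp
      qed
    qed
    define dg where "dg S = pprod A S id" for S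
    note d1 = d1[folded dg_def]
    \<comment> \<open>Compares the product of the diagonal entries x_i - c_ii with that of the x_i.
      For the empty set the difference is recorded as zero because \<open>Ja\<close> at exponent 0
      would say nothing, and the first factor would then gain nothing from \<open>J\<close>.\<close>
    have d2: "dg S \<ominus> (\<Otimes>i\<in>S. x i) \<in> (if S = {} then {\<zero>} else Ja as C (card S)) \<and> dg S \<in> Qa (card S) \<and> (\<Otimes>i\<in>S. x i) \<in> Qa (card S)"
      if "finite S" "S \<subseteq> {..<?k}" for S using that
    proof (induction S rule: finite_induct)
      case empty then show ?case using Qa_0 by (auto simp: dg_def pprod_def a_minus_def R.r_neg)
    next
      case (insert i S)
      have i: "i < ?k" and S: "\<And>j. j \<in> S \<Longrightarrow> j < ?k" using insert.prems by auto
      have SS: "S \<subseteq> {..<?k}" using insert.prems by auto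
      note ih = insert.IH[OF SS]
      note IH = ih[THEN conjunct1] ih[THEN conjunct2, THEN conjunct1] ih[THEN conjunct2, THEN conjunct2]
      have e1: "dg (insert i S) = (x i \<ominus> c i i) \<otimes> dg S"
      proof -
        have "dg (insert i S) = A i i \<otimes> dg S"
          unfolding dg_def pprod_def using insert(1,2) Ac[OF i i] Ac S by (subst R.finprod_insert) auto
        then show ?thesis by (simp add: A_def)
      qed
      have e2: "(\<Otimes>i\<in>insert i S. x i) = x i \<otimes> (\<Otimes>i\<in>S. x i)" using insert(1,2) xc by (intro R.finprod_insert) auto
      have cr: "dg S \<in> carrier R" "(\<Otimes>i\<in>S. x i) \<in> carrier R" "x i \<in> carrier R" "c i i \<in> carrier R"
        using IH Qa_carrier xc cc[OF i i] by auto
      have Aq: "x i \<ominus> c i i \<in> Qa 1" using AQ[OF i i] by (simp add: A_def)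
      have q1: "dg (insert i S) \<in> Qa (card (insert i S))" using Qa_mult[OF Aq IH(2)] insert(1,2) e1 by simp
      have q2: "(\<Otimes>i\<in>insert i S. x i) \<in> Qa (card (insert i S))" using Qa_mult[OF q_Qa[OF x] IH(3), of i] insert(1,2) e2 by simp
      have eq: "dg (insert i S) \<ominus> (\<Otimes>i\<in>insert i S. x i) = (dg S \<ominus> (\<Otimes>i\<in>S. x i)) \<otimes> x i \<ominus> c i i \<otimes> dg S"
        unfolding e1 e2 using cr by algebra
      have 1: "c i i \<otimes> dg S \<in> Ja as C (card (insert i S))" using Ja_mult[OF cJ1[OF i] IH(2)] insert(1,2) by simp
      have 2: "(dg S \<ominus> (\<Otimes>i\<in>S. x i)) \<otimes> x i \<in> Ja as C (card (insert i S))"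
      proof (cases "S = {}")
        case True then show ?thesis using IH(1) cr additive_subgroup.zero_closed[OF ideal.axioms(1)[OF Ja_ideal]] by (simp add: a_minus_def R.r_neg)
      next
        case False then show ?thesis using Ja_mult[OF _ q_Qa[OF x], of _ "card S" i] IH(1) insert(1,2) by simp
      qed
      have "dg (insert i S) \<ominus> (\<Otimes>i\<in>insert i S. x i) \<in> Ja as C (card (insert i S))"
        unfolding eq using 1 2 additive_subgroup.a_closed[OF ideal.axioms(1)[OF Ja_ideal]] JQ by (simp add: a_minus_def)
      then show ?case using q1 q2 by simp
    qed
    let ?X = "\<Otimes>i\<in>{..<?k}. x i"
    have Xc: "?X \<in> carrier R" using xc by (intro R.finprod_closed) auto
    have idc: "dg {..<?k} \<in> carrier R" using d2[of "{..<?k}"] Qa_carrier by auto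
    have \<Delta>c: "?\<Delta> \<in> carrier R"
    proof -
      have "?\<Delta> \<ominus> dg {..<?k} \<oplus> dg {..<?k} = ?\<Delta>" 
      proof -
        have pc: "pprod A {..<?k} p \<in> carrier R" if "p permutes {..<?k}" for p
          unfolding pprod_def using that Ac permutes_in_image[OF that] by (intro R.finprod_closed) auto
        have "?\<Delta> \<in> carrier R" unfolding mdet_def using pc by (intro R.minus_closed R.finsum_closed) (auto simp: eperm_def operm_def)
        then show ?thesis using idc by (simp add: a_minus_def R.a_assoc R.l_neg)
      qed
      then show ?thesis using Qa_carrier[OF Ja_Qa[OF d1]] idc by (metis R.a_closed)
    qed
    have \<Delta>Q: "?\<Delta> \<in> Qa ?k"
    proof -
      have "?\<Delta> = (?\<Delta> \<ominus> dg {..<?k}) \<oplus> dg {..<?k}" using \<Delta>c idc by (simp add: a_minus_def R.a_assoc R.l_neg)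
      moreover have "(?\<Delta> \<ominus> dg {..<?k}) \<oplus> dg {..<?k} \<in> Qa ?k"
      proof -
        have a: "?\<Delta> \<ominus> dg {..<?k} \<in> Qa ?k" "dg {..<?k} \<in> Qa ?k" using Ja_Qa[OF d1] d2[of "{..<?k}"] by auto
        show ?thesis unfolding Qa_def
        proof (intro CollectI conjI allI ballI)
          show "(?\<Delta> \<ominus> dg {..<?k}) \<oplus> dg {..<?k} \<in> carrier R" using \<Delta>c idc by auto
          fix n v assume v: "v \<in> F n"
          then have "(?\<Delta> \<ominus> dg {..<?k}) \<odot>\<^bsub>M\<^esub> v \<in> F (n + ?k)" "dg {..<?k} \<odot>\<^bsub>M\<^esub> v \<in> F (n + ?k)" using a by (auto simp: Qa_def)
          then show "((?\<Delta> \<ominus> dg {..<?k}) \<oplus> dg {..<?k}) \<odot>\<^bsub>M\<^esub> v \<in> F (n + ?k)"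
            using stableD(3)[OF F_sub] stableD(6)[OF F_sub v] \<Delta>c idc by (simp add: smult_l_distr)
        qed
      qed
      ultimately show ?thesis by simp
    qed
    have vG: "v \<in> comb as C gs 1"
    proof -
      have "v \<in> G (Suc 1)" using subsetD[OF FG v] by (simp add: numeral_2_eq_2)
      then show ?thesis by (rule subsetD[OF Gc])
    qed
    then obtain b u where bu: "u \<in> W as C 1" "\<And>l. l < ?k \<Longrightarrow> b l \<in> pw as C 2 (d l)" "v = u \<oplus>\<^bsub>M\<^esub> (\<Oplus>\<^bsub>M\<^esub>l\<in>{..<?k}. b l \<odot>\<^bsub>M\<^esub> g l)"
      unfolding comb_def g_def[symmetric] d_def[symmetric] by (auto simp: Wd_def numeral_2_eq_2)
    have bc: "b l \<in> carrier R" if "l < ?k" for l using pw_carrier[OF bu(2)[OF that]] .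
    have uc: "u \<in> carrier M" using bu(1) W_carrier by auto
    have \<Delta>v: "?\<Delta> \<odot>\<^bsub>M\<^esub> v \<in> W as C (Suc ?k)"
    proof -
      have "?\<Delta> \<odot>\<^bsub>M\<^esub> u \<in> W as C (Suc ?k)" using Qa_W[OF \<Delta>Q bu(1)] by simp
      moreover have "?\<Delta> \<odot>\<^bsub>M\<^esub> (\<Oplus>\<^bsub>M\<^esub>l\<in>{..<?k}. b l \<odot>\<^bsub>M\<^esub> g l) \<in> W as C (Suc ?k)"
      proof -
        have "?\<Delta> \<odot>\<^bsub>M\<^esub> (\<Oplus>\<^bsub>M\<^esub>l\<in>{..<?k}. b l \<odot>\<^bsub>M\<^esub> g l) = (\<Oplus>\<^bsub>M\<^esub>l\<in>{..<?k}. ?\<Delta> \<odot>\<^bsub>M\<^esub> (b l \<odot>\<^bsub>M\<^esub> g l))"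
          using \<Delta>c bc gc by (intro finsum_smult_ldistr) auto
        also have "\<dots> \<in> W as C (Suc ?k)"
        proof (rule stable_finsum[OF sub_W], simp, rule Pi_I)
          fix l assume "l \<in> {..<?k}" then have l: "l < ?k" by simp
          have "b l \<odot>\<^bsub>M\<^esub> (?\<Delta> \<odot>\<^bsub>M\<^esub> g l) \<in> W as C (Suc ?k)"
          proof (cases "d l \<le> 2")
            case True
            then have "b l \<in> Qa (2 - d l)" using bu(2)[OF l] Ja_Qa by (auto simp: pw_def)
            then have "b l \<odot>\<^bsub>M\<^esub> (?\<Delta> \<odot>\<^bsub>M\<^esub> g l) \<in> W as C (?k + d l - 1 + (2 - d l))" using Qa_W[OF _ \<Delta>g[OF l]] by blast
            moreover have "?k + d l - 1 + (2 - d l) = Suc ?k" using True gc(2)[OF l] by linarith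
            ultimately show ?thesis by (simp only:)
          next
            case False
            then have "b l = \<zero>" using bu(2)[OF l] by (auto simp: pw_def)
            then show ?thesis using \<Delta>c gc(1)[OF l] stableD(2)[OF sub_W] by simp
          qed
          then show "?\<Delta> \<odot>\<^bsub>M\<^esub> (b l \<odot>\<^bsub>M\<^esub> g l) \<in> W as C (Suc ?k)" using smult_lcomm[OF \<Delta>c bc[OF l] gc(1)[OF l]] by simp
        qed
        finally show ?thesis .
      qed
      moreover have "(\<Oplus>\<^bsub>M\<^esub>l\<in>{..<?k}. b l \<odot>\<^bsub>M\<^esub> g l) \<in> carrier M" using bc gc by (intro M.finsum_closed) auto
      ultimately show ?thesis using bu(3) uc \<Delta>c stableD(3)[OF sub_W] by (simp add: smult_r_distr)
    qed
    have vc: "v \<in> carrier M" using stableD(6)[OF F_sub v] .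
    show ?thesis
    proof (cases "?k = 0")
      case True
      have "v \<in> W as C 1" using vG True bu(3) bu(1) uc by simp
      then show ?thesis using True vc by simp
    next
      case False
      have dd: "?\<Delta> \<ominus> ?X \<in> Ja as C ?k"
      proof -
        have "dg {..<?k} \<ominus> ?X \<in> Ja as C ?k" 
        proof -
          have ne: "{..<?k} \<noteq> {}" using False by auto
          show ?thesis using d2[OF finite_lessThan order_refl] ne by (simp only: if_False card_lessThan)
        qed
        then have "(?\<Delta> \<ominus> dg {..<?k}) \<oplus> (dg {..<?k} \<ominus> ?X) \<in> Ja as C ?k"
          using d1 additive_subgroup.a_closed[OF ideal.axioms(1)[OF Ja_ideal]] by blast
        moreover have "(?\<Delta> \<ominus> dg {..<?k}) \<oplus> (dg {..<?k} \<ominus> ?X) = ?\<Delta> \<ominus> ?X" using \<Delta>c idc Xc by algebra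
        ultimately show ?thesis by simp
      qed
      then have "(?\<Delta> \<ominus> ?X) \<odot>\<^bsub>M\<^esub> v \<in> W as C (2 + ?k - 1)" using v False unfolding Ja_def by blast
      then have "?\<Delta> \<odot>\<^bsub>M\<^esub> v \<ominus>\<^bsub>M\<^esub> ?X \<odot>\<^bsub>M\<^esub> v \<in> W as C (Suc ?k)" using \<Delta>c Xc vc by (simp add: smult_l_diff)
      then have "?X \<odot>\<^bsub>M\<^esub> v \<ominus>\<^bsub>M\<^esub> ?\<Delta> \<odot>\<^bsub>M\<^esub> v \<in> W as C (Suc ?k)" using stable_diff_sym[OF sub_W] \<Delta>c Xc vc by auto
      then show ?thesis using stable_diff_iff[OF sub_W _ \<Delta>v] Xc vc by auto
    qed
  qed
  \<comment> \<open>F_{j+2} is generated by products of \<open>j\<close> elements of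
    \<open>q\<close> applied to F_2, so it suffices to know \<open>Tk\<close> for arbitrary
    factors.\<close>
  have span: "sub T \<Longrightarrow> (\<And>x v. (\<And>i::nat. x i \<in> q) \<Longrightarrow> v \<in> F 2 \<Longrightarrow> (\<Otimes>i\<in>{..<j}. x i) \<odot>\<^bsub>M\<^esub> v \<in> T) \<Longrightarrow> F (j + 2) \<subseteq> T" for j :: nat and T
  proof (induction j arbitrary: T)
    case 0
    have q0: "\<zero> \<in> q" using additive_subgroup.zero_closed[OF ideal.axioms(1)[OF q_ideal]] .
    show ?case using 0(2)[of "\<lambda>_. \<zero>"] q0 stableD(6)[OF F_sub] by (auto simp: numeral_2_eq_2)
  next
    case (Suc j)
    have "F (Suc (j + 2)) \<subseteq> T"
    proof (rule F_gen_least[OF _ Suc.prems(1)])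
      fix y u assume y: "y \<in> q" and u: "u \<in> F (j + 2)"
      have yc: "y \<in> carrier R" using y q_carrier by auto
      have "F (j + 2) \<subseteq> colon M y T"
      proof (rule Suc.IH[OF sub_colon[OF yc Suc.prems(1)]])
        fix x :: "nat \<Rightarrow> 'a" and v assume x: "\<And>i. x i \<in> q" and v: "v \<in> F 2"
        have xc: "x i \<in> carrier R" for i using x q_carrier by auto
        have vc: "v \<in> carrier M" using stableD(6)[OF F_sub v] .
        let ?x = "\<lambda>i. if i = j then y else x i"
        have "(\<Otimes>i\<in>{..<Suc j}. ?x i) \<odot>\<^bsub>M\<^esub> v \<in> T" using Suc.prems(2)[of ?x v] x y v by auto
        moreover have "(\<Otimes>i\<in>{..<Suc j}. ?x i) = y \<otimes> (\<Otimes>i\<in>{..<j}. ?x i)"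
          unfolding lessThan_Suc using xc yc by (subst R.finprod_insert) auto
        moreover have "(\<Otimes>i\<in>{..<j}. ?x i) = (\<Otimes>i\<in>{..<j}. x i)" using xc by (intro R.finprod_cong') auto
        moreover have "(\<Otimes>i\<in>{..<j}. x i) \<in> carrier R" using xc by (intro R.finprod_closed) auto
        ultimately show "(\<Otimes>i\<in>{..<j}. x i) \<odot>\<^bsub>M\<^esub> v \<in> colon M y T" using yc vc by (simp add: colon_def smult_assoc1)
      qed
      then show "y \<odot>\<^bsub>M\<^esub> u \<in> T" using u by (auto simp: colon_def)
    qed auto
    then show ?case by simp
  qed
  have base: "F (Suc (Suc ?k)) \<subseteq> W as C (Suc ?k)" using span[OF sub_W Tk] by simp
  show ?thesis using n
  proof (induction n rule: dec_induct)
    case base then show ?case using \<open>F (Suc (Suc ?k)) \<subseteq> W as C (Suc ?k)\<close> .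
  next
    case (step n)
    show ?case
    proof (rule F_gen_least[OF _ sub_W])
      fix z u assume z: "z \<in> q" and u: "u \<in> F (Suc n)"
      show "z \<odot>\<^bsub>M\<^esub> u \<in> W as C (Suc n)" using Qa_W[OF q_Qa[OF z], of u n] step u by auto
    qed simp
  qed
qed

end

end

section \<open>Counting generators by lengths in the one-dimensional quotient\<close>

context good_filt begin

text \<open>Each newly adjoined element enlarges the submodule properly and so uses up at least one
  unit of length.\<close>

lemma gens_extract:
  "fl B A \<Longrightarrow> sub A \<Longrightarrow> sub B \<Longrightarrow> B \<subseteq> A \<Longrightarrow>
   \<exists>us. length us \<le> ll B A \<and> set us \<subseteq> A \<and> (\<forall>T. sub T \<longrightarrow> B \<subseteq> T \<longrightarrow> set us \<subseteq> T \<longrightarrow> A \<subseteq> T)"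
proof (induction "ll B A" arbitrary: B rule: less_induct)
  case less
  show ?case
  proof (cases "A = B")
    case True then show ?thesis by (intro exI[of _ "[]"]) auto
  next
    case False
    then obtain u where u: "u \<in> A" "u \<notin> B" using less.prems by auto
    have uc: "u \<in> carrier M" using stableD(6)[OF less.prems(2) u(1)] .
    let ?B = "msum M B (cyc M (carrier R) u)"
    have B: "sub ?B" "B \<subseteq> ?B" "u \<in> ?B" using sub_msum[OF less.prems(3) stable_cyc[OF uc]] msum_upper1[OF less.prems(3) stable_cyc[OF uc]]
        msum_upper2[OF less.prems(3) stable_cyc[OF uc]] cyc_self[OF uc] by auto
    have BA: "?B \<subseteq> A" using msum_least[OF less.prems(2,4) cyc_least[OF less.prems(2) u(1)]] .
    have f: "fl B ?B" "fl ?B A" using len_add(1)[OF less.prems(2) B(1) less.prems(3) B(2) BA] less.prems(1) by auto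
    have e: "ll B A = ll B ?B + ll ?B A" using len_add(2)[OF less.prems(2) B(1) less.prems(3) B(2) BA less.prems(1)] .
    have "ll B ?B \<noteq> 0" using len_0_iff[OF f(1) B(1) less.prems(3) B(2)] u B(3) by auto
    then have "ll ?B A < ll B A" using e by simp
    from less.hyps[OF this f(2) less.prems(2) B(1) BA] obtain us where us: "length us \<le> ll ?B A" "set us \<subseteq> A"
      "\<And>T. sub T \<Longrightarrow> ?B \<subseteq> T \<Longrightarrow> set us \<subseteq> T \<Longrightarrow> A \<subseteq> T" by blast
    have "A \<subseteq> T" if "sub T" "B \<subseteq> T" "set (u # us) \<subseteq> T" for T
    proof (rule us(3)[OF that(1)])
      show "?B \<subseteq> T" using msum_least[OF that(1,2) cyc_least[OF that(1)]] that(3) by auto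
    qed (use that in auto)
    then show ?thesis using us(1,2) u(1) e \<open>ll B ?B \<noteq> 0\<close> by (intro exI[of _ "u # us"]) auto
  qed
qed

lemma reduction_from_lengths:
  fixes G :: "nat \<Rightarrow> 'c set"
  assumes as: "set as \<subseteq> q" and C: "sub C" "C \<subseteq> F 1"
    and Gs: "\<And>n. sub (G n)" and Gq: "\<And>n x u. x \<in> q \<Longrightarrow> u \<in> G n \<Longrightarrow> x \<odot>\<^bsub>M\<^esub> u \<in> G (Suc n)"
    and FG: "\<And>n. F n \<subseteq> G n" and CG: "\<And>n. C \<subseteq> G n"
    and f1: "fl (F 1) (G 1)" and fU: "\<And>n. n \<ge> 1 \<Longrightarrow> fl (msum M C (lsum M as (G n))) (G (Suc n))"
    and stab: "\<And>n. n \<ge> p \<Longrightarrow> G (Suc n) = msum M C (lsum M as (G n))"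
    and K: "ll (F 1) (G 1) + (\<Sum>n\<in>{1..<p}. ll (msum M C (lsum M as (G n))) (G (Suc n))) \<le> K"
    and n: "n \<ge> Suc K"
  shows "F (Suc n) \<subseteq> W as C n"
proof -
  let ?U = "\<lambda>n. msum M C (lsum M as (G n))"
  have asc: "set as \<subseteq> carrier R" using as q_carrier by auto
  have sU: "sub (?U n)" for n using sub_msum[OF C(1) sub_lsum[OF Gs asc]] .
  have UG: "?U n \<subseteq> G (Suc n)" for n
    by (rule msum_least[OF Gs CG lsum_least[OF Gs]]) (use Gq as in auto)
  obtain us0 where us0: "length us0 \<le> ll (F 1) (G 1)" "set us0 \<subseteq> G 1" "\<And>T. sub T \<Longrightarrow> F 1 \<subseteq> T \<Longrightarrow> set us0 \<subseteq> T \<Longrightarrow> G 1 \<subseteq> T"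
    using gens_extract[OF f1 Gs F_sub FG] by blast
  have "\<forall>n. \<exists>us. n \<ge> 1 \<longrightarrow> length us \<le> ll (?U n) (G (Suc n)) \<and> set us \<subseteq> G (Suc n) \<and> (\<forall>T. sub T \<longrightarrow> ?U n \<subseteq> T \<longrightarrow> set us \<subseteq> T \<longrightarrow> G (Suc n) \<subseteq> T)"
    using gens_extract[OF fU Gs sU UG] by blast
  then obtain us where us: "\<forall>n. n \<ge> 1 \<longrightarrow> length (us n) \<le> ll (?U n) (G (Suc n)) \<and> set (us n) \<subseteq> G (Suc n) \<and> (\<forall>T. sub T \<longrightarrow> ?U n \<subseteq> T \<longrightarrow> set (us n) \<subseteq> T \<longrightarrow> G (Suc n) \<subseteq> T)"
    by (rule choice[THEN exE])
  define gs where "gs = map (\<lambda>g. (g, 1)) us0 @ concat (map (\<lambda>n. map (\<lambda>g. (g, Suc n)) (us n)) [1..<p])"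
  have "length gs = length us0 + (\<Sum>n\<in>{1..<p}. length (us n))"
    unfolding gs_def by (simp add: length_concat comp_def interv_sum_list_conv_sum_set_nat)
  also have "(\<Sum>n\<in>{1..<p}. length (us n)) \<le> (\<Sum>n\<in>{1..<p}. ll (?U n) (G (Suc n)))" by (rule sum_mono) (use us in auto)
  finally have lg: "length gs \<le> K" using us0(1) K by linarith
  have gs: "(g, d) \<in> set gs \<longleftrightarrow> (d = 1 \<and> g \<in> set us0) \<or> (\<exists>n. 1 \<le> n \<and> n < p \<and> d = Suc n \<and> g \<in> set (us n))" for g d
    unfolding gs_def by auto
  have gG: "g \<in> G d" if "(g, d) \<in> set gs" for g d using that us0(2) us unfolding gs by auto
  show ?thesis
  proof (rule cayley_hamilton_reduction[OF as C, where G = G and gs = gs])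
    show "g \<in> carrier M \<and> 1 \<le> d" if "(g, d) \<in> set gs" for g d
      using gG[OF that] stableD(6)[OF Gs] that unfolding gs by auto
    show "sub (G n)" for n by (rule Gs)
    show "x \<odot>\<^bsub>M\<^esub> u \<in> G (Suc n)" if "x \<in> q" "u \<in> G n" for n x u using Gq that .
    show "F 2 \<subseteq> G 2" by (rule FG)
    show "g \<in> G d" if "(g, d) \<in> set gs" for g d using gG[OF that] .
    show "G 1 \<subseteq> T" if "sub T" "F 1 \<subseteq> T" "\<And>g. (g, 1) \<in> set gs \<Longrightarrow> g \<in> T" for T
      by (rule us0(3)[OF that(1,2)]) (use that(3) gs in auto)
    show "G (Suc n) \<subseteq> T" if n: "n \<ge> 1" and T: "sub T" "C \<subseteq> T" "\<And>a u. a \<in> set as \<Longrightarrow> u \<in> G n \<Longrightarrow> a \<odot>\<^bsub>M\<^esub> u \<in> T"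
      "\<And>g. (g, Suc n) \<in> set gs \<Longrightarrow> g \<in> T" for n T
    proof -
      have UT: "?U n \<subseteq> T" by (rule msum_least[OF T(1,2) lsum_least[OF T(1) T(3)]])
      show ?thesis
      proof (cases "n < p")
        case True
        have "set (us n) \<subseteq> T" using T(4) gs n True by auto
        then show ?thesis using us n T(1) UT by blast
      next
        case False then show ?thesis using stab[of n] UT by simp
      qed
    qed
    show "n \<ge> Suc (length gs)" using n lg by simp
  qed
qed

lemma colon_nzd:
  assumes D: "sub D" and b: "b \<in> carrier R" "nzd M b D" and N: "sub N'" "D \<subseteq> N'"
  shows "colon M b (msum M D (smul M b N')) = N'"
proof
  show "N' \<subseteq> colon M b (msum M D (smul M b N'))"
    using colon_smul[OF N(1), of b] colon_mono[OF msum_upper2[OF D sub_smul[OF b(1) N(1)]], of M b] by (rule subset_trans)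
  show "colon M b (msum M D (smul M b N')) \<subseteq> N'"
  proof
    fix u assume "u \<in> colon M b (msum M D (smul M b N'))"
    then have uc: "u \<in> carrier M" and "b \<odot>\<^bsub>M\<^esub> u \<in> msum M D (smul M b N')" by (auto simp: colon_def)
    then obtain d v where dv: "d \<in> D" "v \<in> N'" "b \<odot>\<^bsub>M\<^esub> u = d \<oplus>\<^bsub>M\<^esub> b \<odot>\<^bsub>M\<^esub> v" by (auto elim!: msumE smulE)
    have c: "d \<in> carrier M" "v \<in> carrier M" using dv stableD(6)[OF D] stableD(6)[OF N(1)] by auto
    have "b \<odot>\<^bsub>M\<^esub> (u \<ominus>\<^bsub>M\<^esub> v) = d" using dv c uc b by (simp add: smult_r_diff add_minus_cancel)
    then have "u \<ominus>\<^bsub>M\<^esub> v \<in> D" using b(2) dv(1) uc c by (auto simp: nzd_def)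
    then show "u \<in> N'" using stable_diff_iff[OF N(1) uc dv(2)] N(2) by auto
  qed
qed

text \<open>The regular element \<open>b\<close> gives (D + bM)/(D + bN') the length of M/N'.
  Computing the length of M/(D + bN') along D + bM and along N'' yields the equation.\<close>

lemma one_dim_length:
  assumes D: "sub D" and b: "b \<in> carrier R" "nzd M b D" and N: "sub N'" "D \<subseteq> N'" "sub N''" "msum M D (smul M b N') \<subseteq> N''"
    and f: "fl N' (carrier M)" "fl (adj M D b) (carrier M)"
  shows "fl (msum M D (smul M b N')) N''"
    "ll (msum M D (smul M b N')) N'' + ll N'' (carrier M) = ll (adj M D b) (carrier M) + ll N' (carrier M)"
proof -
  let ?Z = "msum M D (smul M b N')"
  have sm: "sub (smul M b N')" "sub (smul M b (carrier M))" using sub_smul[OF b(1) N(1)] sub_smul[OF b(1) sub_carrier] by auto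
  have Z: "sub ?Z" using sub_msum[OF D sm(1)] .
  have A: "sub (adj M D b)" using sub_msum[OF D sm(2)] .
  have cN: "N' \<subseteq> carrier M" using stableD(1)[OF N(1)] .
  have ZA: "?Z \<subseteq> adj M D b" using msum_mono[OF order_refl smul_mono[OF cN]] .
  have T: "msum M ?Z (smul M b (carrier M)) = adj M D b"
  proof
    show "msum M ?Z (smul M b (carrier M)) \<subseteq> adj M D b" using msum_least[OF A ZA msum_upper2[OF D sm(2)]] .
    show "adj M D b \<subseteq> msum M ?Z (smul M b (carrier M))" using msum_mono[OF msum_upper1[OF D sm(1)] order_refl] .
  qed
  note lc = len_colon[OF Z b(1), unfolded T colon_nzd[OF D b N(1,2)]]
  have c: "adj M D b \<subseteq> carrier M" "N'' \<subseteq> carrier M" using stableD(1)[OF A] stableD(1)[OF N(3)] by auto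
  have fZ: "fl ?Z (carrier M)" using len_add(1)[OF sub_carrier A Z ZA c(1)] lc(1) f by auto
  show "fl ?Z N''" using len_add(1)[OF sub_carrier N(3) Z N(4) c(2)] fZ by auto
  show "ll ?Z N'' + ll N'' (carrier M) = ll (adj M D b) (carrier M) + ll N' (carrier M)"
    using len_add(2)[OF sub_carrier A Z ZA c(1) fZ] len_add(2)[OF sub_carrier N(3) Z N(4) c(2) fZ] lc(2) by simp
qed

text \<open>With e the length of M/(D + bM), the length of G_{n+1}/(J G_n + C) equals e plus a
  difference of consecutive colengths of D + G_n; likewise e - H_n for D + F_n. Both sums telescope
  and their far ends agree, so they differ only by the length of G_1/F_1, which is the number of
  units spent on degree-one generators. The total is therefore exactly \<open>K\<close>.\<close>

lemma reduction_bound_core: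
  fixes G :: "nat \<Rightarrow> 'c set"
  assumes as: "set as \<subseteq> q" and C: "sub C" "C \<subseteq> F 1" and D: "sub D" "D \<subseteq> F 1"
    and b: "b \<in> q" "nzd M b D" and k: "F k \<subseteq> adj M D b"
    and Gs: "\<And>n. sub (G n)" and Gq: "\<And>n x u. x \<in> q \<Longrightarrow> u \<in> G n \<Longrightarrow> x \<odot>\<^bsub>M\<^esub> u \<in> G (Suc n)"
    and FG: "\<And>n. F n \<subseteq> G n" and CG: "\<And>n. C \<subseteq> G n"
    and iso: "\<And>n. fl (msum M C (lsum M as (G n))) (G (Suc n)) \<longleftrightarrow> fl (msum M D (smul M b (msum M D (G n)))) (msum M D (G (Suc n)))"
      "\<And>n. ll (msum M C (lsum M as (G n))) (G (Suc n)) = ll (msum M D (smul M b (msum M D (G n)))) (msum M D (G (Suc n)))"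
    and large: "\<And>n. n \<ge> n1 \<Longrightarrow> msum M D (G n) = N D n" "\<And>n. n \<ge> n1 \<Longrightarrow> H D n = ll (adj M D b) (carrier M)"
    and K: "\<And>p. p \<ge> n1 \<Longrightarrow> (\<Sum>n\<in>{1..<p}. int (ll (adj M D b) (carrier M)) - int (H D n)) = int K"
    and n: "n \<ge> Suc K"
  shows "F (Suc n) \<subseteq> W as C n"
proof -
  let ?N = "\<lambda>n. msum M D (G n)" and ?U = "\<lambda>n. msum M C (lsum M as (G n))" and ?e = "ll (adj M D b) (carrier M)"
  have bc: "b \<in> carrier R" using b q_carrier by auto
  have asc: "set as \<subseteq> carrier R" using as q_carrier by auto
  have sA: "sub (adj M D b)" using sub_adj[OF D(1) bc] .
  have sN: "sub (?N n)" "D \<subseteq> ?N n" "?N n \<subseteq> carrier M" for n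
    using sub_msum[OF D(1) Gs] msum_upper1[OF D(1) Gs] stableD(1)[OF sub_msum[OF D(1) Gs]] by auto
  have fA: "fl (adj M D b) (carrier M)" using mnil_flen[OF mnil_F[OF k] sub_carrier sA stableD(1)[OF sA]] .
  have fG: "fl (G n) (carrier M)" for n
    using mnil_flen[OF mnil_F[OF FG] sub_carrier Gs stableD(1)[OF Gs]] .
  have fN: "fl (?N n) (carrier M)" for n
    using mnil_flen[OF mnil_F[of n] sub_carrier sN(1) sN(3)] msum_upper2[OF D(1) Gs, of n] FG[of n] by blast
  have ZN: "msum M D (smul M b (?N n)) \<subseteq> ?N (Suc n)" for n
  proof (rule msum_least[OF sN(1,2)])
    show "smul M b (?N n) \<subseteq> ?N (Suc n)"
    proof
      fix x assume "x \<in> smul M b (?N n)"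
      then obtain y where y: "y \<in> ?N n" "x = b \<odot>\<^bsub>M\<^esub> y" by (rule smulE)
      from y(1) obtain d u where *: "d \<in> D" "u \<in> G n" "y = d \<oplus>\<^bsub>M\<^esub> u" by (rule msumE)
      have c: "d \<in> carrier M" "u \<in> carrier M" using * stableD(6)[OF D(1)] stableD(6)[OF Gs] by auto
      have "b \<odot>\<^bsub>M\<^esub> d \<oplus>\<^bsub>M\<^esub> b \<odot>\<^bsub>M\<^esub> u \<in> ?N (Suc n)" using stableD(5)[OF D(1) bc *(1)] Gq[OF b(1) *(2)] by (rule msumI)
      then show "x \<in> ?N (Suc n)" using y * c bc by (simp add: smult_r_distr)
    qed
  qed
  note od = one_dim_length[OF D(1) bc b(2) sN(1,2) sN(1) ZN fN fA]
  have U: "int (ll (?U n) (G (Suc n))) = int ?e + int (ll (?N n) (carrier M)) - int (ll (?N (Suc n)) (carrier M))" for n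
    using od(2)[of n] iso(2)[of n] by simp
  have fU: "fl (?U n) (G (Suc n))" for n using iso(1) od(1) by blast
  have HD: "int (H D n) = int (ll (N D (Suc n)) (carrier M)) - int (ll (N D n) (carrier M))" for n
    using len_add(2)[OF sub_carrier sub_N[OF D(1)] sub_N[OF D(1)] N_dec N_carrier[OF D(1)] fl_N[OF D(1)], of n] by simp
  have ND1: "N D 1 = F 1" using msum_absorb2[OF D(1) F_sub D(2)] .
  have N1: "?N 1 = G 1" using msum_absorb2[OF D(1) Gs] D(2) FG[of 1] by auto
  have f1: "fl (F 1) (G 1)" and l1: "ll (F 1) (carrier M) = ll (F 1) (G 1) + ll (G 1) (carrier M)"
    using len_add[OF sub_carrier Gs F_sub FG stableD(1)[OF Gs], of 1] fl_N[OF D(1), of 1] ND1 by auto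
  let ?p = "max n1 1"
  have tele: "(\<Sum>n\<in>{1..<p}. f n - f (Suc n)) = f 1 - f p" if "p \<ge> 1" for f :: "nat \<Rightarrow> int" and p
    using that by (induction p rule: dec_induct) auto
  have "(\<Sum>n\<in>{1..<?p}. int (ll (?U n) (G (Suc n)))) = (\<Sum>n\<in>{1..<?p}. int ?e + (int (ll (?N n) (carrier M)) - int (ll (?N (Suc n)) (carrier M))))"
    unfolding U by (simp add: algebra_simps)
  also have "\<dots> = (\<Sum>n\<in>{1..<?p}. int ?e) + (int (ll (?N 1) (carrier M)) - int (ll (?N ?p) (carrier M)))"
    unfolding sum.distrib using tele[of ?p "\<lambda>n. int (ll (?N n) (carrier M))"] by simp
  finally have s1: "(\<Sum>n\<in>{1..<?p}. int (ll (?U n) (G (Suc n)))) = (\<Sum>n\<in>{1..<?p}. int ?e) + (int (ll (?N 1) (carrier M)) - int (ll (?N ?p) (carrier M)))" .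
  have "(\<Sum>n\<in>{1..<?p}. int ?e - int (H D n)) = (\<Sum>n\<in>{1..<?p}. int ?e + (int (ll (N D n) (carrier M)) - int (ll (N D (Suc n)) (carrier M))))"
    unfolding HD by (simp add: algebra_simps)
  also have "\<dots> = (\<Sum>n\<in>{1..<?p}. int ?e) + (int (ll (N D 1) (carrier M)) - int (ll (N D ?p) (carrier M)))"
    unfolding sum.distrib using tele[of ?p "\<lambda>n. int (ll (N D n) (carrier M))"] by simp
  finally have s2: "(\<Sum>n\<in>{1..<?p}. int ?e - int (H D n)) = (\<Sum>n\<in>{1..<?p}. int ?e) + (int (ll (N D 1) (carrier M)) - int (ll (N D ?p) (carrier M)))" .
  have "int (ll (F 1) (G 1)) + (\<Sum>n\<in>{1..<?p}. int (ll (?U n) (G (Suc n)))) = int K"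
    using s1 s2 K[of ?p] l1 ND1 N1 large(1)[of ?p] by simp
  then have K': "ll (F 1) (G 1) + (\<Sum>n\<in>{1..<?p}. ll (?U n) (G (Suc n))) \<le> K"
    by (simp only: of_nat_add[symmetric] of_nat_sum[symmetric] of_nat_eq_iff)
  \<comment> \<open>Where both filtrations agree modulo \<open>D\<close> and the Hilbert function
    has reached its final value, the length in question is zero.\<close>
  have st: "G (Suc n) = ?U n" if "n \<ge> ?p" for n
  proof -
    have "int (ll (?U n) (G (Suc n))) = 0"
      unfolding U using large(1)[of n] large(1)[of "Suc n"] large(2)[of n] HD[of n] that by simp
    then have "ll (?U n) (G (Suc n)) = 0" by simp
    moreover have "?U n \<subseteq> G (Suc n)" by (rule msum_least[OF Gs CG lsum_least[OF Gs]]) (use Gq as in auto)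
    ultimately show ?thesis using len_0_iff[OF fU Gs sub_msum[OF C(1) sub_lsum[OF Gs asc]]] by blast
  qed
  show ?thesis
    by (rule reduction_from_lengths[where G = G and p = ?p and K = K, OF as C Gs Gq FG CG f1 fU st K' n])
qed

text \<open>In dimension one there is nothing to saturate: \<open>C\<close> and \<open>D\<close> are
  zero and \<open>G\<close> is the filtration itself, so the comparison of lengths is an
  identity.\<close>

lemma reduction_bound_1:
  assumes b: "b \<in> q" "nzd M b {\<zero>\<^bsub>M\<^esub>}" and k: "F k \<subseteq> adj M {\<zero>\<^bsub>M\<^esub>} b"
    and large: "\<And>n. n \<ge> n1 \<Longrightarrow> H {\<zero>\<^bsub>M\<^esub>} n = ll (adj M {\<zero>\<^bsub>M\<^esub>} b) (carrier M)"
    and K: "\<And>p. p \<ge> n1 \<Longrightarrow> (\<Sum>n\<in>{1..<p}. int (ll (adj M {\<zero>\<^bsub>M\<^esub>} b) (carrier M)) - int (H {\<zero>\<^bsub>M\<^esub>} n)) = int K"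
    and n: "n \<ge> Suc K"
  shows "F (Suc n) \<subseteq> W [b] {\<zero>\<^bsub>M\<^esub>} n"
proof -
  have bc: "b \<in> carrier R" using b q_carrier by auto
  have z: "msum M {\<zero>\<^bsub>M\<^esub>} A = A" if "sub A" for A using msum_absorb2[OF sub_zero that] stableD(2)[OF that] by simp
  have l: "lsum M [b] (F n) = smul M b (F n)" for n
    using msum_absorb[OF sub_smul[OF bc F_sub] sub_zero] stableD(2)[OF sub_smul[OF bc F_sub]] by simp
  have zF: "{\<zero>\<^bsub>M\<^esub>} \<subseteq> F n" for n using stableD(2)[OF F_sub] by simp
  show ?thesis
  proof (rule reduction_bound_core[where G = F and D = "{\<zero>\<^bsub>M\<^esub>}" and b = b and k = k and ?n1.0 = n1 and K = K])
    show "fl (msum M {\<zero>\<^bsub>M\<^esub>} (lsum M [b] (F n))) (F (Suc n)) \<longleftrightarrow>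
       fl (msum M {\<zero>\<^bsub>M\<^esub>} (smul M b (msum M {\<zero>\<^bsub>M\<^esub>} (F n)))) (msum M {\<zero>\<^bsub>M\<^esub>} (F (Suc n)))" for n
      unfolding l z[OF F_sub] by (rule refl)
    show "ll (msum M {\<zero>\<^bsub>M\<^esub>} (lsum M [b] (F n))) (F (Suc n)) =
       ll (msum M {\<zero>\<^bsub>M\<^esub>} (smul M b (msum M {\<zero>\<^bsub>M\<^esub>} (F n)))) (msum M {\<zero>\<^bsub>M\<^esub>} (F (Suc n)))" for n
      unfolding l z[OF F_sub] by (rule refl)
  qed (use b k large K n zF sub_zero F_sub F_mul in auto)
qed

section \<open>Saturation with respect to a superficial element\<close>

text \<open>A power of \<open>a\<close> cancels the failure of \<open>F\<close> to be \<open>a\<close>-saturated modulo \<open>C\<close>: multiplication by \<open>a\<close> is injective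
  on the graded pieces of this filtration.\<close>
definition "asat a C n = {u \<in> carrier M. \<exists>k::nat. a [^] k \<odot>\<^bsub>M\<^esub> u \<in> N C (n + k)}"

context
  fixes a C
  assumes a: "a \<in> q" and C: "sub C" and nz: "nzd M a C" and sup: "supf q F C a"
begin

lemma a_carrier: "a \<in> carrier R" using a q_carrier by auto

lemma N_mul: "x \<in> q \<Longrightarrow> u \<in> N C n \<Longrightarrow> x \<odot>\<^bsub>M\<^esub> u \<in> N C (Suc n)"
  using N_colon[OF C, of x n] by (auto simp: colon_def)

lemma asat_mono: "a [^] (k::nat) \<odot>\<^bsub>M\<^esub> u \<in> N C (n + k) \<Longrightarrow> u \<in> carrier M \<Longrightarrow> k \<le> l \<Longrightarrow> a [^] l \<odot>\<^bsub>M\<^esub> u \<in> N C (n + l)"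
proof (induction l)
  case (Suc l)
  show ?case
  proof (cases "k = Suc l")
    case False
    then have "a \<odot>\<^bsub>M\<^esub> (a [^] l \<odot>\<^bsub>M\<^esub> u) \<in> N C (Suc (n + l))" using N_mul[OF a] Suc by auto
    then show ?thesis using a_carrier Suc.prems by (simp add: smult_assoc1 smult_lcomm[of a])
  qed (use Suc in simp)
qed simp

lemma sub_asat: "sub (asat a C n)"
  unfolding stab_def
proof (intro conjI ballI)
  show "asat a C n \<subseteq> carrier M" by (auto simp: asat_def)
  show "\<zero>\<^bsub>M\<^esub> \<in> asat a C n" using stableD(2)[OF sub_N[OF C]] by (auto simp: asat_def intro!: exI[of _ 0])
next
  fix x y assume "x \<in> asat a C n" "y \<in> asat a C n"
  then obtain k l where *: "x \<in> carrier M" "a [^] (k::nat) \<odot>\<^bsub>M\<^esub> x \<in> N C (n + k)" "y \<in> carrier M" "a [^] (l::nat) \<odot>\<^bsub>M\<^esub> y \<in> N C (n + l)"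
    by (auto simp: asat_def)
  let ?m = "max k l"
  have "a [^] ?m \<odot>\<^bsub>M\<^esub> x \<in> N C (n + ?m)" "a [^] ?m \<odot>\<^bsub>M\<^esub> y \<in> N C (n + ?m)" using asat_mono[of k x n ?m] asat_mono[of l y n ?m] * by auto
  then have "a [^] ?m \<odot>\<^bsub>M\<^esub> (x \<oplus>\<^bsub>M\<^esub> y) \<in> N C (n + ?m)" using stableD(3)[OF sub_N[OF C]] * a_carrier by (simp add: smult_r_distr)
  then show "x \<oplus>\<^bsub>M\<^esub> y \<in> asat a C n" unfolding asat_def using * by (intro CollectI conjI exI[of _ ?m]) auto
next
  fix x assume "x \<in> asat a C n"
  then show "\<ominus>\<^bsub>M\<^esub> x \<in> asat a C n" using stableD(4)[OF sub_N[OF C]] a_carrier by (auto simp: asat_def smult_r_minus)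
next
  fix s x assume s: "s \<in> carrier R" and "x \<in> asat a C n"
  then show "s \<odot>\<^bsub>M\<^esub> x \<in> asat a C n" using stableD(5)[OF sub_N[OF C] s] a_carrier by (auto simp: asat_def smult_lcomm[of _ s])
qed

lemma N_asat: "N C n \<subseteq> asat a C n"
  using stableD(6)[OF sub_N[OF C]] by (auto simp: asat_def intro!: exI[of _ 0])

lemma asat_mul: "x \<in> q \<Longrightarrow> u \<in> asat a C n \<Longrightarrow> x \<odot>\<^bsub>M\<^esub> u \<in> asat a C (Suc n)"
proof -
  assume x: "x \<in> q" and u: "u \<in> asat a C n"
  then obtain k where k: "u \<in> carrier M" "a [^] (k::nat) \<odot>\<^bsub>M\<^esub> u \<in> N C (n + k)" by (auto simp: asat_def)
  have xc: "x \<in> carrier R" using x q_carrier by auto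
  have "x \<odot>\<^bsub>M\<^esub> (a [^] k \<odot>\<^bsub>M\<^esub> u) \<in> N C (Suc n + k)" using N_mul[OF x k(2)] by simp
  then show ?thesis unfolding asat_def using k xc a_carrier by (auto simp: smult_lcomm[of x])
qed

lemma asat_colon: "colon M a (asat a C (Suc n)) = asat a C n"
proof
  show "asat a C n \<subseteq> colon M a (asat a C (Suc n))" using asat_mul[OF a] by (auto simp: colon_def asat_def)
  show "colon M a (asat a C (Suc n)) \<subseteq> asat a C n"
  proof
    fix u assume "u \<in> colon M a (asat a C (Suc n))"
    then obtain k where k: "u \<in> carrier M" "a [^] (k::nat) \<odot>\<^bsub>M\<^esub> (a \<odot>\<^bsub>M\<^esub> u) \<in> N C (Suc n + k)" by (auto simp: asat_def colon_def)
    have "a [^] Suc k \<odot>\<^bsub>M\<^esub> u \<in> N C (n + Suc k)" using k a_carrier by (simp add: smult_assoc1)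
    then show "u \<in> asat a C n" unfolding asat_def using k(1) by blast
  qed
qed

text \<open>For large degrees \<open>supf_colon\<close> cancels the powers of \<open>a\<close> one
  at a time, so saturation changes only finitely many members of the filtration.\<close>

lemma asat_large: "\<exists>n0. \<forall>n\<ge>n0. asat a C n = N C n"
proof -
  obtain n0 where n0: "\<And>n. n \<ge> n0 \<Longrightarrow> colon M a (N C (Suc n)) = N C n" using supf_colon[OF C nz sup] by auto
  have "asat a C n \<subseteq> N C n" if n: "n \<ge> n0" for n
  proof
    fix u assume "u \<in> asat a C n"
    then obtain k where k: "u \<in> carrier M" "a [^] (k::nat) \<odot>\<^bsub>M\<^esub> u \<in> N C (n + k)" by (auto simp: asat_def)
    from k(2) show "u \<in> N C n"
    proof (induction k)
      case 0 then show ?case using k(1) by simp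
    next
      case (Suc k)
      then have "a \<odot>\<^bsub>M\<^esub> (a [^] k \<odot>\<^bsub>M\<^esub> u) \<in> N C (Suc (n + k))" using a_carrier k(1) by (simp add: smult_assoc1 smult_lcomm[of a])
      then have "a [^] k \<odot>\<^bsub>M\<^esub> u \<in> colon M a (N C (Suc (n + k)))" using a_carrier k(1) by (auto simp: colon_def)
      then show ?case using Suc.IH n0[of "n + k"] n by simp
    qed
  qed
  then show ?thesis using N_asat by blast
qed

text \<open>Prepares the second isomorphism theorem: the intersection is the submodule by which
  G_{n+1} is divided in M/C, and the sum is the numerator in M/D. The resulting equality of lengths
  moves the count from dimension two to dimension one.\<close>

lemma asat_iso:
  assumes b: "b \<in> q"
  defines "D \<equiv> adj M C a"
  shows "asat a C (Suc n) \<inter> msum M D (smul M b (msum M D (asat a C n))) = msum M (msum M C (smul M a (asat a C n))) (smul M b (asat a C n))"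
    "msum M (asat a C (Suc n)) (msum M D (smul M b (msum M D (asat a C n)))) = msum M D (asat a C (Suc n))"
proof -
  have bc: "b \<in> carrier R" using b q_carrier by auto
  let ?G = "asat a C n" and ?G' = "asat a C (Suc n)"
  have CG: "C \<subseteq> asat a C n" for n using N_upper[OF C] N_asat by (rule subset_trans)
  have sD: "sub D" unfolding D_def using sub_adj[OF C a_carrier] .
  have s: "sub (smul M b ?G)" "sub (smul M a ?G)" "sub (smul M a (carrier M))" "sub (smul M b D)"
    using sub_smul[OF bc sub_asat] sub_smul[OF a_carrier sub_asat] sub_smul[OF a_carrier sub_carrier] sub_smul[OF bc sD] by auto
  have aG: "smul M a ?G \<subseteq> ?G'" "smul M b ?G \<subseteq> ?G'" using asat_mul a b by (auto simp: smul_def)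
  have bD: "smul M b D \<subseteq> D" using stableD(5)[OF sD bc] by (auto simp: smul_def)
  have B: "msum M D (smul M b (msum M D ?G)) = msum M D (smul M b ?G)"
  proof
    show "msum M D (smul M b ?G) \<subseteq> msum M D (smul M b (msum M D ?G))"
      by (intro msum_mono smul_mono order_refl msum_upper2[OF sD sub_asat])
    show "msum M D (smul M b (msum M D ?G)) \<subseteq> msum M D (smul M b ?G)"
    proof (rule msum_least[OF sub_msum[OF sD s(1)] msum_upper1[OF sD s(1)]])
      show "smul M b (msum M D ?G) \<subseteq> msum M D (smul M b ?G)"
      proof
        fix x assume "x \<in> smul M b (msum M D ?G)"
        then obtain y where y: "y \<in> msum M D ?G" "x = b \<odot>\<^bsub>M\<^esub> y" by (rule smulE)
        from y(1) obtain d u where *: "d \<in> D" "u \<in> ?G" "y = d \<oplus>\<^bsub>M\<^esub> u" by (rule msumE)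
        have c: "d \<in> carrier M" "u \<in> carrier M" using * stableD(6)[OF sD] stableD(6)[OF sub_asat] by auto
        have "b \<odot>\<^bsub>M\<^esub> d \<oplus>\<^bsub>M\<^esub> b \<odot>\<^bsub>M\<^esub> u \<in> msum M D (smul M b ?G)" by (rule msumI[OF stableD(5)[OF sD bc *(1)] smulI[OF *(2)]])
        then show "x \<in> msum M D (smul M b ?G)" using y * c bc by (simp add: smult_r_distr)
      qed
    qed
  qed
  \<comment> \<open>The only place where saturation is indispensable: if au lies in G_{n+1}, then
    \<open>u\<close> already lies in G_n.\<close>
  have DG: "D \<inter> ?G' = msum M C (smul M a ?G)"
  proof -
    have "smul M a (carrier M) \<inter> ?G' = smul M a ?G"
    proof
      show "smul M a (carrier M) \<inter> ?G' \<subseteq> smul M a ?G"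
      proof
        fix x assume x: "x \<in> smul M a (carrier M) \<inter> ?G'"
        then obtain u where u: "u \<in> carrier M" "x = a \<odot>\<^bsub>M\<^esub> u" by (auto elim: smulE)
        then have "u \<in> ?G" using x asat_colon[of n] by (auto simp: colon_def)
        then show "x \<in> smul M a ?G" using u by (auto intro: smulI)
      qed
      show "smul M a ?G \<subseteq> smul M a (carrier M) \<inter> ?G'" by (rule Int_greatest[OF smul_mono[OF stableD(1)[OF sub_asat]] aG(1)])
    qed
    then show ?thesis unfolding D_def using msum_modular[OF C s(3) sub_asat CG] by simp
  qed
  have sc: "smul M b ?G \<subseteq> carrier M" "D \<subseteq> carrier M" "smul M a ?G \<subseteq> carrier M" "C \<subseteq> carrier M" "?G' \<subseteq> carrier M"
    using s stableD(1)[OF sD] stableD(1)[OF C] stableD(1)[OF sub_asat] by (auto simp: stab_def)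
  have "?G' \<inter> msum M D (smul M b ?G) = msum M (smul M b ?G) D \<inter> ?G'" using msum_comm[OF sc(2,1)] by auto
  also have "\<dots> = msum M (smul M b ?G) (D \<inter> ?G')" by (rule msum_modular[OF s(1) sD sub_asat aG(2)])
  also have "\<dots> = msum M (msum M C (smul M a ?G)) (smul M b ?G)" unfolding DG
    by (rule msum_comm[OF sc(1) stableD(1)[OF sub_msum[OF C s(2)]]])
  finally show "?G' \<inter> msum M D (smul M b (msum M D ?G)) = msum M (msum M C (smul M a ?G)) (smul M b ?G)" unfolding B .
  have "msum M ?G' (msum M D (smul M b ?G)) = msum M D ?G'"
  proof
    show "msum M ?G' (msum M D (smul M b ?G)) \<subseteq> msum M D ?G'"
      by (rule msum_least[OF sub_msum[OF sD sub_asat] msum_upper2[OF sD sub_asat] msum_mono[OF order_refl aG(2)]])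
    show "msum M D ?G' \<subseteq> msum M ?G' (msum M D (smul M b ?G))"
      unfolding msum_comm[OF sc(2,5)] by (rule msum_mono[OF order_refl msum_upper1[OF sD s(1)]])
  qed
  then show "msum M ?G' (msum M D (smul M b (msum M D ?G))) = msum M D ?G'" unfolding B .
qed

end

text \<open>Instantiates \<open>reduction_bound_core\<close> with the saturated filtration. Modulo
  \<open>C\<close> the earlier members of the sequence disappear, so J G_n + C is C + aG_n + bG_n,
  the submodule treated by \<open>asat_iso\<close>.\<close>

lemma reduction_bound_2:
  assumes as: "set as \<subseteq> q" and l: "length as = Suc (Suc m)"
  defines "C \<equiv> bas as m" and "D \<equiv> bas as (Suc m)" and "a \<equiv> as ! m" and "b \<equiv> as ! Suc m"
  assumes sup: "supf q F C a" and nz: "nzd M a C" "nzd M b D" and k: "F k \<subseteq> adj M D b"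
    and large: "\<And>n. n \<ge> n1 \<Longrightarrow> H D n = ll (adj M D b) (carrier M)"
    and K: "\<And>p. p \<ge> n1 \<Longrightarrow> (\<Sum>n\<in>{1..<p}. int (ll (adj M D b) (carrier M)) - int (H D n)) = int K"
    and n: "n \<ge> Suc K"
  shows "F (Suc n) \<subseteq> W as C n"
proof -
  have ab: "a \<in> q" "b \<in> q" using as l nth_mem[of m as] nth_mem[of "Suc m" as] by (auto simp: a_def b_def)
  then have abc: "a \<in> carrier R" "b \<in> carrier R" using q_carrier by auto
  have C: "sub C" "C \<subseteq> F 1" unfolding C_def using sub_bas[OF as] bas_F1[OF as] by auto
  have D: "sub D" "D \<subseteq> F 1" unfolding D_def using sub_bas[OF as] bas_F1[OF as] by auto
  have DC: "D = adj M C a" unfolding C_def D_def a_def by (rule bas_Suc[OF as]) (use l in simp)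
  let ?G = "asat a C"
  note G = sub_asat[OF ab(1) C(1) nz(1) sup]
  note rr = ab(1) C(1) nz(1) sup
  have CG: "C \<subseteq> ?G n" for n using N_upper[OF C(1)] N_asat[OF rr] by (rule subset_trans)
  have FG: "F n \<subseteq> ?G n" for n using msum_upper2[OF C(1) F_sub] N_asat[OF rr] by (rule subset_trans)
  have U: "msum M C (lsum M as (?G n)) = msum M (msum M C (smul M a (?G n))) (smul M b (?G n))" for n
  proof -
    have tk: "as = take m as @ [a, b]"
      using l by (simp add: a_def b_def list_eq_iff_nth_eq nth_append min_def) (metis (no_types) less_Suc_eq diff_Suc_1 One_nat_def diff_self_eq_0 nth_Cons_0 nth_Cons_Suc Suc_diff_Suc less_antisym lessI not_less_eq cancel_ab_semigroup_add_class.add_diff_cancel_left')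
    have s: "sub (smul M a (?G n))" "sub (smul M b (?G n))" using sub_smul[OF abc(1) G] sub_smul[OF abc(2) G] by auto
    have st: "sub (lsum M (take m as) (?G n))" using sub_lsum[OF G take_carrier[OF as]] .
    have "lsum M (take m as) (?G n) \<subseteq> bas as m" unfolding bas_def by (rule lsum_mono[OF stableD(1)[OF G]])
    then have tC: "lsum M (take m as) (?G n) \<subseteq> C" unfolding C_def .
    have "lsum M [a, b] (?G n) = msum M (smul M a (?G n)) (smul M b (?G n))"
      using msum_absorb[OF s(2) sub_zero] stableD(2)[OF s(2)] by simp
    then have "lsum M as (?G n) = msum M (lsum M (take m as) (?G n)) (msum M (smul M a (?G n)) (smul M b (?G n)))"
      using lsum_append[OF G take_carrier[OF as], of "[a, b]" m n] abc tk by simp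
    then have "msum M C (lsum M as (?G n)) = msum M (msum M C (lsum M (take m as) (?G n))) (msum M (smul M a (?G n)) (smul M b (?G n)))"
      using msum_assoc[OF stableD(1)[OF C(1)] stableD(1)[OF st] stableD(1)[OF sub_msum[OF s]]] by simp
    also have "msum M C (lsum M (take m as) (?G n)) = C" by (rule msum_absorb[OF C(1) st tC])
    also have "msum M C (msum M (smul M a (?G n)) (smul M b (?G n))) = msum M (msum M C (smul M a (?G n))) (smul M b (?G n))"
      using msum_assoc[OF stableD(1)[OF C(1)] stableD(1)[OF s(1)] stableD(1)[OF s(2)]] by simp
    finally show ?thesis .
  qed
  obtain n0 where n0: "\<And>n. n \<ge> n0 \<Longrightarrow> ?G n = N C n" using asat_large[OF rr] by auto
  have DN: "msum M D (N C n) = N D n" for n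
  proof -
    have "msum M D (N C n) = msum M (msum M D C) (F n)"
      using msum_assoc[OF stableD(1)[OF D(1)] stableD(1)[OF C(1)] stableD(1)[OF F_sub]] by simp
    also have "msum M D C = D" using msum_absorb[OF D(1) C(1)] adj_upper[OF C(1) abc(1)] DC by simp
    finally show ?thesis .
  qed
  have sB: "sub (msum M D (smul M b (msum M D (?G n))))" for n
    using sub_msum[OF D(1) sub_smul[OF abc(2) sub_msum[OF D(1) G]]] .
  have iso: "fl (msum M C (lsum M as (?G n))) (?G (Suc n)) \<longleftrightarrow> fl (msum M D (smul M b (msum M D (?G n)))) (msum M D (?G (Suc n)))"
     "ll (msum M C (lsum M as (?G n))) (?G (Suc n)) = ll (msum M D (smul M b (msum M D (?G n)))) (msum M D (?G (Suc n)))" for n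
    using len_second_iso[OF G[of "Suc n"] sB[of n]] unfolding asat_iso[OF rr ab(2), of n, folded DC] U[symmetric] by simp_all
  show ?thesis
  proof (rule reduction_bound_core[where G = ?G and D = D and b = b and k = k and ?n1.0 = "max n0 n1" and K = K])
    show "fl (msum M C (lsum M as (?G n))) (?G (Suc n)) \<longleftrightarrow> fl (msum M D (smul M b (msum M D (?G n)))) (msum M D (?G (Suc n)))" for n
      by (rule iso(1))
    show "ll (msum M C (lsum M as (?G n))) (?G (Suc n)) = ll (msum M D (smul M b (msum M D (?G n)))) (msum M D (?G (Suc n)))" for n
      by (rule iso(2))
    show "x \<odot>\<^bsub>M\<^esub> u \<in> ?G (Suc n)" if "x \<in> q" "u \<in> ?G n" for n x u by (rule asat_mul[OF rr that])
    show "msum M D (?G n) = N D n" if "max n0 n1 \<le> n" for n using n0[of n] DN[of n] that by simp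
  qed (use as C D ab nz k large K n G FG CG in auto)
qed

end

section \<open>The associated graded module\<close>

text \<open>The ring may be arbitrary commutative, and the filtration need only be compatible with
  the powers of \<open>q\<close>. This generality lets the ring itself, with its adic filtration, be
  an instance.\<close>

locale gr_setup = module R M for R (structure) and M (structure) +
  fixes q F
  assumes q: "ideal q R" and Fsub: "\<And>n. sub (F n)" and Fdec: "\<And>n. F (Suc n) \<subseteq> F n"
    and Fmul: "\<And>i j. ideal_smult R M (adic_filt R q i) (F j) \<subseteq> F (i + j)"
begin

abbreviation "I n \<equiv> adic_filt R q n"

lemma I_ideal: "ideal (I n) R" using adic_filt_ideal[OF R.is_cring q] .
lemma I_carrier: "a \<in> I n \<Longrightarrow> a \<in> carrier R" using ideal.Icarr[OF I_ideal] .
lemma F_carrier: "x \<in> F n \<Longrightarrow> x \<in> carrier M" using stableD(6)[OF Fsub] .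
lemma IF: "a \<in> I i \<Longrightarrow> x \<in> F j \<Longrightarrow> a \<odot>\<^bsub>M\<^esub> x \<in> F (i + j)" by (rule subsetD[OF Fmul smult_in])
lemma IF': "a \<in> I i \<Longrightarrow> x \<in> F (n - i) \<Longrightarrow> i \<le> n \<Longrightarrow> a \<odot>\<^bsub>M\<^esub> x \<in> F n" using IF[of a i x "n - i"] by simp

definition "cls n x = F (Suc n) +>\<^bsub>M\<^esub> x"
text \<open>Elements of the associated graded module are handled through sequences of representatives, on which
  the graded action is the convolution \<open>conv\<close>.\<close>
definition "reps x \<longleftrightarrow> (\<forall>n. x n \<in> F n) \<and> finite {n. x n \<notin> F (Suc n)}"
definition "mk x = (\<lambda>n. cls n (x n))"
definition "conv a x (n::nat) = (\<Oplus>\<^bsub>M\<^esub>i\<in>{..n}. a i \<odot>\<^bsub>M\<^esub> x (n - i))"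

lemma repsD: "reps x \<Longrightarrow> x n \<in> F n" "reps x \<Longrightarrow> x n \<in> carrier M" using F_carrier[of "x n" n] by (auto simp: reps_def)
lemma reps_bound: "reps x \<Longrightarrow> \<exists>N. \<forall>n\<ge>N. x n \<in> F (Suc n)"
proof -
  assume "reps x"
  then obtain N where "\<forall>n\<in>{n. x n \<notin> F (Suc n)}. n \<le> N" unfolding reps_def using finite_nat_set_iff_bounded_le by blast
  then show ?thesis by (intro exI[of _ "Suc N"]) fastforce
qed
lemma repsI: "(\<And>n. x n \<in> F n) \<Longrightarrow> (\<And>n. n \<ge> N \<Longrightarrow> x n \<in> F (Suc n)) \<Longrightarrow> reps x"
proof -
  assume x: "\<And>n. x n \<in> F n" "\<And>n. n \<ge> N \<Longrightarrow> x n \<in> F (Suc n)"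
  have "{n. x n \<notin> F (Suc n)} \<subseteq> {..<N}" using x(2) not_le by auto
  then show ?thesis using x(1) finite_subset by (auto simp: reps_def)
qed

lemma cls_eq_iff: "x \<in> carrier M \<Longrightarrow> y \<in> carrier M \<Longrightarrow> cls n x = cls n y \<longleftrightarrow> x \<ominus>\<^bsub>M\<^esub> y \<in> F (Suc n)"
  unfolding cls_def by (rule coset_eq_iff[OF Fsub])
lemma cls_zero_iff: "x \<in> carrier M \<Longrightarrow> cls n x = F (Suc n) \<longleftrightarrow> x \<in> F (Suc n)"
  unfolding cls_def by (rule coset_zero_iff[OF Fsub])

lemma carrier_comp: "carrier (gr_comp M F n) = cls n ` F n"
  by (auto simp: gr_comp_def quot_module_def A_RCOSETS_def RCOSETS_def a_r_coset_def r_coset_def cls_def)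
lemma zero_comp: "\<zero>\<^bsub>gr_comp M F n\<^esub> = F (Suc n)" by (simp add: gr_comp_def quot_module_def)
lemma add_comp: "x \<in> carrier M \<Longrightarrow> y \<in> carrier M \<Longrightarrow> cls n x \<oplus>\<^bsub>gr_comp M F n\<^esub> cls n y = cls n (x \<oplus>\<^bsub>M\<^esub> y)"
proof -
  assume "x \<in> carrier M" "y \<in> carrier M"
  then have "(F (Suc n) +>\<^bsub>M\<^esub> x) <+>\<^bsub>M\<^esub> (F (Suc n) +>\<^bsub>M\<^esub> y) = F (Suc n) +>\<^bsub>M\<^esub> (x \<oplus>\<^bsub>M\<^esub> y)"
    using abelian_subgroup.a_rcos_sum[OF abelian_subgroup_sub[OF Fsub]] by blast
  then show ?thesis by (simp add: cls_def gr_comp_def quot_module_def set_add_def set_mult_def)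
qed

lemma module_comp: "module R (gr_comp M F n)"
  unfolding gr_comp_def
proof (rule quot_module_module)
  have s: "submodule (F n) R M" using Fsub submodule_iff_stable by blast
  show m: "module R (M\<lparr>carrier := F n\<rparr>)" using submodule.submodule_is_module[OF s module_axioms] .
  have s': "submodule (F (Suc n)) R M" using Fsub submodule_iff_stable by blast
  show "submodule (F (Suc n)) R (M\<lparr>carrier := F n\<rparr>)"
  proof (rule module.module_incl_imp_submodule[OF m])
    show "F (Suc n) \<subseteq> carrier (M\<lparr>carrier := F n\<rparr>)" using Fdec by simp
    show "module R (M\<lparr>carrier := F n, carrier := F (Suc n)\<rparr>)"
      using submodule.submodule_is_module[OF s' module_axioms] by simp
  qed
qed

lemma finsum_comp: "finite S \<Longrightarrow> (\<And>i. i \<in> S \<Longrightarrow> g i \<in> F n) \<Longrightarrow> (\<Oplus>\<^bsub>gr_comp M F n\<^esub>i\<in>S. cls n (g i)) = cls n (\<Oplus>\<^bsub>M\<^esub>i\<in>S. g i)"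
proof (induction S rule: finite_induct)
  interpret C: module R "gr_comp M F n" by (rule module_comp)
  {
    case empty
    show ?case using cls_zero_iff[of "\<zero>\<^bsub>M\<^esub>" n] stableD(2)[OF Fsub] by (simp add: zero_comp)
  next
    case (insert i S)
    have g: "g j \<in> carrier M" if "j \<in> insert i S" for j using insert.prems[OF that] F_carrier by auto
    have c: "cls n (g j) \<in> carrier (gr_comp M F n)" if "j \<in> insert i S" for j using insert.prems[OF that] by (auto simp: carrier_comp)
    have "(\<Oplus>\<^bsub>gr_comp M F n\<^esub>i\<in>insert i S. cls n (g i)) = cls n (g i) \<oplus>\<^bsub>gr_comp M F n\<^esub> (\<Oplus>\<^bsub>gr_comp M F n\<^esub>i\<in>S. cls n (g i))"
      using insert(1,2) c by (intro C.finsum_insert) auto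
    also have "\<dots> = cls n (g i) \<oplus>\<^bsub>gr_comp M F n\<^esub> cls n (\<Oplus>\<^bsub>M\<^esub>i\<in>S. g i)" using insert by simp
    also have "\<dots> = cls n (g i \<oplus>\<^bsub>M\<^esub> (\<Oplus>\<^bsub>M\<^esub>i\<in>S. g i))" using g by (intro add_comp) (auto intro!: M.finsum_closed)
    also have "g i \<oplus>\<^bsub>M\<^esub> (\<Oplus>\<^bsub>M\<^esub>i\<in>S. g i) = (\<Oplus>\<^bsub>M\<^esub>i\<in>insert i S. g i)" using insert(1,2) g by (intro M.finsum_insert[symmetric]) auto
    finally show ?case .
  }
qed

lemma gr_carrier_eq: "gr_carrier M F = mk ` {x. reps x}"
proof
  show "mk ` {x. reps x} \<subseteq> gr_carrier M F"
  proof (rule image_subsetI)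
    fix x assume "x \<in> {x. reps x}"
    then have x: "reps x" by simp
    have "{n. mk x n \<noteq> F (Suc n)} = {n. x n \<notin> F (Suc n)}" using cls_zero_iff[OF repsD(2)[OF x]] by (simp add: mk_def)
    moreover have "mk x n \<in> cls n ` F n" for n using repsD(1)[OF x, of n] by (simp add: mk_def)
    ultimately show "mk x \<in> gr_carrier M F" using x by (simp add: gr_carrier_def carrier_comp zero_comp reps_def)
  qed
  show "gr_carrier M F \<subseteq> mk ` {x. reps x}"
  proof
    fix f assume f: "f \<in> gr_carrier M F"
    then have "\<forall>n. \<exists>x. x \<in> F n \<and> f n = cls n x" by (auto simp: gr_carrier_def carrier_comp)
    then obtain x where x: "\<And>n. x n \<in> F n" "\<And>n. f n = cls n (x n)" by metis
    have "{n. x n \<notin> F (Suc n)} = {n. f n \<noteq> \<zero>\<^bsub>gr_comp M F n\<^esub>}" using cls_zero_iff[OF F_carrier[OF x(1)]] x(2) by (auto simp: zero_comp)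
    then have "reps x" using f x(1) by (simp add: reps_def gr_carrier_def)
    moreover have "f = mk x" using x(2) by (auto simp: mk_def)
    ultimately show "f \<in> mk ` {x. reps x}" by blast
  qed
qed

lemma mk_in: "reps x \<Longrightarrow> mk x \<in> gr_carrier M F" by (simp add: gr_carrier_eq)
lemma mk_cases: "f \<in> gr_carrier M F \<Longrightarrow> (\<And>x. reps x \<Longrightarrow> f = mk x \<Longrightarrow> thesis) \<Longrightarrow> thesis" by (auto simp: gr_carrier_eq)
lemma mk_eq_iff: "reps x \<Longrightarrow> reps y \<Longrightarrow> mk x = mk y \<longleftrightarrow> (\<forall>n. x n \<ominus>\<^bsub>M\<^esub> y n \<in> F (Suc n))"
  using cls_eq_iff[OF repsD(2) repsD(2)] by (auto simp: mk_def fun_eq_iff)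

lemma reps_zero: "reps (\<lambda>_. \<zero>\<^bsub>M\<^esub>)" by (rule repsI[of _ 0]) (rule stableD(2)[OF Fsub])+
lemma reps_add: assumes "reps x" "reps y" shows "reps (\<lambda>n. x n \<oplus>\<^bsub>M\<^esub> y n)"
proof -
  obtain N N' where "\<And>n. n \<ge> N \<Longrightarrow> x n \<in> F (Suc n)" "\<And>n. n \<ge> N' \<Longrightarrow> y n \<in> F (Suc n)" using reps_bound[OF assms(1)] reps_bound[OF assms(2)] by blast
  then show ?thesis using repsD(1)[OF assms(1)] repsD(1)[OF assms(2)] stableD(3)[OF Fsub] by (intro repsI[of _ "max N N'"]) auto
qed
lemma reps_minus: assumes "reps x" shows "reps (\<lambda>n. \<ominus>\<^bsub>M\<^esub> x n)"
proof -
  obtain N where "\<And>n. n \<ge> N \<Longrightarrow> x n \<in> F (Suc n)" using reps_bound[OF assms] by blast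
  then show ?thesis using repsD(1)[OF assms] stableD(4)[OF Fsub] by (intro repsI[of _ N]) auto
qed

lemma gr_add_mk: "reps x \<Longrightarrow> reps y \<Longrightarrow> gr_add M F (mk x) (mk y) = mk (\<lambda>n. x n \<oplus>\<^bsub>M\<^esub> y n)"
  unfolding gr_add_def mk_def using add_comp repsD(2) by auto
lemma gr_zero_mk: "(\<lambda>n. \<zero>\<^bsub>gr_comp M F n\<^esub>) = mk (\<lambda>_. \<zero>\<^bsub>M\<^esub>)"
  unfolding mk_def zero_comp using cls_zero_iff[of "\<zero>\<^bsub>M\<^esub>"] stableD(2)[OF Fsub] by auto

lemma gr_abelian:
  assumes S: "carrier S = gr_carrier M F" "add S = gr_add M F" "zero S = (\<lambda>n. \<zero>\<^bsub>gr_comp M F n\<^esub>)"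
  shows "abelian_group S"
proof (rule abelian_groupI, unfold S gr_zero_mk)
  show "mk (\<lambda>_. \<zero>\<^bsub>M\<^esub>) \<in> gr_carrier M F" by (rule mk_in[OF reps_zero])
next
  fix x y assume "x \<in> gr_carrier M F" "y \<in> gr_carrier M F"
  then show "gr_add M F x y \<in> gr_carrier M F" "gr_add M F x y = gr_add M F y x"
    by (auto elim!: mk_cases simp: gr_add_mk mk_in reps_add M.a_comm repsD(2))
next
  fix x y z assume "x \<in> gr_carrier M F" "y \<in> gr_carrier M F" "z \<in> gr_carrier M F"
  then show "gr_add M F (gr_add M F x y) z = gr_add M F x (gr_add M F y z)"
    by (auto elim!: mk_cases simp: gr_add_mk reps_add M.a_assoc repsD(2))
next
  fix x assume x: "x \<in> gr_carrier M F"
  then show "gr_add M F (mk (\<lambda>_. \<zero>\<^bsub>M\<^esub>)) x = x" by (auto elim!: mk_cases simp: gr_add_mk reps_zero repsD(2))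
  obtain y where y: "reps y" "x = mk y" using x by (rule mk_cases)
  have "gr_add M F (mk (\<lambda>n. \<ominus>\<^bsub>M\<^esub> y n)) x = mk (\<lambda>_. \<zero>\<^bsub>M\<^esub>)" using y by (simp add: gr_add_mk reps_minus M.l_neg repsD(2))
  then show "\<exists>y\<in>gr_carrier M F. gr_add M F y x = mk (\<lambda>_. \<zero>\<^bsub>M\<^esub>)" using mk_in[OF reps_minus[OF y(1)]] by blast
qed

end

lemma (in cring) ideal_smult_ring:
  assumes I: "ideal I R" and J: "ideal J R" shows "ideal_smult R (ring_as_module R) I J \<subseteq> ideal_prod R I J"
proof -
  interpret A: module R "ring_as_module R" by (rule module_ring_as_module)
  have "A.sub (ideal_prod R I J)" using stab_ring_iff ideal_prod_is_ideal[OF I J] by blast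
  then show ?thesis by (rule A.ideal_smult_least) (auto simp: ring_as_module_def intro: ideal_prod.prod)
qed

lemma (in cring) adic_add: "ideal q R \<Longrightarrow> ideal_prod R (adic_filt R q i) (adic_filt R q j) = adic_filt R q (i + j)"
proof (induction j)
  case 0
  have "ideal_prod R (adic_filt R q i) (carrier R) = adic_filt R q i"
    using ideal_prod_one[OF adic_filt_ideal[OF is_cring 0]] ideal_prod_commute[OF adic_filt_ideal[OF is_cring 0] oneideal] by simp
  then show ?case by (simp add: adic_filt_0)
next
  case (Suc j)
  note i = adic_filt_ideal[OF is_cring Suc.prems]
  show ?case using Suc ideal_prod_assoc[OF i[of i] i[of j] Suc.prems] by (simp add: adic_filt_Suc)
qed

lemma (in cring) adic_1: "ideal q R \<Longrightarrow> adic_filt R q 1 = q"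
  using adic_filt_Suc[of R q 0] ideal_prod_one[of q] ideal_prod_commute[of q "carrier R"] oneideal by (simp add: adic_filt_0)

lemma (in cring) adic_dec: "ideal q R \<Longrightarrow> adic_filt R q (Suc n) \<subseteq> adic_filt R q n"
  using ideal_prod_inter[OF adic_filt_ideal[OF is_cring]] by (auto simp: adic_filt_Suc)

lemma (in cring) gr_setup_ring: "ideal q R \<Longrightarrow> gr_setup R (ring_as_module R) q (adic_filt R q)"
proof -
  assume q: "ideal q R"
  interpret A: module R "ring_as_module R" by (rule module_ring_as_module)
  note i = adic_filt_ideal[OF is_cring q]
  show ?thesis
  proof (intro gr_setup.intro gr_setup_axioms.intro module_ring_as_module)
    show "A.sub (adic_filt R q n)" for n using stab_ring_iff i by blast
    show "ideal_smult R (ring_as_module R) (adic_filt R q i) (adic_filt R q j) \<subseteq> adic_filt R q (i + j)" for i j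
      using ideal_smult_ring[OF i i] adic_add[OF q] by simp
    show "ideal q R" by (rule q)
    show "adic_filt R q (Suc n) \<subseteq> adic_filt R q n" for n by (rule adic_dec[OF q])
  qed
qed

context gr_setup begin

text \<open>The associated graded ring is the associated graded module of the ring over itself, so
  its multiplication is the case \<open>M\<close> = \<open>R\<close> of the graded action and needs
  no separate treatment.\<close>

sublocale GR: gr_setup R "ring_as_module R" q "adic_filt R q" by (rule R.gr_setup_ring[OF q])

lemma GR_cls: "GR.cls n a = I (Suc n) +>\<^bsub>R\<^esub> a"
  unfolding GR.cls_def by (simp add: a_r_coset_def r_coset_def ring_as_module_def)

lemma ras [simp]: "carrier (ring_as_module R) = carrier R" "a \<oplus>\<^bsub>ring_as_module R\<^esub> b = a \<oplus> b"
   "\<zero>\<^bsub>ring_as_module R\<^esub> = \<zero>" "a \<odot>\<^bsub>ring_as_module R\<^esub> b = a \<otimes> b" "\<ominus>\<^bsub>ring_as_module R\<^esub> a = \<ominus> a" "a \<ominus>\<^bsub>ring_as_module R\<^esub> b = a \<ominus> b"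
  by (simp_all add: ring_as_module_def a_inv_def m_inv_def a_minus_def)

lemma GR_repsD: "GR.reps a \<Longrightarrow> a n \<in> I n" "GR.reps a \<Longrightarrow> a n \<in> carrier R" using GR.repsD by auto

lemma conv_closed: "GR.reps a \<Longrightarrow> reps x \<Longrightarrow> reps (conv a x)"
proof -
  assume a: "GR.reps a" and x: "reps x"
  obtain N1 where N1: "\<And>n. n \<ge> N1 \<Longrightarrow> a n \<in> I (Suc n)" using GR.reps_bound[OF a] by blast
  obtain N2 where N2: "\<And>n. n \<ge> N2 \<Longrightarrow> x n \<in> F (Suc n)" using reps_bound[OF x] by blast
  show ?thesis
  proof (rule repsI[of _ "N1 + N2"])
    show "conv a x n \<in> F n" for n unfolding conv_def
    proof (rule stable_finsum[OF Fsub])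
      show "(\<lambda>i. a i \<odot>\<^bsub>M\<^esub> x (n - i)) \<in> {..n} \<rightarrow> F n"
        by (rule Pi_I) (rule IF'[OF GR_repsD(1)[OF a] repsD(1)[OF x]], simp)
    qed simp
    show "conv a x n \<in> F (Suc n)" if n: "n \<ge> N1 + N2" for n unfolding conv_def
    proof (rule stable_finsum[OF Fsub])
      show "(\<lambda>i. a i \<odot>\<^bsub>M\<^esub> x (n - i)) \<in> {..n} \<rightarrow> F (Suc n)"
      proof
        fix i assume i: "i \<in> {..n}"
        show "a i \<odot>\<^bsub>M\<^esub> x (n - i) \<in> F (Suc n)"
        proof (cases "i \<ge> N1")
          case True then show ?thesis using IF[OF N1[OF True] repsD(1)[OF x, of "n - i"]] i by simp
        next
          case False
          then have "n - i \<ge> N2" using n by linarith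
          from IF[OF GR_repsD(1)[OF a, of i] N2[OF this]] show ?thesis using i by simp
        qed
      qed
    qed simp
  qed
qed

lemma gr_smult_mk: assumes a: "GR.reps a" and x: "reps x" shows "gr_smult M F (GR.mk a) (mk x) = mk (conv a x)"
proof
  fix n
  have "(\<Union>b\<in>GR.mk a i. \<Union>y\<in>mk x (n - i). (F (Suc n) +>\<^bsub>M\<^esub> (b \<odot>\<^bsub>M\<^esub> y))) = cls n (a i \<odot>\<^bsub>M\<^esub> x (n - i))" if "i \<le> n" for i
    using gr_smult_class[OF module_axioms q _ Fmul GR_repsD(1)[OF a, of i] repsD(1)[OF x, of "n - i"]] Fsub that
    by (simp add: GR.mk_def GR_cls mk_def cls_def submodule_iff_stable)
  moreover have "a i \<odot>\<^bsub>M\<^esub> x (n - i) \<in> F n" if "i \<le> n" for i using IF'[OF GR_repsD(1)[OF a] repsD(1)[OF x] that] .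
  ultimately have "gr_smult M F (GR.mk a) (mk x) n = (\<Oplus>\<^bsub>gr_comp M F n\<^esub>i\<in>{..n}. cls n (a i \<odot>\<^bsub>M\<^esub> x (n - i)))"
    unfolding gr_smult_def
    by (intro abelian_monoid.finsum_cong'[OF abelian_group.axioms(1)[OF module.axioms(2)[OF module_comp]]]) (auto simp: carrier_comp)
  also have "\<dots> = mk (conv a x) n" unfolding mk_def conv_def
    by (rule finsum_comp) (use IF'[OF GR_repsD(1)[OF a] repsD(1)[OF x]] in auto)
  finally show "gr_smult M F (GR.mk a) (mk x) n = mk (conv a x) n" .
qed

text \<open>The summation bound \<open>k\<close> is kept apart from the degree \<open>n\<close> to
  allow induction on \<open>k\<close>: one step adds one antidiagonal to the triangular double sum.
  Associativity is the case where both agree.\<close>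

lemma conv_assoc_aux:
  assumes a: "\<And>n. a n \<in> carrier R" and b: "\<And>n. b n \<in> carrier R" and x: "\<And>n. x n \<in> carrier M"
  shows "k \<le> (n::nat) \<Longrightarrow> (\<Oplus>\<^bsub>M\<^esub>j\<in>{..k}. (\<Oplus>i\<in>{..j}. a i \<otimes> b (j - i)) \<odot>\<^bsub>M\<^esub> x (n - j)) =
     (\<Oplus>\<^bsub>M\<^esub>j\<in>{..k}. a j \<odot>\<^bsub>M\<^esub> (\<Oplus>\<^bsub>M\<^esub>i\<in>{..k - j}. b i \<odot>\<^bsub>M\<^esub> x (n - j - i)))"
proof (induction k)
  case 0 then show ?case using a b x by (simp add: smult_assoc1)
next
  case (Suc k)
  let ?x = "x (n - Suc k)"
  have S: "(\<Oplus>i\<in>{..j}. a i \<otimes> b (j - i)) \<in> carrier R" for j using a b by (intro R.finsum_closed) auto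
  have T: "(\<Oplus>\<^bsub>M\<^esub>i\<in>{..l}. b i \<odot>\<^bsub>M\<^esub> x (n - j - i)) \<in> carrier M" for j l using b x by (intro M.finsum_closed) auto
  have l: "(\<Oplus>\<^bsub>M\<^esub>j\<in>{..Suc k}. (\<Oplus>i\<in>{..j}. a i \<otimes> b (j - i)) \<odot>\<^bsub>M\<^esub> x (n - j)) =
     (\<Oplus>i\<in>{..Suc k}. a i \<otimes> b (Suc k - i)) \<odot>\<^bsub>M\<^esub> ?x \<oplus>\<^bsub>M\<^esub> (\<Oplus>\<^bsub>M\<^esub>j\<in>{..k}. (\<Oplus>i\<in>{..j}. a i \<otimes> b (j - i)) \<odot>\<^bsub>M\<^esub> x (n - j))"
    using S x by (subst M.finsum_Suc) (auto simp: M.a_comm)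
  have m: "(\<Oplus>i\<in>{..Suc k}. a i \<otimes> b (Suc k - i)) \<odot>\<^bsub>M\<^esub> ?x = (\<Oplus>\<^bsub>M\<^esub>j\<in>{..Suc k}. a j \<odot>\<^bsub>M\<^esub> (b (Suc k - j) \<odot>\<^bsub>M\<^esub> ?x))"
    using a b x by (subst finsum_smult_rdistr) (auto intro!: M.finsum_cong' simp: smult_assoc1)
  have r: "(\<Oplus>\<^bsub>M\<^esub>j\<in>{..k}. a j \<odot>\<^bsub>M\<^esub> (\<Oplus>\<^bsub>M\<^esub>i\<in>{..Suc k - j}. b i \<odot>\<^bsub>M\<^esub> x (n - j - i))) =
     (\<Oplus>\<^bsub>M\<^esub>j\<in>{..k}. a j \<odot>\<^bsub>M\<^esub> (b (Suc k - j) \<odot>\<^bsub>M\<^esub> ?x)) \<oplus>\<^bsub>M\<^esub> (\<Oplus>\<^bsub>M\<^esub>j\<in>{..k}. a j \<odot>\<^bsub>M\<^esub> (\<Oplus>\<^bsub>M\<^esub>i\<in>{..k - j}. b i \<odot>\<^bsub>M\<^esub> x (n - j - i)))"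
  proof -
    have "a j \<odot>\<^bsub>M\<^esub> (\<Oplus>\<^bsub>M\<^esub>i\<in>{..Suc k - j}. b i \<odot>\<^bsub>M\<^esub> x (n - j - i)) =
       a j \<odot>\<^bsub>M\<^esub> (b (Suc k - j) \<odot>\<^bsub>M\<^esub> ?x) \<oplus>\<^bsub>M\<^esub> a j \<odot>\<^bsub>M\<^esub> (\<Oplus>\<^bsub>M\<^esub>i\<in>{..k - j}. b i \<odot>\<^bsub>M\<^esub> x (n - j - i))" if j: "j \<le> k" for j
    proof -
      have e: "Suc k - j = Suc (k - j)" "n - j - Suc (k - j) = n - Suc k" using j Suc.prems by auto
      have "(\<Oplus>\<^bsub>M\<^esub>i\<in>{..Suc (k - j)}. b i \<odot>\<^bsub>M\<^esub> x (n - j - i)) = (b (Suc (k - j)) \<odot>\<^bsub>M\<^esub> ?x) \<oplus>\<^bsub>M\<^esub> (\<Oplus>\<^bsub>M\<^esub>i\<in>{..k - j}. b i \<odot>\<^bsub>M\<^esub> x (n - j - i))"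
        using b x e(2) by (subst M.finsum_Suc) (auto simp: M.a_comm)
      then show ?thesis unfolding e(1) using a b x T by (simp add: smult_r_distr)
    qed
    then have "(\<Oplus>\<^bsub>M\<^esub>j\<in>{..k}. a j \<odot>\<^bsub>M\<^esub> (\<Oplus>\<^bsub>M\<^esub>i\<in>{..Suc k - j}. b i \<odot>\<^bsub>M\<^esub> x (n - j - i))) =
      (\<Oplus>\<^bsub>M\<^esub>j\<in>{..k}. a j \<odot>\<^bsub>M\<^esub> (b (Suc k - j) \<odot>\<^bsub>M\<^esub> ?x) \<oplus>\<^bsub>M\<^esub> a j \<odot>\<^bsub>M\<^esub> (\<Oplus>\<^bsub>M\<^esub>i\<in>{..k - j}. b i \<odot>\<^bsub>M\<^esub> x (n - j - i)))"
      using a b x T by (intro M.finsum_cong') auto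
    also have "\<dots> = (\<Oplus>\<^bsub>M\<^esub>j\<in>{..k}. a j \<odot>\<^bsub>M\<^esub> (b (Suc k - j) \<odot>\<^bsub>M\<^esub> ?x)) \<oplus>\<^bsub>M\<^esub> (\<Oplus>\<^bsub>M\<^esub>j\<in>{..k}. a j \<odot>\<^bsub>M\<^esub> (\<Oplus>\<^bsub>M\<^esub>i\<in>{..k - j}. b i \<odot>\<^bsub>M\<^esub> x (n - j - i)))"
      using a b x T by (intro M.finsum_addf) auto
    finally show ?thesis .
  qed
  let ?X = "(\<Oplus>\<^bsub>M\<^esub>j\<in>{..k}. a j \<odot>\<^bsub>M\<^esub> (b (Suc k - j) \<odot>\<^bsub>M\<^esub> ?x))" and ?Y = "(\<Oplus>\<^bsub>M\<^esub>j\<in>{..k}. a j \<odot>\<^bsub>M\<^esub> (\<Oplus>\<^bsub>M\<^esub>i\<in>{..k - j}. b i \<odot>\<^bsub>M\<^esub> x (n - j - i)))"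
    and ?Z = "a (Suc k) \<odot>\<^bsub>M\<^esub> (b 0 \<odot>\<^bsub>M\<^esub> ?x)"
  have c: "?X \<in> carrier M" "?Y \<in> carrier M" "?Z \<in> carrier M" using a b x T by (auto intro!: M.finsum_closed)
  have "(\<Oplus>\<^bsub>M\<^esub>j\<in>{..Suc k}. a j \<odot>\<^bsub>M\<^esub> (b (Suc k - j) \<odot>\<^bsub>M\<^esub> ?x)) = ?Z \<oplus>\<^bsub>M\<^esub> ?X" using a b x by (subst M.finsum_Suc) (auto simp: M.a_comm)
  moreover have "(\<Oplus>\<^bsub>M\<^esub>j\<in>{..Suc k}. a j \<odot>\<^bsub>M\<^esub> (\<Oplus>\<^bsub>M\<^esub>i\<in>{..Suc k - j}. b i \<odot>\<^bsub>M\<^esub> x (n - j - i))) = ?Z \<oplus>\<^bsub>M\<^esub> (?X \<oplus>\<^bsub>M\<^esub> ?Y)"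
    using a b x T r by (subst M.finsum_Suc) (auto simp: M.a_comm)
  moreover have "(\<Oplus>\<^bsub>M\<^esub>j\<in>{..k}. (\<Oplus>i\<in>{..j}. a i \<otimes> b (j - i)) \<odot>\<^bsub>M\<^esub> x (n - j)) = ?Y" using Suc by simp
  ultimately show ?case unfolding l m using c by (simp add: M.a_assoc)
qed

lemma GR_finsum: "finsum (ring_as_module R) f A = finsum R f A"
  by (simp add: finsum_def finprod_def ring_as_module_def)

lemma GR_conv: "GR.conv a b n = (\<Oplus>i\<in>{..n}. a i \<otimes> b (n - i))" by (simp add: GR.conv_def GR_finsum)

lemma conv_assoc: "GR.reps a \<Longrightarrow> GR.reps b \<Longrightarrow> reps x \<Longrightarrow> conv (GR.conv a b) x = conv a (conv b x)"
proof
  fix n assume "GR.reps a" "GR.reps b" "reps x"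
  then show "conv (GR.conv a b) x n = conv a (conv b x) n"
    using conv_assoc_aux[of a b x n n] GR_repsD(2) repsD(2) by (simp add: conv_def GR_conv)
qed

lemma conv_add_l: "GR.reps a \<Longrightarrow> GR.reps b \<Longrightarrow> reps x \<Longrightarrow> conv (\<lambda>n. a n \<oplus> b n) x = (\<lambda>n. conv a x n \<oplus>\<^bsub>M\<^esub> conv b x n)"
proof
  fix n assume "GR.reps a" "GR.reps b" "reps x"
  then have c: "a i \<in> carrier R" "b i \<in> carrier R" "x i \<in> carrier M" for i using GR_repsD(2) repsD(2) by auto
  show "conv (\<lambda>n. a n \<oplus> b n) x n = conv a x n \<oplus>\<^bsub>M\<^esub> conv b x n"
    unfolding conv_def using c by (subst M.finsum_addf[symmetric]) (auto intro!: M.finsum_cong' simp: smult_l_distr)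
qed

lemma conv_add_r: "GR.reps a \<Longrightarrow> reps x \<Longrightarrow> reps y \<Longrightarrow> conv a (\<lambda>n. x n \<oplus>\<^bsub>M\<^esub> y n) = (\<lambda>n. conv a x n \<oplus>\<^bsub>M\<^esub> conv a y n)"
proof
  fix n assume "GR.reps a" "reps x" "reps y"
  then have c: "a i \<in> carrier R" "x i \<in> carrier M" "y i \<in> carrier M" for i using GR_repsD(2) repsD(2) by auto
  show "conv a (\<lambda>n. x n \<oplus>\<^bsub>M\<^esub> y n) n = conv a x n \<oplus>\<^bsub>M\<^esub> conv a y n"
    unfolding conv_def using c by (subst M.finsum_addf[symmetric]) (auto intro!: M.finsum_cong' simp: smult_r_distr)
qed

definition "gmon k a = (\<lambda>n. if n = k then a else \<zero>)"

lemma GR_reps_mono: "a \<in> I k \<Longrightarrow> GR.reps (gmon k a)"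
  by (rule GR.repsI[of _ "Suc k"]) (auto simp: gmon_def additive_subgroup.zero_closed[OF ideal.axioms(1)[OF I_ideal]])

lemma conv_mono: "a \<in> carrier R \<Longrightarrow> (\<And>n. x n \<in> carrier M) \<Longrightarrow> conv (gmon k a) x n = (if k \<le> n then a \<odot>\<^bsub>M\<^esub> x (n - k) else \<zero>\<^bsub>M\<^esub>)"
proof (cases "k \<le> n")
  case True
  assume a: "a \<in> carrier R" "\<And>n. x n \<in> carrier M"
  have "conv (gmon k a) x n = gmon k a k \<odot>\<^bsub>M\<^esub> x (n - k)" unfolding conv_def by (rule finsum_single) (use True a in \<open>auto simp: gmon_def\<close>)
  then show ?thesis using True by (simp add: gmon_def)
next
  case False
  assume a: "a \<in> carrier R" "\<And>n. x n \<in> carrier M"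
  have "conv (gmon k a) x n = (\<Oplus>\<^bsub>M\<^esub>i\<in>{..n}. \<zero>\<^bsub>M\<^esub>)" unfolding conv_def using False a by (intro M.finsum_cong') (auto simp: gmon_def)
  then show ?thesis using False by (simp add: M.finsum_zero)
qed

lemma GR_conv_comm: "GR.reps a \<Longrightarrow> GR.reps b \<Longrightarrow> GR.conv a b = GR.conv b a"
proof
  fix n :: nat assume ab: "GR.reps a" "GR.reps b"
  have c: "a i \<in> carrier R" "b i \<in> carrier R" for i using GR_repsD(2) ab by auto
  have inj: "inj_on (\<lambda>i. n - i) {..n}" by (auto simp: inj_on_def)
  have "x \<in> (\<lambda>i. n - i) ` {..n}" if "x \<le> n" for x by (rule image_eqI[of _ _ "n - x"]) (use that in auto)
  then have im: "(\<lambda>i. n - i) ` {..n} = {..n}" by auto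
  have "GR.conv a b n = finsum R (\<lambda>i. a i \<otimes> b (n - i)) ((\<lambda>i. n - i) ` {..n})" by (simp add: GR_conv im)
  also have "\<dots> = (\<Oplus>i\<in>{..n}. a (n - i) \<otimes> b (n - (n - i)))" using c inj by (intro R.finsum_reindex) auto
  also have "\<dots> = (\<Oplus>i\<in>{..n}. b i \<otimes> a (n - i))" using c by (intro R.finsum_cong') (auto simp: R.m_comm)
  finally show "GR.conv a b n = GR.conv b a n" by (simp add: GR_conv)
qed

lemma conv_one: "reps x \<Longrightarrow> conv (gmon 0 \<one>) x = x" using conv_mono[of \<one> x 0] repsD(2) by auto

lemmas GR_conv_one = gr_setup.conv_one[OF R.gr_setup_ring[OF q]]
lemmas GR_conv_closed = gr_setup.conv_closed[OF R.gr_setup_ring[OF q]]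
  and GR_conv_assoc = gr_setup.conv_assoc[OF R.gr_setup_ring[OF q]]
  and GR_conv_add_l = gr_setup.conv_add_l[OF R.gr_setup_ring[OF q]]
  and GR_gr_smult_mk = gr_setup.gr_smult_mk[OF R.gr_setup_ring[OF q]]

abbreviation "E \<equiv> gr_module M F"
abbreviation "G \<equiv> gr_ring R q"

lemma carrier_E: "carrier E = gr_carrier M F" and add_E: "x \<oplus>\<^bsub>E\<^esub> y = gr_add M F x y"
  and zero_E: "\<zero>\<^bsub>E\<^esub> = mk (\<lambda>_. \<zero>\<^bsub>M\<^esub>)" and smult_E: "f \<odot>\<^bsub>E\<^esub> x = gr_smult M F f x"
  by (simp_all add: gr_module_def gr_zero_mk)

lemma carrier_G: "carrier G = gr_carrier (ring_as_module R) (adic_filt R q)"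
  and add_G: "x \<oplus>\<^bsub>G\<^esub> y = gr_add (ring_as_module R) (adic_filt R q) x y"
  and mult_G: "x \<otimes>\<^bsub>G\<^esub> y = gr_smult (ring_as_module R) (adic_filt R q) x y"
  and zero_G: "\<zero>\<^bsub>G\<^esub> = GR.mk (\<lambda>_. \<zero>)"
  using GR.gr_zero_mk by (simp_all add: gr_ring_def Let_def)

lemma one_G: "\<one>\<^bsub>G\<^esub> = GR.mk (gmon 0 \<one>)"
proof -
  have "GR.cls n \<zero> = \<zero>\<^bsub>gr_comp (ring_as_module R) (adic_filt R q) n\<^esub>" for n
    using fun_cong[OF GR.gr_zero_mk, of n] by (simp add: GR.mk_def)
  then show ?thesis by (auto simp: gr_ring_def Let_def GR.mk_def GR_cls gmon_def fun_eq_iff)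
qed

lemma one_reps: "GR.reps (gmon 0 \<one>)" by (rule GR_reps_mono) (simp add: adic_filt_0)


lemma gr_mult_mk: "GR.reps a \<Longrightarrow> GR.reps b \<Longrightarrow> GR.mk a \<otimes>\<^bsub>G\<^esub> GR.mk b = GR.mk (GR.conv a b)"
  unfolding mult_G by (rule GR_gr_smult_mk)
lemma gr_radd_mk: "GR.reps a \<Longrightarrow> GR.reps b \<Longrightarrow> GR.mk a \<oplus>\<^bsub>G\<^esub> GR.mk b = GR.mk (\<lambda>n. a n \<oplus> b n)"
  unfolding add_G using GR.gr_add_mk by simp
lemma gr_act_mk: "GR.reps a \<Longrightarrow> reps x \<Longrightarrow> GR.mk a \<odot>\<^bsub>E\<^esub> mk x = mk (conv a x)"
  unfolding smult_E by (rule gr_smult_mk)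
lemma gr_eadd_mk: "reps x \<Longrightarrow> reps y \<Longrightarrow> mk x \<oplus>\<^bsub>E\<^esub> mk y = mk (\<lambda>n. x n \<oplus>\<^bsub>M\<^esub> y n)"
  unfolding add_E by (rule gr_add_mk)

lemma G_cases: "f \<in> carrier G \<Longrightarrow> (\<And>a. GR.reps a \<Longrightarrow> f = GR.mk a \<Longrightarrow> thesis) \<Longrightarrow> thesis"
  unfolding carrier_G by (rule GR.mk_cases)
lemma E_cases: "f \<in> carrier E \<Longrightarrow> (\<And>x. reps x \<Longrightarrow> f = mk x \<Longrightarrow> thesis) \<Longrightarrow> thesis"
  unfolding carrier_E by (rule mk_cases)
lemma G_in: "GR.reps a \<Longrightarrow> GR.mk a \<in> carrier G" unfolding carrier_G by (rule GR.mk_in)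
lemma E_in: "reps x \<Longrightarrow> mk x \<in> carrier E" unfolding carrier_E by (rule mk_in)

lemma GR_reps_add: "GR.reps a \<Longrightarrow> GR.reps b \<Longrightarrow> GR.reps (\<lambda>n. a n \<oplus> b n)" using GR.reps_add by simp

lemma cring_G: "cring G"
proof (rule cringI)
  show "abelian_group G" by (rule GR.gr_abelian) (simp_all add: gr_ring_def Let_def)
  show "comm_monoid G"
  proof (rule comm_monoidI)
    fix x y assume "x \<in> carrier G" "y \<in> carrier G"
    then show "x \<otimes>\<^bsub>G\<^esub> y \<in> carrier G" "x \<otimes>\<^bsub>G\<^esub> y = y \<otimes>\<^bsub>G\<^esub> x"
      by (auto elim!: G_cases simp: gr_mult_mk G_in GR_conv_closed GR_conv_comm)
  next
    show "\<one>\<^bsub>G\<^esub> \<in> carrier G" unfolding one_G by (rule G_in[OF one_reps])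
  next
    fix x y z assume "x \<in> carrier G" "y \<in> carrier G" "z \<in> carrier G"
    then show "x \<otimes>\<^bsub>G\<^esub> y \<otimes>\<^bsub>G\<^esub> z = x \<otimes>\<^bsub>G\<^esub> (y \<otimes>\<^bsub>G\<^esub> z)"
      by (auto elim!: G_cases simp: gr_mult_mk GR_conv_closed GR_conv_assoc)
  next
    fix x assume "x \<in> carrier G" then show "\<one>\<^bsub>G\<^esub> \<otimes>\<^bsub>G\<^esub> x = x"
      by (auto elim!: G_cases simp: one_G gr_mult_mk one_reps GR_conv_one)
  qed
  fix x y z assume "x \<in> carrier G" "y \<in> carrier G" "z \<in> carrier G"
  then show "(x \<oplus>\<^bsub>G\<^esub> y) \<otimes>\<^bsub>G\<^esub> z = x \<otimes>\<^bsub>G\<^esub> z \<oplus>\<^bsub>G\<^esub> y \<otimes>\<^bsub>G\<^esub> z"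
    using GR_conv_add_l by (auto elim!: G_cases simp: gr_mult_mk gr_radd_mk GR_conv_closed GR_reps_add)
qed

text \<open>Makes the theory of submodules, regular sequences and socles available for the
  associated graded module over the associated graded ring.\<close>

lemma module_GE: "module G E"
proof (rule moduleI[OF cring_G])
  show "abelian_group E" by (rule gr_abelian) (simp_all add: gr_module_def)
next
  fix a x assume "a \<in> carrier G" "x \<in> carrier E" then show "a \<odot>\<^bsub>E\<^esub> x \<in> carrier E"
    by (auto elim!: G_cases E_cases simp: gr_act_mk E_in conv_closed)
next
  fix a b x assume "a \<in> carrier G" "b \<in> carrier G" "x \<in> carrier E"
  then show "(a \<oplus>\<^bsub>G\<^esub> b) \<odot>\<^bsub>E\<^esub> x = a \<odot>\<^bsub>E\<^esub> x \<oplus>\<^bsub>E\<^esub> b \<odot>\<^bsub>E\<^esub> x"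
    by (auto elim!: G_cases E_cases simp: gr_act_mk gr_radd_mk gr_eadd_mk conv_closed GR_reps_add conv_add_l)
next
  fix a x y assume "a \<in> carrier G" "x \<in> carrier E" "y \<in> carrier E"
  then show "a \<odot>\<^bsub>E\<^esub> (x \<oplus>\<^bsub>E\<^esub> y) = a \<odot>\<^bsub>E\<^esub> x \<oplus>\<^bsub>E\<^esub> a \<odot>\<^bsub>E\<^esub> y"
    by (auto elim!: G_cases E_cases simp: gr_act_mk gr_eadd_mk conv_closed reps_add conv_add_r)
next
  fix a b x assume "a \<in> carrier G" "b \<in> carrier G" "x \<in> carrier E"
  then show "(a \<otimes>\<^bsub>G\<^esub> b) \<odot>\<^bsub>E\<^esub> x = a \<odot>\<^bsub>E\<^esub> (b \<odot>\<^bsub>E\<^esub> x)"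
    by (auto elim!: G_cases E_cases simp: gr_act_mk gr_mult_mk conv_closed GR_conv_closed conv_assoc)
next
  fix x assume "x \<in> carrier E" then show "\<one>\<^bsub>G\<^esub> \<odot>\<^bsub>E\<^esub> x = x"
    by (auto elim!: E_cases simp: one_G gr_act_mk one_reps conv_one)
qed

end

section \<open>Chain conditions on the associated graded module\<close>

text \<open>Polynomials in \<open>z\<close> of degree less than \<open>n\<close> with coefficients
  in \<open>A\<close>; as the members of \<open>A\<close> lie in a module, the coefficients are not
  unique.\<close>

primrec polyhull :: "('a, 'c) ring_scheme \<Rightarrow> ('a, 'b, 'd) module_scheme \<Rightarrow> 'a \<Rightarrow> 'b set \<Rightarrow> nat \<Rightarrow> 'b set" where
  "polyhull R M z A 0 = {\<zero>\<^bsub>M\<^esub>}"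
| "polyhull R M z A (Suc n) = msum M (polyhull R M z A n) (smul M (z [^]\<^bsub>R\<^esub> n) A)"

context module begin

text \<open>The leading coefficient argument of Hilbert's basis theorem.\<close>
lemma hilbert_basis:
  assumes P: "P \<subseteq> carrier R" and z: "z \<in> carrier R" and A: "stab M P A" and acc: "acc M P {\<zero>\<^bsub>M\<^esub>} A"
  defines "H \<equiv> \<Union>n. polyhull R M z A n"
  shows "A \<subseteq> H" "stab M (insert z P) H" "acc M (insert z P) {\<zero>\<^bsub>M\<^esub>} H"
proof -
  let ?V = "polyhull R M z A"
  have zn: "z [^] n \<in> carrier R" for n :: nat using z by simp
  have V: "stab M P (?V n)" for n
    by (induction n) (simp_all add: stable_zero[OF P] stable_msum[OF P _ stable_smul[OF P zn A]])
  have Vs: "?V n \<subseteq> ?V (Suc n)" for n using msum_upper1[OF V stable_smul[OF P zn A]] by simp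
  have Vm: "?V n \<subseteq> ?V m" if "n \<le> m" for n m by (rule lift_Suc_mono_le[where f="?V", OF Vs that])
  have Vz: "z \<odot>\<^bsub>M\<^esub> v \<in> ?V (Suc n)" if "v \<in> ?V n" for n v
    using that
  proof (induction n arbitrary: v)
    case 0 then show ?case using subsetD[OF Vs stableD(2)[OF V], of 0] z by simp
  next
    case (Suc n)
    then obtain w e where w: "w \<in> ?V n" "e \<in> A" "v = w \<oplus>\<^bsub>M\<^esub> z [^] n \<odot>\<^bsub>M\<^esub> e" by (auto elim!: msumE smulE)
    have "z \<odot>\<^bsub>M\<^esub> v = z \<odot>\<^bsub>M\<^esub> w \<oplus>\<^bsub>M\<^esub> z [^] Suc n \<odot>\<^bsub>M\<^esub> e"
      using stableD(6)[OF V w(1)] stableD(6)[OF A w(2)] z w(3)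
      by (simp add: smult_r_distr smult_assoc1[symmetric] R.m_comm)
    then show ?case using msumI[OF Suc.IH[OF w(1)] smulI[OF w(2), of M "z [^] Suc n"]] by simp
  qed
  show "A \<subseteq> H"
  proof
    fix a assume a: "a \<in> A"
    have "\<zero>\<^bsub>M\<^esub> \<oplus>\<^bsub>M\<^esub> z [^] (0::nat) \<odot>\<^bsub>M\<^esub> a \<in> ?V (Suc 0)" unfolding polyhull.simps by (rule msumI[OF _ smulI[OF a]]) simp
    moreover have "\<zero>\<^bsub>M\<^esub> \<oplus>\<^bsub>M\<^esub> z [^] (0::nat) \<odot>\<^bsub>M\<^esub> a = a" using stableD(6)[OF A a] by simp
    ultimately have "a \<in> ?V (Suc 0)" by metis
    then show "a \<in> H" unfolding H_def by blast
  qed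
  show "stab M (insert z P) H"
    unfolding stab_def
  proof (intro conjI ballI)
    show "H \<subseteq> carrier M" unfolding H_def using stableD(1)[OF V] by blast
    show "\<zero>\<^bsub>M\<^esub> \<in> H" unfolding H_def using stableD(2)[OF V] by blast
    show "\<ominus>\<^bsub>M\<^esub> x \<in> H" if "x \<in> H" for x using that stableD(4)[OF V] unfolding H_def by blast
    show "x \<oplus>\<^bsub>M\<^esub> y \<in> H" if xy: "x \<in> H" "y \<in> H" for x y
    proof -
      obtain n m where n: "x \<in> ?V n" "y \<in> ?V m" using xy unfolding H_def by blast
      have "x \<oplus>\<^bsub>M\<^esub> y \<in> ?V (max n m)"
        by (rule stableD(3)[OF V]) (rule subsetD[OF Vm n(1)], simp, rule subsetD[OF Vm n(2)], simp)
      then show ?thesis unfolding H_def by blast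
    qed
    fix a x assume a: "a \<in> insert z P" and "x \<in> H"
    then obtain n where n: "x \<in> ?V n" unfolding H_def by blast
    have "a \<odot>\<^bsub>M\<^esub> x \<in> ?V (Suc n)"
    proof (cases "a = z")
      case True then show ?thesis using Vz[OF n] by simp
    next
      case False
      then have "a \<in> P" using a by simp
      then show ?thesis using subsetD[OF Vs stableD(5)[OF V _ n]] by blast
    qed
    then show "a \<odot>\<^bsub>M\<^esub> x \<in> H" unfolding H_def by blast
  qed
  \<comment> \<open>Possible leading coefficients in degree \<open>n\<close> of elements of
    \<open>U\<close>. The argument works with sets of such coefficients, so their non-uniqueness
    does no harm.\<close>
  define L where "L n U = {e \<in> A. \<exists>w\<in>?V n. z [^] n \<odot>\<^bsub>M\<^esub> e \<oplus>\<^bsub>M\<^esub> w \<in> U}" for n U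
  have L_stab: "stab M P (L n U)" if U: "stab M (insert z P) U" for n U
    unfolding stab_def
  proof (intro conjI ballI)
    show "L n U \<subseteq> carrier M" unfolding L_def using stableD(1)[OF A] by blast
    have "z [^] n \<odot>\<^bsub>M\<^esub> \<zero>\<^bsub>M\<^esub> \<oplus>\<^bsub>M\<^esub> \<zero>\<^bsub>M\<^esub> \<in> U" using stableD(2)[OF U] zn by simp
    then show "\<zero>\<^bsub>M\<^esub> \<in> L n U" unfolding L_def using stableD(2)[OF A] stableD(2)[OF V] by blast
  next
    fix x y assume "x \<in> L n U" "y \<in> L n U"
    then obtain w w' where w: "x \<in> A" "w \<in> ?V n" "z [^] n \<odot>\<^bsub>M\<^esub> x \<oplus>\<^bsub>M\<^esub> w \<in> U"
      "y \<in> A" "w' \<in> ?V n" "z [^] n \<odot>\<^bsub>M\<^esub> y \<oplus>\<^bsub>M\<^esub> w' \<in> U" unfolding L_def by blast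
    have c: "x \<in> carrier M" "w \<in> carrier M" "y \<in> carrier M" "w' \<in> carrier M"
      using stableD(6)[OF A] stableD(6)[OF V] w by metis+
    have "(z [^] n \<odot>\<^bsub>M\<^esub> x \<oplus>\<^bsub>M\<^esub> w) \<oplus>\<^bsub>M\<^esub> (z [^] n \<odot>\<^bsub>M\<^esub> y \<oplus>\<^bsub>M\<^esub> w') = z [^] n \<odot>\<^bsub>M\<^esub> (x \<oplus>\<^bsub>M\<^esub> y) \<oplus>\<^bsub>M\<^esub> (w \<oplus>\<^bsub>M\<^esub> w')"
      using c zn by (simp add: smult_r_distr M.a_ac)
    then show "x \<oplus>\<^bsub>M\<^esub> y \<in> L n U" unfolding L_def using stableD(3)[OF U w(3) w(6)] stableD(3)[OF A w(1) w(4)] stableD(3)[OF V w(2) w(5)] by force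
  next
    fix x assume "x \<in> L n U"
    then obtain w where w: "x \<in> A" "w \<in> ?V n" "z [^] n \<odot>\<^bsub>M\<^esub> x \<oplus>\<^bsub>M\<^esub> w \<in> U" unfolding L_def by blast
    have c: "x \<in> carrier M" "w \<in> carrier M" using stableD(6)[OF A] stableD(6)[OF V] w by metis+
    have "\<ominus>\<^bsub>M\<^esub> (z [^] n \<odot>\<^bsub>M\<^esub> x \<oplus>\<^bsub>M\<^esub> w) = z [^] n \<odot>\<^bsub>M\<^esub> (\<ominus>\<^bsub>M\<^esub> x) \<oplus>\<^bsub>M\<^esub> (\<ominus>\<^bsub>M\<^esub> w)"
      using c zn by (simp add: smult_r_minus M.minus_add)
    then show "\<ominus>\<^bsub>M\<^esub> x \<in> L n U" unfolding L_def using stableD(4)[OF U w(3)] stableD(4)[OF A w(1)] stableD(4)[OF V w(2)] by force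
  next
    fix a x assume a: "a \<in> P" and "x \<in> L n U"
    then obtain w where w: "x \<in> A" "w \<in> ?V n" "z [^] n \<odot>\<^bsub>M\<^esub> x \<oplus>\<^bsub>M\<^esub> w \<in> U" unfolding L_def by blast
    have c: "x \<in> carrier M" "w \<in> carrier M" using stableD(6)[OF A] stableD(6)[OF V] w by metis+
    have aR: "a \<in> carrier R" using a P by blast
    have "a \<odot>\<^bsub>M\<^esub> (z [^] n \<odot>\<^bsub>M\<^esub> x \<oplus>\<^bsub>M\<^esub> w) = z [^] n \<odot>\<^bsub>M\<^esub> (a \<odot>\<^bsub>M\<^esub> x) \<oplus>\<^bsub>M\<^esub> (a \<odot>\<^bsub>M\<^esub> w)"
      using c zn aR by (simp add: smult_r_distr smult_lcomm[of a])
    then show "a \<odot>\<^bsub>M\<^esub> x \<in> L n U" unfolding L_def using stableD(5)[OF U insertI2[OF a] w(3)] stableD(5)[OF A a w(1)] stableD(5)[OF V a w(2)] by force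
  qed
  have L_mono: "L n U \<subseteq> L n U'" if "U \<subseteq> U'" for n U U' using that unfolding L_def by blast
  have L_Suc: "L n U \<subseteq> L (Suc n) U" if U: "stab M (insert z P) U" for n U
  proof
    fix x assume "x \<in> L n U"
    then obtain w where w: "x \<in> A" "w \<in> ?V n" "z [^] n \<odot>\<^bsub>M\<^esub> x \<oplus>\<^bsub>M\<^esub> w \<in> U" unfolding L_def by blast
    have c: "x \<in> carrier M" "w \<in> carrier M" using stableD(6)[OF A] stableD(6)[OF V] w by metis+
    have "z \<odot>\<^bsub>M\<^esub> (z [^] n \<odot>\<^bsub>M\<^esub> x \<oplus>\<^bsub>M\<^esub> w) = z [^] Suc n \<odot>\<^bsub>M\<^esub> x \<oplus>\<^bsub>M\<^esub> z \<odot>\<^bsub>M\<^esub> w"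
      using c z by (simp add: smult_r_distr smult_assoc1[symmetric] R.m_comm)
    then show "x \<in> L (Suc n) U" unfolding L_def using stableD(5)[OF U insertI1 w(3)] w(1) Vz[OF w(2)] by force
  qed
  have L_le: "L n U \<subseteq> L m U" if "stab M (insert z P) U" "n \<le> m" for n m U using lift_Suc_mono_le[of "\<lambda>n. L n U", OF L_Suc[OF that(1)] that(2)] .
  \<comment> \<open>Subtracting an element of \<open>U\<close> with the same leading coefficient
    lowers the degree, so equal leading coefficients in all degrees force equality.\<close>
  have L_eq: "U' \<subseteq> U" if U: "stab M (insert z P) U" and U': "stab M (insert z P) U'" "U \<subseteq> U'" "U' \<subseteq> H" and e: "\<And>n. L n U' \<subseteq> L n U" for U U'
  proof -
    have "u \<in> U" if "u \<in> U'" "u \<in> ?V n" for u n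
      using that
    proof (induction n arbitrary: u)
      case 0 then show ?case using stableD(2)[OF U] by simp
    next
      case (Suc n)
      then obtain w x where w: "w \<in> ?V n" "x \<in> A" "u = w \<oplus>\<^bsub>M\<^esub> z [^] n \<odot>\<^bsub>M\<^esub> x" by (auto elim!: msumE smulE)
      have c: "x \<in> carrier M" "w \<in> carrier M" using stableD(6)[OF A] stableD(6)[OF V] w by metis+
      have u: "u = z [^] n \<odot>\<^bsub>M\<^esub> x \<oplus>\<^bsub>M\<^esub> w" using w(3) c zn by (simp add: M.a_comm)
      then have "x \<in> L n U'" unfolding L_def using w(1,2) Suc.prems(1) by blast
      then have "x \<in> L n U" using e by blast
      then obtain w' where w': "w' \<in> ?V n" "z [^] n \<odot>\<^bsub>M\<^esub> x \<oplus>\<^bsub>M\<^esub> w' \<in> U" unfolding L_def by blast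
      have c': "w' \<in> carrier M" by (rule stableD(6)[OF V w'(1)])
      let ?y = "z [^] n \<odot>\<^bsub>M\<^esub> x"
      have y: "?y \<in> carrier M" using c zn by simp
      have "(?y \<oplus>\<^bsub>M\<^esub> w) \<oplus>\<^bsub>M\<^esub> (\<ominus>\<^bsub>M\<^esub> ?y \<oplus>\<^bsub>M\<^esub> \<ominus>\<^bsub>M\<^esub> w') = (?y \<oplus>\<^bsub>M\<^esub> \<ominus>\<^bsub>M\<^esub> ?y) \<oplus>\<^bsub>M\<^esub> (w \<oplus>\<^bsub>M\<^esub> \<ominus>\<^bsub>M\<^esub> w')"
        using y c(2) c' by (simp only: M.a_ac M.a_inv_closed M.a_closed)
      then have eq: "u \<ominus>\<^bsub>M\<^esub> (?y \<oplus>\<^bsub>M\<^esub> w') = w \<ominus>\<^bsub>M\<^esub> w'" unfolding u a_minus_def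
        using y c(2) c' by (simp add: M.minus_add M.r_neg)
      have "w \<ominus>\<^bsub>M\<^esub> w' \<in> U" using Suc.IH[of "w \<ominus>\<^bsub>M\<^esub> w'"] stableD(7)[OF U'(1) Suc.prems(1) subsetD[OF U'(2) w'(2)]] stableD(7)[OF V w(1) w'(1)] unfolding eq by blast
      then have "(u \<ominus>\<^bsub>M\<^esub> (?y \<oplus>\<^bsub>M\<^esub> w')) \<oplus>\<^bsub>M\<^esub> (?y \<oplus>\<^bsub>M\<^esub> w') \<in> U" unfolding eq by (rule stableD(3)[OF U _ w'(2)])
      moreover have "u \<in> carrier M" by (rule stableD(6)[OF U'(1) Suc.prems(1)])
      ultimately show ?case using y c' add_minus_cancel(2)[of u "?y \<oplus>\<^bsub>M\<^esub> w'"] by simp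
    qed
    then show ?thesis using U'(3) unfolding H_def by blast
  qed
  show "acc M (insert z P) {\<zero>\<^bsub>M\<^esub>} H"
    unfolding acc_def
  proof (intro allI impI)
    fix f :: "nat \<Rightarrow> 'c set" assume f: "\<forall>n. stab M (insert z P) (f n) \<and> {\<zero>\<^bsub>M\<^esub>} \<subseteq> f n \<and> f n \<subseteq> H \<and> f n \<subseteq> f (Suc n)"
    have fs: "stab M (insert z P) (f n)" for n using f by blast
    have fm: "f n \<subseteq> f m" if "n \<le> m" for n m by (rule lift_Suc_mono_le[where f=f, OF _ that]) (use f in blast)
    have stop: "\<exists>k. \<forall>n\<ge>k. g n = g k" if g: "\<And>n. stab M P (g n)" "\<And>n. g n \<subseteq> A" "\<And>n. g n \<subseteq> g (Suc n)" for g :: "nat \<Rightarrow> 'c set"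
      using acc g stableD(2)[OF g(1)] unfolding acc_def by simp
    have LA: "L n U \<subseteq> A" for n U unfolding L_def by blast
    have "\<exists>k. \<forall>n\<ge>k. L n (f n) = L k (f k)"
    proof (rule stop[OF L_stab[OF fs] LA])
      fix n show "L n (f n) \<subseteq> L (Suc n) (f (Suc n))"
        by (rule order_trans[OF L_Suc[OF fs] L_mono[OF fm]]) simp
    qed
    then obtain k0 where k0: "\<And>n. n \<ge> k0 \<Longrightarrow> L n (f n) = L k0 (f k0)" by blast
    \<comment> \<open>The diagonal sequence gives one index beyond which the leading coefficients
      depend neither on the degree nor on the position in the chain; only the finitely many smaller
      degrees remain to be stabilised one by one.\<close>
    have big: "L n (f m) = L k0 (f k0)" if "n \<ge> k0" "m \<ge> k0" for n m
    proof
      have "L n (f m) \<subseteq> L (max n m) (f (max n m))" by (rule order_trans[OF L_le[OF fs] L_mono[OF fm]]) auto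
      then show "L n (f m) \<subseteq> L k0 (f k0)" using k0[of "max n m"] that by simp
      show "L k0 (f k0) \<subseteq> L n (f m)" by (rule order_trans[OF L_le[OF fs that(1)] L_mono[OF fm[OF that(2)]]])
    qed
    have "\<exists>k. \<forall>m\<ge>k. L n (f m) = L n (f k)" for n
      by (rule stop[OF L_stab[OF fs] LA]) (rule L_mono[OF fm], simp)
    then obtain kk where kk: "\<And>n m. m \<ge> kk n \<Longrightarrow> L n (f m) = L n (f (kk n))" by metis
    define k where "k = Max (insert k0 (kk ` {..<k0}))"
    have k: "k \<ge> k0" "\<And>n. n < k0 \<Longrightarrow> k \<ge> kk n" unfolding k_def by (auto intro: Max_ge)
    have same: "L n (f m) = L n (f k)" if "m \<ge> k" for n m
    proof (cases "n < k0")
      case True then show ?thesis using kk[of n m] kk[of n k] k(2)[OF True] that by simp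
    next
      case False then show ?thesis using big[of n m] big[of n k] k(1) that by simp
    qed
    show "\<exists>k. \<forall>n\<ge>k. f n = f k"
    proof (intro exI allI impI)
      fix m assume m: "m \<ge> k"
      have "f m \<subseteq> f k" by (rule L_eq[OF fs fs fm[OF m]]) (use f same[OF m] in auto)
      then show "f m = f k" using fm[OF m] by blast
    qed
  qed
qed

lemma hilbert_basis_list:
  assumes A: "stab M P A" and P: "P \<subseteq> carrier R" and acc: "acc M P {\<zero>\<^bsub>M\<^esub>} A"
  shows "set zs \<subseteq> carrier R \<Longrightarrow> \<exists>H. A \<subseteq> H \<and> stab M (set zs \<union> P) H \<and> acc M (set zs \<union> P) {\<zero>\<^bsub>M\<^esub>} H"
proof (induction zs)
  case Nil then show ?case using assms by auto
next
  case (Cons z zs)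
  then obtain H where H: "A \<subseteq> H" "stab M (set zs \<union> P) H" "acc M (set zs \<union> P) {\<zero>\<^bsub>M\<^esub>} H" by auto
  have s: "set zs \<union> P \<subseteq> carrier R" "z \<in> carrier R" using Cons.prems P by auto
  have e: "insert z (set zs \<union> P) = set (z # zs) \<union> P" by simp
  show ?case using hilbert_basis[OF s H(2,3)] order_trans[OF H(1)] unfolding e by blast
qed

end

context gr_setup begin

sublocale GE: module "gr_ring R q" "gr_module M F" by (rule module_GE)

definition "emon k v = (\<lambda>n::nat. if n = k then v else \<zero>\<^bsub>M\<^esub>)"
definition "Elow k = {mk x | x. reps x \<and> (\<forall>n\<ge>k. x n \<in> F (Suc n))}"
definition "gr_consts = {GR.mk (gmon 0 r) | r. r \<in> carrier R}"
definition "star z = GR.mk (gmon 1 z)"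

lemma gr_minus_mk: "reps x \<Longrightarrow> \<ominus>\<^bsub>E\<^esub> mk x = mk (\<lambda>n. \<ominus>\<^bsub>M\<^esub> x n)"
  by (rule GE.M.minus_equality) (auto simp: gr_eadd_mk reps_minus E_in zero_E M.l_neg repsD(2))

lemma gr_diff_mk: "reps x \<Longrightarrow> reps y \<Longrightarrow> mk x \<ominus>\<^bsub>E\<^esub> mk y = mk (\<lambda>n. x n \<ominus>\<^bsub>M\<^esub> y n)"
  by (simp add: a_minus_def gr_minus_mk gr_eadd_mk reps_minus)

lemma reps_diff: "reps x \<Longrightarrow> reps y \<Longrightarrow> reps (\<lambda>n. x n \<ominus>\<^bsub>M\<^esub> y n)"
  unfolding a_minus_def by (rule reps_add[OF _ reps_minus])

lemma reps_mon: "v \<in> F k \<Longrightarrow> reps (emon k v)"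
  by (rule repsI[of _ "Suc k"]) (auto simp: emon_def stableD(2)[OF Fsub])

lemma const_reps: "r \<in> carrier R \<Longrightarrow> GR.reps (gmon 0 r)" by (rule GR_reps_mono) (simp add: adic_filt_0)

lemma const_conv: "r \<in> carrier R \<Longrightarrow> reps x \<Longrightarrow> conv (gmon 0 r) x = (\<lambda>n. r \<odot>\<^bsub>M\<^esub> x n)"
proof
  fix n assume "r \<in> carrier R" "reps x"
  then show "conv (gmon 0 r) x n = r \<odot>\<^bsub>M\<^esub> x n" using conv_mono[of r x 0 n] repsD(2) by simp
qed

lemma gr_const_act: "r \<in> carrier R \<Longrightarrow> reps x \<Longrightarrow> GR.mk (gmon 0 r) \<odot>\<^bsub>E\<^esub> mk x = mk (\<lambda>n. r \<odot>\<^bsub>M\<^esub> x n)"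
  using gr_act_mk[OF const_reps, of r x] const_conv[of r x] by simp

lemma reps_smult: "r \<in> carrier R \<Longrightarrow> reps x \<Longrightarrow> reps (\<lambda>n. r \<odot>\<^bsub>M\<^esub> x n)"
  using conv_closed[OF const_reps, of r x] const_conv[of r x] by simp

lemma star_reps: "z \<in> q \<Longrightarrow> GR.reps (gmon 1 z)" by (rule GR_reps_mono) (simp add: R.adic_1[OF q, simplified])
lemma star_in: "z \<in> q \<Longrightarrow> star z \<in> carrier G" unfolding star_def by (rule G_in[OF star_reps])

lemma q_in: "z \<in> q \<Longrightarrow> z \<in> carrier R" using ideal.Icarr[OF q] .

lemma star_act: "z \<in> q \<Longrightarrow> reps x \<Longrightarrow> star z \<odot>\<^bsub>E\<^esub> mk x = mk (\<lambda>n. if n = 0 then \<zero>\<^bsub>M\<^esub> else z \<odot>\<^bsub>M\<^esub> x (n - 1))"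
proof -
  assume z: "z \<in> q" and x: "reps x"
  have "conv (gmon 1 z) x = (\<lambda>n. if n = 0 then \<zero>\<^bsub>M\<^esub> else z \<odot>\<^bsub>M\<^esub> x (n - 1))"
  proof
    fix n :: nat show "conv (gmon 1 z) x n = (if n = 0 then \<zero>\<^bsub>M\<^esub> else z \<odot>\<^bsub>M\<^esub> x (n - 1))"
      using conv_mono[of z x 1 n] q_in[OF z] repsD(2)[OF x] by (cases n) auto
  qed
  then show ?thesis unfolding star_def using gr_act_mk[OF star_reps[OF z] x] by simp
qed

lemma star_mon: "z \<in> q \<Longrightarrow> v \<in> F k \<Longrightarrow> star z \<odot>\<^bsub>E\<^esub> mk (emon k v) = mk (emon (Suc k) (z \<odot>\<^bsub>M\<^esub> v))"
proof -
  assume z: "z \<in> q" and v: "v \<in> F k"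
  have "(\<lambda>n. if n = 0 then \<zero>\<^bsub>M\<^esub> else z \<odot>\<^bsub>M\<^esub> emon k v (n - 1)) = emon (Suc k) (z \<odot>\<^bsub>M\<^esub> v)"
    using q_in[OF z] by (auto simp: emon_def fun_eq_iff)
  then show ?thesis using star_act[OF z reps_mon[OF v]] by simp
qed

lemma Elow_iff: "reps x \<Longrightarrow> mk x \<in> Elow k \<longleftrightarrow> (\<forall>n\<ge>k. x n \<in> F (Suc n))"
proof
  assume x: "reps x" and "mk x \<in> Elow k"
  then obtain y where y: "reps y" "\<forall>n\<ge>k. y n \<in> F (Suc n)" "mk x = mk y" unfolding Elow_def by blast
  have d: "x n \<ominus>\<^bsub>M\<^esub> y n \<in> F (Suc n)" for n using mk_eq_iff[OF x y(1)] y(3) by blast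
  show "\<forall>n\<ge>k. x n \<in> F (Suc n)"
  proof (intro allI impI)
    fix n assume "n \<ge> k"
    then have "(x n \<ominus>\<^bsub>M\<^esub> y n) \<oplus>\<^bsub>M\<^esub> y n \<in> F (Suc n)" using d y(2) stableD(3)[OF Fsub] by blast
    then show "x n \<in> F (Suc n)" using add_minus_cancel(2)[of "x n" "y n"] repsD(2) x y(1) by simp
  qed
qed (auto simp: Elow_def)

lemma gr_consts_carrier: "gr_consts \<subseteq> carrier G" unfolding gr_consts_def using G_in[OF const_reps] by blast

lemma Elow_stab: "stab E gr_consts (Elow k)"
  unfolding stab_def
proof (intro conjI ballI)
  show "Elow k \<subseteq> carrier E" unfolding Elow_def using E_in by blast
  show "\<zero>\<^bsub>E\<^esub> \<in> Elow k" unfolding zero_E Elow_iff[OF reps_zero] using stableD(2)[OF Fsub] by blast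
next
  fix x y assume "x \<in> Elow k" "y \<in> Elow k"
  then obtain u v where u: "reps u" "x = mk u" "\<forall>n\<ge>k. u n \<in> F (Suc n)" "reps v" "y = mk v" "\<forall>n\<ge>k. v n \<in> F (Suc n)" unfolding Elow_def by blast
  then show "x \<oplus>\<^bsub>E\<^esub> y \<in> Elow k" using stableD(3)[OF Fsub] by (simp add: gr_eadd_mk Elow_iff reps_add)
next
  fix x assume "x \<in> Elow k"
  then obtain u where u: "reps u" "x = mk u" "\<forall>n\<ge>k. u n \<in> F (Suc n)" unfolding Elow_def by blast
  then show "\<ominus>\<^bsub>E\<^esub> x \<in> Elow k" using stableD(4)[OF Fsub] by (simp add: gr_minus_mk Elow_iff reps_minus)
next
  fix a x assume "a \<in> gr_consts" "x \<in> Elow k"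
  then obtain r u where u: "r \<in> carrier R" "a = GR.mk (gmon 0 r)" "reps u" "x = mk u" "\<forall>n\<ge>k. u n \<in> F (Suc n)" unfolding Elow_def gr_consts_def by blast
  then show "a \<odot>\<^bsub>E\<^esub> x \<in> Elow k" using stableD(5)[OF Fsub] by (simp add: gr_const_act Elow_iff reps_smult)
qed

lemma Elow_Suc: "Elow k \<subseteq> Elow (Suc k)" unfolding Elow_def by auto

text \<open>Between consecutive degree bounds only the component of degree \<open>k\<close> matters,
  and its representatives form submodules of \<open>M\<close>.\<close>

lemma acc_Elow_step: assumes "acc M (carrier R) {\<zero>\<^bsub>M\<^esub>} (carrier M)" shows "acc E gr_consts (Elow k) (Elow (Suc k))"
  unfolding acc_def
proof (intro allI impI)
  fix f assume f: "\<forall>n::nat. stab E gr_consts (f n) \<and> Elow k \<subseteq> f n \<and> f n \<subseteq> Elow (Suc k) \<and> f n \<subseteq> f (Suc n)"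
  have fs: "stab E gr_consts (f n)" and fl: "Elow k \<subseteq> f n" and fu: "f n \<subseteq> Elow (Suc k)" for n using f by blast+
  have fm: "f n \<subseteq> f m" if "n \<le> m" for n m by (rule lift_Suc_mono_le[where f=f, OF _ that]) (use f in blast)
  define T where "T n = {x k | x. reps x \<and> mk x \<in> f n}" for n
  have TI: "w \<in> T n" if "reps x" "mk x \<in> f n" "x k = w" for x w n using that unfolding T_def by blast
  have Ts: "sub (T n)" for n
    unfolding stab_def
  proof (intro conjI ballI)
    show "T n \<subseteq> carrier M" unfolding T_def using repsD(2) by blast
    show "\<zero>\<^bsub>M\<^esub> \<in> T n" by (rule TI[OF reps_zero]) (use stableD(2)[OF fs[of n]] zero_E in auto)
    fix u assume "u \<in> T n"
    then obtain x where x: "reps x" "mk x \<in> f n" "u = x k" unfolding T_def by blast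
    show "\<ominus>\<^bsub>M\<^esub> u \<in> T n" by (rule TI[OF reps_minus[OF x(1)]]) (use stableD(4)[OF fs x(2)] gr_minus_mk[OF x(1)] x(3) in simp_all)
    fix v assume "v \<in> T n"
    then obtain y where y: "reps y" "mk y \<in> f n" "v = y k" unfolding T_def by blast
    show "u \<oplus>\<^bsub>M\<^esub> v \<in> T n" by (rule TI[OF reps_add[OF x(1) y(1)]]) (use stableD(3)[OF fs x(2) y(2)] gr_eadd_mk[OF x(1) y(1)] x(3) y(3) in simp_all)
  next
    fix r u assume r: "r \<in> carrier R" and "u \<in> T n"
    then obtain x where x: "reps x" "mk x \<in> f n" "u = x k" unfolding T_def by blast
    have "GR.mk (gmon 0 r) \<in> gr_consts" unfolding gr_consts_def using r by blast
    from stableD(5)[OF fs this x(2)] show "r \<odot>\<^bsub>M\<^esub> u \<in> T n"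
      by (intro TI[OF reps_smult[OF r x(1)]]) (use gr_const_act[OF r x(1)] x(3) in simp_all)
  qed
  have "T n \<subseteq> T (Suc n)" for n unfolding T_def using fm[of n "Suc n"] by auto
  then have "\<exists>K. \<forall>n\<ge>K. T n = T K" using assms Ts stableD(1)[OF Ts] stableD(2)[OF Ts] unfolding acc_def by simp
  then obtain K where K: "\<And>n. n \<ge> K \<Longrightarrow> T n = T K" by blast
  show "\<exists>K. \<forall>n\<ge>K. f n = f K"
  proof (intro exI[of _ K] allI impI)
    fix n assume n: "n \<ge> K"
    have "f n \<subseteq> f K"
    proof
      fix \<xi> assume \<xi>: "\<xi> \<in> f n"
      then have "\<xi> \<in> Elow (Suc k)" using fu by blast
      then obtain x where x: "reps x" "\<xi> = mk x" "\<forall>n\<ge>Suc k. x n \<in> F (Suc n)" unfolding Elow_def by blast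
      have "x k \<in> T K" using K[OF n] x(1,2) \<xi> unfolding T_def by blast
      then obtain y where y: "reps y" "mk y \<in> f K" "x k = y k" unfolding T_def by blast
      have yl: "\<forall>n\<ge>Suc k. y n \<in> F (Suc n)" using subsetD[OF fu y(2)] Elow_iff[OF y(1)] by blast
      have "x j \<ominus>\<^bsub>M\<^esub> y j \<in> F (Suc j)" if "j \<ge> k" for j
      proof (cases "j = k")
        case True then show ?thesis using y(3) repsD(2)[OF y(1)] stableD(2)[OF Fsub] by (simp add: a_minus_def M.r_neg)
      next
        case False then show ?thesis using that x(3) yl stableD(7)[OF Fsub] by simp
      qed
      then have "mk x \<ominus>\<^bsub>E\<^esub> mk y \<in> Elow k" unfolding gr_diff_mk[OF x(1) y(1)] Elow_iff[OF reps_diff[OF x(1) y(1)]] by blast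
      then have "(mk x \<ominus>\<^bsub>E\<^esub> mk y) \<oplus>\<^bsub>E\<^esub> mk y \<in> f K" using fl stableD(3)[OF fs _ y(2)] by blast
      then show "\<xi> \<in> f K" using GE.add_minus_cancel(2)[OF E_in[OF x(1)] E_in[OF y(1)]] x(2) by simp
    qed
    then show "f n = f K" using fm[OF n] by blast
  qed
qed

lemma acc_Elow: assumes "acc M (carrier R) {\<zero>\<^bsub>M\<^esub>} (carrier M)" shows "acc E gr_consts {\<zero>\<^bsub>E\<^esub>} (Elow k)"
proof (induction k)
  case 0
  have "Elow 0 \<subseteq> {\<zero>\<^bsub>E\<^esub>}"
  proof
    fix \<xi> assume "\<xi> \<in> Elow 0"
    then obtain x where x: "reps x" "\<xi> = mk x" "\<forall>n. x n \<in> F (Suc n)" unfolding Elow_def by blast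
    have "x n \<ominus>\<^bsub>M\<^esub> \<zero>\<^bsub>M\<^esub> = x n" for n using repsD(2)[OF x(1), of n] by (simp add: a_minus_def)
    then show "\<xi> \<in> {\<zero>\<^bsub>E\<^esub>}" using mk_eq_iff[OF x(1) reps_zero] x by (simp add: zero_E)
  qed
  then have e: "f n = {\<zero>\<^bsub>E\<^esub>}" if "{\<zero>\<^bsub>E\<^esub>} \<subseteq> f n" "f n \<subseteq> Elow 0" for f and n :: nat using that by blast
  show ?case unfolding acc_def
  proof (intro allI impI)
    fix f :: "nat \<Rightarrow> (nat \<Rightarrow> 'c set) set" assume f: "\<forall>n. stab E gr_consts (f n) \<and> {\<zero>\<^bsub>E\<^esub>} \<subseteq> f n \<and> f n \<subseteq> Elow 0 \<and> f n \<subseteq> f (Suc n)"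
    have "f n = {\<zero>\<^bsub>E\<^esub>}" for n by (rule e) (use f in blast)+
    then show "\<exists>k. \<forall>n\<ge>k. f n = f k" by simp
  qed
next
  case (Suc k)
  show ?case
    by (rule GE.acc_trans[OF gr_consts_carrier Suc acc_Elow_step[OF assms] Elow_stab _ Elow_Suc Elow_stab])
       (use stableD(2)[OF Elow_stab] in blast)
qed

text \<open>Degrees 0 and 1 form a Noetherian module over the constants; both are needed as a start,
  since F_{n+1} = qF_n holds from degree 1 on. Adjoining the initial forms of generators of
  \<open>q\<close> by Hilbert's basis argument reaches all of the graded module. The chain condition
  then passes to the larger scalars, for which there are fewer submodules.\<close>

lemma acc_gr:
  assumes acc: "acc M (carrier R) {\<zero>\<^bsub>M\<^esub>} (carrier M)" and zs: "set zs \<subseteq> q"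
    and gen: "\<And>n. n \<ge> 1 \<Longrightarrow> F (Suc n) \<subseteq> lsum M zs (F n)"
  shows "acc E (carrier G) {\<zero>\<^bsub>E\<^esub>} (carrier E)"
proof -
  have szs: "set (map star zs) \<subseteq> carrier G" using zs star_in by auto
  obtain H where H: "Elow 2 \<subseteq> H" "stab E (set (map star zs) \<union> gr_consts) H" "acc E (set (map star zs) \<union> gr_consts) {\<zero>\<^bsub>E\<^esub>} H"
    using GE.hilbert_basis_list[OF Elow_stab gr_consts_carrier acc_Elow[OF acc] szs] by blast
  have mon: "mk (emon k v) \<in> H" if "v \<in> F k" for k v
    using that
  proof (induction k arbitrary: v)
    case 0
    have "mk (emon 0 v) \<in> Elow 2" unfolding Elow_iff[OF reps_mon[OF 0]] using stableD(2)[OF Fsub] by (auto simp: emon_def)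
    then show ?case using H(1) by blast
  next
    case (Suc k)
    show ?case
    proof (cases "k = 0")
      case True
      have "mk (emon (Suc k) v) \<in> Elow 2" unfolding Elow_iff[OF reps_mon[OF Suc.prems]] using stableD(2)[OF Fsub] True by (auto simp: emon_def)
      then show ?thesis using H(1) by blast
    next
      case False
      \<comment> \<open>The elements whose homogeneous class lies in \<open>H\<close> form a
        submodule, so that generation of F_{k+1} by products zu can be tested on these products
        alone.\<close>
      define T where "T = {v \<in> F (Suc k). mk (emon (Suc k) v) \<in> H}"
      have "sub T"
        unfolding stab_def
      proof (intro conjI ballI)
        show "T \<subseteq> carrier M" unfolding T_def using stableD(1)[OF Fsub] by blast
        have "emon (Suc k) \<zero>\<^bsub>M\<^esub> = (\<lambda>_. \<zero>\<^bsub>M\<^esub>)" by (auto simp: emon_def)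
        then show "\<zero>\<^bsub>M\<^esub> \<in> T" using stableD(2)[OF H(2)] stableD(2)[OF Fsub] by (simp add: T_def zero_E)
      next
        fix u v assume "u \<in> T" "v \<in> T"
        then have uv: "u \<in> F (Suc k)" "v \<in> F (Suc k)" "mk (emon (Suc k) u) \<in> H" "mk (emon (Suc k) v) \<in> H" by (auto simp: T_def)
        have "(\<lambda>n. emon (Suc k) u n \<oplus>\<^bsub>M\<^esub> emon (Suc k) v n) = emon (Suc k) (u \<oplus>\<^bsub>M\<^esub> v)" by (auto simp: emon_def)
        then show "u \<oplus>\<^bsub>M\<^esub> v \<in> T" using stableD(3)[OF H(2) uv(3,4)] stableD(3)[OF Fsub uv(1,2)] gr_eadd_mk[OF reps_mon[OF uv(1)] reps_mon[OF uv(2)]] by (simp add: T_def)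
      next
        fix u assume "u \<in> T"
        then have u: "u \<in> F (Suc k)" "mk (emon (Suc k) u) \<in> H" by (auto simp: T_def)
        have "(\<lambda>n. \<ominus>\<^bsub>M\<^esub> emon (Suc k) u n) = emon (Suc k) (\<ominus>\<^bsub>M\<^esub> u)" by (auto simp: emon_def)
        then show "\<ominus>\<^bsub>M\<^esub> u \<in> T" using stableD(4)[OF H(2) u(2)] stableD(4)[OF Fsub u(1)] gr_minus_mk[OF reps_mon[OF u(1)]] by (simp add: T_def)
      next
        fix r u assume r: "r \<in> carrier R" and "u \<in> T"
        then have u: "u \<in> F (Suc k)" "mk (emon (Suc k) u) \<in> H" by (auto simp: T_def)
        have "(\<lambda>n. r \<odot>\<^bsub>M\<^esub> emon (Suc k) u n) = emon (Suc k) (r \<odot>\<^bsub>M\<^esub> u)" using r by (auto simp: emon_def)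
        moreover have "GR.mk (gmon 0 r) \<in> set (map star zs) \<union> gr_consts" using r by (auto simp: gr_consts_def)
        ultimately show "r \<odot>\<^bsub>M\<^esub> u \<in> T" using stableD(5)[OF H(2) _ u(2), of "GR.mk (gmon 0 r)"] stableD(5)[OF Fsub r u(1)] gr_const_act[OF r reps_mon[OF u(1)]] unfolding T_def by simp
      qed
      then have "lsum M zs (F k) \<subseteq> T"
      proof (rule lsum_least)
        fix z u assume z: "z \<in> set zs" and u: "u \<in> F k"
        have zq: "z \<in> q" using z zs by blast
        have "star z \<odot>\<^bsub>E\<^esub> mk (emon k u) \<in> H" by (rule stableD(5)[OF H(2) _ Suc.IH[OF u]]) (use z in auto)
        moreover have "z \<odot>\<^bsub>M\<^esub> u \<in> F (Suc k)" using IF[of z 1 u k] zq u R.adic_1[OF q] by simp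
        ultimately show "z \<odot>\<^bsub>M\<^esub> u \<in> T" unfolding star_mon[OF zq u] T_def by blast
      qed
      then show ?thesis using gen[of k] False Suc.prems unfolding T_def by auto
    qed
  qed
  have all: "mk x \<in> H" if "reps x" "\<forall>n\<ge>N. x n \<in> F (Suc n)" for x N
    using that
  proof (induction N arbitrary: x)
    case 0
    then have "mk x \<in> Elow 2" by (simp add: Elow_iff)
    then show ?case using H(1) by blast
  next
    case (Suc N)
    let ?y = "\<lambda>n. if n = N then \<zero>\<^bsub>M\<^esub> else x n"
    have y: "reps ?y" using repsD(1)[OF Suc.prems(1)] Suc.prems(2) stableD(2)[OF Fsub] by (intro repsI[of _ "Suc N"]) auto
    have 1: "mk ?y \<in> H" by (rule Suc.IH[OF y]) (use Suc.prems(2) stableD(2)[OF Fsub] in auto)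
    have m: "x N \<in> F N" by (rule repsD(1)[OF Suc.prems(1)])
    have 2: "(\<lambda>n. ?y n \<oplus>\<^bsub>M\<^esub> emon N (x N) n) = x" using repsD(2)[OF Suc.prems(1)] by (auto simp: emon_def)
    show ?case using stableD(3)[OF H(2) 1 mon[OF m]] unfolding gr_eadd_mk[OF y reps_mon[OF m]] 2 .
  qed
  have "carrier E \<subseteq> H"
  proof
    fix \<xi> assume "\<xi> \<in> carrier E"
    then obtain x where x: "reps x" "\<xi> = mk x" by (rule E_cases)
    obtain N where "\<forall>n\<ge>N. x n \<in> F (Suc n)" using reps_bound[OF x(1)] by blast
    from all[OF x(1) this] show "\<xi> \<in> H" using x(2) by simp
  qed
  then have "H = carrier E" using stableD(1)[OF H(2)] by blast
  then have a: "acc E (set (map star zs) \<union> gr_consts) {\<zero>\<^bsub>E\<^esub>} (carrier E)" using H(3) by simp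
  have P: "set (map star zs) \<union> gr_consts \<subseteq> carrier G" using szs gr_consts_carrier by blast
  show ?thesis
    unfolding acc_def
  proof (intro allI impI)
    fix f :: "nat \<Rightarrow> (nat \<Rightarrow> 'c set) set"
    assume f: "\<forall>n. stab E (carrier G) (f n) \<and> {\<zero>\<^bsub>E\<^esub>} \<subseteq> f n \<and> f n \<subseteq> carrier E \<and> f n \<subseteq> f (Suc n)"
    then have "stab E (set (map star zs) \<union> gr_consts) (f n)" for n using GE.stable_mono[OF _ P] by blast
    then show "\<exists>k. \<forall>n\<ge>k. f n = f k" by (intro a[unfolded acc_def, rule_format]) (use f in simp)
  qed
qed

end

section \<open>Initial forms and the submodule they generate\<close>

context gr_setup begin

text \<open>The case distinction replaces truncated subtraction, which in degree 0 would wrongly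
  contribute multiples of F_0.\<close>

definition "Lc zs n = (if n = 0 then {\<zero>\<^bsub>M\<^esub>} else lsum M zs (F (n - 1)))"
text \<open>The degree \<open>n\<close> part of the submodule of the graded module generated by the initial forms of \<open>zs\<close>.\<close>
definition "lead zs n = msum M (F (Suc n)) (Lc zs n)"

lemma zs_carrier: "set zs \<subseteq> q \<Longrightarrow> set zs \<subseteq> carrier R" using q_in by blast

lemma qF: "z \<in> q \<Longrightarrow> x \<in> F n \<Longrightarrow> z \<odot>\<^bsub>M\<^esub> x \<in> F (Suc n)"
  using IF[of z 1 x n] R.adic_1[OF q] by simp

lemma F_anti: "n \<le> m \<Longrightarrow> F m \<subseteq> F n" by (rule lift_Suc_antimono_le[where f=F, OF Fdec])

lemma reps_shift: "(\<And>n. v n \<in> F (Suc n)) \<Longrightarrow> (\<And>n. n \<ge> N \<Longrightarrow> v n \<in> F (Suc (Suc n))) \<Longrightarrow> reps (\<lambda>n. if n = 0 then \<zero>\<^bsub>M\<^esub> else v (n - 1))"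
proof (rule repsI[of _ "Suc N"])
  assume v: "\<And>n. v n \<in> F (Suc n)" "\<And>n. n \<ge> N \<Longrightarrow> v n \<in> F (Suc (Suc n))"
  show "(if n = 0 then \<zero>\<^bsub>M\<^esub> else v (n - 1)) \<in> F n" for n using v(1) stableD(2)[OF Fsub] by (cases n) auto
  show "(if n = 0 then \<zero>\<^bsub>M\<^esub> else v (n - 1)) \<in> F (Suc n)" if "n \<ge> Suc N" for n using v(2) that by (cases n) auto
qed

lemma reps_shift_mult: "z \<in> q \<Longrightarrow> reps y \<Longrightarrow> reps (\<lambda>n. if n = 0 then \<zero>\<^bsub>M\<^esub> else z \<odot>\<^bsub>M\<^esub> y (n - 1))"
proof -
  assume z: "z \<in> q" and y: "reps y"
  obtain N where N: "\<And>n. n \<ge> N \<Longrightarrow> y n \<in> F (Suc n)" using reps_bound[OF y] by blast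
  show ?thesis by (rule reps_shift[of "\<lambda>n. z \<odot>\<^bsub>M\<^esub> y n"]) (rule qF[OF z repsD(1)[OF y]], rule qF[OF z N])
qed

lemma lsum_F: "set zs \<subseteq> q \<Longrightarrow> lsum M zs (F n) \<subseteq> F (Suc n)"
  by (rule lsum_least[OF Fsub]) (use qF in blast)

lemma Lc_sub: "set zs \<subseteq> q \<Longrightarrow> sub (Lc zs n)"
  unfolding Lc_def using sub_zero sub_lsum[OF Fsub zs_carrier] by simp

lemma Lc_Suc: "Lc zs (Suc n) = lsum M zs (F n)" by (simp add: Lc_def)

lemma lead_sub: "set zs \<subseteq> q \<Longrightarrow> sub (lead zs n)" unfolding lead_def by (rule sub_msum[OF Fsub Lc_sub])

lemma lead_upper: "set zs \<subseteq> q \<Longrightarrow> F (Suc n) \<subseteq> lead zs n" unfolding lead_def by (rule msum_upper1[OF Fsub Lc_sub])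

lemma lead_act:
  assumes zs: "set zs \<subseteq> q" and r: "r \<in> I j" and x: "x \<in> lead zs n"
  shows "r \<odot>\<^bsub>M\<^esub> x \<in> lead zs (j + n)"
proof -
  have rc: "r \<in> carrier R" by (rule I_carrier[OF r])
  obtain u l where ul: "u \<in> F (Suc n)" "l \<in> Lc zs n" "x = u \<oplus>\<^bsub>M\<^esub> l" using x unfolding lead_def by (rule msumE)
  have c: "u \<in> carrier M" "l \<in> carrier M" using F_carrier[OF ul(1)] stableD(6)[OF Lc_sub[OF zs] ul(2)] .
  have "r \<odot>\<^bsub>M\<^esub> l \<in> Lc zs (j + n)"
  proof (cases n)
    case 0
    then have "l = \<zero>\<^bsub>M\<^esub>" using ul(2) by (simp add: Lc_def)
    then show ?thesis using rc stableD(2)[OF Lc_sub[OF zs]] by simp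
  next
    case (Suc m)
    have s: "sub (Lc zs (j + n))" by (rule Lc_sub[OF zs])
    have "Lc zs n \<subseteq> colon M r (Lc zs (j + n))"
      unfolding Suc Lc_Suc
    proof (rule lsum_least[OF sub_colon[OF rc Lc_sub[OF zs]]])
      fix a v assume a: "a \<in> set zs" and v: "v \<in> F m"
      have ac: "a \<in> carrier R" using a zs_carrier[OF zs] by blast
      have "a \<odot>\<^bsub>M\<^esub> (r \<odot>\<^bsub>M\<^esub> v) \<in> lsum M zs (F (j + m))"
        by (rule lsum_in[OF Fsub zs_carrier[OF zs] a IF[OF r v]])
      then show "a \<odot>\<^bsub>M\<^esub> v \<in> colon M r (Lc zs (j + Suc m))"
        using F_carrier[OF v] ac rc by (simp add: colon_def Lc_Suc smult_lcomm[of a r])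
    qed
    then show ?thesis using ul(2) by (auto simp: colon_def)
  qed
  moreover have "r \<odot>\<^bsub>M\<^esub> u \<in> F (Suc (j + n))" using IF[OF r ul(1)] by simp
  moreover have "r \<odot>\<^bsub>M\<^esub> x = r \<odot>\<^bsub>M\<^esub> u \<oplus>\<^bsub>M\<^esub> r \<odot>\<^bsub>M\<^esub> l" using c rc ul(3) by (simp add: smult_r_distr)
  ultimately show ?thesis unfolding lead_def by (simp add: msumI)
qed

text \<open>The submodule generated by the initial forms of \<open>zs\<close> is homogeneous, so
  membership is decided degree by degree; this converts statements on the graded module into
  statements on the filtration.\<close>

lemma gr_lsum_iff:
  assumes "set zs \<subseteq> q" "reps x"
  shows "mk x \<in> lsum E (map star zs) (carrier E) \<longleftrightarrow> (\<forall>n. x n \<in> lead zs n)"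
  using assms
proof (induction zs arbitrary: x)
  case Nil
  have "lead [] n = F (Suc n)" for n
    using msum_absorb[OF Fsub sub_zero, of "Suc n"] stableD(2)[OF Fsub] unfolding lead_def Lc_def by auto
  moreover have "x n \<ominus>\<^bsub>M\<^esub> \<zero>\<^bsub>M\<^esub> = x n" for n using repsD(2)[OF Nil(2), of n] by (simp add: a_minus_def)
  ultimately show ?case using mk_eq_iff[OF Nil(2) reps_zero] by (simp add: zero_E)
next
  case (Cons z zs)
  have z: "z \<in> q" "set zs \<subseteq> q" using Cons.prems(1) by auto
  have zc: "z \<in> carrier R" by (rule q_in[OF z(1)])
  have s1: "sub (smul M z (F n))" for n by (rule sub_smul[OF zc Fsub])
  have up1: "smul M z (F n) \<subseteq> lead (z # zs) (Suc n)" for n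
    using msum_upper1[OF s1 sub_lsum[OF Fsub zs_carrier[OF z(2)]], of n n] msum_upper2[OF Fsub[of "Suc (Suc n)"] Lc_sub[OF Cons.prems(1), of "Suc n"]]
    unfolding lead_def Lc_Suc lsum.simps by blast
  have "Lc zs n \<subseteq> Lc (z # zs) n" for n
    using msum_upper2[OF s1 sub_lsum[OF Fsub zs_carrier[OF z(2)]]] by (simp add: Lc_def)
  then have up2: "lead zs n \<subseteq> lead (z # zs) n" for n unfolding lead_def by (rule msum_mono[OF order_refl])
  note ls = lead_sub[OF Cons.prems(1)]
  show ?case
  proof
    assume "mk x \<in> lsum E (map star (z # zs)) (carrier E)"
    then have "mk x \<in> msum E (smul E (star z) (carrier E)) (lsum E (map star zs) (carrier E))" by simp
    then obtain \<eta> \<omega> where e: "\<eta> \<in> smul E (star z) (carrier E)" "\<omega> \<in> lsum E (map star zs) (carrier E)" "mk x = \<eta> \<oplus>\<^bsub>E\<^esub> \<omega>" by (rule msumE)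
    have "set (map star zs) \<subseteq> carrier G" using star_in z(2) by auto
    from stableD(6)[OF GE.sub_lsum[OF GE.sub_carrier this] e(2)] have "\<omega> \<in> carrier E" .
    then obtain w where w: "reps w" "\<omega> = mk w" by (rule E_cases)
    from e(1) obtain \<zeta> where \<zeta>: "\<zeta> \<in> carrier E" "\<eta> = star z \<odot>\<^bsub>E\<^esub> \<zeta>" by (rule smulE)
    from \<zeta>(1) obtain y where y: "reps y" "\<zeta> = mk y" by (rule E_cases)
    let ?zy = "\<lambda>n. if n = 0 then \<zero>\<^bsub>M\<^esub> else z \<odot>\<^bsub>M\<^esub> y (n - 1)"
    have zy: "reps ?zy" "\<eta> = mk ?zy"
    proof -
      show "\<eta> = mk ?zy" using star_act[OF z(1) y(1)] \<zeta>(2) y(2) by simp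
      show "reps ?zy" by (rule reps_shift_mult[OF z(1) y(1)])
    qed
    have wl: "\<forall>n. w n \<in> lead zs n" using Cons.IH[OF z(2) w(1)] e(2) w(2) by simp
    have "mk x = mk (\<lambda>n. ?zy n \<oplus>\<^bsub>M\<^esub> w n)" using e(3) gr_eadd_mk[OF zy(1) w(1)] zy(2) w(2) by simp
    then have d: "x n \<ominus>\<^bsub>M\<^esub> (?zy n \<oplus>\<^bsub>M\<^esub> w n) \<in> F (Suc n)" for n using mk_eq_iff[OF Cons.prems(2) reps_add[OF zy(1) w(1)]] by blast
    show "\<forall>n. x n \<in> lead (z # zs) n"
    proof
      fix n
      have 1: "?zy n \<in> lead (z # zs) n"
      proof (cases n)
        case 0 then show ?thesis using stableD(2)[OF ls] by simp
      next
        case (Suc m) then show ?thesis using subsetD[OF up1 smulI[OF repsD(1)[OF y(1), of m], of M z]] by simp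
      qed
      have 2: "w n \<in> lead (z # zs) n" using wl up2 by blast
      have 3: "x n \<ominus>\<^bsub>M\<^esub> (?zy n \<oplus>\<^bsub>M\<^esub> w n) \<in> lead (z # zs) n" by (rule subsetD[OF lead_upper[OF Cons.prems(1)] d])
      have c: "x n \<in> carrier M" "?zy n \<oplus>\<^bsub>M\<^esub> w n \<in> carrier M"
        using repsD(2)[OF Cons.prems(2)] repsD(2)[OF reps_add[OF zy(1) w(1)]] by auto
      show "x n \<in> lead (z # zs) n"
        using stable_diff_iff[OF ls c(1) stableD(3)[OF ls 1 2]] 3 by blast
    qed
  next
    assume x: "\<forall>n. x n \<in> lead (z # zs) n"
    obtain N where N: "\<And>n. n \<ge> N \<Longrightarrow> x n \<in> F (Suc n)" using reps_bound[OF Cons.prems(2)] by blast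
    \<comment> \<open>The summands are chosen as zero wherever the class of \<open>x\<close>
      vanishes, so that the chosen sequences have finite support and represent graded
      elements.\<close>
    have "\<exists>y l. y \<in> F n \<and> l \<in> lsum M zs (F n) \<and> x (Suc n) \<ominus>\<^bsub>M\<^esub> (z \<odot>\<^bsub>M\<^esub> y \<oplus>\<^bsub>M\<^esub> l) \<in> F (Suc (Suc n)) \<and> (N \<le> Suc n \<longrightarrow> y = \<zero>\<^bsub>M\<^esub> \<and> l = \<zero>\<^bsub>M\<^esub>)" for n
    proof (cases "N \<le> Suc n")
      case True
      have "x (Suc n) \<ominus>\<^bsub>M\<^esub> (z \<odot>\<^bsub>M\<^esub> \<zero>\<^bsub>M\<^esub> \<oplus>\<^bsub>M\<^esub> \<zero>\<^bsub>M\<^esub>) = x (Suc n)" using zc repsD(2)[OF Cons.prems(2)] by (simp add: a_minus_def)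
      then show ?thesis using N[OF True] stableD(2)[OF Fsub] stableD(2)[OF sub_lsum[OF Fsub zs_carrier[OF z(2)]]]
        by (intro exI[of _ "\<zero>\<^bsub>M\<^esub>"]) simp
    next
      case False
      have "x (Suc n) \<in> msum M (F (Suc (Suc n))) (msum M (smul M z (F n)) (lsum M zs (F n)))" using spec[OF x, of "Suc n"] unfolding lead_def Lc_Suc lsum.simps .
      then obtain u v where uv: "u \<in> F (Suc (Suc n))" "v \<in> msum M (smul M z (F n)) (lsum M zs (F n))" "x (Suc n) = u \<oplus>\<^bsub>M\<^esub> v" by (rule msumE)
      obtain s l where sl: "s \<in> smul M z (F n)" "l \<in> lsum M zs (F n)" "v = s \<oplus>\<^bsub>M\<^esub> l" using uv(2) by (rule msumE)
      obtain y where y: "y \<in> F n" "s = z \<odot>\<^bsub>M\<^esub> y" using sl(1) by (rule smulE)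
      have "v \<in> carrier M" using uv(2) stableD(6)[OF sub_msum[OF s1 sub_lsum[OF Fsub zs_carrier[OF z(2)]]]] by blast
      then have "x (Suc n) \<ominus>\<^bsub>M\<^esub> (z \<odot>\<^bsub>M\<^esub> y \<oplus>\<^bsub>M\<^esub> l) = u" using uv(3) sl(3) y(2) add_minus_cancel(1)[OF F_carrier[OF uv(1)]] by simp
      then show ?thesis using y(1) sl(2) uv(1) False by auto
    qed
    then obtain y l where yl: "\<And>n. y n \<in> F n" "\<And>n. l n \<in> lsum M zs (F n)" "\<And>n. x (Suc n) \<ominus>\<^bsub>M\<^esub> (z \<odot>\<^bsub>M\<^esub> y n \<oplus>\<^bsub>M\<^esub> l n) \<in> F (Suc (Suc n))"
      "\<And>n. N \<le> Suc n \<Longrightarrow> y n = \<zero>\<^bsub>M\<^esub>" "\<And>n. N \<le> Suc n \<Longrightarrow> l n = \<zero>\<^bsub>M\<^esub>" by metis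
    let ?w = "\<lambda>n. if n = 0 then \<zero>\<^bsub>M\<^esub> else l (n - 1)"
    let ?zy = "\<lambda>n. if n = 0 then \<zero>\<^bsub>M\<^esub> else z \<odot>\<^bsub>M\<^esub> y (n - 1)"
    have y: "reps y" by (rule repsI[of _ N]) (use yl(1,4) stableD(2)[OF Fsub] in auto)
    have w: "reps ?w"
      by (rule reps_shift[of l N]) (rule subsetD[OF lsum_F[OF z(2)] yl(2)], use yl(5) stableD(2)[OF Fsub] in simp)
    have "?w n \<in> lead zs n" for n
    proof (cases n)
      case 0 then show ?thesis using stableD(2)[OF lead_sub[OF z(2)]] by simp
    next
      case (Suc m) then show ?thesis
        using subsetD[OF msum_upper2[OF Fsub[of "Suc n"] Lc_sub[OF z(2), of n]], of "?w n"] yl(2)[of m] by (simp add: lead_def Lc_Suc)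
    qed
    then have wl: "mk ?w \<in> lsum E (map star zs) (carrier E)" using Cons.IH[OF z(2) w] by blast
    have zy: "reps ?zy" by (rule reps_shift_mult[OF z(1) y])
    have "mk x = mk (\<lambda>n. ?zy n \<oplus>\<^bsub>M\<^esub> ?w n)"
      unfolding mk_eq_iff[OF Cons.prems(2) reps_add[OF zy w]]
    proof
      fix n show "x n \<ominus>\<^bsub>M\<^esub> (?zy n \<oplus>\<^bsub>M\<^esub> ?w n) \<in> F (Suc n)"
      proof (cases n)
        case 0
        have "x 0 \<in> msum M (F (Suc 0)) {\<zero>\<^bsub>M\<^esub>}" using x by (auto simp: lead_def Lc_def dest: spec[of _ 0])
        then have "x 0 \<in> F (Suc 0)" using msum_absorb[OF Fsub sub_zero, of "Suc 0"] stableD(2)[OF Fsub] by simp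
        moreover have "x 0 \<ominus>\<^bsub>M\<^esub> (\<zero>\<^bsub>M\<^esub> \<oplus>\<^bsub>M\<^esub> \<zero>\<^bsub>M\<^esub>) = x 0" using repsD(2)[OF Cons.prems(2), of 0] by (simp add: a_minus_def)
        ultimately show ?thesis using 0 by simp
      next
        case (Suc m) then show ?thesis using yl(3)[of m] by simp
      qed
    qed
    then have "mk x = star z \<odot>\<^bsub>E\<^esub> mk y \<oplus>\<^bsub>E\<^esub> mk ?w" using gr_eadd_mk[OF zy w] star_act[OF z(1) y] by simp
    then show "mk x \<in> lsum E (map star (z # zs)) (carrier E)" using msumI[OF smulI[OF E_in[OF y], of _ "star z"] wl] by simp
  qed
qed

end

section \<open>The criterion of Valabrega and Valla\<close>

context gr_setup begin

lemma irrelevant_iff: "GR.reps a \<Longrightarrow> GR.mk a \<in> gr_irrelevant R q \<longleftrightarrow> a 0 \<in> I 1"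
proof -
  assume a: "GR.reps a"
  have "\<zero>\<^bsub>G\<^esub> 0 = I 1" using GR.zero_comp[of 0] by (simp add: gr_ring_def Let_def)
  then show ?thesis using G_in[OF a] GR.cls_zero_iff[of "a 0" 0] GR_repsD(2)[OF a] by (simp add: gr_irrelevant_def GR.mk_def)
qed

lemma irrelevant_cases: "f \<in> gr_irrelevant R q \<Longrightarrow> (\<And>a. GR.reps a \<Longrightarrow> a 0 \<in> I 1 \<Longrightarrow> f = GR.mk a \<Longrightarrow> thesis) \<Longrightarrow> thesis"
  using irrelevant_iff unfolding gr_irrelevant_def by (metis (mono_tags, lifting) G_cases mem_Collect_eq)

lemma star_irrelevant: "z \<in> q \<Longrightarrow> star z \<in> gr_irrelevant R q"
  using irrelevant_iff[OF star_reps[of z]] additive_subgroup.zero_closed[OF ideal.axioms(1)[OF I_ideal], of 1]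
  by (simp add: star_def gmon_def)

lemma irrelevant_scal: "GE.scal_closed (gr_irrelevant R q)"
  unfolding GE.scal_closed_def
proof (intro conjI ballI)
  show "gr_irrelevant R q \<subseteq> carrier G" by (auto simp: gr_irrelevant_def)
next
  fix f g assume "f \<in> gr_irrelevant R q" "g \<in> gr_irrelevant R q"
  then obtain a b where ab: "GR.reps a" "a 0 \<in> I 1" "f = GR.mk a" "GR.reps b" "b 0 \<in> I 1" "g = GR.mk b" by (metis irrelevant_cases)
  have "a 0 \<oplus> b 0 \<in> I 1" by (rule additive_subgroup.a_closed[OF ideal.axioms(1)[OF I_ideal] ab(2,5)])
  then show "f \<oplus>\<^bsub>G\<^esub> g \<in> gr_irrelevant R q" unfolding ab(3,6) gr_radd_mk[OF ab(1,4)] irrelevant_iff[OF GR_reps_add[OF ab(1,4)]] .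
next
  fix f g assume "f \<in> gr_irrelevant R q" "g \<in> carrier G"
  then obtain a b where ab: "GR.reps a" "a 0 \<in> I 1" "f = GR.mk a" "GR.reps b" "g = GR.mk b" by (metis irrelevant_cases G_cases)
  have "GR.conv b a 0 = b 0 \<otimes> a 0" using GR_repsD(2)[OF ab(1)] GR_repsD(2)[OF ab(4)] by (simp add: GR_conv)
  also have "\<dots> \<in> I 1" by (rule ideal.I_l_closed[OF I_ideal ab(2) GR_repsD(2)[OF ab(4)]])
  finally show "g \<otimes>\<^bsub>G\<^esub> f \<in> gr_irrelevant R q" unfolding ab(3,5) gr_mult_mk[OF ab(4,1)] irrelevant_iff[OF GR_conv_closed[OF ab(4,1)]] .
qed

text \<open>An irrelevant element has no degree-zero part, so it shifts \<open>x\<close> upwards: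
  membership in the first \<open>k\<close> degrees becomes membership in one more degree.\<close>

lemma irrelevant_act:
  assumes zs: "set zs \<subseteq> q" and f: "f \<in> gr_irrelevant R q" and x: "reps x" "\<And>n. n < k \<Longrightarrow> x n \<in> lead zs n"
  shows "\<exists>y. reps y \<and> f \<odot>\<^bsub>E\<^esub> mk x = mk y \<and> (\<forall>n<Suc k. y n \<in> lead zs n)"
proof -
  obtain a where a: "GR.reps a" "a 0 \<in> I 1" "f = GR.mk a" using f by (rule irrelevant_cases)
  have "conv a x n \<in> lead zs n" if n: "n < Suc k" for n
    unfolding conv_def
  proof (rule stable_finsum[OF lead_sub[OF zs]])
    show "(\<lambda>i. a i \<odot>\<^bsub>M\<^esub> x (n - i)) \<in> {..n} \<rightarrow> lead zs n"
    proof
      fix i assume i: "i \<in> {..n}"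
      show "a i \<odot>\<^bsub>M\<^esub> x (n - i) \<in> lead zs n"
      proof (cases "i = 0")
        case True
        then show ?thesis using subsetD[OF lead_upper[OF zs] , of "a 0 \<odot>\<^bsub>M\<^esub> x n" n] IF[OF a(2) repsD(1)[OF x(1), of n]] by simp
      next
        case False
        then have "x (n - i) \<in> lead zs (n - i)" using n i by (intro x(2)) auto
        from lead_act[OF zs GR_repsD(1)[OF a(1), of i] this] show ?thesis using i by simp
      qed
    qed
  qed simp
  then show ?thesis using gr_act_mk[OF a(1) x(1)] conv_closed[OF a(1) x(1)] a(3) by blast
qed

text \<open>The first half of the criterion of Valabrega and Valla: superficial elements become regular on
  the associated graded module, provided that the irrelevant ideal has no socle modulo the previous ones.\<close>
lemma star_nzd:
  assumes zs: "set zs \<subseteq> q" and sup: "supf q F (lsum M zs (carrier M)) a"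
    and VV: "\<And>n. F (Suc n) \<inter> lsum M zs (carrier M) \<subseteq> lsum M zs (F n)"
    and sf: "sfree E (gr_irrelevant R q) (lsum E (map star zs) (carrier E))"
  shows "nzd E (star a) (lsum E (map star zs) (carrier E))"
proof -
  let ?B = "lsum M zs (carrier M)" and ?N = "lsum E (map star zs) (carrier E)"
  have a: "a \<in> q" using sup by (simp add: supf_def)
  have ac: "a \<in> carrier R" by (rule q_in[OF a])
  have B: "sub ?B" by (rule sub_lsum[OF sub_carrier zs_carrier[OF zs]])
  obtain c where c: "\<And>n. n \<ge> c \<Longrightarrow> colon M a (msum M ?B (F (Suc n))) \<inter> msum M ?B (F c) = msum M ?B (F n)" using sup by (auto simp: supf_def)
  have szs: "set (map star zs) \<subseteq> carrier G" using star_in zs by auto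
  have N: "GE.sub ?N" by (rule GE.sub_lsum[OF GE.sub_carrier szs])
  have LB: "Lc zs n \<subseteq> ?B" for n
    using lsum_mono[OF stableD(1)[OF Fsub], of zs] stableD(2)[OF B] by (auto simp: Lc_def)
  have comp: "a \<odot>\<^bsub>M\<^esub> x n \<in> lead zs (Suc n)" if x: "reps x" "star a \<odot>\<^bsub>E\<^esub> mk x \<in> ?N" for x n
  proof -
    let ?y = "\<lambda>n. if n = 0 then \<zero>\<^bsub>M\<^esub> else a \<odot>\<^bsub>M\<^esub> x (n - 1)"
    have y: "reps ?y" by (rule reps_shift_mult[OF a x(1)])
    then have "?y (Suc n) \<in> lead zs (Suc n)" using gr_lsum_iff[OF zs y] x(2) star_act[OF a x(1)] by metis
    then show ?thesis by simp
  qed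
  \<comment> \<open>Above \<open>c\<close> superficiality writes \<open>x n\<close> as b + u with u
    in F_{n+1}; then \<open>b\<close> lies in F_n, and \<open>VV\<close> turns it into an
    initial-form combination.\<close>
  have high: "x n \<in> lead zs n" if x: "reps x" "star a \<odot>\<^bsub>E\<^esub> mk x \<in> ?N" and n: "n \<ge> Suc c" for x n
  proof -
    have xn: "x n \<in> carrier M" "x n \<in> F n" using repsD x(1) by auto
    have "lead zs (Suc n) \<subseteq> msum M ?B (F (Suc (Suc n)))"
      unfolding lead_def using msum_upper2[OF B Fsub] order_trans[OF LB msum_upper1[OF B Fsub]] by (intro msum_least[OF sub_msum[OF B Fsub]]) auto
    then have "x n \<in> colon M a (msum M ?B (F (Suc (Suc n))))" using comp[OF x, of n] xn(1) by (auto simp: colon_def)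
    moreover have "x n \<in> msum M ?B (F c)" using subsetD[OF msum_upper2[OF B Fsub] subsetD[OF F_anti xn(2)], of c] n by simp
    ultimately have "x n \<in> msum M ?B (F (Suc n))" using c[of "Suc n"] n by auto
    then obtain b u where bu: "b \<in> ?B" "u \<in> F (Suc n)" "x n = b \<oplus>\<^bsub>M\<^esub> u" by (rule msumE)
    have cc: "b \<in> carrier M" "u \<in> carrier M" using stableD(6)[OF B bu(1)] F_carrier[OF bu(2)] .
    obtain m where m: "n = Suc m" using n by (cases n) auto
    have "b \<in> F n" using stable_add_iff[OF Fsub cc(1) subsetD[OF Fdec bu(2)]] xn(2) bu(3) by simp
    then have "b \<in> Lc zs n" using VV[of m] bu(1) unfolding m Lc_Suc by blast
    then have "u \<oplus>\<^bsub>M\<^esub> b \<in> lead zs n" unfolding lead_def by (rule msumI[OF bu(2)])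
    then show ?thesis using bu(3) cc by (simp add: M.a_comm)
  qed
  \<comment> \<open>Induction on the number \<open>j\<close> of degrees up to \<open>c\<close> that
    are still open. Acting by an irrelevant element closes one of them, so all these products lie in
    the submodule, and the absence of a socle gives the claim for \<open>x\<close>.\<close>
  have low: "j \<le> Suc c \<Longrightarrow> reps x \<Longrightarrow> star a \<odot>\<^bsub>E\<^esub> mk x \<in> ?N \<Longrightarrow> (\<And>n. n < Suc c - j \<Longrightarrow> x n \<in> lead zs n) \<Longrightarrow> mk x \<in> ?N" for x j
  proof (induction j arbitrary: x)
    case 0
    have "x n \<in> lead zs n" for n using 0(4)[of n] high[OF 0(2,3), of n] by (cases "n < Suc c") auto
    then show ?case using gr_lsum_iff[OF zs 0(2)] by blast
  next
    case (Suc j)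
    have "f \<odot>\<^bsub>E\<^esub> mk x \<in> ?N" if f: "f \<in> gr_irrelevant R q" for f
    proof -
      obtain y where y: "reps y" "f \<odot>\<^bsub>E\<^esub> mk x = mk y" "\<forall>n<Suc (Suc c - Suc j). y n \<in> lead zs n"
        using irrelevant_act[OF zs f Suc.prems(2,4)] by blast
      have fG: "f \<in> carrier G" using f by (simp add: gr_irrelevant_def)
      have "star a \<odot>\<^bsub>E\<^esub> mk y = f \<odot>\<^bsub>E\<^esub> (star a \<odot>\<^bsub>E\<^esub> mk x)"
        using GE.smult_lcomm[OF star_in[OF a] fG E_in[OF Suc.prems(2)]] y(2) by simp
      then have sy: "star a \<odot>\<^bsub>E\<^esub> mk y \<in> ?N" using stableD(5)[OF N fG Suc.prems(3)] by simp
      have "mk y \<in> ?N" by (rule Suc.IH[OF _ y(1) sy]) (use Suc.prems(1) y(3) in auto)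
      then show ?thesis using y(2) by simp
    qed
    then show ?case using sf E_in[OF Suc.prems(2)] unfolding sfree_def by blast
  qed
  show ?thesis
    unfolding nzd_def
  proof (intro ballI impI)
    fix \<xi> assume "\<xi> \<in> carrier E" and h: "star a \<odot>\<^bsub>E\<^esub> \<xi> \<in> ?N"
    then obtain x where x: "reps x" "\<xi> = mk x" by (metis E_cases)
    show "\<xi> \<in> ?N" unfolding x(2) by (rule low[OF order_refl x(1)]) (use h x(2) in auto)
  qed
qed

text \<open>Write w = b + au with u in F_k, and raise k step by step. By \<open>VV\<close> the part
  \<open>b\<close> lies in the sum for F_k, so the class of au is an initial-form combination;
  regularity of \<open>star a\<close> gives the same for \<open>u\<close>, whose lower part is then
  absorbed into \<open>b\<close>.\<close>

lemma valabrega_valla_step: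
  assumes zs: "set zs \<subseteq> q" and a: "a \<in> q"
    and VV: "\<And>n. F (Suc n) \<inter> lsum M zs (carrier M) \<subseteq> lsum M zs (F n)"
    and nz: "nzd E (star a) (lsum E (map star zs) (carrier E))" and F0: "F 0 = carrier M"
  shows "F (Suc n) \<inter> lsum M (zs @ [a]) (carrier M) \<subseteq> lsum M (zs @ [a]) (F n)"
proof
  let ?B = "lsum M zs (carrier M)"
  have ac: "a \<in> carrier R" by (rule q_in[OF a])
  have B: "sub ?B" by (rule sub_lsum[OF sub_carrier zs_carrier[OF zs]])
  have LB: "Lc zs n \<subseteq> ?B" for n
    using lsum_mono[OF stableD(1)[OF Fsub], of zs] stableD(2)[OF B] by (auto simp: Lc_def)
  fix w assume w: "w \<in> F (Suc n) \<inter> lsum M (zs @ [a]) (carrier M)"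
  then have w1: "w \<in> F (Suc n)" by blast
  have mid: "b \<in> lsum M zs (F k)" if "b \<in> ?B" "u \<in> F k" "w = b \<oplus>\<^bsub>M\<^esub> a \<odot>\<^bsub>M\<^esub> u" "k \<le> n" for b u k
  proof -
    have "a \<odot>\<^bsub>M\<^esub> u \<in> F (Suc k)" by (rule qF[OF a that(2)])
    moreover have "w \<in> F (Suc k)" by (rule subsetD[OF F_anti w1]) (use that(4) in simp)
    ultimately have "b \<in> F (Suc k)" using stable_add_iff[OF Fsub stableD(6)[OF B that(1)]] that(3) by metis
    then show ?thesis using VV that(1) by blast
  qed
  have "\<exists>b u. b \<in> ?B \<and> u \<in> F k \<and> w = b \<oplus>\<^bsub>M\<^esub> a \<odot>\<^bsub>M\<^esub> u" if "k \<le> n" for k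
    using that
  proof (induction k)
    case 0
    have "w \<in> msum M ?B (smul M a (carrier M))" using w lsum_snoc[OF sub_carrier zs_carrier[OF zs] ac] by simp
    then show ?case unfolding F0 by (auto elim!: msumE smulE)
  next
    case (Suc k)
    then obtain b u where bu: "b \<in> ?B" "u \<in> F k" "w = b \<oplus>\<^bsub>M\<^esub> a \<odot>\<^bsub>M\<^esub> u" by auto
    have bL: "b \<in> lsum M zs (F k)" by (rule mid[OF bu]) (use Suc.prems in simp)
    have c: "b \<in> carrier M" "u \<in> carrier M" "w \<in> carrier M" using stableD(6)[OF B bu(1)] F_carrier[OF bu(2)] F_carrier[OF w1] .
    have w2: "w \<in> F (Suc (Suc k))" by (rule subsetD[OF F_anti w1]) (use Suc.prems in simp)
    have "w \<oplus>\<^bsub>M\<^esub> \<ominus>\<^bsub>M\<^esub> b \<in> lead zs (Suc k)" unfolding lead_def Lc_Suc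
      by (rule msumI[OF w2 stableD(4)[OF sub_lsum[OF Fsub zs_carrier[OF zs]] bL]])
    moreover have "w \<oplus>\<^bsub>M\<^esub> \<ominus>\<^bsub>M\<^esub> b = a \<odot>\<^bsub>M\<^esub> u" using bu(3) add_minus_cancel(3)[of "a \<odot>\<^bsub>M\<^esub> u" b] c ac by (simp add: a_minus_def)
    ultimately have au: "a \<odot>\<^bsub>M\<^esub> u \<in> lead zs (Suc k)" by simp
    have "emon (Suc k) (a \<odot>\<^bsub>M\<^esub> u) j \<in> lead zs j" for j
      using au stableD(2)[OF lead_sub[OF zs]] by (simp add: emon_def)
    then have "mk (emon (Suc k) (a \<odot>\<^bsub>M\<^esub> u)) \<in> lsum E (map star zs) (carrier E)"
      using gr_lsum_iff[OF zs reps_mon[OF qF[OF a bu(2)]]] by blast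
    then have "mk (emon k u) \<in> lsum E (map star zs) (carrier E)"
      using nz E_in[OF reps_mon[OF bu(2)]] star_mon[OF a bu(2)] unfolding nzd_def by metis
    then have "emon k u k \<in> lead zs k" using gr_lsum_iff[OF zs reps_mon[OF bu(2)]] by blast
    then have "u \<in> msum M (F (Suc k)) (Lc zs k)" by (simp add: emon_def lead_def)
    then obtain v l where vl: "v \<in> F (Suc k)" "l \<in> Lc zs k" "u = v \<oplus>\<^bsub>M\<^esub> l" by (rule msumE)
    have lB: "l \<in> ?B" using LB vl(2) by blast
    have c': "v \<in> carrier M" "l \<in> carrier M" using F_carrier[OF vl(1)] stableD(6)[OF B lB] .
    have "w = (b \<oplus>\<^bsub>M\<^esub> a \<odot>\<^bsub>M\<^esub> l) \<oplus>\<^bsub>M\<^esub> a \<odot>\<^bsub>M\<^esub> v"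
      using bu(3) vl(3) c c' ac by (simp add: smult_r_distr M.a_ac)
    then show ?case using stableD(3)[OF B bu(1) stableD(5)[OF B ac lB]] vl(1) by blast
  qed
  then obtain b u where bu: "b \<in> ?B" "u \<in> F n" "w = b \<oplus>\<^bsub>M\<^esub> a \<odot>\<^bsub>M\<^esub> u" by blast
  have "b \<oplus>\<^bsub>M\<^esub> a \<odot>\<^bsub>M\<^esub> u \<in> msum M (lsum M zs (F n)) (smul M a (F n))"
    by (rule msumI[OF mid[OF bu order_refl] smulI[OF bu(2)]])
  then show "w \<in> lsum M (zs @ [a]) (F n)" using lsum_snoc[OF Fsub zs_carrier[OF zs] ac] bu(3) by simp
qed

text \<open>The two conclusions feed each other: equality of intersections for the first i elements
  makes the next initial form regular, and that regularity extends the equality. The given sequence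
  \<open>fs\<close> enters only through the vanishing socles, transferred by
  \<open>soc_exchange\<close>.\<close>

theorem valabrega_valla:
  assumes acc: "acc E (carrier G) {\<zero>\<^bsub>E\<^esub>} (carrier E)" and F0: "F 0 = carrier M"
    and as: "set as \<subseteq> q" and sup: "\<And>i. i < length as \<Longrightarrow> supf q F (lsum M (take i as) (carrier M)) (as ! i)"
    and fs: "set fs \<subseteq> gr_irrelevant R q" "rseq E {\<zero>\<^bsub>E\<^esub>} fs" "length as \<le> length fs"
  shows "F (Suc n) \<inter> lsum M as (carrier M) \<subseteq> lsum M as (F n)"
proof -
  have take_q: "set (take i as) \<subseteq> q" for i using as set_take_subset[of i as] by blast
  have "i \<le> length as \<Longrightarrow> rseq E {\<zero>\<^bsub>E\<^esub>} (map star (take i as)) \<and>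
      (\<forall>n. F (Suc n) \<inter> lsum M (take i as) (carrier M) \<subseteq> lsum M (take i as) (F n))" for i
  proof (induction i)
    case 0 show ?case by simp
  next
    case (Suc i)
    let ?zs = "take i as" and ?a = "as ! i"
    have i: "i < length as" using Suc.prems by simp
    have a: "?a \<in> q" using as nth_mem[OF i] by blast
    have IH: "rseq E {\<zero>\<^bsub>E\<^esub>} (map star ?zs)" "\<And>n. F (Suc n) \<inter> lsum M ?zs (carrier M) \<subseteq> lsum M ?zs (F n)" using Suc by auto
    have sG: "set (map star ?zs) \<subseteq> carrier G" using star_in take_q[of i] by auto
    note al = GE.addl_zero[OF sG]
    have ne: "gr_irrelevant R q \<noteq> {}" using star_irrelevant[OF a] by blast
    have "sfree E (gr_irrelevant R q) (addl E {\<zero>\<^bsub>E\<^esub>} (map star ?zs))"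
    proof (rule GE.soc_exchange[OF irrelevant_scal ne GE.sub_zero acc])
      show "length (map star ?zs) = length (take i fs)" using i fs(3) by simp
      show "set (map star ?zs) \<subseteq> gr_irrelevant R q" using star_irrelevant take_q[of i] by auto
      show "set (take i fs) \<subseteq> gr_irrelevant R q" using fs(1) set_take_subset[of i fs] by blast
      show "rseq E {\<zero>\<^bsub>E\<^esub>} (map star ?zs)" by (rule IH(1))
      show "rseq E {\<zero>\<^bsub>E\<^esub>} (take i fs)" using fs(2) by (metis append_take_drop_id rseq_append)
      show "sfree E (gr_irrelevant R q) (addl E {\<zero>\<^bsub>E\<^esub>} (take i fs))" by (rule GE.sfree_rseq[OF fs(2,1)]) (use i fs(3) in simp)
    qed
    then have nz: "nzd E (star ?a) (lsum E (map star ?zs) (carrier E))"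
      using star_nzd[OF take_q sup[OF i] IH(2)] al by simp
    have t: "take (Suc i) as = ?zs @ [?a]" by (rule take_Suc_conv_app_nth[OF i])
    have "rseq E {\<zero>\<^bsub>E\<^esub>} (map star (take (Suc i) as))" unfolding t using IH(1) nz al by (simp add: rseq_append)
    then show ?case unfolding t using valabrega_valla_step[OF take_q a IH(2) nz F0] by blast
  qed
  from this[of "length as"] show ?thesis by simp
qed

end

section \<open>The bound on the reduction number\<close>

text \<open>Connects the supremum over chains indexed by functions with the recursive chains used
  throughout; finite length makes the supremum a maximum.\<close>

lemma (in module) module_length_eq_len:
  assumes f: "fl {\<zero>\<^bsub>M\<^esub>} (carrier M)"
  shows "module_length R M = enat (ll {\<zero>\<^bsub>M\<^esub>} (carrier M))"
proof -
  have chain: "\<exists>N. (\<forall>i\<le>k. sub (N i)) \<and> (\<forall>i<k. N i \<subset> N (Suc i)) \<and> N k = A" if "chn M (carrier R) k {\<zero>\<^bsub>M\<^esub>} A" for k A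
    using that
  proof (induction k arbitrary: A)
    case 0 then show ?case by (intro exI[of _ "\<lambda>_. A"]) simp
  next
    case (Suc k)
    then obtain C where C: "chn M (carrier R) k {\<zero>\<^bsub>M\<^esub>} C" "C \<subset> A" "sub A" by auto
    obtain N where N: "\<forall>i\<le>k. sub (N i)" "\<forall>i<k. N i \<subset> N (Suc i)" "N k = C" using Suc.IH[OF C(1)] by blast
    show ?case by (intro exI[of _ "N(Suc k := A)"]) (use N C in \<open>auto simp: le_Suc_eq less_Suc_eq\<close>)
  qed
  have chain': "chn M (carrier R) j {\<zero>\<^bsub>M\<^esub>} (N j)" if "\<forall>i\<le>k. sub (N i)" "\<forall>i<k. N i \<subset> N (Suc i)" "j \<le> k" for k j N
    using that(3)
  proof (induction j)
    case 0
    have "sub (N 0)" using that(1) by simp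
    then show ?case using sub_zero stableD(2)[of M "carrier R" "N 0"] by simp
  next
    case (Suc j)
    have "N j \<subset> N (Suc j)" "sub (N (Suc j))" using that(1,2) Suc.prems by auto
    then show ?case using Suc by auto
  qed
  let ?S = "{k. \<exists>N. (\<forall>i\<le>k. submodule (N i) R M) \<and> (\<forall>i<k. N i \<subset> N (Suc i))}"
  have S: "k \<in> ?S \<longleftrightarrow> chn M (carrier R) k {\<zero>\<^bsub>M\<^esub>} (carrier M)" for k
  proof
    assume "k \<in> ?S"
    then obtain N where N: "\<forall>i\<le>k. sub (N i)" "\<forall>i<k. N i \<subset> N (Suc i)" by (auto simp: submodule_iff_stable)
    have "N k \<subseteq> carrier M" using stableD(1)[of M "carrier R" "N k"] N(1) by blast
    then show "chn M (carrier R) k {\<zero>\<^bsub>M\<^esub>} (carrier M)" by (rule chn_mono[OF chain'[OF N order_refl] _ sub_carrier])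
  next
    assume "chn M (carrier R) k {\<zero>\<^bsub>M\<^esub>} (carrier M)"
    from chain[OF this] show "k \<in> ?S" unfolding submodule_iff_stable by blast
  qed
  have z: "{\<zero>\<^bsub>M\<^esub>} \<subseteq> carrier M" by simp
  note c = chn_len[OF f sub_carrier sub_zero z]
  show ?thesis unfolding module_length_def
  proof (rule antisym)
    show "(SUP k\<in>?S. enat k) \<le> enat (ll {\<zero>\<^bsub>M\<^esub>} (carrier M))"
      by (rule SUP_least) (use c(2) S in simp)
    show "enat (ll {\<zero>\<^bsub>M\<^esub>} (carrier M)) \<le> (SUP k\<in>?S. enat k)"
      by (rule SUP_upper) (use c(1) S in blast)
  qed
qed

context gr_setup begin

lemma smult_comp: "r \<in> carrier R \<Longrightarrow> x \<in> F n \<Longrightarrow> r \<odot>\<^bsub>gr_comp M F n\<^esub> cls n x = cls n (r \<odot>\<^bsub>M\<^esub> x)"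
proof -
  assume r: "r \<in> carrier R" and x: "x \<in> F n"
  have "r \<odot>\<^bsub>gr_comp M F n\<^esub> cls n x = r \<odot>\<^bsub>quot_module M (F (Suc n))\<^esub> (F (Suc n) +>\<^bsub>M\<^esub> x)"
    by (simp add: gr_comp_def quot_module_def cls_def a_r_coset_def r_coset_def)
  then show ?thesis using smult_quot[OF Fsub r F_carrier[OF x]] by (simp add: cls_def)
qed

text \<open>The correspondence theorem for F_n/F_{n+1}: taking classes and taking preimages are
  inverse isomorphisms of lattices of submodules, and \<open>len_iso\<close> compares the
  lengths.\<close>

lemma gr_comp_length:
  assumes f: "fl (F (Suc n)) (F n)"
  shows "module_length R (gr_comp M F n) = enat (ll (F (Suc n)) (F n))"
proof -
  let ?C = "gr_comp M F n"
  interpret C: module R ?C by (rule module_comp)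
  have cl: "x \<in> F n \<Longrightarrow> cls n x \<in> carrier ?C" for x by (auto simp: carrier_comp)
  have zc: "cls n x = \<zero>\<^bsub>?C\<^esub> \<longleftrightarrow> x \<in> F (Suc n)" if "x \<in> F n" for x using cls_zero_iff[OF F_carrier[OF that]] zero_comp by simp
  have z0: "\<zero>\<^bsub>?C\<^esub> = cls n \<zero>\<^bsub>M\<^esub>" using zc[of "\<zero>\<^bsub>M\<^esub>"] stableD(2)[OF Fsub] by auto
  have minus: "\<ominus>\<^bsub>?C\<^esub> cls n x = cls n (\<ominus>\<^bsub>M\<^esub> x)" if x: "x \<in> F n" for x
  proof (rule C.M.minus_equality)
    show "cls n (\<ominus>\<^bsub>M\<^esub> x) \<oplus>\<^bsub>?C\<^esub> cls n x = \<zero>\<^bsub>?C\<^esub>"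
      using F_carrier[OF x] by (simp add: add_comp M.l_neg z0)
  qed (use x cl stableD(4)[OF Fsub x] in auto)
  define \<phi> where "\<phi> X = cls n ` X" for X
  define \<psi> where "\<psi> U = {x \<in> F n. cls n x \<in> U}" for U
  have map: "C.sub (\<phi> X) \<and> {\<zero>\<^bsub>?C\<^esub>} \<subseteq> \<phi> X \<and> \<phi> X \<subseteq> carrier ?C \<and> \<psi> (\<phi> X) = X"
    if X: "sub X" "F (Suc n) \<subseteq> X" "X \<subseteq> F n" for X
  proof (intro conjI)
    have zX: "\<zero>\<^bsub>?C\<^esub> \<in> \<phi> X" unfolding \<phi>_def z0 using stableD(2)[OF X(1)] by blast
    then show "{\<zero>\<^bsub>?C\<^esub>} \<subseteq> \<phi> X" by simp
    show cX: "\<phi> X \<subseteq> carrier ?C" unfolding \<phi>_def using X(3) cl by blast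
    show "C.sub (\<phi> X)" unfolding stab_def
    proof (intro conjI ballI cX zX)
      fix u assume "u \<in> \<phi> X"
      then obtain x where x: "x \<in> X" "u = cls n x" unfolding \<phi>_def by blast
      show "\<ominus>\<^bsub>?C\<^esub> u \<in> \<phi> X" unfolding x(2) minus[OF subsetD[OF X(3) x(1)]] \<phi>_def using stableD(4)[OF X(1) x(1)] by blast
      fix v assume "v \<in> \<phi> X"
      then obtain y where y: "y \<in> X" "v = cls n y" unfolding \<phi>_def by blast
      show "u \<oplus>\<^bsub>?C\<^esub> v \<in> \<phi> X"
        unfolding x(2) y(2) add_comp[OF stableD(6)[OF X(1) x(1)] stableD(6)[OF X(1) y(1)]] \<phi>_def using stableD(3)[OF X(1) x(1) y(1)] by blast
    next
      fix r u assume r: "r \<in> carrier R" and "u \<in> \<phi> X"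
      then obtain x where x: "x \<in> X" "u = cls n x" unfolding \<phi>_def by blast
      show "r \<odot>\<^bsub>?C\<^esub> u \<in> \<phi> X" unfolding x(2) smult_comp[OF r subsetD[OF X(3) x(1)]] \<phi>_def using stableD(5)[OF X(1) r x(1)] by blast
    qed
    show "\<psi> (\<phi> X) = X"
    proof
      show "X \<subseteq> \<psi> (\<phi> X)" unfolding \<psi>_def \<phi>_def using X(3) by blast
      show "\<psi> (\<phi> X) \<subseteq> X"
      proof
        fix x assume "x \<in> \<psi> (\<phi> X)"
        then obtain y where y: "x \<in> F n" "y \<in> X" "cls n x = cls n y" unfolding \<psi>_def \<phi>_def by auto
        have "x \<ominus>\<^bsub>M\<^esub> y \<in> X" using cls_eq_iff[OF F_carrier[OF y(1)] stableD(6)[OF X(1) y(2)]] y(3) X(2) by blast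
        then show "x \<in> X" using stable_diff_iff[OF X(1) F_carrier[OF y(1)] y(2)] by blast
      qed
    qed
  qed
  have map': "sub (\<psi> U) \<and> F (Suc n) \<subseteq> \<psi> U \<and> \<psi> U \<subseteq> F n \<and> \<phi> (\<psi> U) = U"
    if U: "C.sub U" "{\<zero>\<^bsub>?C\<^esub>} \<subseteq> U" "U \<subseteq> carrier ?C" for U
  proof (intro conjI)
    show "F (Suc n) \<subseteq> \<psi> U"
    proof
      fix x assume x: "x \<in> F (Suc n)"
      then have "x \<in> F n" using Fdec by blast
      then have "x \<in> F n" "cls n x = \<zero>\<^bsub>?C\<^esub>" using zc x by auto
      then show "x \<in> \<psi> U" using U(2) unfolding \<psi>_def by simp
    qed
    show "\<psi> U \<subseteq> F n" unfolding \<psi>_def by blast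
    show "\<phi> (\<psi> U) = U" using U(3) unfolding \<phi>_def \<psi>_def carrier_comp by auto
    show "sub (\<psi> U)" unfolding stab_def
    proof (intro conjI ballI)
      show "\<psi> U \<subseteq> carrier M" unfolding \<psi>_def using stableD(1)[OF Fsub] by blast
      show "\<zero>\<^bsub>M\<^esub> \<in> \<psi> U" unfolding \<psi>_def using stableD(2)[OF Fsub] stableD(2)[OF U(1)] z0 by auto
      fix x assume "x \<in> \<psi> U"
      then have x: "x \<in> F n" "cls n x \<in> U" unfolding \<psi>_def by auto
      show "\<ominus>\<^bsub>M\<^esub> x \<in> \<psi> U" unfolding \<psi>_def using stableD(4)[OF Fsub x(1)] stableD(4)[OF U(1) x(2)] minus[OF x(1)] by simp
      fix y assume "y \<in> \<psi> U"
      then have y: "y \<in> F n" "cls n y \<in> U" unfolding \<psi>_def by auto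
      show "x \<oplus>\<^bsub>M\<^esub> y \<in> \<psi> U" unfolding \<psi>_def
        using stableD(3)[OF Fsub x(1) y(1)] stableD(3)[OF U(1) x(2) y(2)] add_comp[OF F_carrier[OF x(1)] F_carrier[OF y(1)]] by simp
    next
      fix r x assume r: "r \<in> carrier R" and "x \<in> \<psi> U"
      then have x: "x \<in> F n" "cls n x \<in> U" unfolding \<psi>_def by auto
      show "r \<odot>\<^bsub>M\<^esub> x \<in> \<psi> U" unfolding \<psi>_def using stableD(5)[OF Fsub r x(1)] stableD(5)[OF U(1) r x(2)] smult_comp[OF r x(1)] by simp
    qed
  qed
  have "fl (F (Suc n)) (F n) \<longleftrightarrow> C.fl {\<zero>\<^bsub>?C\<^esub>} (carrier ?C)" "ll (F (Suc n)) (F n) = C.ll {\<zero>\<^bsub>?C\<^esub>} (carrier ?C)"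
    by (rule len_iso[where \<phi> = \<phi> and \<psi> = \<psi>]; (rule map map' C.sub_carrier C.sub_zero Fsub; assumption)?; (auto simp: \<phi>_def \<psi>_def intro: C.sub_carrier C.sub_zero Fsub)?)+
  then show ?thesis using C.module_length_eq_len f by simp
qed

end

context good_filt begin

lemma is_gr_setup: "gr_setup R M q F"
proof (intro gr_setup.intro gr_setup_axioms.intro module_axioms q_ideal F_sub F_dec)
  fix i j
  note ai = adic_filt_ideal[OF R.is_cring q_ideal]
  have s: "submodule (F j) R M" for j using F_sub submodule_iff_stable by blast
  show "ideal_smult R M (adic_filt R q i) (F j) \<subseteq> F (i + j)"
  proof (induction i arbitrary: j)
    case 0 then show ?case using ideal_smult_carrier[OF module_axioms s, of j] by (simp add: adic_filt_0)
  next
    case (Suc i)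
    have "ideal_smult R M (adic_filt R q (Suc i)) (F j) = ideal_smult R M (adic_filt R q i) (ideal_smult R M q (F j))"
      unfolding adic_filt_Suc by (rule ideal_smult_assoc[OF module_axioms ai q_ideal s])
    also have "\<dots> \<subseteq> F (i + Suc j)"
    proof (rule ideal_smult_least[OF F_sub])
      fix a u assume a: "a \<in> adic_filt R q i" and u: "u \<in> ideal_smult R M q (F j)"
      have "ideal_smult R M q (F j) \<subseteq> F (Suc j)" by (rule ideal_smult_least[OF F_sub F_mul])
      then show "a \<odot>\<^bsub>M\<^esub> u \<in> F (i + Suc j)" using subsetD[OF Suc.IH smult_in[OF a], of u "Suc j"] u by blast
    qed
    finally show ?case by simp
  qed
qed

lemma acc_gr_module: "acc (gr_module M F) (carrier (gr_ring R q)) {\<zero>\<^bsub>gr_module M F\<^esub>} (carrier (gr_module M F))"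
proof -
  interpret gr: gr_setup R M q F by (rule is_gr_setup)
  obtain A where A: "A \<subseteq> carrier R" "finite A" "q = Idl A" using noetherian_ring.finetely_gen[OF noeth q_ideal] by blast
  obtain zs where zs: "set zs = A" using finite_list[OF A(2)] by blast
  show ?thesis
  proof (rule gr.acc_gr[OF ac])
    show "set zs \<subseteq> q" unfolding zs A(3) by (rule R.genideal_self[OF A(1)])
    show "F (Suc n) \<subseteq> lsum M zs (F n)" if "n \<ge> 1" for n
      using F_gen[OF that] ideal_smult_Idl[OF F_sub, of zs n] A(1,3) zs by simp
  qed
qed

text \<open>The sequence \<open>fs\<close> may be two shorter than \<open>as\<close>: only the
  elements spanning \<open>C\<close> pass through the criterion of Valabrega and Valla. The
  numerator \<open>h\<close> is delivered together with the bound because both come from the same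
  reduction to dimension one.\<close>

theorem reduction_number_bound:
  assumes as: "set as \<subseteq> q" "rseq M {\<zero>\<^bsub>M\<^esub>} as" and sup: "\<And>i. i < length as \<Longrightarrow> supf q F (bas as i) (as ! i)"
    and nil: "F k \<subseteq> bas as (length as)" and ne: "as \<noteq> []" and nz: "carrier M \<noteq> {\<zero>\<^bsub>M\<^esub>}"
    and fs: "set fs \<subseteq> gr_irrelevant R q" "rseq (gr_module M F) {\<zero>\<^bsub>gr_module M F\<^esub>} fs" "length as \<le> length fs + 2"
  shows "\<exists>h K. HS {\<zero>\<^bsub>M\<^esub>} * (1 - fps_X) ^ length as = fps_of_poly h \<and> poly h 1 \<noteq> 0 \<and>
    int K = poly (pderiv h) 1 - poly h 1 + coeff h 0 \<and> (\<forall>n\<ge>Suc K. F (Suc n) = lsum M as (F n))"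
proof -
  interpret gr: gr_setup R M q F by (rule is_gr_setup)
  let ?r = "length as"
  let ?B = "bas as (?r - 1)" and ?A = "bas as ?r"
  let ?e = "ll ?A (carrier M)"
  obtain h p0 where h: "HS {\<zero>\<^bsub>M\<^esub>} * (1 - fps_X) ^ ?r = fps_of_poly h" "poly h 1 = int ?e"
    "\<And>p. p \<ge> p0 \<Longrightarrow> poly (pderiv h) 1 = (\<Sum>n<p. int ?e - int (H ?B n))" "\<And>n. n \<ge> p0 \<Longrightarrow> H ?B n = ?e"
    "coeff h 0 = int (H {\<zero>\<^bsub>M\<^esub>} 0)"
    using hilbert_reduction[OF as sup nil ne] by blast
  have asc: "set as \<subseteq> carrier R" using as(1) q_carrier by blast
  have r: "?r - 1 < ?r" "?r = Suc (?r - 1)" using ne by (cases as; simp)+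
  have nzd: "nzd M (as ! i) (bas as i)" if "i < ?r" for i using as(2) that by (auto simp: rseq_iff_nth bas_addl[OF as(1)])
  have Ar: "?A = adj M ?B (as ! (?r - 1))" using bas_Suc[OF as(1) r(1)] r(2) by simp
  note sB = sub_bas[OF as(1)]
  have zN: "N {\<zero>\<^bsub>M\<^esub>} n = F n" for n using msum_absorb2[OF sub_zero F_sub[of n]] stableD(2)[OF F_sub] by simp
  have fA: "fl ?A (carrier M)" using fl_N[OF sB[of ?r], of k] msum_absorb[OF sB F_sub nil] by simp
  have "?e \<noteq> 0" using len_0_iff[OF fA sub_carrier sB stableD(1)[OF sB]] bas_proper[OF as(1) nz] by metis
  \<comment> \<open>By Singh's equality the Hilbert function is bounded by a colength that never
    exceeds e_0; hence the sum defining \<open>K\<close> is nonnegative and \<open>K\<close> may be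
    taken as a natural number.\<close>
  have le: "H ?B n \<le> ?e" for n
  proof -
    have aq: "as ! (?r - 1) \<in> q" using as(1) nth_mem[OF r(1)] by blast
    have "H ?B n \<le> ll (N ?A (Suc n)) (carrier M)" using one_step[OF sB[of "?r - 1"] aq, of n] Ar by simp
    also have "\<dots> \<le> ?e"
      using len_add(2)[OF sub_carrier sub_N[OF sB] sB N_upper[OF sB] stableD(1)[OF sub_N[OF sB]] fA, of "Suc n"] by linarith
    finally show ?thesis .
  qed
  have H0: "H ?B 0 = H {\<zero>\<^bsub>M\<^esub>} 0"
  proof -
    have "N ?B (Suc 0) = F (Suc 0)" using msum_absorb2[OF sB F_sub] bas_F1[OF as(1)] by simp
    moreover have "N ?B 0 = carrier M" by (rule N_0[OF sB])
    moreover have "N {\<zero>\<^bsub>M\<^esub>} 0 = carrier M" unfolding zN by (rule F0)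
    ultimately show ?thesis using zN[of "Suc 0"] by simp
  qed
  let ?d = "poly (pderiv h) 1 - poly h 1 + coeff h 0"
  \<comment> \<open>Removing the term n = 0 from e_1 costs e_0 - H_0, and H_0 is h_0 because the
    partial ideals act into F_1 and leave M/F_1 unchanged.\<close>
  have S: "(\<Sum>n\<in>{1..<p}. int ?e - int (H ?B n)) = ?d" if p: "p \<ge> max p0 1" for p
  proof -
    have "{..<p} = insert 0 {1..<p}" using p by auto
    then have "(\<Sum>n<p. int ?e - int (H ?B n)) = (int ?e - int (H ?B 0)) + (\<Sum>n\<in>{1..<p}. int ?e - int (H ?B n))" by simp
    then show ?thesis using h(2) h(3)[of p] h(5) H0 p by simp
  qed
  have "?d \<ge> 0" unfolding S[OF order_refl, symmetric] by (rule sum_nonneg) (use le in simp)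
  define K where "K = nat ?d"
  have K: "int K = ?d" using \<open>?d \<ge> 0\<close> by (simp add: K_def)
  have S': "(\<Sum>n\<in>{1..<p}. int ?e - int (H ?B n)) = int K" if "p \<ge> max p0 1" for p using S[OF that] K by simp
  have large: "H ?B n = ?e" if "n \<ge> max p0 1" for n using h(4) that by simp
  have red: "F (Suc n) \<subseteq> lsum M as (F n)" if n: "n \<ge> Suc K" for n
  proof (cases "?r = 1")
    case True
    then obtain b where b: "as = [b]" by (cases as) auto
    have B0: "?B = {\<zero>\<^bsub>M\<^esub>}" by (simp add: b bas_def)
    have e: "?A = adj M {\<zero>\<^bsub>M\<^esub>} b" using Ar B0 b by simp
    have "F (Suc n) \<subseteq> W [b] {\<zero>\<^bsub>M\<^esub>} n"
    proof (rule reduction_bound_1[where k = k and ?n1.0 = "max p0 1"])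
      show "b \<in> q" using as(1) b by simp
      show "nzd M b {\<zero>\<^bsub>M\<^esub>}" using nzd[OF r(1)] B0 b by simp
      show "F k \<subseteq> adj M {\<zero>\<^bsub>M\<^esub>} b" using nil e by simp
      show "H {\<zero>\<^bsub>M\<^esub>} n = ll (adj M {\<zero>\<^bsub>M\<^esub>} b) (carrier M)" if "n \<ge> max p0 1" for n using large[OF that] unfolding B0 e .
      show "(\<Sum>n\<in>{1..<p}. int (ll (adj M {\<zero>\<^bsub>M\<^esub>} b) (carrier M)) - int (H {\<zero>\<^bsub>M\<^esub>} n)) = int K" if "p \<ge> max p0 1" for p
        using S'[OF that] unfolding B0 e .
    qed (rule n)
    moreover have "W [b] {\<zero>\<^bsub>M\<^esub>} n = lsum M as (F n)"
      unfolding W_def b[symmetric] using msum_absorb2[OF sub_zero sub_lsum[OF F_sub asc, of n]] stableD(2)[OF sub_lsum[OF F_sub asc, of n]] by simp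
    ultimately show ?thesis by simp
  next
    case False
    then obtain m where m: "?r = Suc (Suc m)" using r(2) by (metis One_nat_def not0_implies_Suc)
    have Bm: "?B = bas as (Suc m)" using m by simp
    have e: "?A = adj M (bas as (Suc m)) (as ! Suc m)" using Ar m by simp
    have red: "F (Suc n) \<subseteq> W as (bas as m) n"
    proof (rule reduction_bound_2[OF as(1) m, where k = k and ?n1.0 = "max p0 1"])
      show "supf q F (bas as m) (as ! m)" by (rule sup) (use m in simp)
      show "nzd M (as ! m) (bas as m)" "nzd M (as ! Suc m) (bas as (Suc m))" using nzd m by auto
      show "F k \<subseteq> adj M (bas as (Suc m)) (as ! Suc m)" using nil e by simp
      show "H (bas as (Suc m)) n = ll (adj M (bas as (Suc m)) (as ! Suc m)) (carrier M)" if "n \<ge> max p0 1" for n using large[OF that] unfolding Bm e .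
      show "(\<Sum>n\<in>{1..<p}. int (ll (adj M (bas as (Suc m)) (as ! Suc m)) (carrier M)) - int (H (bas as (Suc m)) n)) = int K" if "p \<ge> max p0 1" for p
        using S'[OF that] unfolding Bm e .
    qed (rule n)
    let ?zs = "take m as"
    have zs: "set ?zs \<subseteq> set as" by (rule set_take_subset)
    have VV: "F (Suc n) \<inter> bas as m \<subseteq> lsum M ?zs (F n)"
      unfolding bas_def
    proof (rule gr.valabrega_valla[OF acc_gr_module F0 _ _ fs(1,2)])
      show "set ?zs \<subseteq> q" using zs as(1) by blast
      show "length ?zs \<le> length fs" using fs(3) m by simp
      fix i assume i: "i < length ?zs"
      then show "supf q F (lsum M (take i ?zs) (carrier M)) (?zs ! i)" using sup[of i] by (simp add: bas_def min_absorb1)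
    qed
    have up: "lsum M ?zs (F n) \<subseteq> lsum M as (F n)"
      by (rule lsum_least[OF sub_lsum[OF F_sub asc]]) (use lsum_in[OF F_sub asc] zs in blast)
    \<comment> \<open>To remove \<open>C\<close>, the component in \<open>C\<close> is seen to lie
      in F_{n+1}, since the component in J F_n does; the criterion then places it in J F_n as
      well.\<close>
    show ?thesis
    proof
      fix w assume w: "w \<in> F (Suc n)"
      then have "w \<in> msum M (bas as m) (lsum M as (F n))" using red unfolding W_def by blast
      then obtain b l where bl: "b \<in> bas as m" "l \<in> lsum M as (F n)" "w = b \<oplus>\<^bsub>M\<^esub> l" by (rule msumE)
      have "l \<in> F (Suc n)" using gr.lsum_F[OF as(1)] bl(2) by blast
      then have "b \<in> F (Suc n)" using stable_add_iff[OF F_sub stableD(6)[OF sB bl(1)]] w bl(3) by metis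
      then have "b \<in> lsum M as (F n)" using VV up bl(1) by blast
      then show "w \<in> lsum M as (F n)" unfolding bl(3) by (rule stableD(3)[OF sub_lsum[OF F_sub asc] _ bl(2)])
    qed
  qed
  have "F (Suc n) = lsum M as (F n)" if "n \<ge> Suc K" for n using red[OF that] gr.lsum_F[OF as(1), of n] by blast
  moreover have "poly h 1 \<noteq> 0" using h(2) \<open>?e \<noteq> 0\<close> by simp
  ultimately show ?thesis using h(1) K by blast
qed

lemma hilbert_series_eq: "hilbert_series R M F = HS {\<zero>\<^bsub>M\<^esub>}"
proof -
  interpret gr: gr_setup R M q F by (rule is_gr_setup)
  have zN: "N {\<zero>\<^bsub>M\<^esub>} n = F n" for n using msum_absorb2[OF sub_zero F_sub[of n]] stableD(2)[OF F_sub] by simp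
  have "fl (F (Suc n)) (F n)" for n
    using len_add(1)[OF sub_carrier F_sub F_sub F_dec stableD(1)[OF F_sub], of n] fl_N[OF sub_zero, of "Suc n"] unfolding zN by blast
  then show ?thesis unfolding hilbert_series_def HS_def zN using gr.gr_comp_length by simp
qed

end

text \<open>A finite supremum in \<open>enat\<close> of a nonempty family is a maximum;
  \<open>r \<ge> 1\<close> excludes the empty family, whose supremum is 0.\<close>

lemma SUP_enat_attained:
  assumes "(SUP x\<in>A. enat (f x)) = enat r" "r \<ge> 1" shows "\<exists>x\<in>A. f x = r"
proof -
  have ne: "A \<noteq> {}" using assms by (auto simp: bot_enat_def zero_enat_def)
  have fin: "finite ((\<lambda>x. enat (f x)) ` A)" using assms(1) ne by (auto simp: Sup_enat_def split: if_splits)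
  have "Max ((\<lambda>x. enat (f x)) ` A) \<in> (\<lambda>x. enat (f x)) ` A" by (rule Max_in[OF fin]) (use ne in simp)
  moreover have "Max ((\<lambda>x. enat (f x)) ` A) = enat r" using assms(1) ne fin by (simp add: Sup_enat_def)
  ultimately have "enat r \<in> (\<lambda>x. enat (f x)) ` A" by simp
  then show ?thesis by auto
qed

theorem theorem4p1p5:
  fixes R :: "('a, 'c) ring_scheme"
    and M :: "('a, 'b, 'd) module_scheme"
    and \<mm> \<qq> J :: "'a set"
    and L :: "'b set"
    and F :: "nat \<Rightarrow> 'b set"
    and as :: "'a list"
    and r :: nat
  assumes local_ring: "noetherian_local_ring R \<mm>"
    and q_primary: "primary_to R \<mm> \<qq>"
    and M_module: "module R M"
    and M_fin_gen: "fin_gen R M"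
    and M_nonzero: "carrier M \<noteq> {\<zero>\<^bsub>M\<^esub>}"
    and M_CM: "cohen_macaulay R \<mm> M"
    and dim: "module_dim R M = enat r"
    and r_pos: "r \<ge> 1"
    and L_submodule: "submodule L R M"
    and L_contains: "ideal_smult R M \<qq> (carrier M) \<subseteq> L"
    and F_induced: "F = induced_filt R \<qq> M L"
    and depth_gr: "gr_depth R \<qq> M F + 2 \<ge> enat r"
    and as_maximal: "maximal_superficial_seq R \<qq> M F as"
    and J_gen: "J = Idl\<^bsub>R\<^esub> (set as)"
  shows "ereal_of_enat (reduction_number R M J F)
           \<le> ereal (hilbert_coeff R M F 1 - hilbert_coeff R M F 0
                      + real_of_int (h_coeff R M F 0) + 1)"
proof -
  interpret module R M by fact
  have noeth: "noetherian_ring R" using local_ring by (auto simp: noetherian_local_ring_def)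
  have q: "ideal \<qq> R" and rad: "radical R \<qq> = \<mm>" using q_primary by (auto simp: primary_to_def primary_ideal_def)
  have q_carrier: "\<qq> \<subseteq> carrier R" using ideal.Icarr[OF q] by blast
  have gf: "good_filtration R \<qq> M F" unfolding F_induced by (rule good_filtration_induced_filt[OF M_module q L_submodule L_contains])
  have F_sub: "sub (F n)" and F_dec: "F (Suc n) \<subseteq> F n" and F_q: "ideal_smult R M \<qq> (F n) \<subseteq> F (Suc n)" and F0: "F 0 = carrier M" for n
    using gf by (auto simp: good_filtration_def submodule_iff_stable)
  have F_gen: "F (Suc n) = ideal_smult R M \<qq> (F n)" if n: "n \<ge> 1" for n
  proof -
    obtain j where j: "n = Suc j" using n by (cases n) auto
    note a = adic_filt_ideal[OF R.is_cring q]
    have "F (Suc n) = ideal_smult R M (ideal_prod R \<qq> (adic_filt R \<qq> j)) L"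
      using R.ideal_prod_commute[OF a q] by (simp add: F_induced j adic_filt_Suc)
    also have "\<dots> = ideal_smult R M \<qq> (F n)"
      using ideal_smult_assoc[OF M_module q a L_submodule] by (simp add: F_induced j)
    finally show ?thesis .
  qed
  interpret good_filt R M \<mm> \<qq> F
  proof (intro good_filt.intro local_module.intro local_module_axioms.intro good_filt_axioms.intro M_module local_ring q F0 F_sub F_dec F_gen)
    show "acc M (carrier R) {\<zero>\<^bsub>M\<^esub>} (carrier M)" by (rule acc_fin_gen[OF noeth M_fin_gen])
    show "\<qq> \<subseteq> \<mm>"
    proof
      fix x assume x: "x \<in> \<qq>"
      then have "x \<in> carrier R" "x [^]\<^bsub>R\<^esub> (1::nat) \<in> \<qq>" using q_carrier by auto
      then show "x \<in> \<mm>" unfolding rad[symmetric] radical_def by blast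
    qed
    show "\<exists>k::nat. z [^]\<^bsub>R\<^esub> k \<in> \<qq>" if "z \<in> \<mm>" for z using that unfolding rad[symmetric] radical_def by blast
    show "x \<odot>\<^bsub>M\<^esub> u \<in> F (Suc n)" if "x \<in> \<qq>" "u \<in> F n" for n x u using subsetD[OF F_q smult_in[OF that]] .
  qed
  have sup: "superficial_seq R \<qq> M F as" and ne: "as \<noteq> []"
    and nil: "nilpotent_filt (quot_by_elems R M as) (quot_filt_by_elems R M as F)"
    and nnil: "\<not> nilpotent_filt (quot_by_elems R M (butlast as)) (quot_filt_by_elems R M (butlast as) F)"
    using as_maximal by (auto simp: maximal_superficial_seq_def)
  have as: "set as \<subseteq> \<qq>" using sup by (auto simp: superficial_seq_def superficial_def in_set_conv_nth)
  have bas: "ideal_smult R M (Idl\<^bsub>R\<^esub> (set (take i as))) (carrier M) = bas as i" for i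
    unfolding bas_def by (rule ideal_smult_Idl[OF sub_carrier take_carrier[OF as]])
  note sB = sub_bas[OF as]
  have supf: "supf \<qq> F (bas as i) (as ! i)" if "i < length as" for i
    using sup that unfolding superficial_seq_def bas using superficial_quot[where F = F, OF sB F_sub q_carrier] by blast
  obtain k where k: "F k \<subseteq> bas as (length as)"
    using nil nilpotent_quot[where F = F, OF sB[of "length as"] F_sub F_dec] bas[of "length as"] by auto
  have nk: "\<not> F k \<subseteq> bas as (length as - 1)" for k
    using nnil nilpotent_quot[where F = F, OF sB[of "length as - 1"] F_sub F_dec] bas[of "length as - 1"] by (auto simp: butlast_conv_take)
  have "depth R \<mm> M = enat r" using M_CM dim by (simp add: cohen_macaulay_def)
  then obtain xs where xs: "set xs \<subseteq> \<mm>" "regular_seq R M xs" "length xs = r"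
    unfolding depth_def using SUP_enat_attained[OF _ r_pos] by blast
  have ann: "annihilator R M = annM {\<zero>\<^bsub>M\<^esub>}" by (simp add: annihilator_def annM_def)
  \<comment> \<open>A chain with r + 1 proper inclusions of primes over the annihilator would exceed
    the dimension.\<close>
  have chains: "\<exists>j<Suc (length xs). \<not> P j \<subset> P (Suc j)"
    if P: "\<forall>j\<le>Suc (length xs). primeideal (P j) R \<and> annM {\<zero>\<^bsub>M\<^esub>} \<subseteq> P j" for P
  proof (rule ccontr)
    assume "\<not> ?thesis"
    then have "enat (Suc r) \<le> module_dim R M"
      unfolding module_dim_def ann using P xs(3) by (intro SUP_upper) blast
    then show False using dim by simp
  qed
  note ms = maximal_superficial_regular[OF as supf xs(1) regular_seq_rseq[OF xs(2)] M_nonzero k nk chains]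
  have len: "length as = r" using ms(1) xs(3) by simp
  interpret gr: gr_setup R M \<qq> F by (rule is_gr_setup)
  \<comment> \<open>For \<open>r \<le> 2\<close> the empty sequence is long enough. Otherwise r - 3
    is strictly below the depth, and strictness yields a regular sequence of length at least r - 2
    even when the depth is infinite.\<close>
  obtain fs where fs: "set fs \<subseteq> gr_irrelevant R \<qq>" "rseq (gr_module M F) {\<zero>\<^bsub>gr_module M F\<^esub>} fs" "r \<le> length fs + 2"
  proof (cases "r \<le> 2")
    case True then show thesis by (intro that[of "[]"]) auto
  next
    case False
    have "enat (r - 3) < gr_depth R \<qq> M F"
    proof (rule ccontr)
      assume "\<not> enat (r - 3) < gr_depth R \<qq> M F"
      then have "gr_depth R \<qq> M F + 2 \<le> enat (r - 3) + 2" by (intro add_right_mono) simp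
      then have "enat r \<le> enat (r - 3) + 2" by (rule order_trans[OF depth_gr])
      then have "r \<le> r - 3 + 2" by (simp add: numeral_eq_enat)
      then show False using False by arith
    qed
    then obtain fs where "set fs \<subseteq> gr_irrelevant R \<qq>" "regular_seq (gr_ring R \<qq>) (gr_module M F) fs" "r - 3 < length fs"
      unfolding gr_depth_def depth_def less_SUP_iff by auto
    then show thesis by (intro that[of fs] gr.GE.regular_seq_rseq) auto
  qed
  obtain h K where h: "HS {\<zero>\<^bsub>M\<^esub>} * (1 - fps_X) ^ r = fps_of_poly h" "poly h 1 \<noteq> 0"
    "int K = poly (pderiv h) 1 - poly h 1 + coeff h 0" "\<forall>n\<ge>Suc K. F (Suc n) = lsum M as (F n)"
    using reduction_number_bound[OF as ms(2) supf k ne M_nonzero fs(1,2)] fs(3) unfolding len by blast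
  \<comment> \<open>The series fixes the numerator, since a polynomial is determined by its power
    series; so the definite description in \<open>h_poly\<close> denotes \<open>h\<close>.\<close>
  have hp: "h_poly R M F = h"
    unfolding h_poly_def hilbert_series_eq dim the_enat.simps
  proof (rule the_equality)
    show "h' = h" if "HS {\<zero>\<^bsub>M\<^esub>} * (1 - fps_X) ^ r = fps_of_poly h' \<and> poly h' 1 \<noteq> 0" for h'
      using that h(1) by (simp add: fps_of_poly_eq_iff)
  qed (use h in simp)
  have "ideal_smult R M J (F n) = lsum M as (F n)" for n
    unfolding J_gen using ideal_smult_Idl[OF F_sub] as q_carrier by blast
  \<comment> \<open>All indices from K + 1 on satisfy the defining equality, so K + 1 belongs to the
    set whose infimum is the reduction number.\<close>
  then have "reduction_number R M J F \<le> enat (Suc K)"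
    unfolding reduction_number_def by (intro INF_lower) (use h(4) in simp)
  then have "ereal_of_enat (reduction_number R M J F) \<le> ereal_of_enat (enat (Suc K))" by (simp only: ereal_of_enat_le_iff)
  also have "\<dots> = ereal (real_of_int (int K) + 1)" by simp
  also have "\<dots> = ereal (hilbert_coeff R M F 1 - hilbert_coeff R M F 0 + real_of_int (h_coeff R M F 0) + 1)"
    unfolding h(3) by (simp add: hilbert_coeff_def h_coeff_def hp)
  finally show ?thesis .
qed

end
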